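(* Let $p>2$, $\nu_0,\nu_1>0$, and let $\widetilde f\in(\widetilde V_2(\mathbb{R}^3_+))'\cap L^2(\mathbb{R}^3_+)$. Then the boundary value problem $$\begin{cases}-\nabla\cdot\big((\nu_0+\nu_1|\mathcal{D}\widetilde u|^{p-2})\,\mathcal{D}\widetilde u\big)+\nabla\pi=\widetilde f,\quad \nabla\cdot\widetilde u=0&\text{in }\mathbb{R}^3_+,\\ \widetilde u\cdot\underline n=0,\quad(\nabla\times\widetilde u)\times\underline n=0&\text{on }\Gamma\end{cases}$$ admits a unique weak solution $\widetilde u\in\widetilde V(\mathbb{R}^3_+)$. Furthermore, all second derivatives $D^2\widetilde u$ belong to $L^2(\mathbb{R}^3_+)$.
   Context: $\mathbb{R}^3_+=\{x_3>0\}$, $\Gamma=\{x_3=0\}$, $\underline n=(0,0,-1)$. $\mathcal{D}u=\frac12(\nabla u+\nabla u^T)$ is the symmetric gradient. $\|\cdot\|$ is the $L^2(\mathbb{R}^3_+)$ norm and $\|\cdot\|_p$ the $L^p(\mathbb{R}^3_+)$ norm. $\widetilde D^1(\mathbb{R}^3_+)=D^{1,2}(\mathbb{R}^3_+)$ is the completion of $C_0^\infty(\overline{\mathbb{R}^3_+})$ (vector fields) with respect to $\|\nabla v\|$. Set $$\widetilde V_2(\mathbb{R}^3_+)=\{v\in\widetilde D^1(\mathbb{R}^3_+):\nabla\cdot v=0,\ v_3|_{x_3=0}=0\},$$ endowed with the norm $\|\nabla v\|$, with dual space $(\widetilde V_2(\mathbb{R}^3_+))'$, and $$\widetilde V(\mathbb{R}^3_+)=\{v\in\widetilde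 V_2(\mathbb{R}^3_+):\|\mathcal{D}v\|_p<\infty\},$$ endowed with the norm $\|\nabla v\|+\|\mathcal{D}v\|_p$. The condition $\widetilde f\in(\widetilde V_2(\mathbb{R}^3_+))'\cap L^2(\mathbb{R}^3_+)$ means that $\widetilde f$ is an $L^2$ vector field which defines, via the duality pairing extending $v\mapsto\int_{\mathbb{R}^3_+}\widetilde f\cdot v\,dx$, a bounded linear functional on $\widetilde V_2(\mathbb{R}^3_+)$. A weak solution of the boundary value problem is a $\widetilde u\in\widetilde V(\mathbb{R}^3_+)$ such that $$\int_{\mathbb{R}^3_+}(\nu_0+\nu_1|\mathcal{D}\widetilde u|^{p-2})\,\mathcal{D}\widetilde u\cdot\mathcal{D}v\,dx=\int_{\mathbb{R}^3_+}\widetilde f\cdot v\,dx\qquad\text{for all }v\in\widetilde V(\mathbb{R}^3_+),$$ the right-hand side being understood as this duality pairing. *)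

theory Defs
  imports "HOL-Analysis.Analysis"
begin

definition Lp :: "real \<Rightarrow> 'a set \<Rightarrow> ('a::euclidean_space \<Rightarrow> 'b::euclidean_space) set" where
  "Lp p \<Omega> = {f \<in> borel_measurable (lebesgue_on \<Omega>).
               integrable (lebesgue_on \<Omega>) (\<lambda>x. norm (f x) powr p)}"

(* Meaningful only for f in Lp p \<Omega>: the Bochner integral of a non-integrable function is 0. *)
definition Lp_norm :: "real \<Rightarrow> 'a set \<Rightarrow> ('a::euclidean_space \<Rightarrow> 'b::euclidean_space) \<Rightarrow> real" where
  "Lp_norm p \<Omega> f = (LINT x|lebesgue_on \<Omega>. norm (f x) powr p) powr (1 / p)"

definition half_space :: "(real^3) set" where
  "half_space = {x. x $ 3 > 0}"

definition boundary_point :: "real^2 \<Rightarrow> real^3" where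
  "boundary_point y = vector [y $ 1, y $ 2, 0]"

definition partial :: "3 \<Rightarrow> (real^3 \<Rightarrow> 'b::euclidean_space) \<Rightarrow> real^3 \<Rightarrow> 'b" where
  "partial i f x = frechet_derivative f (at x) (axis i 1)"

primrec C_order :: "nat \<Rightarrow> (real^3 \<Rightarrow> 'b::euclidean_space) \<Rightarrow> bool" where
  "C_order 0 f \<longleftrightarrow> continuous_on UNIV f"
| "C_order (Suc k) f \<longleftrightarrow> (\<forall>x. f differentiable (at x)) \<and> (\<forall>i. C_order k (partial i f))"

definition test_functions :: "(real^3) set \<Rightarrow> (real^3 \<Rightarrow> 'b::euclidean_space) set" where
  "test_functions \<Omega> = {\<phi>. (\<forall>k. C_order k \<phi>) \<and>
     compact (closure {x. \<phi> x \<noteq> 0}) \<and> closure {x. \<phi> x \<noteq> 0} \<subseteq> \<Omega>}"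

(* C_0^infinity of the closed half-space consists of the restrictions of compactly supported
   smooth fields on the whole space; they need not vanish on the boundary. *)
abbreviation test_fields :: "(real^3 \<Rightarrow> real^3) set" where
  "test_fields \<equiv> test_functions UNIV"

definition grad :: "(real^3 \<Rightarrow> real^3) \<Rightarrow> real^3 \<Rightarrow> real^3^3" where
  "grad \<phi> x = (\<chi> i j. partial j \<phi> x $ i)"

definition loc_integrable :: "(real^3 \<Rightarrow> 'b::euclidean_space) \<Rightarrow> bool" where
  "loc_integrable f \<longleftrightarrow> (\<forall>K. compact K \<and> K \<subseteq> half_space \<longrightarrow> integrable (lebesgue_on K) f)"

definition has_weak_partial ::
    "3 \<Rightarrow> (real^3 \<Rightarrow> 'b::euclidean_space) \<Rightarrow> (real^3 \<Rightarrow> 'b) \<Rightarrow> bool" where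
  "has_weak_partial i f w \<longleftrightarrow> loc_integrable f \<and> loc_integrable w \<and>
     (\<forall>\<phi>::real^3 \<Rightarrow> real. \<phi> \<in> test_functions half_space \<longrightarrow>
        (LINT x|lebesgue_on half_space. partial i \<phi> x *\<^sub>R f x)
          = - (LINT x|lebesgue_on half_space. \<phi> x *\<^sub>R w x))"

definition weakly_differentiable :: "3 \<Rightarrow> (real^3 \<Rightarrow> 'b::euclidean_space) \<Rightarrow> bool" where
  "weakly_differentiable i f \<longleftrightarrow> (\<exists>w. has_weak_partial i f w)"

(* A representative; weak derivatives are determined up to null sets of the half-space. *)
definition weak_partial :: "3 \<Rightarrow> (real^3 \<Rightarrow> 'b::euclidean_space) \<Rightarrow> real^3 \<Rightarrow> 'b" where
  "weak_partial i f = (SOME w. has_weak_partial i f w)"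

definition weak_grad :: "(real^3 \<Rightarrow> real^3) \<Rightarrow> real^3 \<Rightarrow> real^3^3" where
  "weak_grad v x = (\<chi> i j. weak_partial j v x $ i)"

definition weak_div :: "(real^3 \<Rightarrow> real^3) \<Rightarrow> real^3 \<Rightarrow> real" where
  "weak_div v x = trace (weak_grad v x)"

(* The norm and inner product of real^3^3 are the Frobenius ones. *)
definition sym_grad :: "(real^3 \<Rightarrow> real^3) \<Rightarrow> real^3 \<Rightarrow> real^3^3" where
  "sym_grad v x = (1/2) *\<^sub>R (weak_grad v x + transpose (weak_grad v x))"

(* Convergence of test fields to v in the gradient norm. The L^2_loc convergence selects the
   function that represents the limit: by the Sobolev inequality, test fields that are Cauchy in
   the gradient norm converge in L^6, hence in L^2 on bounded parts of the half-space, so each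
   element of the completion is represented by exactly one function (up to null sets). *)
definition D1_approx :: "(nat \<Rightarrow> real^3 \<Rightarrow> real^3) \<Rightarrow> (real^3 \<Rightarrow> real^3) \<Rightarrow> bool" where
  "D1_approx \<phi> v \<longleftrightarrow> (\<forall>n. \<phi> n \<in> test_fields) \<and>
     (\<lambda>n. Lp_norm 2 half_space (\<lambda>x. grad (\<phi> n) x - weak_grad v x)) \<longlonglongrightarrow> 0 \<and>
     (\<forall>R. (\<lambda>n. Lp_norm 2 (half_space \<inter> ball 0 R) (\<lambda>x. \<phi> n x - v x)) \<longlonglongrightarrow> 0)"

definition D1 :: "(real^3 \<Rightarrow> real^3) set" where
  "D1 = {v. (\<forall>i. weakly_differentiable i v) \<and> weak_grad v \<in> Lp 2 half_space \<and>
            (\<forall>R. v \<in> Lp 2 (half_space \<inter> ball 0 R)) \<and> (\<exists>\<phi>. D1_approx \<phi> v)}"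

(* The trace operator: the extension by continuity of the restriction of test fields to the
   boundary, which is continuous from D1 to L^2_loc of the boundary plane. *)
definition has_boundary_trace :: "(real^3 \<Rightarrow> real^3) \<Rightarrow> (real^2 \<Rightarrow> real^3) \<Rightarrow> bool" where
  "has_boundary_trace v g \<longleftrightarrow> (\<forall>R. g \<in> Lp 2 (ball 0 R)) \<and>
     (\<exists>\<phi>. D1_approx \<phi> v \<and>
        (\<forall>R. (\<lambda>n. Lp_norm 2 (ball 0 R) (\<lambda>y. \<phi> n (boundary_point y) - g y)) \<longlonglongrightarrow> 0))"

definition V2 :: "(real^3 \<Rightarrow> real^3) set" where
  "V2 = {v \<in> D1. (AE x in lebesgue_on half_space. weak_div v x = 0) \<and>
                 (\<exists>g. has_boundary_trace v g \<and> (AE y in lebesgue. g y $ 3 = 0))}"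

definition V :: "real \<Rightarrow> (real^3 \<Rightarrow> real^3) set" where
  "V p = {v \<in> V2. sym_grad v \<in> Lp p half_space}"

definition bounded_functional_V2 :: "((real^3 \<Rightarrow> real^3) \<Rightarrow> real) \<Rightarrow> bool" where
  "bounded_functional_V2 F \<longleftrightarrow>
     (\<forall>v\<in>V2. \<forall>w\<in>V2. F (\<lambda>x. v x + w x) = F v + F w) \<and>
     (\<forall>c. \<forall>v\<in>V2. F (\<lambda>x. c *\<^sub>R v x) = c * F v) \<and>
     (\<exists>C. \<forall>v\<in>V2. \<bar>F v\<bar> \<le> C * Lp_norm 2 half_space (weak_grad v))"

(* f . v need not be integrable for f in L^2 and v in V2, since v is only in L^6; the integral is
   therefore prescribed on the intersection of V2 with L^2, which is dense in V2, so that F is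
   determined by f. *)
definition duality_pairing :: "(real^3 \<Rightarrow> real^3) \<Rightarrow> ((real^3 \<Rightarrow> real^3) \<Rightarrow> real) \<Rightarrow> bool" where
  "duality_pairing f F \<longleftrightarrow> bounded_functional_V2 F \<and>
     (\<forall>v \<in> V2 \<inter> Lp 2 half_space. F v = (LINT x|lebesgue_on half_space. f x \<bullet> v x))"

definition weak_solution ::
    "real \<Rightarrow> real \<Rightarrow> real \<Rightarrow> ((real^3 \<Rightarrow> real^3) \<Rightarrow> real) \<Rightarrow> (real^3 \<Rightarrow> real^3) \<Rightarrow> bool" where
  "weak_solution p \<nu>0 \<nu>1 F u \<longleftrightarrow> u \<in> V p \<and>
     (\<forall>v \<in> V p. (LINT x|lebesgue_on half_space.
          ((\<nu>0 + \<nu>1 * norm (sym_grad u x) powr (p - 2)) *\<^sub>R sym_grad u x) \<bullet> sym_grad v x)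
        = F v)"

end

theory Submission
  imports Defs
begin

text \<open>Why the theorem holds. The weak formulation is the Euler--Lagrange equation of the strictly convex
energy \<open>\<integral> \<nu>0 / 2 \<bar>D u\<bar>\<^sup>2 + \<nu>1 / p \<bar>D u\<bar>\<^sup>p - F u\<close> on the space of admissible fields, so existence,
uniqueness and regularity all rest on the coercivity of the quadratic part (Korn's inequality) and on
the completeness of the space. What gives access to both, and at the same time allows differences in
the direction normal to the boundary, is reflection: the boundary conditions are those of a field on
the whole space whose tangential components are even, and whose normal component is odd, in \<open>x\<^sub>3\<close>.

\<^item> The inequality of Hardy type \<open>hardy_half\<close> bounds a field, multiplied by the weight
  \<open>1 / sqrt (1 + \<bar>x\<bar>\<^sup>2)\<close>, by its gradient; \<open>trace_half\<close> does so for the boundary values. Hence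
  a sequence of test fields whose gradients converge has a limit field with a boundary trace.

\<^item> The vanishing normal trace makes the reflected field weakly differentiable across the boundary
  plane (\<open>extend_weak_derivative\<close>). Cutting off and mollifying with a symmetric kernel then
  approximates it by test fields with the same symmetry (\<open>V2_symmetric_approximation\<close>); conversely
  every limit of such fields with vanishing divergence is admissible (\<open>V2_intro\<close>). The trace and the
  approximation in the definition of the space are thus replaced by a symmetry, which is inherited by
  linear combinations, second differences and limits.

\<^item> For divergence-free fields on the whole space two integrations by parts give
  \<open>\<parallel>\<nabla> u\<parallel>\<^sup>2 = 2 \<parallel>D u\<parallel>\<^sup>2\<close> (\<open>korn_full\<close>), and by reflection the same identity holds on the half-space.

\<^item> Existence: a minimising sequence of the energy is Cauchy by uniform convexity and Korn's
  identity, and its limit is a minimiser (\<open>energy_minimiser\<close>); convexity and dominated convergence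
  turn minimality into the weak formulation (\<open>minimiser_weak_solution\<close>). Uniqueness is monotonicity
  of the flux, combined with Korn and Hardy (\<open>weak_solution_unique\<close>).

\<^item> Regularity: the reflected solution is tested with its own second difference in an arbitrary
  coordinate direction. This field is again symmetric, hence admissible, and square integrable, so
  the functional is an integral against \<open>f\<close>. Summation by parts and monotonicity give a bound of
  first order for the difference of the gradient (\<open>gradient_difference_bound\<close>), and such a bound
  makes the distributional derivative a square integrable function
  (\<open>weak_derivative_of_difference_bound\<close>).\<close>

section \<open>Square-integrable functions\<close>

abbreviation half_measure :: "(real^3) measure" where
  "half_measure \<equiv> lebesgue_on half_space"

text \<open>Square integrability over an arbitrary measure, so that the whole space, the half-space, bounded
  parts of it and the boundary plane are treated alike.\<close>
definition sq_integrable :: "'a measure \<Rightarrow> ('a \<Rightarrow> 'b::euclidean_space) \<Rightarrow> bool" where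
  "sq_integrable M f \<longleftrightarrow> f \<in> borel_measurable M \<and> integrable M (\<lambda>x. (norm (f x))\<^sup>2)"

definition L2norm :: "'a measure \<Rightarrow> ('a \<Rightarrow> 'b::euclidean_space) \<Rightarrow> real" where
  "L2norm M f = sqrt (LINT x|M. (norm (f x))\<^sup>2)"

lemma Lp_2_iff: "f \<in> Lp 2 \<Omega> \<longleftrightarrow> sq_integrable (lebesgue_on \<Omega>) f"
  by (simp add: Lp_def sq_integrable_def)

lemma Lp_norm_2: "Lp_norm 2 \<Omega> f = L2norm (lebesgue_on \<Omega>) f"
  by (simp add: Lp_norm_def L2norm_def powr_half_sqrt)

lemma L2norm_nonneg [simp]: "0 \<le> L2norm M f"
  by (simp add: L2norm_def)

lemma L2norm_square: "(L2norm M f)\<^sup>2 = (LINT x|M. (norm (f x))\<^sup>2)"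
  by (simp add: L2norm_def)

lemma sq_integrable_meas: "sq_integrable M f \<Longrightarrow> f \<in> borel_measurable M"
  by (simp add: sq_integrable_def)

lemma sq_integrable_bound:
  assumes "sq_integrable M g" "f \<in> borel_measurable M" "AE x in M. norm (f x) \<le> c * norm (g x)"
  shows "sq_integrable M f"
proof -
  have "integrable M (\<lambda>x. c\<^sup>2 * (norm (g x))\<^sup>2)"
    using assms(1) by (simp add: sq_integrable_def)
  then have "integrable M (\<lambda>x. (norm (f x))\<^sup>2)"
  proof (rule Bochner_Integration.integrable_bound)
    show "AE x in M. norm ((norm (f x))\<^sup>2) \<le> norm (c\<^sup>2 * (norm (g x))\<^sup>2)"
      using assms(3)
    proof eventually_elim
      case (elim x)
      then have "(norm (f x))\<^sup>2 \<le> (c * norm (g x))\<^sup>2"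
        by (intro power_mono) auto
      then show ?case by (simp add: power_mult_distrib)
    qed
  qed (use assms(2) in measurable)
  then show ?thesis using assms(2) by (simp add: sq_integrable_def)
qed

lemma L2norm_mono:
  assumes "sq_integrable M g" "f \<in> borel_measurable M" "AE x in M. norm (f x) \<le> norm (g x)"
  shows "L2norm M f \<le> L2norm M g"
proof -
  have "sq_integrable M f" using sq_integrable_bound[of M g f 1] assms by simp
  moreover have "AE x in M. (norm (f x))\<^sup>2 \<le> (norm (g x))\<^sup>2"
    using assms(3) by eventually_elim (intro power_mono, auto)
  ultimately show ?thesis
    using assms unfolding L2norm_def sq_integrable_def
    by (intro real_sqrt_le_mono integral_mono_AE) auto
qed

lemma sq_integrable_cong_AE:
  assumes "sq_integrable M f" "g \<in> borel_measurable M" "AE x in M. g x = f x"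
  shows "sq_integrable M g"
proof (rule sq_integrable_bound[OF assms(1,2)])
  show "AE x in M. norm (g x) \<le> 1 * norm (f x)"
    using assms(3) by eventually_elim simp
qed

lemma L2norm_cong_AE:
  assumes "g \<in> borel_measurable M" "f \<in> borel_measurable M" "AE x in M. g x = f x"
  shows "L2norm M g = L2norm M f"
  unfolding L2norm_def
  by (intro arg_cong[where f=sqrt] integral_cong_AE) (use assms in auto)

lemma sq_integrable_add:
  assumes "sq_integrable M f" "sq_integrable M g"
  shows "sq_integrable M (\<lambda>x. f x + g x)"
proof -
  have m: "f \<in> borel_measurable M" "g \<in> borel_measurable M"
    using assms by (auto simp: sq_integrable_def)
  have "integrable M (\<lambda>x. 2 * (norm (f x))\<^sup>2 + 2 * (norm (g x))\<^sup>2)"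
    using assms by (simp add: sq_integrable_def)
  then have "integrable M (\<lambda>x. (norm (f x + g x))\<^sup>2)"
  proof (rule Bochner_Integration.integrable_bound)
    have "(norm (f x + g x))\<^sup>2 \<le> 2 * (norm (f x))\<^sup>2 + 2 * (norm (g x))\<^sup>2" for x
    proof -
      have "(norm (f x + g x))\<^sup>2 \<le> (norm (f x) + norm (g x))\<^sup>2"
        by (intro power_mono norm_triangle_ineq) auto
      also have "\<dots> \<le> 2 * (norm (f x))\<^sup>2 + 2 * (norm (g x))\<^sup>2"
        using zero_le_power2[of "norm (f x) - norm (g x)"]
        by (simp add: power2_eq_square algebra_simps)
      finally show ?thesis .
    qed
    then show "AE x in M. norm ((norm (f x + g x))\<^sup>2) \<le> norm (2 * (norm (f x))\<^sup>2 + 2 * (norm (g x))\<^sup>2)"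
      by simp
  qed (use m in measurable)
  then show ?thesis using m by (simp add: sq_integrable_def)
qed

lemma sq_integrable_scaleR: "sq_integrable M f \<Longrightarrow> sq_integrable M (\<lambda>x. c *\<^sub>R f x)"
  by (auto simp: sq_integrable_def power_mult_distrib intro!: borel_measurable_scaleR)

lemma sq_integrable_zero [simp]: "sq_integrable M (\<lambda>x. 0)"
  by (simp add: sq_integrable_def)

lemma sq_integrable_minus: "sq_integrable M f \<Longrightarrow> sq_integrable M (\<lambda>x. - f x)"
  by (simp add: sq_integrable_def)

lemma sq_integrable_diff:
  "sq_integrable M f \<Longrightarrow> sq_integrable M g \<Longrightarrow> sq_integrable M (\<lambda>x. f x - g x)"
  using sq_integrable_add[of M f "\<lambda>x. - g x"] sq_integrable_minus[of M g] by simp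

lemma L2norm_scaleR: "L2norm M (\<lambda>x. c *\<^sub>R f x) = \<bar>c\<bar> * L2norm M f"
  by (simp add: L2norm_def power_mult_distrib real_sqrt_mult)

lemma L2norm_minus: "L2norm M (\<lambda>x. - f x) = L2norm M f"
  by (simp add: L2norm_def)

lemma L2norm_commute: "L2norm M (\<lambda>x. f x - g x) = L2norm M (\<lambda>x. g x - f x)"
  by (simp add: L2norm_def norm_minus_commute)

lemma sq_integrable_mult_norm:
  fixes f :: "'a \<Rightarrow> 'b::euclidean_space" and g :: "'a \<Rightarrow> 'c::euclidean_space"
  assumes "sq_integrable M f" "sq_integrable M g"
  shows "integrable M (\<lambda>x. norm (f x) * norm (g x))"
proof -
  have m: "f \<in> borel_measurable M" "g \<in> borel_measurable M"
    using assms by (auto simp: sq_integrable_def)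
  have "integrable M (\<lambda>x. (norm (f x))\<^sup>2 + (norm (g x))\<^sup>2)"
    using assms by (simp add: sq_integrable_def)
  then show ?thesis
  proof (rule Bochner_Integration.integrable_bound)
    have "norm (f x) * norm (g x) \<le> (norm (f x))\<^sup>2 + (norm (g x))\<^sup>2" for x
    proof -
      have "0 \<le> norm (f x) * norm (g x)" by simp
      moreover have "0 \<le> (norm (f x) - norm (g x))\<^sup>2" by simp
      ultimately show ?thesis unfolding power2_diff by linarith
    qed
    then show "AE x in M. norm (norm (f x) * norm (g x)) \<le> norm ((norm (f x))\<^sup>2 + (norm (g x))\<^sup>2)"
      by simp
  qed (use m in measurable)
qed

lemma L2norm_Cauchy_Schwarz:
  fixes f :: "'a \<Rightarrow> 'b::euclidean_space" and g :: "'a \<Rightarrow> 'c::euclidean_space"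
  assumes "sq_integrable M f" "sq_integrable M g"
  shows "(LINT x|M. norm (f x) * norm (g x)) \<le> L2norm M f * L2norm M g"
proof -
  define A where "A = (LINT x|M. (norm (f x))\<^sup>2)"
  define B where "B = (LINT x|M. norm (f x) * norm (g x))"
  define C where "C = (LINT x|M. (norm (g x))\<^sup>2)"
  have i: "integrable M (\<lambda>x. (norm (f x))\<^sup>2)" "integrable M (\<lambda>x. (norm (g x))\<^sup>2)"
    "integrable M (\<lambda>x. norm (f x) * norm (g x))"
    using assms sq_integrable_mult_norm[OF assms] by (auto simp: sq_integrable_def)
  have nn: "A \<ge> 0" "B \<ge> 0" "C \<ge> 0" unfolding A_def B_def C_def by simp_all
  have quad: "0 \<le> A - 2 * t * B + t\<^sup>2 * C" for t
  proof -
    have "0 \<le> (LINT x|M. (norm (f x) - t * norm (g x))\<^sup>2)" by simp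
    also have "\<dots> = (LINT x|M. (norm (f x))\<^sup>2 - 2 * t * (norm (f x) * norm (g x)) + t\<^sup>2 * (norm (g x))\<^sup>2)"
      by (intro Bochner_Integration.integral_cong) (auto simp: power2_eq_square algebra_simps)
    also have "\<dots> = A - 2 * t * B + t\<^sup>2 * C"
      using i unfolding A_def B_def C_def by simp
    finally show ?thesis .
  qed
  have "B\<^sup>2 \<le> A * C"
  proof (cases "C = 0")
    case True
    have "B = 0"
    proof (rule ccontr)
      assume "B \<noteq> 0"
      then have "0 \<le> A - 2 * ((A + 1) / B) * B" using quad[of "(A+1)/B"] True by simp
      then show False using \<open>B \<noteq> 0\<close> nn by simp
    qed
    then show ?thesis using nn by simp
  next
    case False
    then have "C > 0" using nn by simp
    have "0 \<le> (A - 2 * (B / C) * B + (B / C)\<^sup>2 * C) * C"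
      using quad[of "B/C"] nn by simp
    also have "\<dots> = A * C - B\<^sup>2" using \<open>C > 0\<close> by (simp add: field_simps power2_eq_square)
    finally show ?thesis by simp
  qed
  then have "sqrt (B\<^sup>2) \<le> sqrt (A * C)" by (rule real_sqrt_le_mono)
  then show ?thesis using nn unfolding L2norm_def A_def[symmetric] B_def[symmetric] C_def[symmetric]
    by (simp add: real_sqrt_mult)
qed

lemma sq_integrable_inner:
  assumes "sq_integrable M f" "sq_integrable M g"
  shows "integrable M (\<lambda>x. f x \<bullet> g x)"
  by (rule Bochner_Integration.integrable_bound[OF sq_integrable_mult_norm[OF assms]])
     (use assms in \<open>auto simp: sq_integrable_def Cauchy_Schwarz_ineq2\<close>)

lemma L2norm_inner_bound:
  assumes "sq_integrable M f" "sq_integrable M g"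
  shows "\<bar>LINT x|M. f x \<bullet> g x\<bar> \<le> L2norm M f * L2norm M g"
proof -
  have "\<bar>LINT x|M. f x \<bullet> g x\<bar> \<le> (LINT x|M. \<bar>f x \<bullet> g x\<bar>)"
    using integral_norm_bound[of M "\<lambda>x. f x \<bullet> g x"] by simp
  also have "\<dots> \<le> (LINT x|M. norm (f x) * norm (g x))"
    using sq_integrable_inner[OF assms] sq_integrable_mult_norm[OF assms]
    by (intro integral_mono) (auto simp: Cauchy_Schwarz_ineq2)
  finally show ?thesis using L2norm_Cauchy_Schwarz[OF assms] by simp
qed

lemma sq_integrable_scaleR_prod:
  assumes "sq_integrable M a" "sq_integrable M g"
  shows "integrable M (\<lambda>x. a x *\<^sub>R g x)"
  by (rule Bochner_Integration.integrable_bound[OF sq_integrable_mult_norm[OF assms]])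
     (use assms in \<open>auto simp: sq_integrable_def\<close>)

lemma L2norm_scaleR_prod_bound:
  assumes "sq_integrable M a" "sq_integrable M g"
  shows "norm (LINT x|M. a x *\<^sub>R g x) \<le> L2norm M a * L2norm M g"
proof -
  have "norm (LINT x|M. a x *\<^sub>R g x) \<le> (LINT x|M. norm (a x) * norm (g x))"
    using integral_norm_bound[of M "\<lambda>x. a x *\<^sub>R g x"] by simp
  then show ?thesis using L2norm_Cauchy_Schwarz[OF assms] by simp
qed

lemma L2norm_triangle:
  assumes "sq_integrable M f" "sq_integrable M g"
  shows "L2norm M (\<lambda>x. f x + g x) \<le> L2norm M f + L2norm M g"
proof -
  have i: "integrable M (\<lambda>x. (norm (f x))\<^sup>2)" "integrable M (\<lambda>x. (norm (g x))\<^sup>2)"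
    "integrable M (\<lambda>x. norm (f x) * norm (g x))"
    using assms sq_integrable_mult_norm[OF assms] by (auto simp: sq_integrable_def)
  have "(L2norm M (\<lambda>x. f x + g x))\<^sup>2 = (LINT x|M. (norm (f x + g x))\<^sup>2)"
    by (simp add: L2norm_square)
  also have "\<dots> \<le> (LINT x|M. (norm (f x))\<^sup>2 + 2 * (norm (f x) * norm (g x)) + (norm (g x))\<^sup>2)"
  proof (rule integral_mono)
    show "integrable M (\<lambda>x. (norm (f x + g x))\<^sup>2)"
      using sq_integrable_add[OF assms] by (simp add: sq_integrable_def)
    show "integrable M (\<lambda>x. (norm (f x))\<^sup>2 + 2 * (norm (f x) * norm (g x)) + (norm (g x))\<^sup>2)"
      using i by simp
    show "(norm (f x + g x))\<^sup>2 \<le> (norm (f x))\<^sup>2 + 2 * (norm (f x) * norm (g x)) + (norm (g x))\<^sup>2" for x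
    proof -
      have "(norm (f x + g x))\<^sup>2 \<le> (norm (f x) + norm (g x))\<^sup>2"
        by (intro power_mono norm_triangle_ineq) auto
      then show ?thesis by (simp add: power2_sum)
    qed
  qed
  also have "\<dots> = (L2norm M f)\<^sup>2 + 2 * (LINT x|M. norm (f x) * norm (g x)) + (L2norm M g)\<^sup>2"
    using i by (simp add: L2norm_square)
  also have "\<dots> \<le> (L2norm M f + L2norm M g)\<^sup>2"
    using L2norm_Cauchy_Schwarz[OF assms] by (simp add: power2_sum)
  finally show ?thesis by (rule power2_le_imp_le) simp
qed

lemma L2norm_triangle3:
  assumes "sq_integrable M f" "sq_integrable M g" "sq_integrable M h"
  shows "L2norm M (\<lambda>x. f x - h x) \<le> L2norm M (\<lambda>x. f x - g x) + L2norm M (\<lambda>x. g x - h x)"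
  using L2norm_triangle[OF sq_integrable_diff[OF assms(1,2)] sq_integrable_diff[OF assms(2,3)]] by simp

lemma L2norm_le_add:
  assumes "sq_integrable M f" "sq_integrable M g"
  shows "L2norm M f \<le> L2norm M (\<lambda>x. f x - g x) + L2norm M g"
  using L2norm_triangle[OF sq_integrable_diff[OF assms] assms(2)] by simp

lemma L2norm_zero_AE:
  assumes "sq_integrable M f" "L2norm M f = 0"
  shows "AE x in M. f x = 0"
proof -
  have "(LINT x|M. (norm (f x))\<^sup>2) = 0" using assms(2) by (simp add: L2norm_def)
  then have "AE x in M. (norm (f x))\<^sup>2 = 0"
    using assms(1) integral_nonneg_eq_0_iff_AE[of M "\<lambda>x. (norm (f x))\<^sup>2"] by (simp add: sq_integrable_def)
  then show ?thesis by simp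
qed

text \<open>Convergence in the mean yields pointwise convergence along a subsequence, because the
  squared norms of the differences converge to zero in the \<open>L\<^sup>1\<close> sense.\<close>
lemma L2_lim_AE_subseq:
  assumes "\<And>n. sq_integrable M (\<lambda>x. f n x - g x)" "(\<lambda>n. L2norm M (\<lambda>x. f n x - g x)) \<longlonglongrightarrow> 0"
  obtains r :: "nat \<Rightarrow> nat" where "strict_mono r" "AE x in M. (\<lambda>n. f (r n) x) \<longlonglongrightarrow> g x"
proof -
  have "(\<lambda>n. (L2norm M (\<lambda>x. f n x - g x))\<^sup>2) \<longlonglongrightarrow> 0\<^sup>2"
    by (intro tendsto_intros assms)
  then have "(\<lambda>n. LINT x|M. norm ((norm (f n x - g x))\<^sup>2)) \<longlonglongrightarrow> 0"
    by (simp add: L2norm_square)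
  then obtain r where r: "strict_mono r" "AE x in M. (\<lambda>n. (norm (f (r n) x - g x))\<^sup>2) \<longlonglongrightarrow> 0"
    using tendsto_L1_AE_subseq[of M "\<lambda>n x. (norm (f n x - g x))\<^sup>2"] assms(1)
    by (auto simp: sq_integrable_def)
  have "AE x in M. (\<lambda>n. f (r n) x) \<longlonglongrightarrow> g x"
    using r(2)
  proof eventually_elim
    case (elim x)
    then have "(\<lambda>n. sqrt ((norm (f (r n) x - g x))\<^sup>2)) \<longlonglongrightarrow> sqrt 0" by (rule tendsto_real_sqrt)
    then show ?case by (simp add: tendsto_norm_zero_iff LIM_zero_iff)
  qed
  then show ?thesis using r(1) that by blast
qed

text \<open>Fatou's lemma in the form in which it is used to pass bounds to pointwise limits.\<close>
lemma Fatou_integrable: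
  fixes f :: "nat \<Rightarrow> 'a \<Rightarrow> real"
  assumes i: "\<And>n. integrable M (f n)" and nn: "\<And>n x. 0 \<le> f n x"
    and lim: "AE x in M. (\<lambda>n. f n x) \<longlonglongrightarrow> g x" and g: "g \<in> borel_measurable M"
    and b: "\<And>n. (LINT x|M. f n x) \<le> c n" and c: "c \<longlonglongrightarrow> C"
  shows "integrable M g" "(LINT x|M. g x) \<le> C"
proof -
  have gnn: "AE x in M. 0 \<le> g x"
    using lim by eventually_elim (rule LIMSEQ_le_const, auto simp: nn)
  have C: "C \<ge> 0"
  proof (rule LIMSEQ_le_const[OF c], intro exI allI impI)
    show "0 \<le> c n" for n using b[of n] Bochner_Integration.integral_nonneg[of M "f n"] nn by (smt (verit))
  qed
  have "(\<integral>\<^sup>+x. ennreal (g x) \<partial>M) = (\<integral>\<^sup>+x. liminf (\<lambda>n. ennreal (f n x)) \<partial>M)"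
  proof (rule nn_integral_cong_AE)
    show "AE x in M. ennreal (g x) = liminf (\<lambda>n. ennreal (f n x))"
      using lim
    proof eventually_elim
      case (elim x)
      then have "(\<lambda>n. ennreal (f n x)) \<longlonglongrightarrow> ennreal (g x)" by (rule tendsto_ennrealI)
      then show ?case by (simp add: lim_imp_Liminf)
    qed
  qed
  also have "\<dots> \<le> liminf (\<lambda>n. \<integral>\<^sup>+x. ennreal (f n x) \<partial>M)"
    by (rule nn_integral_liminf) (use i in measurable)
  also have "\<dots> \<le> liminf (\<lambda>n. ennreal (c n))"
    by (intro Liminf_mono always_eventually allI)
       (auto simp: nn_integral_eq_integral[OF i] nn intro!: ennreal_leI b)
  also have "\<dots> = ennreal C"
    by (intro lim_imp_Liminf) (auto intro!: tendsto_ennrealI c)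
  finally have le: "(\<integral>\<^sup>+x. ennreal (g x) \<partial>M) \<le> ennreal C" .
  have "(\<integral>\<^sup>+x. ennreal (norm (g x)) \<partial>M) = (\<integral>\<^sup>+x. ennreal (g x) \<partial>M)"
    by (rule nn_integral_cong_AE) (use gnn in auto)
  then show ig: "integrable M g"
    using le g by (intro integrableI_bounded) (auto simp: le_less_trans)
  have "ennreal (LINT x|M. g x) \<le> ennreal C"
    using le nn_integral_eq_integral[OF ig gnn] by simp
  then show "(LINT x|M. g x) \<le> C" using C by (simp add: ennreal_le_iff)
qed

lemma L2_Fatou:
  assumes i: "\<And>n. sq_integrable M (f n)" and g: "g \<in> borel_measurable M"
    and lim: "AE x in M. (\<lambda>n. f n x) \<longlonglongrightarrow> g x"
    and b: "\<And>n. L2norm M (f n) \<le> c n" and c: "c \<longlonglongrightarrow> C"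
  shows "sq_integrable M g" "L2norm M g \<le> C"
proof -
  have c0: "c n \<ge> 0" for n by (rule order_trans[OF L2norm_nonneg b])
  have C0: "C \<ge> 0" by (rule LIMSEQ_le_const[OF c]) (use c0 in auto)
  have lim2: "AE x in M. (\<lambda>n. (norm (f n x))\<^sup>2) \<longlonglongrightarrow> (norm (g x))\<^sup>2"
    using lim by eventually_elim (intro tendsto_intros)
  have b2: "(LINT x|M. (norm (f n x))\<^sup>2) \<le> (c n)\<^sup>2" for n
    unfolding L2norm_square[symmetric] by (intro power_mono b) simp
  have i2: "integrable M (\<lambda>x. (norm (f n x))\<^sup>2)" for n
    using i[of n] by (simp add: sq_integrable_def)
  have g2: "(\<lambda>x. (norm (g x))\<^sup>2) \<in> borel_measurable M" using g by measurable
  note * = Fatou_integrable[OF i2 zero_le_power2 lim2 g2 b2 tendsto_power[OF c]]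
  show "sq_integrable M g" using * g by (simp add: sq_integrable_def)
  show "L2norm M g \<le> C"
    by (rule power2_le_imp_le[OF _ C0], unfold L2norm_square, rule *(2))
qed

text \<open>Completeness. Along a subsequence whose consecutive differences have norms at most
  \<open>8\<^sup>-\<^sup>k\<close>, the series \<open>\<Sum> 4\<^sup>k \<bar>f\<^sub>k\<^sub>+\<^sub>1 - f\<^sub>k\<bar>\<^sup>2\<close> has a finite integral; hence
  the differences are eventually below \<open>2\<^sup>-\<^sup>k\<close> at almost every point, the subsequence
  converges there, and Fatou's lemma identifies the limit in the mean.\<close>
lemma L2_complete:
  fixes f :: "nat \<Rightarrow> 'a \<Rightarrow> 'b::euclidean_space"
  assumes i: "\<And>n. sq_integrable M (f n)"
    and cau: "\<And>e. e > 0 \<Longrightarrow> \<exists>N. \<forall>m\<ge>N. \<forall>n\<ge>N. L2norm M (\<lambda>x. f m x - f n x) < e"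
  obtains g where "sq_integrable M g" "(\<lambda>n. L2norm M (\<lambda>x. f n x - g x)) \<longlonglongrightarrow> 0"
proof -
  have [measurable]: "f n \<in> borel_measurable M" for n using i[of n] by (simp add: sq_integrable_def)
  have "\<forall>k. \<exists>N. \<forall>m\<ge>N. \<forall>n\<ge>N. L2norm M (\<lambda>x. f m x - f n x) < (1/8)^k"
    by (intro allI cau) simp
  from choice[OF this] obtain N
    where N: "\<And>k m n. m \<ge> N k \<Longrightarrow> n \<ge> N k \<Longrightarrow> L2norm M (\<lambda>x. f m x - f n x) < (1/8)^k"
    by blast
  define r where "r k = k + (\<Sum>j\<le>k. N j)" for k
  have rN: "r k \<ge> N k" for k
    using member_le_sum[of k "{..k}" N] by (simp add: r_def)
  have rS: "r (Suc k) > r k" for k by (simp add: r_def)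
  have rm: "strict_mono r" using rS by (simp add: strict_mono_Suc_iff)
  have rge: "r k \<ge> k" for k by (simp add: r_def)
  define D where "D k x = f (r (Suc k)) x - f (r k) x" for k x
  have Dm[measurable]: "D k \<in> borel_measurable M" for k unfolding D_def by measurable
  have D: "sq_integrable M (D k)" for k
    unfolding D_def by (rule sq_integrable_diff[OF i i])
  have Dn: "L2norm M (D k) < (1/8)^k" for k
  proof -
    have "N k \<le> r (Suc k)" using rN[of k] rS[of k] by linarith
    then show ?thesis unfolding D_def using rN[of k] by (rule N)
  qed
  have D2: "(\<integral>\<^sup>+x. ennreal (4^k * (norm (D k x))\<^sup>2) \<partial>M) \<le> ennreal ((1/2)^k)" for k
  proof -
    have "(LINT x|M. 4^k * (norm (D k x))\<^sup>2) = 4^k * (L2norm M (D k))\<^sup>2"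
      by (simp add: L2norm_square)
    also have "\<dots> \<le> 4^k * ((1/8)^k)\<^sup>2"
      by (intro mult_left_mono power_mono) (use Dn[of k] in auto)
    also have "\<dots> = (4 * (1/64))^k"
    proof -
      have "((1/8::real)^k)\<^sup>2 = ((1/8)\<^sup>2)^k" by (simp only: power_mult[symmetric] mult.commute)
      then show ?thesis by (simp only: power_mult_distrib) (simp add: power2_eq_square)
    qed
    also have "\<dots> \<le> (1/2)^k" by (intro power_mono) auto
    finally show ?thesis
      using D[of k] by (subst nn_integral_eq_integral) (auto simp: sq_integrable_def ennreal_leI)
  qed
  have "(\<integral>\<^sup>+x. (\<Sum>k. ennreal (4^k * (norm (D k x))\<^sup>2)) \<partial>M) = (\<Sum>k. (\<integral>\<^sup>+x. ennreal (4^k * (norm (D k x))\<^sup>2) \<partial>M))"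
    by (rule nn_integral_suminf) measurable
  also have "\<dots> \<le> (\<Sum>k. ennreal ((1/2)^k))" by (intro suminf_le D2) auto
  also have "\<dots> = ennreal (\<Sum>k. (1/2)^k)" by (intro suminf_ennreal2) (auto intro: summable_geometric)
  also have "\<dots> < \<infinity>" by simp
  finally have "AE x in M. (\<Sum>k. ennreal (4^k * (norm (D k x))\<^sup>2)) \<noteq> \<infinity>"
    by (intro nn_integral_PInf_AE) auto
  then have conv: "AE x in M. convergent (\<lambda>k. f (r k) x)"
  proof eventually_elim
    case (elim x)
    then have "summable (\<lambda>k. 4^k * (norm (D k x))\<^sup>2)"
      by (intro summable_suminf_not_top) auto
    then have "(\<lambda>k. 4^k * (norm (D k x))\<^sup>2) \<longlonglongrightarrow> 0" by (rule summable_LIMSEQ_zero)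
    then have "eventually (\<lambda>k. 4^k * (norm (D k x))\<^sup>2 < 1) sequentially"
      by (rule order_tendstoD) simp
    then have "eventually (\<lambda>k. norm (D k x) \<le> (1/2)^k) sequentially"
    proof eventually_elim
      case (elim k)
      have "(norm (D k x))\<^sup>2 \<le> ((1/2)^k)\<^sup>2"
      proof -
        have "((1/2::real)^k)\<^sup>2 = ((1/2)\<^sup>2)^k" by (simp only: power_mult[symmetric] mult.commute)
        then have "((1/2::real)^k)\<^sup>2 = 1 / 4^k" by (simp only: power_divide) simp
        then show ?thesis using elim by (simp add: field_simps)
      qed
      then show ?case by (rule power2_le_imp_le) simp
    qed
    then have "summable (\<lambda>k. D k x)"
      by (rule summable_comparison_test_ev) (auto intro: summable_geometric)
    then have "convergent (\<lambda>n. \<Sum>k<n. D k x)" by (simp add: summable_iff_convergent)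
    moreover have "(\<Sum>k<n. D k x) = f (r n) x - f (r 0) x" for n
      unfolding D_def by (rule sum_lessThan_telescope)
    ultimately have "convergent (\<lambda>n. (f (r n) x - f (r 0) x) + f (r 0) x)"
      by (intro convergent_add[OF _ convergent_const]) simp
    then show ?case by simp
  qed
  define g where "g x = lim (\<lambda>k. f (r k) x)" for x
  have gm[measurable]: "g \<in> borel_measurable M" unfolding g_def by (rule borel_measurable_lim_metric) measurable
  have lim: "AE x in M. (\<lambda>k. f (r k) x) \<longlonglongrightarrow> g x"
    using conv by eventually_elim (auto simp: g_def convergent_LIMSEQ_iff)
  have est: "sq_integrable M (\<lambda>x. f m x - g x)" "L2norm M (\<lambda>x. f m x - g x) \<le> (1/8)^k" if "m \<ge> N k" for m k
  proof -
    have l: "AE x in M. (\<lambda>j. f m x - f (r (j + k)) x) \<longlonglongrightarrow> f m x - g x"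
      using lim
    proof eventually_elim
      case (elim x)
      show ?case by (rule tendsto_diff[OF tendsto_const LIMSEQ_ignore_initial_segment[OF elim]])
    qed
    have b: "L2norm M (\<lambda>x. f m x - f (r (j + k)) x) \<le> (1/8)^k" for j
      using N[of k m "r (j+k)"] that rN[of k] strict_mono_leD[OF rm, of k "j+k"] by simp
    have m: "(\<lambda>x. f m x - g x) \<in> borel_measurable M" by measurable
    show "sq_integrable M (\<lambda>x. f m x - g x)" "L2norm M (\<lambda>x. f m x - g x) \<le> (1/8)^k"
      by (rule L2_Fatou[OF sq_integrable_diff[OF i i] m l b tendsto_const])+
  qed
  have "sq_integrable M (\<lambda>x. f (N 0) x - (f (N 0) x - g x))"
    by (rule sq_integrable_diff[OF i est(1)[of 0]]) simp
  then have gi: "sq_integrable M g" by simp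
  have "(\<lambda>n. L2norm M (\<lambda>x. f n x - g x)) \<longlonglongrightarrow> 0"
  proof (rule LIMSEQ_I)
    fix e :: real assume "e > 0"
    then obtain k where "(1/8)^k < e" using real_arch_pow_inv[of e "1/8"] by auto
    then have "norm (L2norm M (\<lambda>x. f n x - g x) - 0) < e" if "n \<ge> N k" for n
      using est(2)[OF that] by simp
    then show "\<exists>n0. \<forall>n\<ge>n0. norm (L2norm M (\<lambda>x. f n x - g x) - 0) < e" by blast
  qed
  then show ?thesis using gi that by blast
qed

lemma L2norm_tendsto:
  assumes "\<And>n. sq_integrable M (f n)" "sq_integrable M g" "(\<lambda>n. L2norm M (\<lambda>x. f n x - g x)) \<longlonglongrightarrow> 0"
  shows "(\<lambda>n. L2norm M (f n)) \<longlonglongrightarrow> L2norm M g"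
proof -
  have "\<bar>L2norm M (f n) - L2norm M g\<bar> \<le> L2norm M (\<lambda>x. f n x - g x)" for n
    using L2norm_le_add[OF assms(1)[of n] assms(2)] L2norm_le_add[OF assms(2) assms(1)[of n]]
    by (simp add: L2norm_commute[of M g] abs_le_iff)
  then have "(\<lambda>n. L2norm M (f n) - L2norm M g) \<longlonglongrightarrow> 0"
    by (intro Lim_null_comparison[OF _ assms(3)]) auto
  then show ?thesis by (simp add: LIM_zero_iff)
qed

lemma L2_lim_inner:
  assumes "\<And>n. sq_integrable M (f n)" "sq_integrable M g" "(\<lambda>n. L2norm M (\<lambda>x. f n x - g x)) \<longlonglongrightarrow> 0"
    and "sq_integrable M h"
  shows "(\<lambda>n. LINT x|M. f n x \<bullet> h x) \<longlonglongrightarrow> (LINT x|M. g x \<bullet> h x)"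
proof -
  have "\<bar>(LINT x|M. f n x \<bullet> h x) - (LINT x|M. g x \<bullet> h x)\<bar> \<le> L2norm M (\<lambda>x. f n x - g x) * L2norm M h" for n
    using L2norm_inner_bound[OF sq_integrable_diff[OF assms(1)[of n] assms(2)] assms(4)]
    by (simp add: inner_diff_left sq_integrable_inner assms)
  moreover have "(\<lambda>n. L2norm M (\<lambda>x. f n x - g x) * L2norm M h) \<longlonglongrightarrow> 0"
    using tendsto_mult_right[OF assms(3), of "L2norm M h"] by simp
  ultimately have "(\<lambda>n. (LINT x|M. f n x \<bullet> h x) - (LINT x|M. g x \<bullet> h x)) \<longlonglongrightarrow> 0"
    by (intro Lim_null_comparison[where f="\<lambda>n. (LINT x|M. f n x \<bullet> h x) - (LINT x|M. g x \<bullet> h x)"]) auto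
  then show ?thesis by (simp add: LIM_zero_iff)
qed

lemma sq_integrable_linear:
  assumes "sq_integrable M f" "bounded_linear L"
  shows "sq_integrable M (\<lambda>x. L (f x))"
proof -
  obtain K where "\<And>x. norm (L x) \<le> norm x * K" using bounded_linear.bounded[OF assms(2)] by auto
  moreover have "(\<lambda>x. L (f x)) \<in> borel_measurable M"
    using assms(1) linear_continuous_on[OF assms(2)]
    by (intro borel_measurable_continuous_on[of L]) (auto simp: sq_integrable_def)
  ultimately show ?thesis using sq_integrable_bound[OF assms(1), of "\<lambda>x. L (f x)" K]
    by (simp add: mult.commute)
qed

lemma L2_lim_linear:
  assumes "\<And>n. sq_integrable M (\<lambda>x. f n x - g x)" "(\<lambda>n. L2norm M (\<lambda>x. f n x - g x)) \<longlonglongrightarrow> 0"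
    "bounded_linear L"
  shows "(\<lambda>n. L2norm M (\<lambda>x. L (f n x) - L (g x))) \<longlonglongrightarrow> 0"
proof -
  interpret L: bounded_linear L by fact
  obtain K where K: "\<And>x. norm (L x) \<le> norm x * K" "K \<ge> 0" using L.nonneg_bounded by auto
  have "L2norm M (\<lambda>x. L (f n x) - L (g x)) \<le> K * L2norm M (\<lambda>x. f n x - g x)" for n
  proof -
    have "L2norm M (\<lambda>x. L (f n x) - L (g x)) \<le> L2norm M (\<lambda>x. K *\<^sub>R (f n x - g x))"
    proof (rule L2norm_mono)
      show "sq_integrable M (\<lambda>x. K *\<^sub>R (f n x - g x))" by (intro sq_integrable_scaleR assms)
      show "(\<lambda>x. L (f n x) - L (g x)) \<in> borel_measurable M"
        using sq_integrable_meas[OF sq_integrable_linear[OF assms(1)[of n] assms(3)]] by (simp add: L.diff)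
      show "AE x in M. norm (L (f n x) - L (g x)) \<le> norm (K *\<^sub>R (f n x - g x))"
        using K by (simp add: L.diff[symmetric] mult.commute)
    qed
    then show ?thesis using K by (simp add: L2norm_scaleR)
  qed
  then show ?thesis
    by (intro Lim_null_comparison[OF _ tendsto_mult_right_zero[OF assms(2), of K]]) auto
qed

lemma L2_lim_unique:
  assumes "\<And>n. sq_integrable M (f n)" "sq_integrable M g" "sq_integrable M h"
    "(\<lambda>n. L2norm M (\<lambda>x. f n x - g x)) \<longlonglongrightarrow> 0" "(\<lambda>n. L2norm M (\<lambda>x. f n x - h x)) \<longlonglongrightarrow> 0"
  shows "AE x in M. g x = h x"
proof -
  have "L2norm M (\<lambda>x. g x - h x) \<le> L2norm M (\<lambda>x. f n x - g x) + L2norm M (\<lambda>x. f n x - h x)" for n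
    using L2norm_triangle3[OF assms(2) assms(1)[of n] assms(3)] by (simp add: L2norm_commute[of M g])
  then have "L2norm M (\<lambda>x. g x - h x) \<le> 0 + 0"
    by (intro LIMSEQ_le_const[OF tendsto_add[OF assms(4,5)]] exI[of _ 0]) simp
  then have "L2norm M (\<lambda>x. g x - h x) = 0" by (simp add: antisym)
  then have "AE x in M. g x - h x = 0"
    by (rule L2norm_zero_AE[OF sq_integrable_diff[OF assms(2,3)]])
  then show ?thesis by simp
qed

section \<open>Smooth functions and test functions\<close>

definition smooth :: "(real^3 \<Rightarrow> 'b::euclidean_space) \<Rightarrow> bool" where
  "smooth f \<longleftrightarrow> (\<forall>k. C_order k f)"

lemma partial_eqI: "(f has_derivative f') (at x) \<Longrightarrow> partial i f x = f' (axis i 1)"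
  unfolding partial_def by (metis frechet_derivative_at)

lemma vec3_decomp: "(h::real^3) = (\<Sum>i\<in>UNIV. (h $ i) *\<^sub>R axis i 1)"
  by (simp add: vec_eq_iff axis_def if_distrib[of "\<lambda>z. _ * z"] cong: if_cong)

lemma has_derivative_partial:
  assumes "f differentiable (at x)"
  shows "(f has_derivative (\<lambda>h. \<Sum>i\<in>UNIV. (h $ i) *\<^sub>R partial i f x)) (at x)"
proof -
  let ?D = "frechet_derivative f (at x)"
  have D: "(f has_derivative ?D) (at x)" using assms by (simp add: frechet_derivative_works)
  then have "linear ?D" by (rule has_derivative_linear)
  have "?D h = (\<Sum>i\<in>UNIV. (h $ i) *\<^sub>R partial i f x)" for h
  proof -
    have "?D h = ?D (\<Sum>i\<in>UNIV. (h $ i) *\<^sub>R axis i 1)" using vec3_decomp[of h] by simp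
    also have "\<dots> = (\<Sum>i\<in>UNIV. (h $ i) *\<^sub>R ?D (axis i 1))"
      using \<open>linear ?D\<close> by (simp add: linear_sum linear_scale)
    finally show ?thesis by (simp add: partial_def)
  qed
  then have "?D = (\<lambda>h. \<Sum>i\<in>UNIV. (h $ i) *\<^sub>R partial i f x)" by blast
  then show ?thesis using D by metis
qed

lemma partial_add:
  "f differentiable (at x) \<Longrightarrow> g differentiable (at x) \<Longrightarrow>
    partial i (\<lambda>x. f x + g x) x = partial i f x + partial i g x"
  by (subst partial_eqI[OF has_derivative_add], (erule iffD1[OF frechet_derivative_works])+)
     (simp add: partial_def)

lemma partial_scaleR:
  fixes a :: "real^3 \<Rightarrow> real"
  assumes "a differentiable (at x)" "g differentiable (at x)"
  shows "partial i (\<lambda>x. a x *\<^sub>R g x) x = partial i a x *\<^sub>R g x + a x *\<^sub>R partial i g x"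
  using partial_eqI[OF has_derivative_scaleR[OF iffD1[OF frechet_derivative_works assms(1)]
      iffD1[OF frechet_derivative_works assms(2)]]]
  by (simp add: partial_def add.commute)

lemma partial_mult:
  fixes a b :: "real^3 \<Rightarrow> real"
  assumes "a differentiable (at x)" "b differentiable (at x)"
  shows "partial i (\<lambda>x. a x * b x) x = partial i a x * b x + a x * partial i b x"
  using partial_scaleR[OF assms] by simp

lemma partial_linear:
  assumes "f differentiable (at x)" "bounded_linear L"
  shows "partial i (\<lambda>x. L (f x)) x = L (partial i f x)"
  using partial_eqI[OF bounded_linear.has_derivative[OF assms(2) iffD1[OF frechet_derivative_works assms(1)]]]
  by (simp add: partial_def)

lemma partial_const [simp]: "partial i (\<lambda>x. c) x = 0"
  using partial_eqI[OF has_derivative_const] by fastforce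

lemma differentiable_linear_comp:
  "f differentiable (at x) \<Longrightarrow> bounded_linear L \<Longrightarrow> (\<lambda>x. L (f x)) differentiable (at x)"
  unfolding differentiable_def using bounded_linear.has_derivative by blast

lemma affine_has_derivative:
  assumes "bounded_linear A"
  shows "((\<lambda>x. A x + b) has_derivative A) (at x)"
  by (rule has_derivative_eq_rhs, rule has_derivative_add[OF bounded_linear_imp_has_derivative[OF assms] has_derivative_const]) simp

lemma has_derivative_affine_comp:
  assumes "bounded_linear A" "f differentiable (at (A x + b))"
  shows "((\<lambda>x. f (A x + b)) has_derivative (\<lambda>h. \<Sum>j\<in>UNIV. (A h $ j) *\<^sub>R partial j f (A x + b))) (at x)"
  using has_derivative_compose[OF affine_has_derivative[OF assms(1), of b x] has_derivative_partial[OF assms(2)]]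
  by simp

lemma partial_affine_comp:
  assumes "bounded_linear A" "f differentiable (at (A x + b))"
  shows "partial i (\<lambda>x. f (A x + b)) x = (\<Sum>j\<in>UNIV. (A (axis i 1) $ j) *\<^sub>R partial j f (A x + b))"
  by (rule partial_eqI[OF has_derivative_affine_comp[OF assms]])

lemma partial_translate:
  assumes "f differentiable (at (x + b))"
  shows "partial i (\<lambda>x. f (x + b)) x = partial i f (x + b)"
  using partial_affine_comp[of "\<lambda>x. x" f x b i] assms
  by (simp add: axis_def if_distrib[of "\<lambda>z. z *\<^sub>R _"] cong: if_cong)

lemma C_order_D: "C_order (Suc k) f \<Longrightarrow> f differentiable (at x)"
  by simp

lemma C_order_lower: "C_order (Suc k) f \<Longrightarrow> C_order k f"
proof (induction k arbitrary: f)
  case 0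
  then show ?case
    by (auto simp: differentiable_imp_continuous_within intro!: continuous_at_imp_continuous_on)
next
  case (Suc k)
  then show ?case by (metis C_order.simps(2))
qed

lemma C_order_continuous: "C_order k f \<Longrightarrow> continuous_on UNIV f"
proof (induction k)
  case (Suc k)
  then show ?case using C_order_lower by blast
qed simp

lemma C_order_add: "C_order k f \<Longrightarrow> C_order k g \<Longrightarrow> C_order k (\<lambda>x. f x + g x)"
proof (induction k arbitrary: f g)
  case 0 then show ?case by (auto intro: continuous_intros)
next
  case (Suc k)
  have "partial i (\<lambda>x. f x + g x) = (\<lambda>x. partial i f x + partial i g x)" for i
    using Suc.prems by (auto simp: partial_add)
  then show ?case using Suc by auto
qed

lemma C_order_linear: "C_order k f \<Longrightarrow> bounded_linear L \<Longrightarrow> C_order k (\<lambda>x. L (f x))"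
proof (induction k arbitrary: f)
  case 0 then show ?case by (auto intro: bounded_linear.continuous_on)
next
  case (Suc k)
  have "partial i (\<lambda>x. L (f x)) = (\<lambda>x. L (partial i f x))" for i
    using Suc.prems by (auto simp: partial_linear)
  then show ?case using Suc by (auto intro: differentiable_linear_comp)
qed

lemma C_order_const: "C_order k (\<lambda>x. c)"
proof (induction k arbitrary: c)
  case (Suc k)
  have "partial i (\<lambda>x. c) = (\<lambda>x. 0)" for i by (rule ext) simp
  then show ?case using Suc by simp
qed simp

lemma C_order_sum: "finite I \<Longrightarrow> (\<And>i. i \<in> I \<Longrightarrow> C_order k (f i)) \<Longrightarrow> C_order k (\<lambda>x. \<Sum>i\<in>I. f i x)"
  by (induction I rule: finite_induct) (auto intro: C_order_const C_order_add)

lemma C_order_scaleR: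
  fixes a :: "real^3 \<Rightarrow> real"
  shows "C_order k a \<Longrightarrow> C_order k g \<Longrightarrow> C_order k (\<lambda>x. a x *\<^sub>R g x)"
proof (induction k arbitrary: a g)
  case 0 then show ?case by (auto intro: continuous_intros)
next
  case (Suc k)
  have "partial i (\<lambda>x. a x *\<^sub>R g x) = (\<lambda>x. partial i a x *\<^sub>R g x + a x *\<^sub>R partial i g x)" for i
    using Suc.prems by (auto simp: partial_scaleR)
  then show ?case using Suc C_order_lower[OF Suc.prems(1)] C_order_lower[OF Suc.prems(2)]
    by (auto intro!: C_order_add differentiable_scaleR)
qed

text \<open>The chain rule expresses the partial derivatives of the composition as linear combinations of
  compositions of lower order.\<close>
lemma C_order_affine:
  assumes "bounded_linear A"
  shows "C_order k f \<Longrightarrow> C_order k (\<lambda>x. f (A x + b))"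
proof (induction k arbitrary: f)
  case 0
  have "continuous_on UNIV (\<lambda>x. A x + b)"
    by (intro continuous_intros bounded_linear.continuous_on[OF assms])
  then show ?case using 0 by (auto intro: continuous_on_compose2)
next
  case (Suc k)
  have "partial i (\<lambda>x. f (A x + b)) = (\<lambda>x. \<Sum>j\<in>UNIV. (A (axis i 1) $ j) *\<^sub>R partial j f (A x + b))" for i
    using Suc.prems by (auto intro!: partial_affine_comp assms)
  moreover have "(\<lambda>x. f (A x + b)) differentiable (at x)" for x
    using has_derivative_affine_comp[OF assms, of f x b] Suc.prems by (auto simp: differentiable_def)
  moreover have "C_order k (\<lambda>x. \<Sum>j\<in>UNIV. (A (axis i 1) $ j) *\<^sub>R partial j f (A x + b))" for i
    using Suc by (intro C_order_sum C_order_linear[OF _ bounded_linear_scaleR_right]) auto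
  ultimately show ?case by simp
qed

lemma smooth_differentiable: "smooth f \<Longrightarrow> f differentiable (at x)"
  unfolding smooth_def using C_order_D by blast

lemma smooth_partial: "smooth f \<Longrightarrow> smooth (partial i f)"
  unfolding smooth_def by (metis C_order.simps(2))

lemma smooth_continuous: "smooth f \<Longrightarrow> continuous_on UNIV f"
  unfolding smooth_def using C_order_continuous by blast

lemma smooth_add: "smooth f \<Longrightarrow> smooth g \<Longrightarrow> smooth (\<lambda>x. f x + g x)"
  by (simp add: smooth_def C_order_add)

lemma smooth_linear: "smooth f \<Longrightarrow> bounded_linear L \<Longrightarrow> smooth (\<lambda>x. L (f x))"
  by (simp add: smooth_def C_order_linear)

lemma smooth_const: "smooth (\<lambda>x. c)"
  by (simp add: smooth_def C_order_const)

lemma smooth_scaleR: "smooth a \<Longrightarrow> smooth g \<Longrightarrow> smooth (\<lambda>x. (a x :: real) *\<^sub>R g x)"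
  by (simp add: smooth_def C_order_scaleR)

lemma smooth_mult: "smooth a \<Longrightarrow> smooth b \<Longrightarrow> smooth (\<lambda>x. (a x :: real) * b x)"
  using smooth_scaleR[of a b] by simp

lemma smooth_affine: "smooth f \<Longrightarrow> bounded_linear A \<Longrightarrow> smooth (\<lambda>x. f (A x + b))"
  by (simp add: smooth_def C_order_affine)

lemma smooth_component: "smooth f \<Longrightarrow> smooth (\<lambda>x. (f x :: real^3) $ i)"
  by (rule smooth_linear[OF _ bounded_linear_vec_nth])

lemma smooth_prod: "finite I \<Longrightarrow> (\<And>i. i \<in> I \<Longrightarrow> smooth (f i)) \<Longrightarrow> smooth (\<lambda>x. \<Prod>i\<in>I. f i x :: real)"
  by (induction I rule: finite_induct) (auto intro: smooth_const smooth_mult)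

subsection \<open>Smooth bumps\<close>

text \<open>The functions \<open>t\<^sup>-\<^sup>k exp (- 1 / t)\<close>, continued by zero, are closed under differentiation
  up to linear combinations; this makes each of them smooth on the whole line.\<close>
definition flat_exp :: "nat \<Rightarrow> real \<Rightarrow> real" where
  "flat_exp k t = (if t > 0 then exp (- 1 / t) / t ^ k else 0)"

lemma flat_exp_bounds: "0 \<le> flat_exp 0 t" "flat_exp 0 t \<le> 1"
  by (auto simp: flat_exp_def)

lemma flat_exp_lim0: "((flat_exp k) \<longlongrightarrow> 0) (at 0)"
proof -
  have "((\<lambda>t. flat_exp k t) \<longlongrightarrow> 0) (at_right 0)"
  proof -
    have "((\<lambda>t. (inverse t) ^ k / exp (inverse t)) \<longlongrightarrow> 0) (at_right (0::real))"
      by (rule filterlim_compose[OF tendsto_power_div_exp_0 filterlim_inverse_at_top_right])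
    moreover have "eventually (\<lambda>t. (inverse t) ^ k / exp (inverse t) = flat_exp k t) (at_right (0::real))"
      by (auto simp: eventually_at_right_less flat_exp_def exp_minus field_simps
          intro!: eventually_mono[OF eventually_at_right_less])
    ultimately show ?thesis by (rule Lim_transform_eventually)
  qed
  moreover have "((\<lambda>t. flat_exp k t) \<longlongrightarrow> 0) (at_left 0)"
  proof -
    have "eventually (\<lambda>t. 0 = flat_exp k t) (at_left (0::real))"
      by (auto simp: flat_exp_def eventually_at_left_field intro!: exI[of _ "-1"])
    then show ?thesis by (rule Lim_transform_eventually[OF tendsto_const])
  qed
  ultimately show ?thesis by (simp add: filterlim_split_at)
qed

lemma flat_exp_deriv:
  "(flat_exp k has_real_derivative (flat_exp (k+2) t - real k * flat_exp (k+1) t)) (at t)"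
proof (cases "t = 0")
  case True
  have "(\<lambda>h. (flat_exp k h - flat_exp k 0) / h) = flat_exp (Suc k)"
    by (auto simp: flat_exp_def fun_eq_iff)
  then have "((\<lambda>h. (flat_exp k h - flat_exp k 0) / h) \<longlongrightarrow> 0) (at 0)"
    using flat_exp_lim0[of "Suc k"] by simp
  then show ?thesis using True by (simp add: has_field_derivative_iff flat_exp_def)
next
  case False
  show ?thesis
  proof (cases "t > 0")
    case True
    have "((\<lambda>t. exp (- 1 / t) / t ^ k) has_real_derivative
            (exp (- 1 / t) / t ^ (k+2) - real k * (exp (- 1 / t) / t ^ (k+1)))) (at t)"
    proof (cases k)
      case 0
      then show ?thesis using True
        by (auto intro!: derivative_eq_intros simp: field_simps power2_eq_square)
    next
      case (Suc n)
      have [simp]: "t ^ n = t * t ^ (n - Suc 0)" if "n \<noteq> 0"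
        using that by (cases n) auto
      show ?thesis unfolding Suc using True
        by (cases "n = 0") (auto intro!: derivative_eq_intros simp: field_simps power2_eq_square)
    qed
    moreover have ev: "eventually (\<lambda>s. exp (- 1 / s) / s ^ k = flat_exp k s) (nhds t)"
      using eventually_nhds_in_open[of "{0<..}" t] True
      by (auto simp: flat_exp_def elim!: eventually_mono)
    ultimately have "(flat_exp k has_real_derivative
        (exp (- 1 / t) / t ^ (k+2) - real k * (exp (- 1 / t) / t ^ (k+1)))) (at t)"
      using DERIV_cong_ev[OF refl ev refl] by blast
    then show ?thesis using True by (simp add: flat_exp_def)
  next
    case False
    then have "t < 0" using \<open>t \<noteq> 0\<close> by simp
    moreover have "eventually (\<lambda>s. 0 = flat_exp k s) (nhds t)"
      using eventually_nhds_in_open[of "{..<0}" t] \<open>t < 0\<close>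
      by (auto simp: flat_exp_def elim!: eventually_mono)
    ultimately show ?thesis
      using DERIV_cong_ev[of t t "\<lambda>s. 0" "flat_exp k" 0 0] by (simp add: flat_exp_def)
  qed
qed

text \<open>The differentiation rule for \<open>flat_exp\<close> closes the induction on the order, because its
  right-hand side consists of functions of the same family.\<close>
lemma flat_exp_coord_smooth: "smooth (\<lambda>x::real^3. flat_exp k (c * x $ i + d))"
proof -
  have der: "((\<lambda>x::real^3. flat_exp k (c * x $ i + d)) has_derivative
      (\<lambda>h. (flat_exp (k+2) (c * x $ i + d) - real k * flat_exp (k+1) (c * x $ i + d)) * (c * h $ i))) (at x)" for x k
  proof -
    have "((\<lambda>x::real^3. c * x $ i + d) has_derivative (\<lambda>h. c * h $ i)) (at x)"
      by (auto intro!: derivative_eq_intros bounded_linear_imp_has_derivative)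
    from has_derivative_compose[OF this flat_exp_deriv[unfolded has_field_derivative_def]]
    show ?thesis by simp
  qed
  have "C_order n (\<lambda>x::real^3. flat_exp k (c * x $ i + d))" for n
  proof (induction n arbitrary: k)
    case 0
    show ?case using der[of k] by (auto intro!: continuous_at_imp_continuous_on dest: has_derivative_continuous)
  next
    case (Suc n)
    have p: "partial j (\<lambda>x::real^3. flat_exp k (c * x $ i + d)) =
       (\<lambda>x. (c * axis j 1 $ i) *\<^sub>R flat_exp (k+2) (c * x $ i + d)
          + (- real k * (c * axis j 1 $ i)) *\<^sub>R flat_exp (k+1) (c * x $ i + d))" for j
      by (rule ext, subst partial_eqI[OF der]) (simp add: algebra_simps)
    have "C_order n (partial j (\<lambda>x::real^3. flat_exp k (c * x $ i + d)))" for j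
      unfolding p by (intro C_order_add C_order_linear[OF Suc bounded_linear_scaleR_right])
    then show ?case using der[of k] by (auto simp: differentiable_def)
  qed
  then show ?thesis by (simp add: smooth_def)
qed

text \<open>As the parameter \<open>m\<close> grows, the bump increases to the indicator of the open box.\<close>
definition box_bump :: "real \<Rightarrow> real^3 \<Rightarrow> real^3 \<Rightarrow> real^3 \<Rightarrow> real" where
  "box_bump m a b x = (\<Prod>i\<in>UNIV. flat_exp 0 (m * (x $ i - a $ i)) * flat_exp 0 (m * (b $ i - x $ i)))"

lemma smooth_box_bump: "smooth (box_bump m a b)"
proof -
  have "smooth (\<lambda>x. flat_exp 0 (m * x $ i + (- m * a $ i)) * flat_exp 0 (- m * x $ i + m * b $ i))" for i
    by (intro smooth_mult flat_exp_coord_smooth)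
  then have "smooth (\<lambda>x. flat_exp 0 (m * (x $ i - a $ i)) * flat_exp 0 (m * (b $ i - x $ i)))" for i
    by (simp add: algebra_simps)
  then show ?thesis unfolding box_bump_def[abs_def] by (intro smooth_prod) auto
qed

lemma box_bump_bounds: "0 \<le> box_bump m a b x" "box_bump m a b x \<le> 1"
  unfolding box_bump_def
  by (auto intro!: prod_nonneg prod_le_1 mult_nonneg_nonneg mult_le_one flat_exp_bounds)

lemma box_bump_zero: assumes "m > 0" "x \<notin> box a b" shows "box_bump m a b x = 0"
proof -
  obtain i where "x $ i \<le> a $ i \<or> b $ i \<le> x $ i" using assms(2) by (auto simp: mem_box_cart not_less)
  then have "flat_exp 0 (m * (x $ i - a $ i)) * flat_exp 0 (m * (b $ i - x $ i)) = 0"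
    using assms(1) by (auto simp: flat_exp_def zero_less_mult_iff)
  then show ?thesis unfolding box_bump_def by (metis (mono_tags, lifting) UNIV_I finite prod_zero)
qed

lemma box_bump_pos: assumes "m > 0" "x \<in> box a b" shows "box_bump m a b x > 0"
  unfolding box_bump_def using assms
  by (intro prod_pos) (auto simp: mem_box_cart flat_exp_def)

lemma box_bump_lim: "(\<lambda>n. box_bump (real (Suc n)) a b x) \<longlonglongrightarrow> indicator (box a b) x"
proof (cases "x \<in> box a b")
  case False then show ?thesis by (simp add: box_bump_zero)
next
  case True
  have lim: "(\<lambda>n. flat_exp 0 (real (Suc n) * s)) \<longlonglongrightarrow> 1" if "s > 0" for s
  proof -
    have "(\<lambda>n. exp (- (inverse (real (Suc n))) * (1/s))) \<longlonglongrightarrow> exp (- 0 * (1/s))"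
      by (intro tendsto_intros LIMSEQ_inverse_real_of_nat)
    then show ?thesis using that by (simp add: flat_exp_def field_simps del: of_nat_Suc)
  qed
  have "(\<lambda>n. box_bump (real (Suc n)) a b x) \<longlonglongrightarrow> (\<Prod>i\<in>(UNIV::3 set). 1 * 1)"
    unfolding box_bump_def using True
    by (intro tendsto_prod tendsto_mult lim) (auto simp: mem_box_cart)
  then show ?thesis using True by simp
qed

subsection \<open>Test functions\<close>

lemma zero_off_support: "x \<notin> closure {x. f x \<noteq> 0} \<Longrightarrow> f x = 0"
  using closure_subset[of "{x. f x \<noteq> 0}"] by auto

lemma partial_zero_off_support:
  assumes "x \<notin> closure {x. f x \<noteq> 0}"
  shows "partial i f x = 0"
proof -
  have op: "open (- closure {x. f x \<noteq> 0})" by (rule open_Compl) (rule closed_closure)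
  have "(f has_derivative (\<lambda>h. 0)) (at x)"
  proof (rule has_derivative_transform_within_open[OF has_derivative_const op])
    show "x \<in> - closure {x. f x \<noteq> 0}" using assms by blast
    show "0 = f y" if "y \<in> - closure {x. f x \<noteq> 0}" for y
      using zero_off_support[of y f] that by (metis ComplD)
  qed
  from partial_eqI[OF this] show ?thesis by simp
qed

lemma test_smooth: "\<phi> \<in> test_functions \<Omega> \<Longrightarrow> smooth \<phi>"
  by (auto simp: test_functions_def smooth_def)

lemma test_mono: "\<phi> \<in> test_functions A \<Longrightarrow> A \<subseteq> B \<Longrightarrow> \<phi> \<in> test_functions B"
  by (auto simp: test_functions_def)

lemma test_UNIV: "\<phi> \<in> test_functions A \<Longrightarrow> \<phi> \<in> test_functions UNIV"
  by (rule test_mono) auto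

lemma testI:
  assumes "smooth f" "compact K" "K \<subseteq> \<Omega>" "\<And>x. x \<notin> K \<Longrightarrow> f x = 0"
  shows "f \<in> test_functions \<Omega>"
proof -
  have sub: "closure {x. f x \<noteq> 0} \<subseteq> K"
    using assms by (intro closure_minimal) (auto simp: compact_imp_closed)
  then have "compact (closure {x. f x \<noteq> 0})"
    using assms(2) by (metis closed_closure compact_Int_closed inf.absorb2)
  then show ?thesis using assms sub by (auto simp: test_functions_def smooth_def)
qed

text \<open>A product inherits its support from either factor.\<close>
lemma test_sub:
  assumes "\<phi> \<in> test_functions \<Omega>" "smooth f" "\<And>x. x \<notin> closure {x. \<phi> x \<noteq> 0} \<Longrightarrow> f x = 0"
  shows "f \<in> test_functions \<Omega>"
  using assms by (intro testI[of f "closure {x. \<phi> x \<noteq> 0}"]) (auto simp: test_functions_def)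

lemma test_partial: "\<phi> \<in> test_functions \<Omega> \<Longrightarrow> partial i \<phi> \<in> test_functions \<Omega>"
  by (rule test_sub[of \<phi>]) (auto intro: smooth_partial test_smooth partial_zero_off_support)

lemma test_scaleR_smooth:
  "\<phi> \<in> test_functions \<Omega> \<Longrightarrow> smooth g \<Longrightarrow> (\<lambda>x. (\<phi> x :: real) *\<^sub>R g x) \<in> test_functions \<Omega>"
  by (rule test_sub[of \<phi>]) (auto intro: smooth_scaleR test_smooth dest: zero_off_support)

lemma test_mult_smooth:
  "\<phi> \<in> test_functions \<Omega> \<Longrightarrow> smooth g \<Longrightarrow> (\<lambda>x. (\<phi> x :: real) * g x) \<in> test_functions \<Omega>"
  using test_scaleR_smooth[of \<phi> \<Omega> g] by simp

lemma test_linear: "\<phi> \<in> test_functions \<Omega> \<Longrightarrow> bounded_linear L \<Longrightarrow> (\<lambda>x. L (\<phi> x)) \<in> test_functions \<Omega>"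
  by (rule test_sub[of \<phi>])
     (auto intro: smooth_linear test_smooth dest!: zero_off_support simp: linear_simps(3))

lemma test_component: "\<phi> \<in> test_functions \<Omega> \<Longrightarrow> (\<lambda>x. (\<phi> x :: real^3) $ i) \<in> test_functions \<Omega>"
  by (rule test_linear[OF _ bounded_linear_vec_nth])

lemma test_add:
  assumes "\<phi> \<in> test_functions \<Omega>" "\<psi> \<in> test_functions \<Omega>"
  shows "(\<lambda>x. \<phi> x + \<psi> x) \<in> test_functions \<Omega>"
proof (rule testI)
  show "compact (closure {x. \<phi> x \<noteq> 0} \<union> closure {x. \<psi> x \<noteq> 0})"
    using assms by (auto simp: test_functions_def)
  show "smooth (\<lambda>x. \<phi> x + \<psi> x)" using assms by (intro smooth_add test_smooth)
qed (use assms in \<open>auto simp: test_functions_def dest!: zero_off_support\<close>)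

lemma test_scale: "\<phi> \<in> test_functions \<Omega> \<Longrightarrow> (\<lambda>x. c *\<^sub>R \<phi> x) \<in> test_functions \<Omega>"
  by (rule test_linear[OF _ bounded_linear_scaleR_right])

lemma test_minus: "\<phi> \<in> test_functions \<Omega> \<Longrightarrow> (\<lambda>x. - \<phi> x) \<in> test_functions \<Omega>"
  by (rule test_linear[OF _ bounded_linear_minus[OF bounded_linear_ident]])

lemma test_diff:
  "\<phi> \<in> test_functions \<Omega> \<Longrightarrow> \<psi> \<in> test_functions \<Omega> \<Longrightarrow> (\<lambda>x. \<phi> x - \<psi> x) \<in> test_functions \<Omega>"
  using test_add[OF _ test_minus] by fastforce

lemma test_zero: "(\<lambda>x. 0) \<in> test_functions \<Omega>"
  by (rule testI[of _ "{}"]) (auto intro: smooth_const)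

lemma test_supp_bound:
  assumes "\<phi> \<in> test_functions \<Omega>"
  obtains R where "R > 0" "\<And>x. norm x > R \<Longrightarrow> \<phi> x = 0"
proof -
  have "bounded (closure {x. \<phi> x \<noteq> 0})" using assms by (auto simp: test_functions_def compact_imp_bounded)
  then obtain R where "R > 0" "\<And>x. x \<in> closure {x. \<phi> x \<noteq> 0} \<Longrightarrow> norm x \<le> R"
    by (auto simp: bounded_pos)
  then show ?thesis using that zero_off_support by (metis not_le)
qed

lemma test_UNIV_I:
  assumes "smooth f" "\<And>x. norm x > R \<Longrightarrow> f x = 0"
  shows "f \<in> test_functions UNIV"
  using assms by (intro testI[of f "cball 0 R"]) auto

lemma test_translate: "\<phi> \<in> test_functions UNIV \<Longrightarrow> (\<lambda>x. \<phi> (x + b)) \<in> test_functions UNIV"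
proof -
  assume a: "\<phi> \<in> test_functions UNIV"
  then obtain R where R: "\<And>x. norm x > R \<Longrightarrow> \<phi> x = 0" using test_supp_bound by metis
  show ?thesis
  proof (rule test_UNIV_I)
    show "smooth (\<lambda>x. \<phi> (x + b))" using smooth_affine[OF test_smooth[OF a] bounded_linear_ident] by simp
    show "\<phi> (x + b) = 0" if "norm x > R + norm b" for x
      using norm_diff_ineq[of x b] that by (intro R) linarith
  qed
qed

section \<open>Integration on the space and on the half-space\<close>

subsection \<open>Translations and the reflection preserve Lebesgue measure\<close>

definition lebesgue_preserving :: "('a::euclidean_space \<Rightarrow> 'a) \<Rightarrow> bool" where
  "lebesgue_preserving T \<longleftrightarrow> T \<in> lebesgue \<rightarrow>\<^sub>M lebesgue \<and> distr lebesgue lebesgue T = lebesgue"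

lemma lebesgue_preserving_translation: "lebesgue_preserving (\<lambda>x. x + b)"
proof -
  have "(\<lambda>x. b + (\<Sum>j\<in>Basis. (1 * (x \<bullet> j)) *\<^sub>R j)) = (\<lambda>x. x + b)"
    by (simp add: euclidean_representation add.commute)
  then show ?thesis
    using lebesgue_affine_euclidean[of "\<lambda>_. 1" b] lebesgue_affine_measurable[of "\<lambda>_. 1" b]
    unfolding lebesgue_preserving_def by (simp add: density_1)
qed

definition reflect :: "real^3 \<Rightarrow> real^3" where
  "reflect x = (\<chi> i. if i = 3 then - x $ i else x $ i)"

lemma reflect_nth [simp]: "reflect x $ i = (if i = 3 then - x $ i else x $ i)"
  by (simp add: reflect_def)

lemma reflect_reflect [simp]: "reflect (reflect x) = x"
  by (simp add: vec_eq_iff)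

lemma reflect_add: "reflect (x + y) = reflect x + reflect y"
  by (simp add: vec_eq_iff)

lemma reflect_scaleR: "reflect (c *\<^sub>R x) = c *\<^sub>R reflect x"
  by (simp add: vec_eq_iff)

lemma norm_reflect [simp]: "norm (reflect x) = norm x"
  unfolding norm_vec_def by (intro L2_set_cong) auto

lemma bounded_linear_reflect: "bounded_linear reflect"
  by (rule bounded_linear_intro[where K=1]) (auto simp: reflect_add reflect_scaleR)

lemma lebesgue_preserving_reflect: "lebesgue_preserving reflect"
proof -
  let ?c = "\<lambda>j::real^3. if j = axis 3 1 then -1 else (1::real)"
  have B: "(Basis :: (real^3) set) = range (\<lambda>i. axis i 1)"
    by (auto simp: Basis_vec_def)
  have inj: "inj (\<lambda>i::3. axis i (1::real))" by (rule injI) (simp add: axis_eq_axis)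
  have "(\<lambda>x. 0 + (\<Sum>j\<in>Basis. (?c j * (x \<bullet> j)) *\<^sub>R j)) = reflect"
    unfolding B sum.reindex[OF inj]
    by (rule ext) (simp add: inner_axis axis_eq_axis,
      auto simp: vec_eq_iff axis_def if_distrib[of "\<lambda>z. _ * z"] cong: if_cong)
  moreover have "(\<Prod>j\<in>Basis. \<bar>?c j\<bar>) = 1" by (rule prod.neutral) auto
  ultimately show ?thesis
    using lebesgue_affine_euclidean[of ?c 0] lebesgue_affine_measurable[of ?c 0]
    unfolding lebesgue_preserving_def by (simp add: density_1 cong: if_cong)
qed

context
  fixes T :: "'a::euclidean_space \<Rightarrow> 'a"
  assumes T: "lebesgue_preserving T"
begin

lemma preserving_measurable: "f \<in> borel_measurable lebesgue \<Longrightarrow> (\<lambda>x. f (T x)) \<in> borel_measurable lebesgue"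
  using T measurable_compose[of T lebesgue lebesgue f borel] by (simp add: lebesgue_preserving_def)

lemma preserving_integral:
  fixes f :: "'a \<Rightarrow> 'b::{banach, second_countable_topology}"
  assumes "f \<in> borel_measurable lebesgue"
  shows "(LINT x|lebesgue. f (T x)) = (LINT x|lebesgue. f x)"
  using integral_distr[of T lebesgue lebesgue f] T assms by (simp add: lebesgue_preserving_def)

lemma preserving_integrable:
  fixes f :: "'a \<Rightarrow> 'b::{banach, second_countable_topology}"
  shows "integrable lebesgue f \<Longrightarrow> integrable lebesgue (\<lambda>x. f (T x))"
  using integrable_distr[of T lebesgue lebesgue f] T by (simp add: lebesgue_preserving_def)

lemma preserving_AE: "AE x in lebesgue. P x \<Longrightarrow> AE x in lebesgue. P (T x)"
proof -
  assume "AE x in lebesgue. P x"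
  moreover have "distr lebesgue lebesgue T = lebesgue" "T \<in> lebesgue \<rightarrow>\<^sub>M lebesgue"
    using T by (auto simp: lebesgue_preserving_def)
  ultimately show ?thesis using AE_distrD[of T lebesgue lebesgue P] by metis
qed

lemma preserving_sq_integrable: "sq_integrable lebesgue f \<Longrightarrow> sq_integrable lebesgue (\<lambda>x. f (T x))"
  unfolding sq_integrable_def using preserving_integrable[of "\<lambda>x. (norm (f x))\<^sup>2"] preserving_measurable[of f]
  by auto

lemma preserving_L2norm: "f \<in> borel_measurable lebesgue \<Longrightarrow> L2norm lebesgue (\<lambda>x. f (T x)) = L2norm lebesgue f"
  unfolding L2norm_def using preserving_integral[of "\<lambda>x. (norm (f x))\<^sup>2"] by simp

end

lemma half_space_sets [measurable, simp]: "half_space \<in> sets lebesgue" "half_space \<in> sets borel"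
proof -
  have "open half_space" unfolding half_space_def
    by (intro open_Collect_less continuous_intros)
  then show "half_space \<in> sets borel" "half_space \<in> sets lebesgue" by auto
qed

lemma sq_integrable_restrict:
  assumes "A \<in> sets lebesgue"
  shows "sq_integrable (lebesgue_on A) f \<longleftrightarrow> sq_integrable lebesgue (\<lambda>x. if x \<in> A then f x else 0)"
proof -
  have "(\<lambda>x. (norm (if x \<in> A then f x else 0))\<^sup>2) = (\<lambda>x. if x \<in> A then (norm (f x))\<^sup>2 else 0)" by auto
  then show ?thesis unfolding sq_integrable_def
    using Lebesgue_Measure.integrable_restrict_UNIV[OF assms, of "\<lambda>x. (norm (f x))\<^sup>2"] borel_measurable_if[OF assms, of f] by auto
qed

lemma L2norm_restrict:
  assumes "A \<in> sets lebesgue"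
  shows "L2norm (lebesgue_on A) f = L2norm lebesgue (\<lambda>x. if x \<in> A then f x else 0)"
proof -
  have "(\<lambda>x. (norm (if x \<in> A then f x else 0))\<^sup>2) = (\<lambda>x. if x \<in> A then (norm (f x))\<^sup>2 else 0)" by auto
  then show ?thesis unfolding L2norm_def
    using Lebesgue_Measure.integral_restrict_UNIV[OF assms, of "\<lambda>x. (norm (f x))\<^sup>2"] by auto
qed

lemma sq_integrable_sub:
  assumes "A \<in> sets lebesgue" "B \<in> sets lebesgue" "A \<subseteq> B" "sq_integrable (lebesgue_on B) f"
  shows "sq_integrable (lebesgue_on A) f" "L2norm (lebesgue_on A) f \<le> L2norm (lebesgue_on B) f"
proof -
  let ?fA = "\<lambda>x. if x \<in> A then f x else 0" and ?fB = "\<lambda>x. if x \<in> B then f x else 0"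
  have B: "sq_integrable lebesgue ?fB" using assms sq_integrable_restrict by blast
  have eq: "?fA = (\<lambda>x. if x \<in> A then ?fB x else 0)" by (rule ext) (use assms(3) in auto)
  have m: "?fA \<in> borel_measurable lebesgue"
    unfolding eq by (rule borel_measurable_if_I[OF measurable_restrict_space1[OF sq_integrable_meas[OF B]] assms(1)])
  have le: "AE x in lebesgue. norm (?fA x) \<le> norm (?fB x)" using assms(3) by auto
  show "sq_integrable (lebesgue_on A) f"
    using sq_integrable_bound[OF B m, of 1] le assms(1) by (simp add: sq_integrable_restrict)
  show "L2norm (lebesgue_on A) f \<le> L2norm (lebesgue_on B) f"
    using L2norm_mono[OF B m le] assms by (simp add: L2norm_restrict)
qed

lemma sq_integrable_on_UNIV_sub:
  assumes "A \<in> sets lebesgue" "sq_integrable lebesgue f"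
  shows "sq_integrable (lebesgue_on A) f" "L2norm (lebesgue_on A) f \<le> L2norm lebesgue f"
  using sq_integrable_sub[OF assms(1), of UNIV f] assms(2) by (auto simp: lebesgue_on_UNIV_eq)

lemma integrable_restrictI:
  fixes f :: "'a::euclidean_space \<Rightarrow> 'b::euclidean_space"
  assumes "A \<in> sets lebesgue" "integrable lebesgue f"
  shows "integrable (lebesgue_on A) f"
  using assms integrable_mult_indicator[OF assms] by (subst integrable_restrict_space) auto

lemma continuous_measurable_on:
  fixes f :: "'a::euclidean_space \<Rightarrow> 'b::euclidean_space"
  shows "continuous_on UNIV f \<Longrightarrow> f \<in> borel_measurable (lebesgue_on A)"
  by (intro measurable_restrict_space1 measurable_completion) (auto intro: borel_measurable_continuous_onI)

lemma AE_half_iff: "(AE x in half_measure. P x) \<longleftrightarrow> (AE x in lebesgue. x \<in> half_space \<longrightarrow> P x)"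
  by (simp add: AE_restrict_space_iff)

lemma AE_off_boundary: "AE x in lebesgue. (x::real^3) $ 3 \<noteq> 0"
proof -
  have "negligible {x::real^3. x $ 3 = 0}"
    using negligible_standard_hyperplane[of "axis 3 1 :: real^3" 0] by (simp add: inner_axis axis_in_Basis_iff)
  then have "{x::real^3. x $ 3 = 0} \<in> null_sets lebesgue" by (simp add: negligible_iff_null_sets)
  then have "AE x in lebesgue. x \<notin> {x::real^3. x $ 3 = 0}" by (rule AE_not_in)
  then show ?thesis by simp
qed

text \<open>The value zero on the boundary plane makes the transformation law \<open>extend_reflect\<close> hold at
  every point, and not just almost everywhere.\<close>
definition extend :: "('b \<Rightarrow> 'b::euclidean_space) \<Rightarrow> (real^3 \<Rightarrow> 'b) \<Rightarrow> real^3 \<Rightarrow> 'b" where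
  "extend S h x = (if x $ 3 > 0 then h x else if x $ 3 < 0 then S (h (reflect x)) else 0)"

lemma extend_half [simp]: "x \<in> half_space \<Longrightarrow> extend S h x = h x"
  by (simp add: extend_def half_space_def)

lemma extend_reflect: "bounded_linear S \<Longrightarrow> (\<And>y. S (S y) = y) \<Longrightarrow> extend S h (reflect x) = S (extend S h x)"
  by (auto simp: extend_def linear_simps(3))

lemma extend_eq_sum:
  assumes "bounded_linear S"
  shows "extend S h x = (if x \<in> half_space then h x else 0)
    + S ((if reflect x \<in> half_space then h (reflect x) else 0))"
  using assms by (auto simp: extend_def half_space_def linear_simps(3))

lemma extend_integrable:
  assumes S: "bounded_linear S" and h: "integrable half_measure h"
  shows "integrable lebesgue (extend S h)"
proof -
  have 1: "integrable lebesgue (\<lambda>x. if x \<in> half_space then h x else 0)"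
    using h by (simp add: Lebesgue_Measure.integrable_restrict_UNIV)
  show ?thesis unfolding extend_eq_sum[OF S, abs_def]
    by (intro Bochner_Integration.integrable_add 1 integrable_bounded_linear[OF S]
        preserving_integrable[OF lebesgue_preserving_reflect 1])
qed

lemma integral_split_reflect:
  fixes f :: "real^3 \<Rightarrow> 'b::euclidean_space"
  assumes f: "integrable lebesgue f"
  shows "(LINT x|lebesgue. f x) = (LINT x|half_measure. f x) + (LINT x|half_measure. f (reflect x))"
proof -
  let ?g = "\<lambda>x. if x \<in> half_space then f (reflect x) else 0"
  have i1: "integrable lebesgue (\<lambda>x. if x \<in> half_space then f x else 0)"
    using integrable_restrictI[OF half_space_sets(1) f] by (simp add: Lebesgue_Measure.integrable_restrict_UNIV)
  have i2: "integrable lebesgue ?g"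
    using integrable_restrictI[OF half_space_sets(1) preserving_integrable[OF lebesgue_preserving_reflect f]]
    by (simp add: Lebesgue_Measure.integrable_restrict_UNIV)
  have i3: "integrable lebesgue (\<lambda>x. ?g (reflect x))" by (rule preserving_integrable[OF lebesgue_preserving_reflect i2])
  have "(LINT x|lebesgue. f x) = (LINT x|lebesgue. (if x \<in> half_space then f x else 0) + ?g (reflect x))"
  proof (rule integral_cong_AE)
    show "AE x in lebesgue. f x = (if x \<in> half_space then f x else 0) + ?g (reflect x)"
      using AE_off_boundary by eventually_elim (auto simp: half_space_def)
  qed (use f i1 i3 in auto)
  also have "\<dots> = (LINT x|half_measure. f x) + (LINT x|lebesgue. ?g (reflect x))"
    using i1 i3 by (simp add: Lebesgue_Measure.integral_restrict_UNIV)
  also have "(LINT x|lebesgue. ?g (reflect x)) = (LINT x|lebesgue. ?g x)"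
    by (rule preserving_integral[OF lebesgue_preserving_reflect]) (use i2 in auto)
  also have "\<dots> = (LINT x|half_measure. f (reflect x))"
    by (simp add: Lebesgue_Measure.integral_restrict_UNIV)
  finally show ?thesis .
qed

lemma integral_reflect_invariant:
  fixes f :: "real^3 \<Rightarrow> real"
  assumes f: "integrable lebesgue f" and s: "\<And>x. f (reflect x) = f x"
  shows "(LINT x|lebesgue. f x) = 2 * (LINT x|half_measure. f x)"
  using integral_split_reflect[OF f] s by simp

lemma L2norm_reflect_invariant:
  assumes f: "sq_integrable lebesgue f" and s: "\<And>x. norm (f (reflect x)) = norm (f x)"
  shows "L2norm lebesgue f = sqrt 2 * L2norm half_measure f"
  unfolding L2norm_def
  by (subst integral_reflect_invariant) (use f s in \<open>auto simp: sq_integrable_def real_sqrt_mult\<close>)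

lemma extend_sq_integrable:
  assumes S: "bounded_linear S" and iso: "\<And>y. norm (S y) = norm y"
    and h: "sq_integrable half_measure h"
  shows "sq_integrable lebesgue (extend S h)"
proof -
  have 1: "sq_integrable lebesgue (\<lambda>x. if x \<in> half_space then h x else 0)"
    using h by (simp add: sq_integrable_restrict)
  show ?thesis unfolding extend_eq_sum[OF S, abs_def]
    by (intro sq_integrable_add 1 sq_integrable_linear[OF _ S]
        preserving_sq_integrable[OF lebesgue_preserving_reflect 1])
qed

subsection \<open>Compactly supported continuous functions\<close>

lemma cs_integrable:
  fixes f :: "'a::euclidean_space \<Rightarrow> 'b::euclidean_space"
  assumes c: "continuous_on UNIV f" and z: "\<And>x. norm x > R \<Longrightarrow> f x = 0"
  shows "integrable lebesgue f"
proof -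
  have "integrable lborel (\<lambda>x. indicator (cball 0 R) x *\<^sub>R f x)"
    by (rule borel_integrable_compact) (auto intro: continuous_on_subset[OF c])
  moreover have "(\<lambda>x. indicator (cball 0 R) x *\<^sub>R f x) = f"
    using z by (auto simp: indicator_def fun_eq_iff not_le)
  ultimately have "integrable lborel f" by simp
  moreover have "f \<in> borel_measurable lborel" using c by (simp add: borel_measurable_continuous_onI)
  ultimately show ?thesis by (simp add: integrable_completion)
qed

lemma cs_bounded:
  fixes f :: "'a::euclidean_space \<Rightarrow> 'b::euclidean_space"
  assumes c: "continuous_on UNIV f" and z: "\<And>x. norm x > R \<Longrightarrow> f x = 0"
  obtains B where "B > 0" "\<And>x. norm (f x) \<le> B"
proof -
  have "compact (f ` cball 0 R)"
    by (intro compact_continuous_image continuous_on_subset[OF c]) auto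
  then obtain B where B: "B > 0" "\<And>y. y \<in> f ` cball 0 R \<Longrightarrow> norm y \<le> B"
    by (meson bounded_pos compact_imp_bounded)
  have "norm (f x) \<le> B" for x
    using B z[of x] by (cases "norm x \<le> R") (auto simp: not_le)
  then show ?thesis using that B(1) by blast
qed

lemma cs_sq_integrable:
  fixes f :: "'a::euclidean_space \<Rightarrow> 'b::euclidean_space"
  assumes c: "continuous_on UNIV f" and z: "\<And>x. norm x > R \<Longrightarrow> f x = 0"
  shows "sq_integrable lebesgue f"
proof -
  have "integrable lebesgue (\<lambda>x. (norm (f x))\<^sup>2)"
    by (rule cs_integrable[where R=R]) (auto simp: z intro!: continuous_intros c)
  moreover have "f \<in> borel_measurable lebesgue"
    using c by (intro measurable_completion) (simp add: borel_measurable_continuous_onI)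
  ultimately show ?thesis by (simp add: sq_integrable_def)
qed

lemma test_continuous: "\<phi> \<in> test_functions \<Omega> \<Longrightarrow> continuous_on UNIV \<phi>"
  by (intro smooth_continuous test_smooth)

lemma test_integrable: "\<phi> \<in> test_functions \<Omega> \<Longrightarrow> integrable lebesgue \<phi>"
  by (metis cs_integrable test_continuous test_supp_bound)

lemma test_sq_integrable: "\<phi> \<in> test_functions \<Omega> \<Longrightarrow> sq_integrable lebesgue \<phi>"
  by (metis cs_sq_integrable test_continuous test_supp_bound)

lemma test_sq_integrable_on:
  "\<phi> \<in> test_functions \<Omega> \<Longrightarrow> A \<in> sets lebesgue \<Longrightarrow> sq_integrable (lebesgue_on A) \<phi>"
  using sq_integrable_on_UNIV_sub(1) test_sq_integrable by blast

lemma test_bounded: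
  assumes "\<phi> \<in> test_functions \<Omega>"
  obtains B where "B > 0" "\<And>x. norm (\<phi> x) \<le> B"
  by (metis assms cs_bounded test_continuous test_supp_bound)

subsection \<open>Difference quotients\<close>

text \<open>The regularity under which difference quotients converge to the partial derivative under the
  integral sign.\<close>
definition C1c :: "(real^3 \<Rightarrow> 'b::euclidean_space) \<Rightarrow> bool" where
  "C1c f \<longleftrightarrow> (\<forall>x. f differentiable (at x)) \<and> (\<forall>i. continuous_on UNIV (partial i f)) \<and>
     (\<exists>R. \<forall>x. norm x > R \<longrightarrow> f x = 0)"

lemma C1c_test: "\<phi> \<in> test_functions \<Omega> \<Longrightarrow> C1c \<phi>"
  unfolding C1c_def
  by (metis smooth_continuous smooth_differentiable smooth_partial test_smooth test_supp_bound)

lemma C1c_continuous: "C1c f \<Longrightarrow> continuous_on UNIV f"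
  by (auto simp: C1c_def intro!: continuous_at_imp_continuous_on differentiable_imp_continuous_within)

lemma partial_zero_far:
  assumes "\<And>x. norm x > R \<Longrightarrow> f x = 0" "norm x > R"
  shows "partial i f x = 0"
proof -
  have "(f has_derivative (\<lambda>h. 0)) (at x)"
  proof (rule has_derivative_transform_within_open[OF has_derivative_const])
    show "open (- cball 0 R :: (real^3) set)" by (simp add: open_Compl)
  qed (use assms in auto)
  from partial_eqI[OF this] show ?thesis by simp
qed

definition diff_quot :: "3 \<Rightarrow> real \<Rightarrow> (real^3 \<Rightarrow> 'b::euclidean_space) \<Rightarrow> real^3 \<Rightarrow> 'b" where
  "diff_quot i t f x = (1 / t) *\<^sub>R (f (x + t *\<^sub>R axis i 1) - f x)"

lemma diff_quot_lim:
  assumes "f differentiable (at x)" "\<And>n. t n \<noteq> 0" "t \<longlonglongrightarrow> 0"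
  shows "(\<lambda>n. diff_quot i (t n) f x) \<longlonglongrightarrow> partial i f x"
proof -
  have "((\<lambda>s. x + s *\<^sub>R axis i 1) has_derivative (\<lambda>s. s *\<^sub>R axis i 1)) (at (0::real))"
    by (auto intro!: derivative_eq_intros)
  moreover have "(f has_derivative frechet_derivative f (at x)) (at (x + 0 *\<^sub>R axis i 1))"
    using assms(1) by (simp add: frechet_derivative_works)
  ultimately have "((\<lambda>s. f (x + s *\<^sub>R axis i 1)) has_derivative (\<lambda>s. frechet_derivative f (at x) (s *\<^sub>R axis i 1))) (at 0)"
    by (rule has_derivative_compose)
  moreover have "frechet_derivative f (at x) (s *\<^sub>R axis i 1) = s *\<^sub>R partial i f x" for s
    using linear_scale[OF linear_frechet_derivative[OF assms(1)]] by (simp add: partial_def)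
  ultimately have "((\<lambda>s. f (x + s *\<^sub>R axis i 1)) has_vector_derivative partial i f x) (at 0)"
    by (simp add: has_vector_derivative_def)
  then have "((\<lambda>s. f (x + s *\<^sub>R axis i 1)) has_derivative (\<lambda>s. s *\<^sub>R partial i f x)) (at 0)"
    by (simp add: has_vector_derivative_def)
  then have "((\<lambda>s. norm (f (x + s *\<^sub>R axis i 1) - f x - s *\<^sub>R partial i f x) / \<bar>s\<bar>) \<longlongrightarrow> 0) (at 0)"
    by (simp add: has_derivative_at)
  moreover have "eventually (\<lambda>s. norm (f (x + s *\<^sub>R axis i 1) - f x - s *\<^sub>R partial i f x) / \<bar>s\<bar>
      = norm (diff_quot i s f x - partial i f x)) (at 0)"
    unfolding eventually_at_filter
  proof (intro always_eventually allI impI)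
    fix s :: real assume "s \<noteq> 0"
    then have "diff_quot i s f x - partial i f x = (1 / s) *\<^sub>R (f (x + s *\<^sub>R axis i 1) - f x - s *\<^sub>R partial i f x)"
      by (simp add: diff_quot_def algebra_simps)
    then show "norm (f (x + s *\<^sub>R axis i 1) - f x - s *\<^sub>R partial i f x) / \<bar>s\<bar>
      = norm (diff_quot i s f x - partial i f x)" by simp
  qed
  ultimately have "((\<lambda>s. norm (diff_quot i s f x - partial i f x)) \<longlongrightarrow> 0) (at 0)"
    by (rule Lim_transform_eventually)
  then have lim: "((\<lambda>s. diff_quot i s f x) \<longlongrightarrow> partial i f x) (at 0)"
    by (simp add: tendsto_norm_zero_iff LIM_zero_iff)
  have "filterlim t (at 0) sequentially" using assms(2,3) by (simp add: filterlim_at)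
  from filterlim_compose[OF lim this] show ?thesis .
qed

lemma C1c_lipschitz:
  assumes f: "C1c f"
  obtains M where "M > 0" "\<And>x t. norm (f (x + t *\<^sub>R axis i 1) - f x) \<le> M * \<bar>t\<bar>"
proof -
  obtain R where R: "\<And>x. norm x > R \<Longrightarrow> f x = 0" using f by (auto simp: C1c_def)
  have c: "continuous_on UNIV (partial i f)" using f by (auto simp: C1c_def)
  have pz: "partial i f x = 0" if "norm x > R" for x by (rule partial_zero_far[OF R that])
  obtain M where M: "M > 0" "\<And>x. norm (partial i f x) \<le> M"
    by (rule cs_bounded[OF c, where R=R]) (erule pz, rule that)
  have "norm (f (x + t *\<^sub>R axis i 1) - f x) \<le> M * \<bar>t\<bar>" for x t
  proof -
    let ?g = "\<lambda>s. f (x + s *\<^sub>R axis i 1)"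
    have der: "(?g has_derivative (\<lambda>s. s *\<^sub>R partial i f (x + r *\<^sub>R axis i 1))) (at r within UNIV)" for r
    proof -
      have d: "f differentiable (at (x + r *\<^sub>R axis i 1))" using f by (auto simp: C1c_def)
      have "((\<lambda>s. x + s *\<^sub>R axis i 1) has_derivative (\<lambda>s. s *\<^sub>R axis i 1)) (at (r::real))"
        by (auto intro!: derivative_eq_intros)
      from has_derivative_compose[OF this iffD1[OF frechet_derivative_works d]]
      have "(?g has_derivative (\<lambda>s. frechet_derivative f (at (x + r *\<^sub>R axis i 1)) (s *\<^sub>R axis i 1))) (at r)" .
      moreover have "frechet_derivative f (at (x + r *\<^sub>R axis i 1)) (s *\<^sub>R axis i 1) = s *\<^sub>R partial i f (x + r *\<^sub>R axis i 1)" for s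
        using linear_scale[OF linear_frechet_derivative[OF d]] by (simp add: partial_def)
      ultimately show ?thesis by simp
    qed
    have on: "onorm (\<lambda>s::real. s *\<^sub>R partial i f (x + r *\<^sub>R axis i 1)) \<le> M" for r
    proof (rule onorm_le)
      fix s :: real
      show "norm (s *\<^sub>R partial i f (x + r *\<^sub>R axis i 1)) \<le> M * norm s"
        using mult_left_mono[OF M(2), of "\<bar>s\<bar>"] by (simp add: mult.commute)
    qed
    have "norm (?g t - ?g 0) \<le> M * norm (t - 0)"
      by (rule differentiable_bound[OF convex_UNIV der on]) auto
    then show ?thesis by simp
  qed
  then show ?thesis using M(1) that by blast
qed

text \<open>The common bound for all small steps that dominated convergence asks for.\<close>
lemma C1c_diff_quot_dominated:
  assumes f: "C1c f"
  obtains M R where "M > 0" "R > 0"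
    "\<And>t x. 0 < \<bar>t\<bar> \<Longrightarrow> \<bar>t\<bar> \<le> 1 \<Longrightarrow> norm (diff_quot i t f x) \<le> M * indicator (cball 0 R) x"
proof -
  obtain M where M: "M > 0" "\<And>x t. norm (f (x + t *\<^sub>R axis i 1) - f x) \<le> M * \<bar>t\<bar>"
    by (rule C1c_lipschitz[OF f]) (rule that)
  obtain R where R: "\<And>x. norm x > R \<Longrightarrow> f x = 0" using f by (auto simp: C1c_def)
  have "norm (diff_quot i t f x) \<le> M * indicator (cball 0 (\<bar>R\<bar> + 1)) x" if t: "0 < \<bar>t\<bar>" "\<bar>t\<bar> \<le> 1" for t x
  proof (cases "norm x \<le> \<bar>R\<bar> + 1")
    case True
    have "norm (diff_quot i t f x) \<le> M"
    proof -
      have "norm (diff_quot i t f x) = norm (f (x + t *\<^sub>R axis i 1) - f x) / \<bar>t\<bar>"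
        by (simp add: diff_quot_def)
      then show ?thesis using M(2)[of x t] t by (simp add: divide_le_eq)
    qed
    then show ?thesis using True by simp
  next
    case False
    have "norm (x + t *\<^sub>R axis i 1) \<ge> norm x - norm (t *\<^sub>R axis i 1 :: real^3)" by (rule norm_diff_ineq)
    then have "norm (x + t *\<^sub>R axis i 1) > R" using False t by simp
    moreover have "norm x > R" using False by simp
    ultimately show ?thesis using R M(1) by (simp add: diff_quot_def indicator_def)
  qed
  then show ?thesis using M(1) that[of M "\<bar>R\<bar> + 1"] by auto
qed

lemma diff_quot_continuous: "continuous_on UNIV f \<Longrightarrow> continuous_on UNIV (diff_quot i t f)"
  unfolding diff_quot_def[abs_def]
  by (intro continuous_intros continuous_on_compose2[of UNIV f UNIV "\<lambda>x. x + t *\<^sub>R axis i 1"]) auto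

lemma cont_measurable: "continuous_on UNIV f \<Longrightarrow> f \<in> borel_measurable lebesgue" for f :: "'a::euclidean_space \<Rightarrow> 'b::euclidean_space"
  using continuous_measurable_on[of f UNIV] by (simp add: lebesgue_on_UNIV_eq)

lemma diff_quot_integral_lim:
  fixes f :: "real^3 \<Rightarrow> real" and g :: "real^3 \<Rightarrow> 'b::euclidean_space"
  assumes f: "C1c f" and g: "\<And>r. integrable lebesgue (\<lambda>x. indicator (cball 0 r) x *\<^sub>R g x)"
    and gm: "g \<in> borel_measurable lebesgue"
    and t: "\<And>n. 0 < \<bar>t n\<bar>" "\<And>n. \<bar>t n\<bar> \<le> 1" "t \<longlonglongrightarrow> 0"
  shows "(\<lambda>n. LINT x|lebesgue. diff_quot i (t n) f x *\<^sub>R g x) \<longlonglongrightarrow> (LINT x|lebesgue. partial i f x *\<^sub>R g x)"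
    and "\<And>n. integrable lebesgue (\<lambda>x. diff_quot i (t n) f x *\<^sub>R g x)"
    and "integrable lebesgue (\<lambda>x. partial i f x *\<^sub>R g x)"
proof -
  obtain M R where M: "M > 0" "R > 0"
    "\<And>t x. 0 < \<bar>t\<bar> \<Longrightarrow> \<bar>t\<bar> \<le> 1 \<Longrightarrow> norm (diff_quot i t f x) \<le> M * indicator (cball 0 R) x"
    by (rule C1c_diff_quot_dominated[OF f]) (rule that)
  have m1: "(\<lambda>x. diff_quot i (t n) f x *\<^sub>R g x) \<in> borel_measurable lebesgue" for n
    by (intro borel_measurable_scaleR cont_measurable diff_quot_continuous C1c_continuous f gm)
  have m2: "(\<lambda>x. partial i f x *\<^sub>R g x) \<in> borel_measurable lebesgue"
    by (intro borel_measurable_scaleR cont_measurable gm) (use f in \<open>auto simp: C1c_def\<close>)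
  have w: "integrable lebesgue (\<lambda>x. M * norm (indicator (cball 0 R) x *\<^sub>R g x))"
    by (intro integrable_mult_right integrable_norm g)
  have lim: "AE x in lebesgue. (\<lambda>n. diff_quot i (t n) f x *\<^sub>R g x) \<longlonglongrightarrow> partial i f x *\<^sub>R g x"
  proof (rule AE_I2, intro tendsto_scaleR tendsto_const diff_quot_lim t)
    show "f differentiable at x" for x using f by (simp add: C1c_def)
    show "t n \<noteq> 0" for n using t(1)[of n] by auto
  qed
  have bd: "AE x in lebesgue. norm (diff_quot i (t n) f x *\<^sub>R g x) \<le> M * norm (indicator (cball 0 R) x *\<^sub>R g x)" for n
  proof (rule AE_I2)
    fix x
    show "norm (diff_quot i (t n) f x *\<^sub>R g x) \<le> M * norm (indicator (cball 0 R) x *\<^sub>R g x)"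
      using mult_right_mono[OF M(3)[OF t(1,2)[of n]], of "norm (g x)" x] by (simp add: mult.assoc)
  qed
  show "(\<lambda>n. LINT x|lebesgue. diff_quot i (t n) f x *\<^sub>R g x) \<longlonglongrightarrow> (LINT x|lebesgue. partial i f x *\<^sub>R g x)"
    by (rule integral_dominated_convergence[OF m2 m1 w lim bd])
  show "integrable lebesgue (\<lambda>x. diff_quot i (t n) f x *\<^sub>R g x)" for n
    by (rule integrable_dominated_convergence2[OF m2 m1 w lim bd])
  show "integrable lebesgue (\<lambda>x. partial i f x *\<^sub>R g x)"
    by (rule integrable_dominated_convergence[OF m2 m1 w lim bd])
qed

lemma diff_quot_L2_lim:
  assumes f: "C1c f" and t: "\<And>n. 0 < \<bar>t n\<bar>" "\<And>n. \<bar>t n\<bar> \<le> 1" "t \<longlonglongrightarrow> 0"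
  shows "(\<lambda>n. L2norm lebesgue (diff_quot i (t n) f)) \<longlonglongrightarrow> L2norm lebesgue (partial i f)"
proof -
  obtain M R where M: "M > 0" "R > 0"
    "\<And>t x. 0 < \<bar>t\<bar> \<Longrightarrow> \<bar>t\<bar> \<le> 1 \<Longrightarrow> norm (diff_quot i t f x) \<le> M * indicator (cball 0 R) x"
    by (rule C1c_diff_quot_dominated[OF f]) (rule that)
  have m1[measurable]: "diff_quot i (t n) f \<in> borel_measurable lebesgue" for n
    by (intro cont_measurable diff_quot_continuous C1c_continuous f)
  have m2[measurable]: "partial i f \<in> borel_measurable lebesgue"
    by (intro cont_measurable) (use f in \<open>auto simp: C1c_def\<close>)
  have w: "integrable lebesgue (\<lambda>x::real^3. M\<^sup>2 * indicator (cball 0 R) x)"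
    using emeasure_bounded_finite[OF bounded_cball, of "0::real^3" R]
    by (intro integrable_mult_right integrable_real_indicator) auto
  have "(\<lambda>n. LINT x|lebesgue. (norm (diff_quot i (t n) f x))\<^sup>2) \<longlonglongrightarrow> (LINT x|lebesgue. (norm (partial i f x))\<^sup>2)"
  proof (rule integral_dominated_convergence)
    show "AE x in lebesgue. (\<lambda>n. (norm (diff_quot i (t n) f x))\<^sup>2) \<longlonglongrightarrow> (norm (partial i f x))\<^sup>2"
    proof (rule AE_I2, intro tendsto_power tendsto_norm diff_quot_lim t)
      show "f differentiable at x" for x using f by (simp add: C1c_def)
      show "t n \<noteq> 0" for n using t(1)[of n] by auto
    qed
    show "AE x in lebesgue. norm ((norm (diff_quot i (t n) f x))\<^sup>2) \<le> M\<^sup>2 * indicator (cball 0 R) x" for n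
    proof (rule AE_I2)
      fix x
      have "(norm (diff_quot i (t n) f x))\<^sup>2 \<le> (M * indicator (cball 0 R) x)\<^sup>2"
        by (intro power_mono M t) auto
      also have "\<dots> = M\<^sup>2 * indicator (cball 0 R) x"
        by (simp add: power_mult_distrib indicator_def)
      finally show "norm ((norm (diff_quot i (t n) f x))\<^sup>2) \<le> M\<^sup>2 * indicator (cball 0 R) x" by simp
    qed
    show "integrable lebesgue (\<lambda>x::real^3. M\<^sup>2 * indicator (cball 0 R) x)" by (rule w)
  qed measurable
  then show ?thesis unfolding L2norm_def by (rule tendsto_real_sqrt)
qed

text \<open>The sequence of steps along which difference quotients are evaluated.\<close>
lemma steps: "0 < \<bar>inverse (real (Suc n))\<bar>" "\<bar>inverse (real (Suc n))\<bar> \<le> 1" "(\<lambda>n. inverse (real (Suc n))) \<longlonglongrightarrow> 0"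
  by (simp_all add: LIMSEQ_inverse_real_of_nat inverse_le_1_iff del: of_nat_Suc)

lemma loc_integrable_indicator:
  assumes "A \<in> sets lebesgue"
  shows "integrable lebesgue (\<lambda>x::real^3. indicator (cball 0 r) x *\<^sub>R (indicator A x :: real))"
proof -
  have "integrable lebesgue (indicator (cball 0 r \<inter> A) :: real^3 \<Rightarrow> real)"
  proof (rule integrable_real_indicator)
    have "emeasure lebesgue (cball 0 r \<inter> A) \<le> emeasure lebesgue (cball (0::real^3) r)"
      by (intro emeasure_mono) auto
    also have "\<dots> < \<infinity>" using emeasure_bounded_finite[of "cball (0::real^3) r"] by simp
    finally show "emeasure lebesgue (cball 0 r \<inter> A) < \<infinity>" .
  qed (use assms in auto)
  then show ?thesis unfolding indicator_inter_arith by simp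
qed

subsection \<open>The divergence theorem\<close>

text \<open>On a set that is invariant under translations in direction \<open>i\<close>, all difference quotients in
  this direction have integral zero.\<close>
lemma integral_partial_invariant:
  fixes f :: "real^3 \<Rightarrow> real"
  assumes f: "C1c f" and A: "A \<in> sets lebesgue" "\<And>x t. x + t *\<^sub>R axis i 1 \<in> A \<longleftrightarrow> x \<in> A"
  shows "(LINT x|lebesgue_on A. partial i f x) = 0"
proof -
  obtain R where R: "\<And>x. norm x > R \<Longrightarrow> f x = 0" using f by (auto simp: C1c_def)
  have fi: "integrable lebesgue f" using cs_integrable[OF C1c_continuous[OF f] R] .
  have ti: "integrable lebesgue (\<lambda>x. indicator A x * f x)"
    using integrable_mult_indicator[OF A(1) fi] by simp
  have z: "(LINT x|lebesgue. diff_quot i t f x *\<^sub>R (indicator A x :: real)) = 0" for t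
  proof -
    note pr = lebesgue_preserving_translation[of "t *\<^sub>R axis i 1 :: real^3"]
    have "(LINT x|lebesgue. diff_quot i t f x *\<^sub>R (indicator A x :: real)) =
      (LINT x|lebesgue. (1/t) * (indicator A (x + t *\<^sub>R axis i 1) * f (x + t *\<^sub>R axis i 1) - indicator A x * f x))"
      by (intro Bochner_Integration.integral_cong refl) (simp add: diff_quot_def indicator_def A(2))
    also have "\<dots> = (1/t) * ((LINT x|lebesgue. indicator A (x + t *\<^sub>R axis i 1) * f (x + t *\<^sub>R axis i 1)) - (LINT x|lebesgue. indicator A x * f x))"
      using preserving_integrable[OF pr ti] ti by simp
    also have "\<dots> = 0"
      using preserving_integral[OF pr borel_measurable_integrable[OF ti]] by simp
    finally show ?thesis .
  qed
  have im: "(indicator A :: _ \<Rightarrow> real) \<in> borel_measurable lebesgue" using A(1) by simp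
  have "(\<lambda>n::nat. 0) \<longlonglongrightarrow> (LINT x|lebesgue. partial i f x *\<^sub>R (indicator A x :: real))"
    using diff_quot_integral_lim(1)[OF f loc_integrable_indicator[OF A(1)] im steps(1) steps(2) steps(3), of i]
    unfolding z .
  then have "(LINT x|lebesgue. partial i f x *\<^sub>R (indicator A x :: real)) = 0" by (simp add: LIMSEQ_const_iff)
  then show ?thesis using A(1) by (subst integral_restrict_space) (auto simp: mult.commute)
qed

lemma integral_partial_zero:
  fixes f :: "real^3 \<Rightarrow> real"
  shows "C1c f \<Longrightarrow> (LINT x|lebesgue. partial i f x) = 0"
  using integral_partial_invariant[of f UNIV i] by (simp add: lebesgue_on_UNIV_eq)

lemma integral_partial_half_tangential:
  fixes f :: "real^3 \<Rightarrow> real"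
  shows "C1c f \<Longrightarrow> i \<noteq> 3 \<Longrightarrow> (LINT x|half_measure. partial i f x) = 0"
  by (rule integral_partial_invariant) (auto simp: half_space_def axis_def)

definition slab_point :: "(real^2) \<times> real \<Rightarrow> real^3" where
  "slab_point z = vector [fst z $ 1, fst z $ 2, snd z]"

lemma slab_point_nth [simp]: "slab_point z $ 1 = fst z $ 1" "slab_point z $ 2 = fst z $ 2" "slab_point z $ 3 = snd z"
  by (simp_all add: slab_point_def vector_3)

lemma slab_point_boundary: "slab_point (y, 0) = boundary_point y"
  by (simp add: slab_point_def boundary_point_def)

lemma slab_point_continuous: "continuous_on UNIV slab_point"
proof -
  have eq: "slab_point = (\<lambda>z. (fst z $ 1) *\<^sub>R axis 1 1 + (fst z $ 2) *\<^sub>R axis 2 1 + snd z *\<^sub>R axis 3 1)"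
    by (auto simp: fun_eq_iff vec_eq_iff forall_3 axis_def)
  show ?thesis unfolding eq by (intro continuous_intros)
qed

lemma slab_point_measurable: "slab_point \<in> borel_measurable borel"
  by (rule borel_measurable_continuous_onI[OF slab_point_continuous])

text \<open>Splitting off the normal coordinate maps products of boxes to boxes of the same volume.\<close>
lemma distr_slab_point: "distr (lborel \<Otimes>\<^sub>M lborel) borel slab_point = lborel"
proof (rule lborel_eqI[symmetric])
  have m: "slab_point \<in> (lborel \<Otimes>\<^sub>M lborel) \<rightarrow>\<^sub>M borel"
    using slab_point_measurable by (simp add: lborel_prod)
  have prod3: "prod g (Basis :: (real^3) set) = g (axis 1 1) * g (axis 2 1) * g (axis 3 1)" for g :: "real^3 \<Rightarrow> real"
  proof -
    have B: "(Basis :: (real^3) set) = {axis 1 1, axis 2 1, axis 3 1}"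
      by (auto simp: Basis_vec_def UNIV_3)
    show ?thesis unfolding B by (simp add: axis_eq_axis mult.assoc)
  qed
  have prod2: "prod g (Basis :: (real^2) set) = g (axis 1 1) * g (axis 2 1)" for g :: "real^2 \<Rightarrow> real"
  proof -
    have B: "(Basis :: (real^2) set) = {axis 1 1, axis 2 1}"
      by (auto simp: Basis_vec_def UNIV_2)
    show ?thesis unfolding B by (simp add: axis_eq_axis)
  qed
  fix l u :: "real^3" assume lu: "\<And>b. b \<in> Basis \<Longrightarrow> l \<bullet> b \<le> u \<bullet> b"
  have lui: "l $ i \<le> u $ i" for i using lu[of "axis i 1"] by (simp add: inner_axis)
  define l2 u2 :: "real^2" where "l2 = vector [l $ 1, l $ 2]" and "u2 = vector [u $ 1, u $ 2]"
  have v: "slab_point -` box l u \<inter> space (lborel \<Otimes>\<^sub>M lborel) = box l2 u2 \<times> box (l $ 3) (u $ 3)"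
    by (auto simp: mem_box_cart forall_3 forall_2 space_pair_measure l2_def u2_def vector_2)
  have lu2: "l2 \<bullet> b \<le> u2 \<bullet> b" if "b \<in> Basis" for b
    using that lui by (auto simp: Basis_vec_def inner_axis UNIV_2 l2_def u2_def vector_2)
  have "emeasure (distr (lborel \<Otimes>\<^sub>M lborel) borel slab_point) (box l u) = emeasure lborel (box l2 u2) * emeasure lborel (box (l $ 3) (u $ 3))"
    using m by (subst emeasure_distr) (simp_all add: v lborel.emeasure_pair_measure_Times)
  also have "\<dots> = ennreal (prod ((\<bullet>) (u2 - l2)) Basis) * ennreal (u $ 3 - l $ 3)"
    using lu2 lui by simp
  also have "\<dots> = ennreal (prod ((\<bullet>) (u - l)) Basis)"
    using lui[of 1] lui[of 2] lui[of 3] unfolding prod2 prod3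
    by (simp add: ennreal_mult[symmetric] inner_axis l2_def u2_def vector_2)
  finally show "emeasure (distr (lborel \<Otimes>\<^sub>M lborel) borel slab_point) (box l u) = ennreal (prod ((\<bullet>) (u - l)) Basis)" .
qed simp

lemma norm_slab_point_ge: "norm (slab_point z) \<ge> \<bar>snd z\<bar>" "norm (slab_point z) \<ge> norm (fst z)"
proof -
  show "norm (slab_point z) \<ge> \<bar>snd z\<bar>" using component_le_norm_cart[of "slab_point z" 3] by simp
  have "(norm (fst z))\<^sup>2 \<le> (norm (slab_point z))\<^sup>2"
    by (simp add: power2_norm_eq_inner inner_vec_def sum_3 sum_2)
  then show "norm (slab_point z) \<ge> norm (fst z)" by (rule power2_le_imp_le) simp
qed

text \<open>By Fubini's theorem the integral is taken along the lines orthogonal to the boundary plane first,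
  where the fundamental theorem of calculus leaves the value at the endpoint.\<close>
lemma integral_partial_half_normal:
  fixes f :: "real^3 \<Rightarrow> real"
  assumes f: "C1c f"
  shows "(LINT x|half_measure. partial 3 f x) = - (LINT y|lebesgue. f (boundary_point y))"
proof -
  obtain R0 where R0: "\<And>x. norm x > R0 \<Longrightarrow> f x = 0" using f by (auto simp: C1c_def)
  define R where "R = \<bar>R0\<bar> + 1"
  have R: "f x = 0" if "norm x > R" for x using that by (intro R0) (simp add: R_def)
  have R1: "R > 0" by (simp add: R_def)
  note R = R R1
  have c: "continuous_on UNIV (partial 3 f)" using f by (auto simp: C1c_def)
  have pz: "partial 3 f x = 0" if "norm x > R" for x using partial_zero_far[OF R(1) that] .
  have pi: "integrable lborel (\<lambda>x. indicator half_space x * partial 3 f x)"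
  proof -
    have "integrable lebesgue (partial 3 f)" by (rule cs_integrable[OF c pz])
    then have "integrable lborel (partial 3 f)"
      using c by (simp add: integrable_completion borel_measurable_continuous_onI)
    then show ?thesis using integrable_mult_indicator[of half_space lborel "partial 3 f"] by simp
  qed
  have m: "slab_point \<in> (lborel \<Otimes>\<^sub>M lborel) \<rightarrow>\<^sub>M borel"
    using slab_point_measurable by (simp add: lborel_prod)
  have mm: "(\<lambda>x. indicator half_space x * partial 3 f x) \<in> borel_measurable borel"
    using borel_measurable_integrable[OF pi] by simp
  let ?h = "\<lambda>y t. indicator half_space (slab_point (y, t)) * partial 3 f (slab_point (y, t))"
  have I: "integrable (lborel \<Otimes>\<^sub>M lborel) (\<lambda>z. indicator half_space (slab_point z) * partial 3 f (slab_point z))"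
    using integrable_distr_eq[OF m mm] pi by (simp add: distr_slab_point)
  have "(LINT x|half_measure. partial 3 f x) = (LINT x|lebesgue. indicator half_space x * partial 3 f x)"
    by (simp add: integral_restrict_space)
  also have "\<dots> = (LINT x|lborel. indicator half_space x * partial 3 f x)"
    using mm by (simp add: integral_completion)
  also have "\<dots> = (LINT z|(lborel \<Otimes>\<^sub>M lborel). indicator half_space (slab_point z) * partial 3 f (slab_point z))"
    using integral_distr[OF m mm] by (simp add: distr_slab_point)
  also have "\<dots> = (LINT z|(lborel \<Otimes>\<^sub>M lborel). (case z of (y, t) \<Rightarrow> ?h y t))"
    by (intro Bochner_Integration.integral_cong) auto
  also have "\<dots> = (LINT y|lborel. (LINT t|lborel. ?h y t))"
    using I by (subst lborel_pair.integral_fst) (auto simp: case_prod_beta')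
  also have "\<dots> = (LINT y|lborel. - f (boundary_point y))"
  proof (intro Bochner_Integration.integral_cong refl)
    fix y :: "real^2"
    let ?F = "\<lambda>t. f (slab_point (y, t))"
    have der: "(?F has_vector_derivative partial 3 f (slab_point (y, t))) (at t within S)" for t S
    proof -
      have d: "f differentiable (at (slab_point (y, t)))" using f by (auto simp: C1c_def)
      have eq: "(\<lambda>s. slab_point (y, s)) = (\<lambda>s. slab_point (y, 0) + s *\<^sub>R axis 3 1)"
        by (auto simp: fun_eq_iff vec_eq_iff forall_3 axis_def)
      have "((\<lambda>s. slab_point (y, s)) has_derivative (\<lambda>s. s *\<^sub>R axis 3 1)) (at t within S)"
        unfolding eq by (auto intro!: derivative_eq_intros)
      from has_derivative_compose[OF this has_derivative_partial[OF d]]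
      show ?thesis by (simp add: has_vector_derivative_def axis_def sum_3)
    qed
    have cF: "continuous_on {0..R + 1} (\<lambda>t. partial 3 f (slab_point (y, t)))"
      by (intro continuous_on_compose2[OF c] continuous_on_compose2[OF slab_point_continuous] continuous_intros) auto
    have "(LINT t|lborel. ?h y t) = (LINT t|lborel. indicator {0..R+1} t *\<^sub>R partial 3 f (slab_point (y, t)))"
    proof (rule integral_cong_AE)
      show "AE t in lborel. ?h y t = indicator {0..R+1} t *\<^sub>R partial 3 f (slab_point (y, t))"
        using AE_lborel_singleton[of "0::real"]
      proof eventually_elim
        case (elim t)
        show ?case
        proof (cases "t > R + 1")
          case True
          then have "partial 3 f (slab_point (y, t)) = 0"
            using norm_slab_point_ge(1)[of "(y, t)"] R(2) by (intro pz) simp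
          then show ?thesis by simp
        next
          case False
          then show ?thesis using elim by (auto simp: half_space_def indicator_def)
        qed
      qed
      have cy: "(\<lambda>t. slab_point (y, t)) \<in> borel_measurable borel"
        by (intro borel_measurable_continuous_onI continuous_on_compose2[OF slab_point_continuous] continuous_intros) auto
      show "(\<lambda>t. ?h y t) \<in> borel_measurable lborel"
        using measurable_compose[OF cy mm] by simp
      have "(\<lambda>t. partial 3 f (slab_point (y, t))) \<in> borel_measurable borel"
        using measurable_compose[OF cy borel_measurable_continuous_onI[OF c]] by simp
      then show "(\<lambda>t. indicator {0..R+1} t *\<^sub>R partial 3 f (slab_point (y, t))) \<in> borel_measurable lborel"
        by (intro borel_measurable_scaleR) auto
    qed
    also have "\<dots> = ?F (R + 1) - ?F 0"
      by (rule integral_FTC_Icc[OF _ der cF]) (use R in auto)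
    also have "?F (R + 1) = 0"
      using norm_slab_point_ge(1)[of "(y, R + 1)"] R(2) by (intro R(1)) simp
    finally show "(LINT t|lborel. ?h y t) = - f (boundary_point y)" by (simp add: slab_point_boundary)
  qed
  also have "\<dots> = - (LINT y|lborel. f (boundary_point y))" by simp
  also have "(LINT y|lborel. f (boundary_point y)) = (LINT y|lebesgue. f (boundary_point y))"
  proof -
    have "continuous_on UNIV (\<lambda>y. f (slab_point (y, 0)))"
      by (intro continuous_on_compose2[OF C1c_continuous[OF f]] continuous_on_compose2[OF slab_point_continuous] continuous_intros) auto
    then show ?thesis
      by (subst integral_completion) (auto simp: slab_point_boundary intro: borel_measurable_continuous_onI)
  qed
  finally show ?thesis .
qed

section \<open>Inequalities for test fields\<close>

lemma partial_component:
  fixes f :: "real^3 \<Rightarrow> real^3"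
  shows "f differentiable (at x) \<Longrightarrow> partial i (\<lambda>x. f x $ a) x = partial i f x $ a"
  using partial_linear[OF _ bounded_linear_vec_nth] .

lemma integral_test_on:
  assumes "\<phi> \<in> test_functions \<Omega>" "A \<in> sets lebesgue"
  shows "integrable (lebesgue_on A) \<phi>"
  using integrable_restrictI[OF assms(2) test_integrable[OF assms(1)]] .

lemma integration_by_parts:
  fixes a b :: "real^3 \<Rightarrow> real"
  assumes a: "a \<in> test_functions \<Omega>" and b: "smooth b"
  shows "(LINT x|lebesgue. partial i a x * b x) = - (LINT x|lebesgue. a x * partial i b x)"
proof -
  have eq: "partial i (\<lambda>x. a x * b x) x = partial i a x * b x + a x * partial i b x" for x
    by (intro partial_mult smooth_differentiable test_smooth[OF a] b)
  have i: "integrable lebesgue (\<lambda>x. partial i a x * b x)" "integrable lebesgue (\<lambda>x. a x * partial i b x)"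
    by (intro test_integrable[of _ \<Omega>] test_mult_smooth test_partial a b smooth_partial)+
  have "(LINT x|lebesgue. partial i (\<lambda>x. a x * b x) x) = 0"
    by (rule integral_partial_zero[OF C1c_test[OF test_mult_smooth[OF a b]]])
  then show ?thesis unfolding eq using i by simp
qed

lemma integration_by_parts_half:
  fixes a b :: "real^3 \<Rightarrow> real"
  assumes a: "a \<in> test_functions UNIV" and b: "smooth b"
  shows "(LINT x|half_measure. partial i a x * b x) = - (LINT x|half_measure. a x * partial i b x)
     - (if i = 3 then LINT y|lebesgue. a (boundary_point y) * b (boundary_point y) else 0)"
proof -
  have eq: "partial i (\<lambda>x. a x * b x) x = partial i a x * b x + a x * partial i b x" for x
    by (intro partial_mult smooth_differentiable test_smooth[OF a] b)
  have i: "integrable half_measure (\<lambda>x. partial i a x * b x)" "integrable half_measure (\<lambda>x. a x * partial i b x)"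
    by (intro integral_test_on[of _ UNIV] test_mult_smooth test_partial a b smooth_partial half_space_sets)+
  have C: "C1c (\<lambda>x. a x * b x)" by (rule C1c_test[OF test_mult_smooth[OF a b]])
  have "(LINT x|half_measure. partial i (\<lambda>x. a x * b x) x) =
    - (if i = 3 then LINT y|lebesgue. a (boundary_point y) * b (boundary_point y) else 0)"
    using integral_partial_half_tangential[OF C, of i] integral_partial_half_normal[OF C] by (cases "i = 3") auto
  then show ?thesis unfolding eq using i by simp
qed

text \<open>Both sides are limits of integrals in which one derivative is replaced by difference quotients;
  these commute with the other derivative, and are moved from one factor to the other by a
  translation.\<close>
lemma integral_partial_swap:
  fixes a b :: "real^3 \<Rightarrow> real"
  assumes a: "a \<in> test_functions UNIV" and b: "b \<in> test_functions UNIV"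
  shows "(LINT x|lebesgue. partial j a x * partial i b x) = (LINT x|lebesgue. partial i a x * partial j b x)"
proof -
  let ?t = "\<lambda>n. inverse (real (Suc n))"
  have li: "integrable lebesgue (\<lambda>x. indicator (cball 0 r) x *\<^sub>R \<phi> x)" if "\<phi> \<in> test_functions UNIV" for r and \<phi> :: "real^3 \<Rightarrow> real"
    by (intro integrable_mult_indicator test_integrable[OF that]) simp
  have me: "\<phi> \<in> borel_measurable lebesgue" if "\<phi> \<in> test_functions UNIV" for \<phi> :: "real^3 \<Rightarrow> real"
    by (rule cont_measurable[OF test_continuous[OF that]])
  have key: "(LINT x|lebesgue. diff_quot j t a x * partial i b x) = (LINT x|lebesgue. diff_quot j (- t) b x * partial i a x)"
    if t: "t \<noteq> 0" for t
  proof -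
    let ?e = "t *\<^sub>R axis j 1 :: real^3"
    have ae: "(\<lambda>x. a (x + ?e)) \<in> test_functions UNIV" by (rule test_translate[OF a])
    have sb: "smooth b" by (rule test_smooth[OF b])
    have pe: "partial i (\<lambda>x. a (x + ?e)) = (\<lambda>x. partial i a (x + ?e))"
      by (rule ext, rule partial_translate, rule smooth_differentiable[OF test_smooth[OF a]])
    have i0: "integrable lebesgue (\<lambda>x. a (x + ?e) * partial i b x)" "integrable lebesgue (\<lambda>x. a x * partial i b x)"
      by (intro test_integrable[of _ UNIV] test_mult_smooth ae a smooth_partial sb)+
    have i1: "integrable lebesgue (\<lambda>x. partial i a x * b (x - ?e))" "integrable lebesgue (\<lambda>x. partial i a x * b x)"
      using smooth_affine[OF sb bounded_linear_ident, of "- ?e"]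
      by (intro test_integrable[of _ UNIV] test_mult_smooth test_partial a sb; simp)+
    have "(LINT x|lebesgue. diff_quot j t a x * partial i b x) =
       (LINT x|lebesgue. (1/t) * (a (x + ?e) * partial i b x - a x * partial i b x))"
      by (simp add: diff_quot_def algebra_simps)
    also have "\<dots> = (1/t) * ((LINT x|lebesgue. a (x + ?e) * partial i b x) - (LINT x|lebesgue. a x * partial i b x))"
      using i0 by simp
    also have "(LINT x|lebesgue. a (x + ?e) * partial i b x) = - (LINT x|lebesgue. partial i a (x + ?e) * b x)"
      using integration_by_parts[OF ae sb, of i] by (simp add: pe)
    also have "(LINT x|lebesgue. partial i a (x + ?e) * b x) = (LINT x|lebesgue. partial i a x * b (x - ?e))"
      using preserving_integral[OF lebesgue_preserving_translation borel_measurable_integrable[OF i1(1)], of ?e]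
      by simp
    also have "(LINT x|lebesgue. a x * partial i b x) = - (LINT x|lebesgue. partial i a x * b x)"
      using integration_by_parts[OF a sb, of i] by simp
    also have "(1/t) * (- (LINT x|lebesgue. partial i a x * b (x - ?e)) - - (LINT x|lebesgue. partial i a x * b x)) =
       (LINT x|lebesgue. (1/t) * (partial i a x * b x - partial i a x * b (x - ?e)))"
      using i1 by (simp add: algebra_simps)
    also have "\<dots> = (LINT x|lebesgue. diff_quot j (- t) b x * partial i a x)"
      by (simp add: diff_quot_def algebra_simps)
    finally show ?thesis .
  qed
  have "(\<lambda>n. LINT x|lebesgue. diff_quot j (?t n) a x *\<^sub>R partial i b x) \<longlonglongrightarrow> (LINT x|lebesgue. partial j a x *\<^sub>R partial i b x)"
    by (rule diff_quot_integral_lim(1)[OF C1c_test[OF a] li[OF test_partial[OF b]] me[OF test_partial[OF b]] steps])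
  moreover have "(\<lambda>n. LINT x|lebesgue. diff_quot j (- ?t n) b x *\<^sub>R partial i a x) \<longlonglongrightarrow> (LINT x|lebesgue. partial j b x *\<^sub>R partial i a x)"
    using tendsto_minus[OF steps(3)] steps(1,2)
    by (intro diff_quot_integral_lim(1)[OF C1c_test[OF b] li[OF test_partial[OF a]] me[OF test_partial[OF a]]]) auto
  ultimately have "(LINT x|lebesgue. partial j a x *\<^sub>R partial i b x) = (LINT x|lebesgue. partial j b x *\<^sub>R partial i a x)"
    using key[of "?t _"] by (simp add: LIMSEQ_unique)
  then show ?thesis by (simp add: mult.commute)
qed

text \<open>The bound for a translation by \<open>t\<close> follows by adding up \<open>m\<close> translations by \<open>t / m\<close> and
  letting \<open>m\<close> tend to infinity.\<close>
lemma translation_bound_test: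
  assumes a: "\<phi> \<in> test_functions UNIV"
  shows "L2norm lebesgue (\<lambda>x. \<phi> (x + t *\<^sub>R axis i 1) - \<phi> x) \<le> \<bar>t\<bar> * L2norm lebesgue (partial i \<phi>)"
proof (cases "t = 0")
  case True then show ?thesis by (simp add: L2norm_def)
next
  case False
  define N where "N s = L2norm lebesgue (\<lambda>x. \<phi> (x + s *\<^sub>R axis i 1) - \<phi> x)" for s
  have te: "(\<lambda>x. \<phi> (x + b)) \<in> test_functions UNIV" for b by (rule test_translate[OF a])
  have mult: "N (real m * s) \<le> real m * N s" for m s
  proof (induction m)
    case 0 show ?case by (simp add: N_def L2norm_def)
  next
    case (Suc m)
    let ?b = "(real m * s) *\<^sub>R axis i 1 :: real^3" and ?e = "s *\<^sub>R axis i 1 :: real^3"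
    have "N (real (Suc m) * s) = L2norm lebesgue (\<lambda>x. \<phi> (x + ?b + ?e) - \<phi> x)"
      by (simp add: N_def algebra_simps)
    also have "\<dots> \<le> L2norm lebesgue (\<lambda>x. \<phi> (x + ?b + ?e) - \<phi> (x + ?b)) + L2norm lebesgue (\<lambda>x. \<phi> (x + ?b) - \<phi> x)"
      using te[of "?b + ?e"] te[of ?b] a
      by (intro L2norm_triangle3 test_sq_integrable[of _ UNIV]) (simp_all add: add.assoc)
    also have "L2norm lebesgue (\<lambda>x. \<phi> (x + ?b + ?e) - \<phi> (x + ?b)) = N s"
      unfolding N_def
      by (rule preserving_L2norm[OF lebesgue_preserving_translation, of "\<lambda>x. \<phi> (x + ?e) - \<phi> x"])
         (rule cont_measurable[OF test_continuous[OF test_diff[OF te a]]])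
    finally show ?case using Suc by (simp add: N_def algebra_simps)
  qed
  \<comment> \<open>The first terms are replaced by one only to keep every step in the range \<open>0 < \<bar>s\<bar> \<le> 1\<close>.\<close>
  let ?s = "\<lambda>n. if \<bar>t\<bar> \<le> real (Suc n) then t / real (Suc n) else 1"
  have "?s \<longlonglongrightarrow> 0"
  proof (rule Lim_transform_eventually)
    show "(\<lambda>n. t / real (Suc n)) \<longlonglongrightarrow> 0"
      using tendsto_mult_right_zero[OF LIMSEQ_inverse_real_of_nat, of t] by (simp add: divide_inverse)
    obtain n0 where "\<bar>t\<bar> \<le> real n0" using real_arch_simple by blast
    then show "eventually (\<lambda>n. t / real (Suc n) = ?s n) sequentially"
      by (intro eventually_sequentiallyI[of n0]) auto
  qed
  then have lim: "(\<lambda>n. \<bar>t\<bar> * L2norm lebesgue (diff_quot i (?s n) \<phi>)) \<longlonglongrightarrow> \<bar>t\<bar> * L2norm lebesgue (partial i \<phi>)"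
    by (intro tendsto_mult_left diff_quot_L2_lim[OF C1c_test[OF a]]) (use False in auto)
  obtain n0 where n0: "\<bar>t\<bar> \<le> real n0" using real_arch_simple by blast
  have "N t \<le> \<bar>t\<bar> * L2norm lebesgue (diff_quot i (?s n) \<phi>)" if "n \<ge> n0" for n
  proof -
    have sn: "?s n = t / real (Suc n)" using n0 that by auto
    have "N t \<le> real (Suc n) * N (?s n)" using mult[of "Suc n" "t / real (Suc n)"] unfolding sn by simp
    also have "N (?s n) = \<bar>?s n\<bar> * L2norm lebesgue (diff_quot i (?s n) \<phi>)"
      unfolding N_def L2norm_scaleR[symmetric] using False by (simp add: diff_quot_def sn)
    also have "real (Suc n) * (\<bar>?s n\<bar> * L2norm lebesgue (diff_quot i (?s n) \<phi>)) = \<bar>t\<bar> * L2norm lebesgue (diff_quot i (?s n) \<phi>)"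
      unfolding sn by (simp add: abs_divide)
    finally show ?thesis .
  qed
  then have "N t \<le> \<bar>t\<bar> * L2norm lebesgue (partial i \<phi>)"
    by (intro LIMSEQ_le_const[OF lim]) blast
  then show ?thesis by (simp add: N_def)
qed

subsection \<open>The weighted inequalities of Hardy type\<close>

text \<open>Fields in the completion need not be square integrable, but their products with this weight are,
  with norm controlled by the gradient. As the weight is bounded below on bounded sets, the weighted
  norm also controls convergence in the square mean on bounded sets.\<close>
definition weight :: "'a::real_inner \<Rightarrow> real" where
  "weight x = 1 / sqrt (1 + x \<bullet> x)"

lemma weight_pos: "0 < weight x" "weight x \<le> 1"
  by (auto simp: weight_def add_pos_nonneg)

lemma weight_square: "(weight x)\<^sup>2 = 1 / (1 + x \<bullet> x)"
  by (simp add: weight_def power_divide)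

lemma weight_mult_square: "(weight x * c)\<^sup>2 = c * c * (1 / (1 + x \<bullet> x))"
  unfolding power_mult_distrib weight_square by (simp add: power2_eq_square)

lemma weight_cont: "continuous_on UNIV weight"
proof -
  have "sqrt (1 + x \<bullet> x) \<noteq> 0" for x :: 'a using inner_ge_zero[of x] by (smt (verit) real_sqrt_eq_zero_cancel_iff)
  then show ?thesis unfolding weight_def[abs_def] by (intro continuous_intros) auto
qed

lemma weight_lower: "norm x \<le> R \<Longrightarrow> 1 / sqrt (1 + R\<^sup>2) \<le> weight x"
  unfolding weight_def
  by (intro divide_left_mono real_sqrt_le_mono mult_pos_pos)
     (auto simp: dot_square_norm power_mono add_pos_nonneg)

lemma has_derivative_inv_quad:
  "((\<lambda>x::real^3. 1 / (1 + x \<bullet> x)) has_derivative (\<lambda>h. - 2 * (x \<bullet> h) * (1 / (1 + x \<bullet> x) * (1 / (1 + x \<bullet> x))))) (at x)"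
proof -
  have "1 + x \<bullet> x \<noteq> 0" using inner_ge_zero[of x] by linarith
  then show ?thesis
    by (auto intro!: derivative_eq_intros simp: inner_commute field_simps power2_eq_square)
qed

lemma partial_inv_quad:
  "partial i (\<lambda>x::real^3. 1 / (1 + x \<bullet> x)) = (\<lambda>x. (-2) *\<^sub>R (x $ i *\<^sub>R (1 / (1 + x \<bullet> x) * (1 / (1 + x \<bullet> x)))))"
  by (rule ext, subst partial_eqI[OF has_derivative_inv_quad]) (simp add: inner_axis)

lemma smooth_coord: "smooth (\<lambda>x::real^3. x $ i)"
proof -
  have d: "((\<lambda>x::real^3. x $ i) has_derivative (\<lambda>h. h $ i)) (at x)" for x
    by (rule bounded_linear_imp_has_derivative[OF bounded_linear_vec_nth])
  have p: "partial j (\<lambda>x::real^3. x $ i) = (\<lambda>x. axis j 1 $ i)" for j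
    by (rule ext) (rule partial_eqI[OF d])
  have "C_order k (\<lambda>x::real^3. x $ i)" for k
    by (cases k) (auto simp: p C_order_const intro: continuous_intros d simp: differentiable_def)
  then show ?thesis by (simp add: smooth_def)
qed

lemma smooth_inv_quad: "smooth (\<lambda>x::real^3. 1 / (1 + x \<bullet> x))"
proof -
  have "C_order k (\<lambda>x::real^3. 1 / (1 + x \<bullet> x))" for k
  proof (induction k)
    case 0
    have "1 + x \<bullet> x \<noteq> 0" for x :: "real^3" using inner_ge_zero[of x] by linarith
    then show ?case by (auto intro!: continuous_intros)
  next
    case (Suc k)
    have "C_order k (\<lambda>x::real^3. x $ i)" for i using smooth_coord by (simp add: smooth_def)
    then have "C_order k (\<lambda>x::real^3. (-2) *\<^sub>R (x $ i *\<^sub>R (1 / (1 + x \<bullet> x) * (1 / (1 + x \<bullet> x)))))" for i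
      using C_order_scaleR[OF Suc Suc]
      by (intro C_order_linear[OF _ bounded_linear_scaleR_right] C_order_scaleR) simp_all
    moreover have "(\<lambda>x::real^3. 1 / (1 + x \<bullet> x)) differentiable (at x)" for x
      using has_derivative_inv_quad[of x] unfolding differentiable_def by blast
    ultimately show ?case unfolding C_order.simps partial_inv_quad by blast
  qed
  then show ?thesis by (simp add: smooth_def)
qed

lemma partial_coord: "partial j (\<lambda>x::real^3. x $ i) x = (if i = j then 1 else 0)"
  by (subst partial_eqI[OF bounded_linear_imp_has_derivative[OF bounded_linear_vec_nth]]) (simp add: axis_def)

text \<open>Hardy's inequality from the vector field \<open>X = x / (1 + \<bar>x\<bar>\<^sup>2)\<close>: its divergence is at least
  \<open>1 / (1 + \<bar>x\<bar>\<^sup>2)\<close> in dimension three, its length is at most the square root of this, and it is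
  tangent to the boundary plane, so that the divergence theorem for \<open>a\<^sup>2 X\<close> has no boundary term.\<close>
lemma hardy_scalar:
  fixes a :: "real^3 \<Rightarrow> real"
  assumes a: "a \<in> test_functions UNIV"
  shows "(LINT x|half_measure. (weight x * a x)\<^sup>2)
    \<le> 4 * (LINT x|half_measure. (\<Sum>i\<in>UNIV. (partial i a x)\<^sup>2))"
proof -
  define q where "q = (\<lambda>x::real^3. 1 / (1 + x \<bullet> x))"
  define X where "X i x = x $ i * q x" for i and x :: "real^3"
  have sq: "smooth q" unfolding q_def by (rule smooth_inv_quad)
  have sX: "smooth (X i)" for i unfolding X_def by (intro smooth_mult smooth_coord sq)
  have sa: "smooth a" by (rule test_smooth[OF a])
  have qpos: "q x > 0" for x using inner_ge_zero[of x] by (simp add: q_def add_pos_nonneg)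
  have pX: "partial i (X i) x = q x - 2 * (x $ i)\<^sup>2 * (q x)\<^sup>2" for i x
  proof -
    have "partial i (X i) x = partial i (\<lambda>x. x $ i) x * q x + x $ i * partial i q x"
      unfolding X_def by (intro partial_mult smooth_differentiable smooth_coord sq)
    then show ?thesis
      by (simp add: partial_coord partial_inv_quad q_def power2_eq_square)
  qed
  have a2: "(\<lambda>x. a x * a x) \<in> test_functions UNIV" by (rule test_mult_smooth[OF a sa])
  have tX: "(\<lambda>x. a x * a x * X i x) \<in> test_functions UNIV" for i by (rule test_mult_smooth[OF a2 sX])
  have pp: "partial i (\<lambda>x. a x * a x * X i x) x = 2 * a x * partial i a x * X i x + (a x)\<^sup>2 * partial i (X i) x" for i x
  proof -
    have d: "a differentiable (at x)" "X i differentiable (at x)" "(\<lambda>x. a x * a x) differentiable (at x)"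
      by (intro smooth_differentiable sa sX test_smooth[OF a2])+
    show ?thesis using partial_mult[OF d(3,2), of i] partial_mult[OF d(1,1), of i]
      by (simp add: algebra_simps power2_eq_square)
  qed
  have z: "(LINT x|half_measure. partial i (\<lambda>x. a x * a x * X i x) x) = 0" for i
  proof (cases "i = 3")
    case False then show ?thesis by (rule integral_partial_half_tangential[OF C1c_test[OF tX]])
  next
    case True
    have "X 3 (boundary_point y) = 0" for y by (simp add: X_def boundary_point_def vector_3)
    then show ?thesis using integral_partial_half_normal[OF C1c_test[OF tX[of 3]]] True by simp
  qed
  have ti: "integrable half_measure (partial i (\<lambda>x. a x * a x * X i x))" for i
    by (rule integral_test_on[OF test_partial[OF tX]]) simp
  have gi: "integrable half_measure (\<lambda>x. \<Sum>i\<in>UNIV. (partial i a x)\<^sup>2)"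
    unfolding power2_eq_square
    by (intro Bochner_Integration.integrable_sum integral_test_on[of _ UNIV] test_mult_smooth test_partial a smooth_partial sa) simp
  have wi: "integrable half_measure (\<lambda>x. (weight x * a x)\<^sup>2)"
  proof -
    have "(\<lambda>x. (weight x * a x)\<^sup>2) = (\<lambda>x. a x * a x * q x)"
      by (simp add: weight_mult_square q_def)
    moreover have "integrable half_measure (\<lambda>x. a x * a x * q x)"
      by (intro integral_test_on[of _ UNIV] test_mult_smooth a2 sq) simp
    ultimately show ?thesis by simp
  qed
  \<comment> \<open>The divergence of \<open>X\<close> beats the mixed term after completing the square, which costs half of the weighted square.\<close>
  have pt: "(1/2) * (weight x * a x)\<^sup>2 - 2 * (\<Sum>i\<in>UNIV. (partial i a x)\<^sup>2)
      \<le> (\<Sum>i\<in>UNIV. partial i (\<lambda>x. a x * a x * X i x) x)" for x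
  proof -
    define r where "r = x \<bullet> x"
    have "r = (\<Sum>i\<in>UNIV. (x $ i)\<^sup>2)" by (simp add: r_def inner_vec_def power2_eq_square)
    moreover have "r \<ge> 0" unfolding r_def by (rule inner_ge_zero)
    ultimately have r: "r \<ge> 0" "r = (\<Sum>i\<in>UNIV. (x $ i)\<^sup>2)" by auto
    define g where "g = (\<chi> i. partial i a x)"
    have gg: "g \<bullet> g = (\<Sum>i\<in>UNIV. (partial i a x)\<^sup>2)" by (simp add: g_def inner_vec_def power2_eq_square)
    have qr: "q x = 1 / (1 + r)" by (simp add: q_def r_def)
    have qle: "q x * r \<le> 1" using r by (simp add: qr)
    have "(\<Sum>i\<in>UNIV. partial i (\<lambda>x. a x * a x * X i x) x)
       = 2 * a x * q x * (\<Sum>i\<in>UNIV. partial i a x * x $ i) + (a x)\<^sup>2 * (\<Sum>i\<in>UNIV. partial i (X i) x)"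
      unfolding pp by (simp add: X_def sum_3 algebra_simps)
    also have "(\<Sum>i\<in>UNIV. partial i a x * x $ i) = g \<bullet> x" by (simp add: g_def inner_vec_def)
    also have "(\<Sum>i\<in>UNIV. partial i (X i) x) = 3 * q x - 2 * r * (q x)\<^sup>2"
      unfolding pX r(2) by (simp add: sum_3 algebra_simps)
    finally have eq: "(\<Sum>i\<in>UNIV. partial i (\<lambda>x. a x * a x * X i x) x)
       = 2 * a x * q x * (g \<bullet> x) + (a x)\<^sup>2 * (3 * q x - 2 * r * (q x)\<^sup>2)" .
    have "q x \<le> 3 * q x - 2 * r * (q x)\<^sup>2"
      using mult_left_mono[OF qle, of "2 * q x"] qpos[of x] by (simp add: power2_eq_square algebra_simps)
    then have 1: "(a x)\<^sup>2 * q x \<le> (a x)\<^sup>2 * (3 * q x - 2 * r * (q x)\<^sup>2)" by (rule mult_left_mono) simp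
    have 2: "- (2 * a x * q x * (g \<bullet> x)) \<le> (1/2) * ((a x)\<^sup>2 * q x) + 2 * (g \<bullet> g)"
    proof -
      have "0 \<le> ((a x * q x) *\<^sub>R x + 2 *\<^sub>R g) \<bullet> ((a x * q x) *\<^sub>R x + 2 *\<^sub>R g)" by simp
      also have "\<dots> = (a x)\<^sup>2 * q x * (q x * r) + 4 * (a x * q x * (g \<bullet> x)) + 4 * (g \<bullet> g)"
        by (simp add: inner_add_left inner_add_right inner_commute r_def power2_eq_square algebra_simps)
      finally have "0 \<le> (a x)\<^sup>2 * q x * (q x * r) + 4 * (a x * q x * (g \<bullet> x)) + 4 * (g \<bullet> g)" .
      moreover have "(a x)\<^sup>2 * q x * (q x * r) \<le> (a x)\<^sup>2 * q x * 1"
        by (intro mult_left_mono qle) (use qpos[of x] in simp)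
      ultimately show ?thesis by simp
    qed
    have 3: "(weight x * a x)\<^sup>2 = (a x)\<^sup>2 * q x"
      by (simp add: power_mult_distrib weight_square q_def)
    show ?thesis unfolding eq 3 gg[symmetric] using 1 2 by linarith
  qed
  have "(LINT x|half_measure. (1/2) * (weight x * a x)\<^sup>2 - 2 * (\<Sum>i\<in>UNIV. (partial i a x)\<^sup>2))
     \<le> (LINT x|half_measure. (\<Sum>i\<in>UNIV. partial i (\<lambda>x. a x * a x * X i x) x))"
    by (intro integral_mono pt Bochner_Integration.integrable_diff integrable_mult_right wi gi Bochner_Integration.integrable_sum ti)
  also have "\<dots> = 0" using ti z by simp
  finally show ?thesis using wi gi by simp
qed

text \<open>The boundary values are controlled by integrating the derivative of the weighted square in
  the normal direction.\<close>
lemma trace_scalar: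
  fixes a :: "real^3 \<Rightarrow> real"
  assumes a: "a \<in> test_functions UNIV"
  shows "(LINT y|lebesgue. (weight (boundary_point y) * a (boundary_point y))\<^sup>2)
    \<le> 9 * (LINT x|half_measure. (\<Sum>i\<in>UNIV. (partial i a x)\<^sup>2))"
proof -
  define q where "q = (\<lambda>x::real^3. 1 / (1 + x \<bullet> x))"
  have sq: "smooth q" unfolding q_def by (rule smooth_inv_quad)
  have sa: "smooth a" by (rule test_smooth[OF a])
  have w: "(weight x * a x)\<^sup>2 = a x * a x * q x" for x
    by (simp add: weight_mult_square q_def)
  have a2: "(\<lambda>x. a x * a x) \<in> test_functions UNIV" by (rule test_mult_smooth[OF a sa])
  have tX: "(\<lambda>x. a x * a x * q x) \<in> test_functions UNIV" by (rule test_mult_smooth[OF a2 sq])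
  have pp: "partial 3 (\<lambda>x. a x * a x * q x) x = 2 * a x * partial 3 a x * q x + (a x)\<^sup>2 * partial 3 q x" for x
  proof -
    have d: "a differentiable (at x)" "q differentiable (at x)" "(\<lambda>x. a x * a x) differentiable (at x)"
      by (intro smooth_differentiable sa sq test_smooth[OF a2])+
    show ?thesis using partial_mult[OF d(3,2), of 3] partial_mult[OF d(1,1), of 3]
      by (simp add: algebra_simps power2_eq_square)
  qed
  have gi: "integrable half_measure (\<lambda>x. \<Sum>i\<in>UNIV. (partial i a x)\<^sup>2)"
    unfolding power2_eq_square
    by (intro Bochner_Integration.integrable_sum integral_test_on[of _ UNIV] test_mult_smooth test_partial a smooth_partial sa) simp
  have wi: "integrable half_measure (\<lambda>x. (weight x * a x)\<^sup>2)"
    unfolding w by (intro integral_test_on[of _ UNIV] tX) simp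
  \<comment> \<open>One weighted square absorbs the mixed term, the other the derivative of the weight; with Hardy this gives \<open>2 * 4 + 1 = 9\<close>.\<close>
  have pt: "- partial 3 (\<lambda>x. a x * a x * q x) x \<le> 2 * (weight x * a x)\<^sup>2 + (\<Sum>i\<in>UNIV. (partial i a x)\<^sup>2)" for x
  proof -
    have q: "q x > 0" "q x \<le> 1" using inner_ge_zero[of x] by (simp_all add: q_def add_pos_nonneg)
    have x3: "2 * \<bar>x $ 3\<bar> \<le> 1 + x \<bullet> x"
    proof -
      have "(x $ 3)\<^sup>2 \<le> x \<bullet> x" by (simp add: inner_vec_def sum_3 power2_eq_square)
      moreover have "0 \<le> (1 - \<bar>x $ 3\<bar>)\<^sup>2" by simp
      ultimately show ?thesis unfolding power2_diff by simp
    qed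
    have "partial 3 q x = - 2 * x $ 3 * q x * q x" by (simp add: partial_inv_quad q_def)
    then have "\<bar>partial 3 q x\<bar> = 2 * \<bar>x $ 3\<bar> * q x * q x" using q by (simp add: abs_mult)
    also have "\<dots> \<le> (1 + x \<bullet> x) * q x * q x"
      by (intro mult_right_mono x3) (use q in auto)
    also have "\<dots> = q x" using inner_ge_zero[of x] by (simp add: q_def add_pos_nonneg)
    finally have pq: "- partial 3 q x \<le> q x" by linarith
    have 1: "- ((a x)\<^sup>2 * partial 3 q x) \<le> (a x)\<^sup>2 * q x"
      using mult_left_mono[OF pq, of "(a x)\<^sup>2"] by simp
    have 2: "- (2 * a x * partial 3 a x * q x) \<le> (a x)\<^sup>2 * q x + (partial 3 a x)\<^sup>2"
    proof -
      have "0 \<le> (a x + partial 3 a x)\<^sup>2 * q x" using q by simp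
      also have "\<dots> = (a x)\<^sup>2 * q x + (2 * a x * partial 3 a x * q x) + (partial 3 a x)\<^sup>2 * q x"
        by (simp add: power2_sum algebra_simps)
      finally have "0 \<le> (a x)\<^sup>2 * q x + (2 * a x * partial 3 a x * q x) + (partial 3 a x)\<^sup>2 * q x" .
      moreover have "(partial 3 a x)\<^sup>2 * q x \<le> (partial 3 a x)\<^sup>2 * 1" by (intro mult_left_mono q) simp
      ultimately show ?thesis by simp
    qed
    have 3: "(partial 3 a x)\<^sup>2 \<le> (\<Sum>i\<in>UNIV. (partial i a x)\<^sup>2)" by (simp add: sum_3)
    have 4: "(weight x * a x)\<^sup>2 = (a x)\<^sup>2 * q x" unfolding w by (simp add: power2_eq_square)
    show ?thesis unfolding pp 4 using 1 2 3 by linarith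
  qed
  have "(LINT y|lebesgue. (weight (boundary_point y) * a (boundary_point y))\<^sup>2) = (LINT x|half_measure. - partial 3 (\<lambda>x. a x * a x * q x) x)"
    using integral_partial_half_normal[OF C1c_test[OF tX]] by (simp add: w)
  also have "\<dots> \<le> (LINT x|half_measure. 2 * (weight x * a x)\<^sup>2 + (\<Sum>i\<in>UNIV. (partial i a x)\<^sup>2))"
    using integral_test_on[OF test_partial[OF tX] half_space_sets(1)]
    by (intro integral_mono pt Bochner_Integration.integrable_add integrable_mult_right wi gi) simp
  also have "\<dots> \<le> 9 * (LINT x|half_measure. (\<Sum>i\<in>UNIV. (partial i a x)\<^sup>2))"
    using hardy_scalar[OF a] wi gi by simp
  finally show ?thesis .
qed

lemma norm_matrix_square: "(norm (A :: real^3^3))\<^sup>2 = (\<Sum>a\<in>UNIV. \<Sum>i\<in>UNIV. (A $ a $ i)\<^sup>2)"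
  unfolding power2_norm_eq_inner by (simp add: inner_vec_def power2_eq_square)

lemma norm_vec_square: "(norm (v :: real^'n))\<^sup>2 = (\<Sum>a\<in>UNIV. (v $ a)\<^sup>2)"
  unfolding power2_norm_eq_inner by (simp add: inner_vec_def power2_eq_square)

lemma grad_nth: "smooth \<phi> \<Longrightarrow> grad \<phi> x $ a $ i = partial i (\<lambda>x. \<phi> x $ a) x"
  by (simp add: grad_def partial_component smooth_differentiable)

lemma grad_test:
  assumes "\<phi> \<in> test_fields"
  shows "continuous_on UNIV (grad \<phi>)" "sq_integrable lebesgue (grad \<phi>)"
proof -
  have c: "continuous_on UNIV (partial i \<phi>)" for i by (rule test_continuous[OF test_partial[OF assms]])
  show cc: "continuous_on UNIV (grad \<phi>)"
    unfolding grad_def[abs_def] by (intro continuous_intros c)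
  obtain R where R: "\<And>x. norm x > R \<Longrightarrow> \<phi> x = 0" by (rule test_supp_bound[OF assms]) (rule that)
  show "sq_integrable lebesgue (grad \<phi>)"
    by (rule cs_sq_integrable[OF cc, where R=R]) (simp add: grad_def partial_zero_far[OF R] vec_eq_iff)
qed

lemma grad_test_on: "\<phi> \<in> test_fields \<Longrightarrow> A \<in> sets lebesgue \<Longrightarrow> sq_integrable (lebesgue_on A) (grad \<phi>)"
  using sq_integrable_on_UNIV_sub(1)[OF _ grad_test(2)] .

lemma grad_square_integral:
  assumes "\<phi> \<in> test_fields" "A \<in> sets lebesgue"
  shows "(L2norm (lebesgue_on A) (grad \<phi>))\<^sup>2 =
    (\<Sum>a\<in>UNIV. LINT x|lebesgue_on A. (\<Sum>i\<in>UNIV. (partial i (\<lambda>x. \<phi> x $ a) x)\<^sup>2))"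
proof -
  have "integrable (lebesgue_on A) (\<lambda>x. (partial i (\<lambda>x. \<phi> x $ a) x)\<^sup>2)" for i a
    unfolding power2_eq_square
    by (intro integral_test_on[of _ UNIV] test_mult_smooth test_partial test_component assms smooth_partial
        smooth_component test_smooth[OF assms(1)])
  then show ?thesis
    by (simp add: L2norm_square norm_matrix_square grad_nth[OF test_smooth[OF assms(1)]])
qed

lemma weighted_test_continuous: "\<phi> \<in> test_fields \<Longrightarrow> continuous_on UNIV (\<lambda>x. weight x *\<^sub>R \<phi> x)"
  by (intro continuous_intros weight_cont test_continuous)

lemma weighted_test_sq_integrable:
  assumes "\<phi> \<in> test_fields" "A \<in> sets lebesgue"
  shows "sq_integrable (lebesgue_on A) (\<lambda>x. weight x *\<^sub>R \<phi> x)"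
proof -
  obtain R where R: "\<And>x. norm x > R \<Longrightarrow> \<phi> x = 0" by (rule test_supp_bound[OF assms(1)]) (rule that)
  show ?thesis
    by (rule sq_integrable_on_UNIV_sub(1)[OF assms(2)], rule cs_sq_integrable[OF weighted_test_continuous[OF assms(1)], where R=R])
       (simp add: R)
qed

lemma hardy_half:
  assumes "\<phi> \<in> test_fields"
  shows "L2norm half_measure (\<lambda>x. weight x *\<^sub>R \<phi> x) \<le> 2 * L2norm half_measure (grad \<phi>)"
proof (rule power2_le_imp_le)
  have i: "integrable half_measure (\<lambda>x. (weight x * \<phi> x $ a)\<^sup>2)" for a
  proof -
    have "integrable half_measure (\<lambda>x. \<phi> x $ a * \<phi> x $ a * (1 / (1 + x \<bullet> x)))"
      by (intro integral_test_on[of _ UNIV] test_mult_smooth test_component assms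
        smooth_component test_smooth[OF assms(1)] smooth_inv_quad) simp
    then show ?thesis by (simp add: weight_mult_square)
  qed
  have "(L2norm half_measure (\<lambda>x. weight x *\<^sub>R \<phi> x))\<^sup>2 =
     (LINT x|half_measure. (\<Sum>a\<in>UNIV. (weight x * \<phi> x $ a)\<^sup>2))"
    unfolding L2norm_square norm_vec_square by simp
  also have "\<dots> = (\<Sum>a\<in>UNIV. LINT x|half_measure. (weight x * \<phi> x $ a)\<^sup>2)"
    using i by simp
  also have "\<dots> \<le> (\<Sum>a\<in>UNIV. 4 * (LINT x|half_measure. (\<Sum>i\<in>UNIV. (partial i (\<lambda>x. \<phi> x $ a) x)\<^sup>2)))"
    by (intro sum_mono hardy_scalar test_component assms)
  also have "\<dots> = (2 * L2norm half_measure (grad \<phi>))\<^sup>2"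
    by (simp add: power_mult_distrib grad_square_integral[OF assms half_space_sets(1)] sum_distrib_left)
  finally show "(L2norm half_measure (\<lambda>x. weight x *\<^sub>R \<phi> x))\<^sup>2 \<le> (2 * L2norm half_measure (grad \<phi>))\<^sup>2" .
qed simp

lemma boundary_cs_sq_integrable:
  assumes c: "continuous_on UNIV (f :: real^3 \<Rightarrow> 'b::euclidean_space)" and z: "\<And>x. norm x > R \<Longrightarrow> f x = 0"
  shows "sq_integrable lebesgue (\<lambda>y. f (boundary_point y))"
proof (rule cs_sq_integrable[where R=R])
  show "continuous_on UNIV (\<lambda>y. f (boundary_point y))"
    unfolding slab_point_boundary[symmetric]
    by (intro continuous_on_compose2[OF c] continuous_on_compose2[OF slab_point_continuous] continuous_intros) auto
  show "f (boundary_point y) = 0" if "norm y > R" for y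
    using norm_slab_point_ge(2)[of "(y, 0)"] that by (intro z) (simp add: slab_point_boundary)
qed

lemma boundary_test_sq_integrable:
  assumes "\<phi> \<in> test_fields"
  shows "sq_integrable lebesgue (\<lambda>y. weight (boundary_point y) *\<^sub>R \<phi> (boundary_point y))"
    "sq_integrable lebesgue (\<lambda>y. \<phi> (boundary_point y))"
proof -
  obtain R where R: "\<And>x. norm x > R \<Longrightarrow> \<phi> x = 0" by (rule test_supp_bound[OF assms(1)]) (rule that)
  show "sq_integrable lebesgue (\<lambda>y. weight (boundary_point y) *\<^sub>R \<phi> (boundary_point y))"
    by (rule boundary_cs_sq_integrable[OF weighted_test_continuous[OF assms], where R=R]) (simp add: R)
  show "sq_integrable lebesgue (\<lambda>y. \<phi> (boundary_point y))"
    by (rule boundary_cs_sq_integrable[OF test_continuous[OF assms], where R=R]) (simp add: R)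
qed

lemma trace_half:
  assumes "\<phi> \<in> test_fields"
  shows "L2norm lebesgue (\<lambda>y. weight (boundary_point y) *\<^sub>R \<phi> (boundary_point y)) \<le> 3 * L2norm half_measure (grad \<phi>)"
proof (rule power2_le_imp_le)
  have i: "integrable lebesgue (\<lambda>y. (weight (boundary_point y) * \<phi> (boundary_point y) $ a)\<^sup>2)" for a
    using sq_integrable_linear[OF boundary_test_sq_integrable(1)[OF assms] bounded_linear_vec_nth[of a]]
    by (simp add: sq_integrable_def)
  have "(L2norm lebesgue (\<lambda>y. weight (boundary_point y) *\<^sub>R \<phi> (boundary_point y)))\<^sup>2 =
     (LINT y|lebesgue. (\<Sum>a\<in>UNIV. (weight (boundary_point y) * \<phi> (boundary_point y) $ a)\<^sup>2))"
    unfolding L2norm_square norm_vec_square by simp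
  also have "\<dots> = (\<Sum>a\<in>UNIV. LINT y|lebesgue. (weight (boundary_point y) * \<phi> (boundary_point y) $ a)\<^sup>2)"
    using i by simp
  also have "\<dots> \<le> (\<Sum>a\<in>UNIV. 9 * (LINT x|half_measure. (\<Sum>i\<in>UNIV. (partial i (\<lambda>x. \<phi> x $ a) x)\<^sup>2)))"
    by (intro sum_mono trace_scalar test_component assms)
  also have "\<dots> = (3 * L2norm half_measure (grad \<phi>))\<^sup>2"
    by (simp add: power_mult_distrib grad_square_integral[OF assms half_space_sets(1)] sum_distrib_left)
  finally show "(L2norm lebesgue (\<lambda>y. weight (boundary_point y) *\<^sub>R \<phi> (boundary_point y)))\<^sup>2 \<le> (3 * L2norm half_measure (grad \<phi>))\<^sup>2" .
qed simp

section \<open>Uniqueness of weak derivatives\<close>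

text \<open>Bumps converge to the indicator of a box inside the half-space, so all integrals over boxes
  vanish, and the function is recovered from these integrals at almost every point.\<close>
lemma test_orthogonal_box:
  fixes h :: "real^3 \<Rightarrow> 'b::euclidean_space"
  assumes li: "loc_integrable h"
    and orth: "\<And>\<phi>::real^3 \<Rightarrow> real. \<phi> \<in> test_functions half_space \<Longrightarrow> (LINT x|half_measure. \<phi> x *\<^sub>R h x) = 0"
    and sub: "cbox a b \<subseteq> half_space"
  shows "integral (cbox a b) h = 0"
proof -
  let ?B = "\<lambda>n x. box_bump (real (Suc n)) a b x"
  have te: "?B n \<in> test_functions half_space" for n
  proof (rule testI[OF smooth_box_bump compact_cbox sub])
    show "?B n x = 0" if "x \<notin> cbox a b" for x
      using that box_subset_cbox[of a b] by (intro box_bump_zero) auto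
  qed
  have hi: "integrable lebesgue (\<lambda>x. indicator (cbox a b) x *\<^sub>R h x)"
    using li sub unfolding loc_integrable_def by (subst integrable_restrict_space[symmetric]) auto
  have eq: "indicator half_space x *\<^sub>R (?B n x *\<^sub>R h x) = ?B n x *\<^sub>R (indicator (cbox a b) x *\<^sub>R h x)" for n x
    using sub box_subset_cbox[of a b] box_bump_zero[of "real (Suc n)" x a b] by (auto simp: indicator_def)
  have z: "(LINT x|lebesgue. ?B n x *\<^sub>R (indicator (cbox a b) x *\<^sub>R h x)) = 0" for n
  proof -
    have "(LINT x|half_measure. ?B n x *\<^sub>R h x) = (LINT x|lebesgue. indicator half_space x *\<^sub>R (?B n x *\<^sub>R h x))"
      by (rule integral_restrict_space) simp
    then show ?thesis using orth[OF te[of n]] by (simp only: eq)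
  qed
  have "(\<lambda>n. LINT x|lebesgue. ?B n x *\<^sub>R (indicator (cbox a b) x *\<^sub>R h x)) \<longlonglongrightarrow>
      (LINT x|lebesgue. indicator (box a b) x *\<^sub>R (indicator (cbox a b) x *\<^sub>R h x))"
  proof (rule integral_dominated_convergence)
    show "integrable lebesgue (\<lambda>x. norm (indicator (cbox a b) x *\<^sub>R h x))"
      by (rule integrable_norm[OF hi])
    show "(\<lambda>x. indicator (box a b) x *\<^sub>R (indicator (cbox a b) x *\<^sub>R h x)) \<in> borel_measurable lebesgue"
      by (rule borel_measurable_scaleR[OF _ borel_measurable_integrable[OF hi]], rule borel_measurable_indicator) auto
    show "(\<lambda>x. ?B n x *\<^sub>R (indicator (cbox a b) x *\<^sub>R h x)) \<in> borel_measurable lebesgue" for n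
      by (rule borel_measurable_scaleR[OF cont_measurable[OF smooth_continuous[OF smooth_box_bump]] borel_measurable_integrable[OF hi]])
    show "AE x in lebesgue. (\<lambda>n. ?B n x *\<^sub>R (indicator (cbox a b) x *\<^sub>R h x)) \<longlonglongrightarrow> indicator (box a b) x *\<^sub>R (indicator (cbox a b) x *\<^sub>R h x)"
      by (intro AE_I2 tendsto_scaleR tendsto_const box_bump_lim)
    show "AE x in lebesgue. norm (?B n x *\<^sub>R (indicator (cbox a b) x *\<^sub>R h x)) \<le> norm (indicator (cbox a b) x *\<^sub>R h x)" for n
    proof (rule AE_I2)
      fix x
      have "norm (?B n x *\<^sub>R (indicator (cbox a b) x *\<^sub>R h x)) = ?B n x * norm (indicator (cbox a b) x *\<^sub>R h x)"
        using box_bump_bounds(1)[of "real (Suc n)" a b x] by (simp only: norm_scaleR abs_of_nonneg)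
      also have "\<dots> \<le> norm (indicator (cbox a b) x *\<^sub>R h x)"
        by (intro mult_left_le_one_le box_bump_bounds norm_ge_zero)
      finally show "norm (?B n x *\<^sub>R (indicator (cbox a b) x *\<^sub>R h x)) \<le> norm (indicator (cbox a b) x *\<^sub>R h x)" .
    qed
  qed
  then have z2: "(LINT x|lebesgue. indicator (box a b) x *\<^sub>R (indicator (cbox a b) x *\<^sub>R h x)) = 0"
    unfolding z by (simp add: LIMSEQ_const_iff)
  have eq2: "indicator (box a b) x *\<^sub>R (indicator (cbox a b) x *\<^sub>R h x) = indicator (box a b) x *\<^sub>R h x" for x
    using box_subset_cbox[of a b] by (auto simp: indicator_def)
  have bi: "integrable (lebesgue_on (box a b)) h"
    using integrable_mult_indicator[of "box a b" lebesgue, OF _ hi] unfolding eq2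
    by (subst integrable_restrict_space) auto
  have "integral (box a b) h = (LINT x|lebesgue_on (box a b). h x)"
    using lebesgue_integral_eq_integral[OF bi] by simp
  also have "\<dots> = 0" using z2 unfolding eq2 by (subst integral_restrict_space) auto
  finally show ?thesis by (simp add: integral_open_interval)
qed

lemma test_orthogonal_zero:
  fixes h :: "real^3 \<Rightarrow> 'b::euclidean_space"
  assumes li: "loc_integrable h"
    and orth: "\<And>\<phi>::real^3 \<Rightarrow> real. \<phi> \<in> test_functions half_space \<Longrightarrow> (LINT x|half_measure. \<phi> x *\<^sub>R h x) = 0"
  shows "AE x in half_measure. h x = 0"
proof -
  define K where "K n = cbox (vector [- real n, - real n, inverse (real (Suc n))]) (vector [real n, real n, real n] :: real^3)" for n
  have Ksub: "K n \<subseteq> half_space" for n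
  proof
    fix x assume "x \<in> K n"
    then have "inverse (real (Suc n)) \<le> x $ 3" by (auto simp: K_def mem_box_cart forall_3 vector_3)
    moreover have "0 < inverse (real (Suc n))" by simp
    ultimately have "0 < x $ 3" by linarith
    then show "x \<in> half_space" by (simp add: half_space_def)
  qed
  have K0: "\<exists>N. negligible N \<and> (\<forall>x\<in>interior (K n). x \<notin> N \<longrightarrow> h x = 0)" for n
  proof -
    let ?f = "\<lambda>x. if x \<in> K n then h x else 0"
    have Kc: "compact (K n)" by (simp add: K_def)
    then have Ks: "K n \<in> sets lebesgue" by (simp add: K_def)
    have "integrable (lebesgue_on (K n)) h" using li Ksub Kc by (auto simp: loc_integrable_def)
    then have "integrable lebesgue ?f" using Ks by (simp add: Lebesgue_Measure.integrable_restrict_UNIV)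
    then have "?f integrable_on UNIV" using integrable_on_lebesgue_on[of UNIV ?f] by (simp add: lebesgue_on_UNIV_eq)
    then have "?f integrable_on cbox a b" for a b using integrable_on_subcbox by blast
    then obtain N where N: "negligible N" "\<And>x e. \<lbrakk>x \<notin> N; 0 < e\<rbrakk> \<Longrightarrow>
               \<exists>d>0. \<forall>s. 0 < s \<and> s < d \<longrightarrow> norm (integral (cbox x (x + s *\<^sub>R One)) ?f /\<^sub>R s ^ DIM(real^3) - ?f x) < e"
      by (rule integrable_ccontinuous_explicit) (rule that)
    have "h x = 0" if x: "x \<in> interior (K n)" "x \<notin> N" for x
    proof (rule ccontr)
      assume nz: "h x \<noteq> 0"
      obtain d where d: "d > 0" "\<And>s. 0 < s \<Longrightarrow> s < d \<Longrightarrow> norm (integral (cbox x (x + s *\<^sub>R One)) ?f /\<^sub>R s ^ DIM(real^3) - ?f x) < norm (h x)"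
        using N(2)[OF x(2), of "norm (h x)"] nz by auto
      obtain r where r: "r > 0" "ball x r \<subseteq> K n" using x(1) by (auto simp: mem_interior)
      define s where "s = min (d / 2) (r / (2 * norm (One :: real^3) + 2))"
      have nO: "norm (One :: real^3) \<ge> 0" by simp
      have "0 < r / (2 * norm (One :: real^3) + 2)" using r(1) nO by (intro divide_pos_pos) linarith+
      then have s: "0 < s" "s < d" using d(1) by (auto simp: s_def min_less_iff_disj)
      have "s * norm (One :: real^3) < r"
      proof -
        have "s \<le> r / (2 * norm (One :: real^3) + 2)" by (simp add: s_def)
        then have "s * (2 * norm (One :: real^3) + 2) \<le> r" using nO by (simp add: pos_le_divide_eq)
        then have "2 * (s * norm (One :: real^3)) + 2 * s \<le> r" by (simp add: algebra_simps)
        moreover have "0 \<le> s * norm (One :: real^3)" using s nO by simp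
        ultimately show ?thesis using s(1) by linarith
      qed
      then have "x + s *\<^sub>R One \<in> ball x r" using s by (simp add: dist_norm)
      moreover have "x \<in> ball x r" using r by simp
      ultimately have "x \<in> K n" "x + s *\<^sub>R One \<in> K n" using r(2) by auto
      then have sub: "cbox x (x + s *\<^sub>R One) \<subseteq> K n"
        unfolding K_def by (auto simp: mem_box simp del: inner_add_left of_nat_Suc) (blast intro: order_trans)+
      have "integral (cbox x (x + s *\<^sub>R One)) ?f = integral (cbox x (x + s *\<^sub>R One)) h"
        by (rule integral_cong) (use sub in auto)
      also have "\<dots> = 0" by (rule test_orthogonal_box[OF li orth]) (use sub Ksub in auto)
      finally show False using d(2)[OF s] \<open>x \<in> K n\<close> by simp
    qed
    then show ?thesis using N(1) by blast
  qed
  then have "\<forall>n. \<exists>N. negligible N \<and> (\<forall>x\<in>interior (K n). x \<notin> N \<longrightarrow> h x = 0)" by blast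
  from choice[OF this] obtain N where N: "\<And>n. negligible (N n)" "\<And>n x. x \<in> interior (K n) \<Longrightarrow> x \<notin> N n \<Longrightarrow> h x = 0"
    by blast
  have "negligible (\<Union>n. N n)" using N(1) by (intro negligible_countable_Union) auto
  then have "AE x in lebesgue. x \<notin> (\<Union>n. N n)" by (intro AE_not_in) (simp add: negligible_iff_null_sets)
  then have "AE x in lebesgue. x \<in> half_space \<longrightarrow> h x = 0"
  proof eventually_elim
    case (elim x)
    show ?case
    proof
      assume "x \<in> half_space"
      then have x3: "x $ 3 > 0" by (simp add: half_space_def)
      obtain n1 where n1: "norm x < real n1" using reals_Archimedean2 by blast
      obtain n2 where n2: "inverse (real (Suc n2)) < x $ 3" using reals_Archimedean[OF x3] by blast
      define n where "n = max n1 n2"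
      have "\<bar>x $ i\<bar> < real n" for i using component_le_norm_cart[of x i] n1 by (simp add: n_def)
      then have c: "- real n < x $ i" "x $ i < real n" for i by (simp_all add: abs_less_iff minus_less_iff)
      have "inverse (real (Suc n)) \<le> inverse (real (Suc n2))" by (intro le_imp_inverse_le) (auto simp: n_def)
      then have "inverse (real (Suc n)) < x $ 3" using n2 by linarith
      then have "x \<in> interior (K n)" using c by (simp add: K_def interior_cbox mem_box_cart forall_3 vector_3)
      then show "h x = 0" using N(2) elim by blast
    qed
  qed
  then show ?thesis by (simp add: AE_half_iff)
qed

lemma compact_sets_lebesgue: "compact (K :: 'a::euclidean_space set) \<Longrightarrow> K \<in> sets lebesgue"
  by (simp add: borel_compact)

lemma loc_integrable_diff: "loc_integrable f \<Longrightarrow> loc_integrable g \<Longrightarrow> loc_integrable (\<lambda>x. f x - g x)"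
  by (simp add: loc_integrable_def)

text \<open>The support of a test function is a compact subset of the half-space, on which \<open>f\<close> is integrable.\<close>
lemma loc_integrable_measurable_mult:
  fixes \<phi> :: "real^3 \<Rightarrow> real"
  assumes "loc_integrable f" "\<phi> \<in> test_functions half_space"
  shows "integrable half_measure (\<lambda>x. \<phi> x *\<^sub>R f x)"
proof -
  let ?K = "closure {x. \<phi> x \<noteq> 0}"
  have K: "compact ?K" "?K \<subseteq> half_space" using assms(2) by (auto simp: test_functions_def)
  have fi: "integrable lebesgue (\<lambda>x. indicator ?K x *\<^sub>R f x)"
    using assms(1) K compact_sets_lebesgue[OF K(1)] unfolding loc_integrable_def
    by (subst integrable_restrict_space[symmetric]) auto
  obtain B where B: "B > 0" "\<And>x. norm (\<phi> x) \<le> B" by (rule test_bounded[OF assms(2)]) (rule that)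
  have "integrable lebesgue (\<lambda>x. \<phi> x *\<^sub>R (indicator ?K x *\<^sub>R f x))"
  proof (rule Bochner_Integration.integrable_bound[OF integrable_mult_right[OF integrable_norm[OF fi], of B]])
    show "(\<lambda>x. \<phi> x *\<^sub>R (indicator ?K x *\<^sub>R f x)) \<in> borel_measurable lebesgue"
      by (rule borel_measurable_scaleR[OF cont_measurable[OF test_continuous[OF assms(2)]] borel_measurable_integrable[OF fi]])
    show "AE x in lebesgue. norm (\<phi> x *\<^sub>R (indicator ?K x *\<^sub>R f x)) \<le> norm (B * norm (indicator ?K x *\<^sub>R f x))"
    proof (rule AE_I2)
      fix x
      have "norm (\<phi> x *\<^sub>R (indicator ?K x *\<^sub>R f x)) = norm (\<phi> x) * norm (indicator ?K x *\<^sub>R f x)"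
        by (simp only: norm_scaleR real_norm_def)
      also have "\<dots> \<le> B * norm (indicator ?K x *\<^sub>R f x)" by (intro mult_right_mono B) simp
      finally show "norm (\<phi> x *\<^sub>R (indicator ?K x *\<^sub>R f x)) \<le> norm (B * norm (indicator ?K x *\<^sub>R f x))" by simp
    qed
  qed
  moreover have "\<phi> x *\<^sub>R (indicator ?K x *\<^sub>R f x) = indicator half_space x *\<^sub>R (\<phi> x *\<^sub>R f x)" for x
    using K(2) zero_off_support[of x \<phi>] by (cases "x \<in> ?K") (auto simp: indicator_def)
  ultimately show ?thesis by (subst integrable_restrict_space) (simp, simp only:)
qed

lemma weak_partial_unique:
  assumes "has_weak_partial i f w" "has_weak_partial i f w'"
  shows "AE x in half_measure. w x = w' x"
proof -
  have "AE x in half_measure. w x - w' x = 0"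
  proof (rule test_orthogonal_zero)
    show "loc_integrable (\<lambda>x. w x - w' x)" using assms by (auto simp: has_weak_partial_def intro: loc_integrable_diff)
    fix \<phi> :: "real^3 \<Rightarrow> real" assume p: "\<phi> \<in> test_functions half_space"
    have "(LINT x|half_measure. \<phi> x *\<^sub>R (w x - w' x)) =
       (LINT x|half_measure. \<phi> x *\<^sub>R w x) - (LINT x|half_measure. \<phi> x *\<^sub>R w' x)"
    proof -
      have "integrable half_measure (\<lambda>x. \<phi> x *\<^sub>R w x)" "integrable half_measure (\<lambda>x. \<phi> x *\<^sub>R w' x)"
        using assms by (auto simp: has_weak_partial_def intro: loc_integrable_measurable_mult[OF _ p])
      then show ?thesis by (simp add: scaleR_diff_right)
    qed
    also have "\<dots> = 0"
    proof -
      let ?X = "LINT x|half_measure. partial i \<phi> x *\<^sub>R f x"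
      have "?X = - (LINT x|half_measure. \<phi> x *\<^sub>R w x)"
        using assms(1) p unfolding has_weak_partial_def by blast
      moreover have "?X = - (LINT x|half_measure. \<phi> x *\<^sub>R w' x)"
        using assms(2) p unfolding has_weak_partial_def by blast
      ultimately show ?thesis by simp
    qed
    finally show "(LINT x|half_measure. \<phi> x *\<^sub>R (w x - w' x)) = 0" .
  qed
  then show ?thesis by simp
qed

lemma weak_partial_works: "weakly_differentiable i f \<Longrightarrow> has_weak_partial i f (weak_partial i f)"
proof -
  assume "weakly_differentiable i f"
  moreover have "weak_partial i f = (SOME w. has_weak_partial i f w)"
    by (rule ext) (simp add: weak_partial_def)
  ultimately show ?thesis unfolding weakly_differentiable_def by (metis someI_ex)
qed

lemma weak_partial_eq_AE:
  assumes "has_weak_partial i f w"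
  shows "AE x in half_measure. weak_partial i f x = w x"
proof -
  have "weakly_differentiable i f" using assms by (auto simp: weakly_differentiable_def)
  from weak_partial_unique[OF weak_partial_works[OF this] assms] show ?thesis .
qed

section \<open>Mollification\<close>

lemma L2_dominated:
  assumes m: "\<And>n. f n \<in> borel_measurable M" "g \<in> borel_measurable M" and w: "integrable M (\<lambda>x. (w x)\<^sup>2)"
    and lim: "AE x in M. (\<lambda>n. f n x) \<longlonglongrightarrow> g x" and b: "\<And>n. AE x in M. norm (f n x - g x) \<le> w x"
  shows "(\<lambda>n. L2norm M (\<lambda>x. f n x - g x)) \<longlonglongrightarrow> 0"
proof -
  have "(\<lambda>n. LINT x|M. (norm (f n x - g x))\<^sup>2) \<longlonglongrightarrow> (LINT x|M. 0)"
  proof (rule integral_dominated_convergence[OF _ _ w])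
    show "AE x in M. (\<lambda>n. (norm (f n x - g x))\<^sup>2) \<longlonglongrightarrow> 0"
      using lim
    proof eventually_elim
      case (elim x)
      have "(\<lambda>n. (norm (f n x - g x))\<^sup>2) \<longlonglongrightarrow> (norm (g x - g x))\<^sup>2" by (intro tendsto_intros elim)
      then show ?case by simp
    qed
    show "AE x in M. norm ((norm (f n x - g x))\<^sup>2) \<le> (w x)\<^sup>2" for n
      using b[of n] by eventually_elim (simp add: power_mono)
  qed (use m in measurable)
  from tendsto_real_sqrt[OF this] show ?thesis unfolding L2norm_def by simp
qed

text \<open>Radial truncation of values; it is continuous and does not increase the norm, so that truncating
  approximants of \<open>f\<close> preserves pointwise convergence and provides a dominating function.\<close>
definition clip :: "real \<Rightarrow> 'b::real_normed_vector \<Rightarrow> 'b" where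
  "clip R v = (R / max R (norm v)) *\<^sub>R v"

lemma clip_props:
  assumes "R > 0"
  shows "norm (clip R v) \<le> R" "norm (clip R v) \<le> norm v" "norm v \<le> R \<Longrightarrow> clip R v = v" "continuous_on UNIV (clip R)"
proof -
  show "norm (clip R v) \<le> R" "norm (clip R v) \<le> norm v"
    using assms by (auto simp: clip_def max_def field_simps)
  show "norm v \<le> R \<Longrightarrow> clip R v = v" using assms by (simp add: clip_def max_def)
  show "continuous_on UNIV (clip R)" unfolding clip_def[abs_def]
    using assms by (intro continuous_intros) (auto simp: max_def)
qed

definition cutoff :: "real \<Rightarrow> 'a::real_normed_vector \<Rightarrow> real" where
  "cutoff R x = max 0 (min 1 (R + 1 - norm x))"

lemma cutoff_props: "0 \<le> cutoff R x" "cutoff R x \<le> 1" "norm x \<le> R \<Longrightarrow> cutoff R x = 1" "norm x > R + 1 \<Longrightarrow> cutoff R x = 0"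
  "continuous_on UNIV (cutoff R)"
  by (auto simp: cutoff_def) (auto simp: cutoff_def[abs_def] intro!: continuous_intros)

text \<open>A measurable function is an almost everywhere limit of continuous ones. Truncating the values and
  the domain, first for \<open>f\<close> and then for the continuous approximants with the same bounds, makes both
  passages to the limit dominated.\<close>
lemma lebesgue_approx_continuous:
  fixes f :: "'a::euclidean_space \<Rightarrow> 'b::euclidean_space"
  assumes f: "sq_integrable lebesgue f" and e: "e > 0"
  obtains k R where "continuous_on UNIV k" "\<And>x. norm x > R \<Longrightarrow> k x = 0" "L2norm lebesgue (\<lambda>x. f x - k x) < e"
proof -
  have fm: "f \<in> borel_measurable lebesgue" using f by (simp add: sq_integrable_def)
  have "f measurable_on UNIV" using fm by (simp add: measurable_on_iff_borel_measurable lebesgue_on_UNIV_eq)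
  then obtain N g where N: "negligible N" "\<And>n. continuous_on UNIV (g n)" "\<And>x. x \<notin> N \<Longrightarrow> (\<lambda>n. g n x) \<longlonglongrightarrow> f x"
    unfolding measurable_on_def by auto
  have aeN: "AE x in lebesgue. x \<notin> N" using N(1) by (intro AE_not_in) (simp add: negligible_iff_null_sets)
  let ?F = "\<lambda>m x. cutoff (real (Suc m)) x *\<^sub>R clip (real (Suc m)) (f x)"
  have Fm: "?F m \<in> borel_measurable lebesgue" for m
    by (intro borel_measurable_scaleR cont_measurable cutoff_props borel_measurable_continuous_on[OF _ fm] clip_props) simp
  have Fb: "norm (?F m x) \<le> norm (f x)" for m x
    using mult_mono[OF cutoff_props(2)[of "real (Suc m)" x] clip_props(2)[of "real (Suc m)" "f x"]] cutoff_props(1)[of "real (Suc m)" x]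
    by simp
  have "(\<lambda>m. L2norm lebesgue (\<lambda>x. ?F m x - f x)) \<longlonglongrightarrow> 0"
  proof (rule L2_dominated[OF Fm fm])
    show "integrable lebesgue (\<lambda>x. (2 * norm (f x))\<^sup>2)" using f by (simp add: sq_integrable_def power_mult_distrib)
    show "AE x in lebesgue. norm (?F m x - f x) \<le> 2 * norm (f x)" for m
    proof (rule AE_I2)
      fix x show "norm (?F m x - f x) \<le> 2 * norm (f x)"
        using norm_triangle_ineq4[of "?F m x" "f x"] Fb[of m x] by linarith
    qed
    show "AE x in lebesgue. (\<lambda>m. ?F m x) \<longlonglongrightarrow> f x"
    proof (rule AE_I2)
      fix x
      obtain n0 where n0: "max (norm x) (norm (f x)) \<le> real n0" using real_arch_simple by blast
      have "eventually (\<lambda>m. f x = ?F m x) sequentially"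
      proof (rule eventually_sequentiallyI[of n0])
        fix m assume "n0 \<le> m"
        then have "norm x \<le> real (Suc m)" "norm (f x) \<le> real (Suc m)" using n0 by auto
        then show "f x = ?F m x" using cutoff_props(3) clip_props(3) by (metis of_nat_0_less_iff scaleR_one zero_less_Suc)
      qed
      then show "(\<lambda>m. ?F m x) \<longlonglongrightarrow> f x" by (rule Lim_transform_eventually[OF tendsto_const])
    qed
  qed
  then have "eventually (\<lambda>m. L2norm lebesgue (\<lambda>x. ?F m x - f x) < e / 2) sequentially"
    by (rule order_tendstoD) (use e in simp)
  then obtain m where m: "L2norm lebesgue (\<lambda>x. ?F m x - f x) < e / 2" by (auto simp: eventually_sequentially)
  define R where "R = real (Suc m)"
  have R: "R > 0" by (simp add: R_def)
  let ?k = "\<lambda>n x. cutoff R x *\<^sub>R clip R (g n x)"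
  have kc: "continuous_on UNIV (?k n)" for n
    by (intro continuous_intros cutoff_props continuous_on_compose2[OF clip_props(4)[OF R] N(2)]) auto
  have kz: "?k n x = 0" if "norm x > R + 1" for n x using cutoff_props(4)[OF that] by simp
  have kb: "norm (cutoff R x *\<^sub>R clip R v) \<le> R * indicator (cball 0 (R + 1)) x" for x :: 'a and v :: 'b
  proof (cases "norm x \<le> R + 1")
    case True
    then show ?thesis
      using mult_mono[OF cutoff_props(2)[of R x] clip_props(1)[OF R, of v]] cutoff_props(1)[of R x] R by simp
  next
    case False
    then show ?thesis using cutoff_props(4)[of R x] by simp
  qed
  have "(\<lambda>n. L2norm lebesgue (\<lambda>x. ?k n x - ?F m x)) \<longlonglongrightarrow> 0"
  proof (rule L2_dominated[OF cont_measurable[OF kc] Fm])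
    have "(\<lambda>x::'a. (2 * R * indicator (cball 0 (R+1)) x)\<^sup>2) = (\<lambda>x. (2 * R)\<^sup>2 * indicator (cball 0 (R+1)) x)"
      by (auto simp: indicator_def fun_eq_iff)
    moreover have "integrable lebesgue (\<lambda>x::'a. (2 * R)\<^sup>2 * indicator (cball 0 (R+1)) x)"
      using emeasure_bounded_finite[OF bounded_cball, of "0::'a" "R+1"]
      by (intro integrable_mult_right integrable_real_indicator) auto
    ultimately show "integrable lebesgue (\<lambda>x::'a. (2 * R * indicator (cball 0 (R+1)) x)\<^sup>2)" by simp
    show "AE x in lebesgue. norm (?k n x - ?F m x) \<le> 2 * R * indicator (cball 0 (R+1)) x" for n
    proof (rule AE_I2)
      fix x show "norm (?k n x - ?F m x) \<le> 2 * R * indicator (cball 0 (R+1)) x"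
        using norm_triangle_ineq4[of "?k n x" "?F m x"] kb[of x "g n x"] kb[of x "f x"] unfolding R_def by linarith
    qed
    show "AE x in lebesgue. (\<lambda>n. ?k n x) \<longlonglongrightarrow> ?F m x"
      using aeN
    proof eventually_elim
      case (elim x)
      have "isCont (clip R) (f x)" by (rule continuous_on_interior[OF clip_props(4)[OF R]]) simp
      then have "(\<lambda>n. clip R (g n x)) \<longlonglongrightarrow> clip R (f x)" using N(3)[OF elim] by (rule isCont_tendsto_compose)
      then show ?case unfolding R_def by (intro tendsto_scaleR tendsto_const)
    qed
  qed
  then have "eventually (\<lambda>n. L2norm lebesgue (\<lambda>x. ?k n x - ?F m x) < e / 2) sequentially"
    by (rule order_tendstoD) (use e in simp)
  then obtain n where n: "L2norm lebesgue (\<lambda>x. ?k n x - ?F m x) < e / 2" by (auto simp: eventually_sequentially)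
  have Fs: "sq_integrable lebesgue (?F m)" by (rule sq_integrable_bound[OF f Fm, where c=1]) (use Fb in simp)
  have ks: "sq_integrable lebesgue (?k n)" by (rule cs_sq_integrable[OF kc kz])
  have "L2norm lebesgue (\<lambda>x. f x - ?k n x) \<le> L2norm lebesgue (\<lambda>x. f x - ?F m x) + L2norm lebesgue (\<lambda>x. ?F m x - ?k n x)"
    by (rule L2norm_triangle3[OF f Fs ks])
  also have "\<dots> < e"
    using m n L2norm_commute[of lebesgue f "?F m"] L2norm_commute[of lebesgue "?F m" "?k n"] by linarith
  finally show ?thesis using that[OF kc[of n] kz[of _ n]] by blast
qed

lemma cs_uniformly_continuous:
  fixes f :: "'a::euclidean_space \<Rightarrow> 'b::euclidean_space"
  assumes c: "continuous_on UNIV f" and z: "\<And>x. norm x > R \<Longrightarrow> f x = 0" and e: "e > 0"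
  shows "\<exists>d>0. \<forall>x y. norm (y - x) < d \<longrightarrow> norm (f y - f x) < e"
proof -
  have "uniformly_continuous_on (cball 0 (R + 1)) f"
    by (intro compact_uniformly_continuous continuous_on_subset[OF c]) auto
  then obtain d where d: "d > 0" "\<And>x y. x \<in> cball 0 (R+1) \<Longrightarrow> y \<in> cball 0 (R+1) \<Longrightarrow> dist y x < d \<Longrightarrow> dist (f y) (f x) < e"
    using e unfolding uniformly_continuous_on_def by metis
  have "norm (f y - f x) < e" if xy: "norm (y - x) < min d 1" for x y
  proof (cases "norm x \<le> R + 1 \<and> norm y \<le> R + 1")
    case True
    then show ?thesis using d(2)[of x y] xy by (simp add: dist_norm)
  next
    case False
    have "norm y \<le> norm x + norm (y - x)" "norm x \<le> norm y + norm (y - x)"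
      using norm_triangle_sub[of y x] norm_triangle_sub[of x y] by (auto simp: norm_minus_commute)
    then have "norm x > R" "norm y > R" using False xy by auto
    then show ?thesis using z e by simp
  qed
  then show ?thesis using d(1) by (intro exI[of _ "min d 1"]) auto
qed

definition mollify :: "(real^3 \<Rightarrow> real) \<Rightarrow> (real^3 \<Rightarrow> 'b::euclidean_space) \<Rightarrow> real^3 \<Rightarrow> 'b" where
  "mollify \<rho> f x = (LINT y|lebesgue. \<rho> (x - y) *\<^sub>R f y)"

lemma mollify_integrable:
  fixes f :: "real^3 \<Rightarrow> 'b::euclidean_space"
  assumes \<rho>: "\<rho> \<in> test_functions UNIV" and f: "integrable lebesgue f"
  shows "integrable lebesgue (\<lambda>y. \<rho> (x - y) *\<^sub>R f y)"
proof -
  obtain B where B: "B > 0" "\<And>x. norm (\<rho> x) \<le> B" by (rule test_bounded[OF \<rho>]) (rule that)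
  have c: "continuous_on UNIV (\<lambda>y. \<rho> (x - y))"
    by (intro continuous_on_compose2[OF test_continuous[OF \<rho>]] continuous_intros) auto
  have nf: "integrable lebesgue (\<lambda>y. B * norm (f y))" using f by (intro integrable_mult_right integrable_norm)
  show ?thesis
  proof (rule Bochner_Integration.integrable_bound[OF nf])
    show "AE y in lebesgue. norm (\<rho> (x - y) *\<^sub>R f y) \<le> norm (B * norm (f y))"
      using B by (intro AE_I2) (simp add: mult_right_mono)
  qed (intro borel_measurable_scaleR cont_measurable c borel_measurable_integrable f)
qed

text \<open>The partial derivatives are uniformly continuous, so the remainder is small uniformly in the base
  point. This is what justifies differentiation under the integral in a convolution.\<close>
lemma taylor_uniform:
  fixes \<rho> :: "real^3 \<Rightarrow> real"
  assumes \<rho>: "\<rho> \<in> test_functions UNIV" and e: "e > 0"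
  shows "\<exists>d>0. \<forall>z h. norm h < d \<longrightarrow> \<bar>\<rho> (z + h) - \<rho> z - (\<Sum>i\<in>UNIV. h $ i * partial i \<rho> z)\<bar> \<le> e * norm h"
proof -
  have "\<exists>d>0. \<forall>x y. norm (y - x) < d \<longrightarrow> norm (partial i \<rho> y - partial i \<rho> x) < e / 3" for i
  proof -
    have t: "partial i \<rho> \<in> test_functions UNIV" by (rule test_partial[OF \<rho>])
    obtain R where R: "\<And>x. norm x > R \<Longrightarrow> partial i \<rho> x = 0" by (rule test_supp_bound[OF t]) (rule that)
    show ?thesis by (rule cs_uniformly_continuous[OF test_continuous[OF t] R]) (use e in auto)
  qed
  then obtain D where D: "\<And>i. D i > 0" "\<And>i x y. norm (y - x) < D i \<Longrightarrow> norm (partial i \<rho> y - partial i \<rho> x) < e / 3"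
    by metis
  define d where "d = Min (range D)"
  have d: "d > 0" "\<And>i. d \<le> D i" using D(1) by (auto simp: d_def)
  have "\<bar>\<rho> (z + h) - \<rho> z - (\<Sum>i\<in>UNIV. h $ i * partial i \<rho> z)\<bar> \<le> e * norm h" if h: "norm h < d" for z h
  proof -
    let ?L = "\<lambda>y k. (\<Sum>i\<in>UNIV. k $ i * partial i \<rho> y)"
    let ?g = "\<lambda>y. \<rho> y - ?L z y"
    have der: "(?g has_derivative (\<lambda>k. ?L y k - ?L z k)) (at y within ball z d)" for y
    proof (rule has_derivative_at_withinI, rule has_derivative_diff)
      show "(\<rho> has_derivative ?L y) (at y)"
        using has_derivative_partial[OF smooth_differentiable[OF test_smooth[OF \<rho>]]] by simp
      show "(?L z has_derivative ?L z) (at y)"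
        by (intro has_derivative_sum has_derivative_mult_left bounded_linear_imp_has_derivative bounded_linear_vec_nth)
    qed
    have on: "onorm (\<lambda>k. ?L y k - ?L z k) \<le> e" if y: "y \<in> ball z d" for y
    proof (rule onorm_le)
      fix k :: "real^3"
      have "norm (?L y k - ?L z k) = norm (\<Sum>i\<in>UNIV. k $ i * (partial i \<rho> y - partial i \<rho> z))"
        by (simp add: sum_subtractf algebra_simps)
      also have "\<dots> \<le> (\<Sum>i\<in>UNIV. norm (k $ i * (partial i \<rho> y - partial i \<rho> z)))" by (rule norm_sum)
      also have "\<dots> \<le> (\<Sum>i\<in>(UNIV::3 set). norm k * (e / 3))"
      proof (rule sum_mono)
        fix i :: 3
        have "norm (y - z) < D i" using y d(2)[of i] by (simp add: dist_norm norm_minus_commute)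
        then have "\<bar>partial i \<rho> y - partial i \<rho> z\<bar> \<le> e / 3" using D(2)[of y z i] by simp
        then show "norm (k $ i * (partial i \<rho> y - partial i \<rho> z)) \<le> norm k * (e / 3)"
          unfolding norm_mult using component_le_norm_cart[of k i] by (intro mult_mono) auto
      qed
      also have "\<dots> = e * norm k" by simp
      finally show "norm (?L y k - ?L z k) \<le> e * norm k" .
    qed
    have "norm (?g (z + h) - ?g z) \<le> e * norm ((z + h) - z)"
      by (rule differentiable_bound[OF convex_ball der on]) (use h d in \<open>auto simp: dist_norm\<close>)
    then show ?thesis by (simp add: sum.distrib algebra_simps)
  qed
  then show ?thesis using d(1) by blast
qed

lemma mollify_has_derivative:
  assumes \<rho>: "\<rho> \<in> test_functions UNIV" and f: "integrable lebesgue f"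
  shows "(mollify \<rho> f has_derivative (\<lambda>h. \<Sum>i\<in>UNIV. (h $ i) *\<^sub>R mollify (partial i \<rho>) f x)) (at x)"
  unfolding has_derivative_at
proof (intro conjI)
  show "bounded_linear (\<lambda>h::real^3. \<Sum>i\<in>UNIV. (h $ i) *\<^sub>R mollify (partial i \<rho>) f x)"
    by (intro bounded_linear_sum bounded_linear_compose[OF bounded_linear_scaleR_left bounded_linear_vec_nth])
  define I where "I = (LINT y|lebesgue. norm (f y))"
  have I: "I \<ge> 0" by (simp add: I_def)
  let ?r = "\<lambda>h. norm (mollify \<rho> f (x + h) - mollify \<rho> f x - (\<Sum>i\<in>UNIV. (h $ i) *\<^sub>R mollify (partial i \<rho>) f x))"
  show "(\<lambda>h. ?r h / norm h) \<midarrow>0\<rightarrow> 0"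
  proof (rule LIM_I)
    fix e :: real assume e: "e > 0"
    define e' where "e' = e / (2 * (I + 1))"
    have "0 < I + 1" using I by linarith
    then have e': "e' > 0" unfolding e'_def using e by simp
    obtain d where d: "d > 0" "\<And>z h. norm h < d \<Longrightarrow> \<bar>\<rho> (z + h) - \<rho> z - (\<Sum>i\<in>UNIV. h $ i * partial i \<rho> z)\<bar> \<le> e' * norm h"
      using taylor_uniform[OF \<rho> e'] by blast
    have "norm (?r h / norm h - 0) < e" if h: "h \<noteq> 0" "norm h < d" for h
    proof -
      let ?R = "\<lambda>y. \<rho> (x - y + h) - \<rho> (x - y) - (\<Sum>i\<in>UNIV. h $ i * partial i \<rho> (x - y))"
      have i1: "integrable lebesgue (\<lambda>y. \<rho> (x + h - y) *\<^sub>R f y)" "integrable lebesgue (\<lambda>y. \<rho> (x - y) *\<^sub>R f y)"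
        "integrable lebesgue (\<lambda>y. partial i \<rho> (x - y) *\<^sub>R f y)" for i
        by (intro mollify_integrable \<rho> test_partial f)+
      have "mollify \<rho> f (x + h) - mollify \<rho> f x - (\<Sum>i\<in>UNIV. (h $ i) *\<^sub>R mollify (partial i \<rho>) f x) = (LINT y|lebesgue. ?R y *\<^sub>R f y)"
      proof -
        have "(LINT y|lebesgue. ?R y *\<^sub>R f y) = (LINT y|lebesgue. \<rho> (x + h - y) *\<^sub>R f y - \<rho> (x - y) *\<^sub>R f y - (\<Sum>i\<in>UNIV. (h $ i) *\<^sub>R (partial i \<rho> (x - y) *\<^sub>R f y)))"
          by (intro Bochner_Integration.integral_cong refl) (simp add: scaleR_left_diff_distrib scaleR_sum_left add_diff_eq diff_add_eq)
        also have "\<dots> = mollify \<rho> f (x + h) - mollify \<rho> f x - (\<Sum>i\<in>UNIV. (h $ i) *\<^sub>R mollify (partial i \<rho>) f x)"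
          unfolding mollify_def using i1 by (simp del: scaleR_scaleR)
        finally show ?thesis by simp
      qed
      then have "?r h = norm (LINT y|lebesgue. ?R y *\<^sub>R f y)" by simp
      also have "\<dots> \<le> (LINT y|lebesgue. (e' * norm h) * norm (f y))"
      proof (rule Bochner_Integration.integral_norm_bound_integral)
        show "integrable lebesgue (\<lambda>y. ?R y *\<^sub>R f y)"
        proof -
          have "integrable lebesgue (\<lambda>y. \<rho> (x + h - y) *\<^sub>R f y - \<rho> (x - y) *\<^sub>R f y - (\<Sum>i\<in>UNIV. (h $ i) *\<^sub>R (partial i \<rho> (x - y) *\<^sub>R f y)))"
            using i1 by (intro Bochner_Integration.integrable_diff Bochner_Integration.integrable_sum integrable_scaleR_right) auto
          then show ?thesis by (simp add: scaleR_left_diff_distrib scaleR_sum_left add_diff_eq diff_add_eq)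
        qed
        show "integrable lebesgue (\<lambda>y. (e' * norm h) * norm (f y))" using f by simp
        show "norm (?R y *\<^sub>R f y) \<le> (e' * norm h) * norm (f y)" for y
          using mult_right_mono[OF d(2)[OF h(2), of "x - y"], of "norm (f y)"] by simp
      qed
      also have "\<dots> = e' * norm h * I" using f by (simp add: I_def)
      finally have "?r h / norm h \<le> e' * I" using h(1) by (simp add: divide_le_eq mult.commute mult.left_commute)
      also have "\<dots> < e"
        using e I unfolding e'_def by (simp add: field_simps) (smt (verit) mult_nonneg_nonneg)
      finally show ?thesis by simp
    qed
    then show "\<exists>s>0. \<forall>h. h \<noteq> 0 \<and> norm (h - 0) < s \<longrightarrow> norm (?r h / norm h - 0) < e"
      using d(1) by auto
  qed
qed

lemma partial_mollify:
  assumes \<rho>: "\<rho> \<in> test_functions UNIV" and f: "integrable lebesgue f"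
  shows "partial i (mollify \<rho> f) = mollify (partial i \<rho>) f"
proof
  fix x
  have "partial i (mollify \<rho> f) x = (\<Sum>j\<in>UNIV. (axis i 1 $ j) *\<^sub>R mollify (partial j \<rho>) f x)"
    by (rule partial_eqI[OF mollify_has_derivative[OF assms]])
  then show "partial i (mollify \<rho> f) x = mollify (partial i \<rho>) f x"
    by (simp add: axis_def if_distrib[of "\<lambda>z. z *\<^sub>R _"] cong: if_cong)
qed

lemma smooth_mollify:
  assumes \<rho>: "\<rho> \<in> test_functions UNIV" and f: "integrable lebesgue f"
  shows "smooth (mollify \<rho> f)"
proof -
  have "\<rho> \<in> test_functions UNIV \<Longrightarrow> C_order k (mollify \<rho> f)" for k \<rho>
  proof (induction k arbitrary: \<rho>)
    case 0
    then show ?case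
      using has_derivative_continuous[OF mollify_has_derivative[OF 0 f]] by (simp add: continuous_at_imp_continuous_on)
  next
    case (Suc k)
    then show ?case
      using mollify_has_derivative[OF Suc.prems f] Suc.IH[OF test_partial[OF Suc.prems]]
      by (auto simp: partial_mollify[OF Suc.prems f] differentiable_def)
  qed
  then show ?thesis using \<rho> by (simp add: smooth_def)
qed

lemma mollify_support:
  assumes "\<And>x. norm x > r \<Longrightarrow> \<rho> x = 0" "\<And>x. norm x > R \<Longrightarrow> f x = 0" "norm x > r + R"
  shows "mollify \<rho> f x = 0"
proof -
  have "\<rho> (x - y) *\<^sub>R f y = 0" for y
  proof (cases "norm y > R")
    case True then show ?thesis using assms(2) by simp
  next
    case False
    then have "norm (x - y) > r" using norm_triangle_ineq2[of x y] assms(3) by simp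
    then show ?thesis using assms(1) by simp
  qed
  then show ?thesis unfolding mollify_def by (simp only: integral_zero)
qed

lemma test_mollify:
  assumes \<rho>: "\<rho> \<in> test_functions UNIV" and f: "integrable lebesgue f" and z: "\<And>x. norm x > R \<Longrightarrow> f x = 0"
  shows "mollify \<rho> f \<in> test_functions UNIV"
proof -
  obtain r where r: "\<And>x. norm x > r \<Longrightarrow> \<rho> x = 0" by (rule test_supp_bound[OF \<rho>]) (rule that)
  show ?thesis
    by (rule test_UNIV_I[OF smooth_mollify[OF \<rho> f], of "r + R"]) (rule mollify_support[OF r z])
qed

lemma lebesgue_preserving_flip: "lebesgue_preserving (\<lambda>y. b - y)"
proof -
  have "(\<lambda>x. b + (\<Sum>j\<in>Basis. (- 1 * (x \<bullet> j)) *\<^sub>R j)) = (\<lambda>x. b - x)"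
    by (simp add: sum_negf euclidean_representation)
  then show ?thesis
    using lebesgue_affine_euclidean[of "\<lambda>_. -1" b] lebesgue_affine_measurable[of "\<lambda>_. -1" b]
    unfolding lebesgue_preserving_def by (simp add: density_1)
qed

lemma test_flip: "\<rho> \<in> test_functions UNIV \<Longrightarrow> (\<lambda>y. \<rho> (x - y)) \<in> test_functions UNIV"
proof -
  assume a: "\<rho> \<in> test_functions UNIV"
  then obtain R where R: "\<And>x. norm x > R \<Longrightarrow> \<rho> x = 0" using test_supp_bound by metis
  show ?thesis
  proof (rule test_UNIV_I)
    show "smooth (\<lambda>y. \<rho> (x - y))"
      using smooth_affine[OF test_smooth[OF a] bounded_linear_minus[OF bounded_linear_ident], of x] by simp
    show "\<rho> (x - y) = 0" if "norm y > R + norm x" for y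
      using norm_triangle_ineq2[of y x] that by (intro R) (simp add: norm_minus_commute)
  qed
qed

lemma partial_flip:
  assumes "\<rho> \<in> test_functions UNIV"
  shows "partial i (\<lambda>y. \<rho> (x - y)) y = - partial i \<rho> (x - y)"
  using partial_affine_comp[OF bounded_linear_minus[OF bounded_linear_ident], of \<rho> y x i]
    smooth_differentiable[OF test_smooth[OF assms]]
  by (simp add: axis_def if_distrib[of "\<lambda>z. z *\<^sub>R _"] if_distrib[of "\<lambda>z. z * _"] if_distrib[of uminus] cong: if_cong)

text \<open>Averages do not increase the norm: Jensen's inequality for the probability density \<open>\<rho>\<close>, then
  Tonelli's theorem, applied to a Borel representative of \<open>\<bar>f\<bar>\<^sup>2\<close>.\<close>
lemma mollify_L2_bound:
  assumes \<rho>: "\<rho> \<in> test_functions UNIV" "\<And>x. \<rho> x \<ge> 0" "(LINT x|lebesgue. \<rho> x) = 1"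
    and f: "integrable lebesgue f" "sq_integrable lebesgue f"
  shows "sq_integrable lebesgue (mollify \<rho> f)" "L2norm lebesgue (mollify \<rho> f) \<le> L2norm lebesgue f"
proof -
  have cm: "continuous_on UNIV (mollify \<rho> f)" by (rule smooth_continuous[OF smooth_mollify[OF \<rho>(1) f(1)]])
  have cr: "continuous_on UNIV \<rho>" by (rule test_continuous[OF \<rho>(1)])
  have f2: "(\<lambda>y. (norm (f y))\<^sup>2) \<in> borel_measurable lebesgue" "integrable lebesgue (\<lambda>y. (norm (f y))\<^sup>2)"
    using f(2) by (auto simp: sq_integrable_def)
  obtain g where g: "g \<in> borel_measurable lborel" "AE y in lborel. (norm (f y))\<^sup>2 = g y"
    using completion_ex_borel_measurable_real[OF f2(1)] by blast
  have gnn: "AE y in lborel. 0 \<le> g y" using g(2) by eventually_elim (metis zero_le_power2)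
  have int1: "(LINT y|lebesgue. \<rho> (x - y)) = 1" for x
    using preserving_integral[OF lebesgue_preserving_flip cont_measurable[OF cr], of x] \<rho>(3) by simp
  have int2: "(LINT x|lebesgue. \<rho> (x - y)) = 1" for y
    using preserving_integral[OF lebesgue_preserving_translation cont_measurable[OF cr], of "- y"] \<rho>(3) by simp
  have ti: "integrable lebesgue (\<lambda>x. \<rho> (x - y))" for y
    using test_integrable[OF test_translate[OF \<rho>(1), of "- y"]] by simp
  have pt: "ennreal ((norm (mollify \<rho> f x))\<^sup>2) \<le> (\<integral>\<^sup>+y. ennreal (\<rho> (x - y) * g y) \<partial>lborel)" for x
  proof -
    let ?s = "\<lambda>y. sqrt (\<rho> (x - y))"
    have cs: "continuous_on UNIV ?s" by (intro continuous_intros continuous_on_compose2[OF cr]) auto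
    obtain B where B: "B > 0" "\<And>x. norm (\<rho> x) \<le> B" by (rule test_bounded[OF \<rho>(1)]) (rule that)
    have s1: "sq_integrable lebesgue ?s"
      using test_integrable[OF test_flip[OF \<rho>(1)]] \<rho>(2) cont_measurable[OF cs] by (simp add: sq_integrable_def)
    have s2: "sq_integrable lebesgue (\<lambda>y. ?s y *\<^sub>R f y)"
    proof (rule sq_integrable_bound[OF f(2), of _ "sqrt B"])
      show "(\<lambda>y. ?s y *\<^sub>R f y) \<in> borel_measurable lebesgue"
        by (intro borel_measurable_scaleR cont_measurable cs sq_integrable_meas f)
      show "AE y in lebesgue. norm (?s y *\<^sub>R f y) \<le> sqrt B * norm (f y)"
        using B \<rho>(2) by (intro AE_I2) (simp add: mult_right_mono)
    qed
    have sqf: "(norm (?s y *\<^sub>R f y))\<^sup>2 = \<rho> (x - y) * (norm (f y))\<^sup>2" for y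
      using \<rho>(2) by (simp add: power_mult_distrib)
    have "norm (mollify \<rho> f x) \<le> (LINT y|lebesgue. norm (?s y) * norm (?s y *\<^sub>R f y))"
      unfolding mollify_def using integral_norm_bound[of lebesgue "\<lambda>y. \<rho> (x - y) *\<^sub>R f y"] \<rho>(2)
      by (simp add: mult.assoc[symmetric])
    also have "\<dots> \<le> L2norm lebesgue ?s * L2norm lebesgue (\<lambda>y. ?s y *\<^sub>R f y)"
      by (rule L2norm_Cauchy_Schwarz[OF s1 s2])
    also have "L2norm lebesgue ?s = 1" using int1[of x] \<rho>(2) by (simp add: L2norm_def)
    finally have "norm (mollify \<rho> f x) \<le> L2norm lebesgue (\<lambda>y. ?s y *\<^sub>R f y)" by simp
    then have "(norm (mollify \<rho> f x))\<^sup>2 \<le> (L2norm lebesgue (\<lambda>y. ?s y *\<^sub>R f y))\<^sup>2" by (intro power_mono) auto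
    also have "\<dots> = (LINT y|lebesgue. \<rho> (x - y) * (norm (f y))\<^sup>2)" unfolding L2norm_square sqf ..
    finally have "ennreal ((norm (mollify \<rho> f x))\<^sup>2) \<le> ennreal (LINT y|lebesgue. \<rho> (x - y) * (norm (f y))\<^sup>2)"
      by (rule ennreal_leI)
    also have "\<dots> = (\<integral>\<^sup>+y. ennreal (\<rho> (x - y) * (norm (f y))\<^sup>2) \<partial>lebesgue)"
      using s2 \<rho>(2) unfolding sq_integrable_def sqf by (subst nn_integral_eq_integral) auto
    also have "\<dots> = (\<integral>\<^sup>+y. ennreal (\<rho> (x - y) * (norm (f y))\<^sup>2) \<partial>lborel)" by (rule nn_integral_completion)
    also have "\<dots> = (\<integral>\<^sup>+y. ennreal (\<rho> (x - y) * g y) \<partial>lborel)"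
      by (rule nn_integral_cong_AE) (use g(2) in eventually_elim, simp)
    finally show ?thesis .
  qed
  have mj: "(\<lambda>(x, y). ennreal (\<rho> (x - y) * g y)) \<in> borel_measurable (lborel \<Otimes>\<^sub>M lborel)"
  proof -
    have "(\<lambda>z. \<rho> (fst z - snd z)) \<in> borel_measurable (lborel \<Otimes>\<^sub>M lborel)"
      using borel_measurable_continuous_onI[of "\<lambda>z::(real^3)\<times>(real^3). \<rho> (fst z - snd z)"]
      by (simp add: lborel_prod continuous_on_compose2[OF cr] continuous_intros)
    moreover have "(\<lambda>z. g (snd z)) \<in> borel_measurable (lborel \<Otimes>\<^sub>M lborel)"
      using g(1) by measurable
    ultimately have "(\<lambda>z. \<rho> (fst z - snd z) * g (snd z)) \<in> borel_measurable (lborel \<Otimes>\<^sub>M lborel)"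
      by (rule borel_measurable_times)
    from measurable_compose[OF this measurable_ennreal] show ?thesis by (simp add: case_prod_beta')
  qed
  have "(\<integral>\<^sup>+x. ennreal ((norm (mollify \<rho> f x))\<^sup>2) \<partial>lborel) \<le> (\<integral>\<^sup>+x. (\<integral>\<^sup>+y. ennreal (\<rho> (x - y) * g y) \<partial>lborel) \<partial>lborel)"
    by (intro nn_integral_mono pt)
  also have "\<dots> = (\<integral>\<^sup>+y. (\<integral>\<^sup>+x. ennreal (\<rho> (x - y) * g y) \<partial>lborel) \<partial>lborel)"
    using lborel_pair.Fubini[OF mj] by simp
  also have "\<dots> = (\<integral>\<^sup>+y. ennreal (g y) \<partial>lborel)"
  proof (rule nn_integral_cong_AE, use gnn in eventually_elim)
    case (elim y)
    have "(\<integral>\<^sup>+x. ennreal (\<rho> (x - y) * g y) \<partial>lborel) = (\<integral>\<^sup>+x. ennreal (\<rho> (x - y) * g y) \<partial>lebesgue)"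
      by (rule nn_integral_completion[symmetric])
    also have "\<dots> = ennreal (LINT x|lebesgue. \<rho> (x - y) * g y)"
      using ti[of y] \<rho>(2) elim by (subst nn_integral_eq_integral) auto
    also have "\<dots> = ennreal (g y)" using int2[of y] by simp
    finally show ?case .
  qed
  also have "\<dots> = (\<integral>\<^sup>+y. ennreal ((norm (f y))\<^sup>2) \<partial>lborel)"
    by (rule nn_integral_cong_AE) (use g(2) in eventually_elim, simp)
  also have "\<dots> = (\<integral>\<^sup>+y. ennreal ((norm (f y))\<^sup>2) \<partial>lebesgue)" by (rule nn_integral_completion[symmetric])
  also have "\<dots> = ennreal (LINT y|lebesgue. (norm (f y))\<^sup>2)" using f2 by (subst nn_integral_eq_integral) auto
  finally have le: "(\<integral>\<^sup>+x. ennreal ((norm (mollify \<rho> f x))\<^sup>2) \<partial>lebesgue) \<le> ennreal (LINT y|lebesgue. (norm (f y))\<^sup>2)"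
    by (simp add: nn_integral_completion)
  have mm: "mollify \<rho> f \<in> borel_measurable lebesgue" by (rule cont_measurable[OF cm])
  have mi: "integrable lebesgue (\<lambda>x. (norm (mollify \<rho> f x))\<^sup>2)"
    using le mm by (intro integrableI_bounded) (auto intro: le_less_trans)
  then show "sq_integrable lebesgue (mollify \<rho> f)" using mm by (simp add: sq_integrable_def)
  have "ennreal (LINT x|lebesgue. (norm (mollify \<rho> f x))\<^sup>2) \<le> ennreal (LINT y|lebesgue. (norm (f y))\<^sup>2)"
    using le by (subst (asm) nn_integral_eq_integral[OF mi]) auto
  then have "(LINT x|lebesgue. (norm (mollify \<rho> f x))\<^sup>2) \<le> (LINT y|lebesgue. (norm (f y))\<^sup>2)"
    by (subst (asm) ennreal_le_iff) auto
  then show "L2norm lebesgue (mollify \<rho> f) \<le> L2norm lebesgue f"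
    unfolding L2norm_def by (rule real_sqrt_le_mono)
qed

text \<open>The kernels are normalised bumps on the cubes with corners \<open>\<plusminus>moll_corner n\<close>. Cubes centred at the
  origin are invariant under the reflection, hence so are the kernels.\<close>
definition moll_corner :: "nat \<Rightarrow> real^3" where
  "moll_corner n = (\<chi> i. inverse (real (Suc n)))"

definition moll_kernel :: "nat \<Rightarrow> real^3 \<Rightarrow> real" where
  "moll_kernel n x = box_bump 1 (- moll_corner n) (moll_corner n) x / (LINT x|lebesgue. box_bump 1 (- moll_corner n) (moll_corner n) x)"

lemma moll_kernel_props:
  shows "moll_kernel n \<in> test_functions UNIV" "moll_kernel n x \<ge> 0" "(LINT x|lebesgue. moll_kernel n x) = 1"
    "norm x > 3 * inverse (real (Suc n)) \<Longrightarrow> moll_kernel n x = 0" "moll_kernel n (reflect x) = moll_kernel n x"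
proof -
  let ?c = "moll_corner n" and ?b = "box_bump 1 (- moll_corner n) (moll_corner n)"
  have z: "?b x = 0" if "norm x > 3 * inverse (real (Suc n))" for x
  proof (rule box_bump_zero)
    show "x \<notin> box (- ?c) ?c"
    proof
      assume "x \<in> box (- ?c) ?c"
      then have "\<bar>x $ i\<bar> \<le> inverse (real (Suc n))" for i
        by (simp add: mem_box_cart moll_corner_def abs_le_iff del: of_nat_Suc) (smt (verit))
      then have "norm x \<le> (\<Sum>i\<in>(UNIV::3 set). inverse (real (Suc n)))"
        using norm_le_l1_cart[of x] sum_mono[of UNIV "\<lambda>i. \<bar>x $ i\<bar>" "\<lambda>i. inverse (real (Suc n))"] by simp
      then show False using that by simp
    qed
  qed simp
  have t: "?b \<in> test_functions UNIV" by (rule test_UNIV_I[OF smooth_box_bump z])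
  have nn: "?b x \<ge> 0" for x by (rule box_bump_bounds)
  have "(LINT x|lebesgue. ?b x) \<noteq> 0"
  proof
    assume "(LINT x|lebesgue. ?b x) = 0"
    then have "AE x in lebesgue. ?b x = 0"
      using integral_nonneg_eq_0_iff_AE[OF test_integrable[OF t]] nn by simp
    then have "AE x in lebesgue. x \<notin> box (- ?c) ?c"
      by eventually_elim (use box_bump_pos[of 1] in force)
    then have "box (- ?c) ?c \<in> null_sets lebesgue" by (subst AE_iff_null_sets) auto
    then have "negligible (box (- ?c) ?c)" by (simp add: negligible_iff_null_sets)
    then have "box (- ?c) ?c = {}" by (meson open_box open_not_negligible)
    moreover have "0 \<in> box (- ?c) ?c" by (simp add: mem_box_cart moll_corner_def)
    ultimately show False by blast
  qed
  then have pos: "(LINT x|lebesgue. ?b x) > 0" using nn by (simp add: less_le)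
  show "moll_kernel n \<in> test_functions UNIV"
    using test_scale[OF t, of "1 / (LINT x|lebesgue. ?b x)"] unfolding moll_kernel_def[abs_def] by simp
  show "moll_kernel n x \<ge> 0" unfolding moll_kernel_def using nn pos by simp
  show "(LINT x|lebesgue. moll_kernel n x) = 1" unfolding moll_kernel_def using pos by simp
  show "norm x > 3 * inverse (real (Suc n)) \<Longrightarrow> moll_kernel n x = 0" unfolding moll_kernel_def using z by simp
  have "?b (reflect x) = ?b x"
    unfolding box_bump_def by (intro prod.cong refl) (auto simp: moll_corner_def algebra_simps)
  then show "moll_kernel n (reflect x) = moll_kernel n x" unfolding moll_kernel_def by simp
qed

lemma mollify_diff:
  assumes "\<rho> \<in> test_functions UNIV" "integrable lebesgue f" "integrable lebesgue g"
  shows "mollify \<rho> (\<lambda>x. f x - g x) x = mollify \<rho> f x - mollify \<rho> g x"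
  unfolding mollify_def using mollify_integrable[OF assms(1,2)] mollify_integrable[OF assms(1,3)]
  by (simp add: scaleR_diff_right)

text \<open>Mollification is a contraction, so it suffices to approximate \<open>f\<close> by a continuous function \<open>k\<close>
  with bounded support; for \<open>k\<close> the convergence is uniform and takes place on a fixed ball.\<close>
lemma mollify_L2_lim:
  fixes f :: "real^3 \<Rightarrow> 'b::euclidean_space"
  assumes f: "integrable lebesgue f" "sq_integrable lebesgue f"
  shows "(\<lambda>n. L2norm lebesgue (\<lambda>x. mollify (moll_kernel n) f x - f x)) \<longlonglongrightarrow> 0"
proof (rule LIMSEQ_I)
  fix e :: real assume e: "e > 0"
  obtain k R where k: "continuous_on UNIV k" "\<And>x. norm x > R \<Longrightarrow> k x = 0" "L2norm lebesgue (\<lambda>x. f x - k x) < e / 3"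
    by (rule lebesgue_approx_continuous[OF f(2), of "e / 3"]) (use e in simp, rule that)
  have ki: "integrable lebesgue k" "sq_integrable lebesgue k"
    using cs_integrable[OF k(1,2)] cs_sq_integrable[OF k(1,2)] by auto
  define W where "W = sqrt (LINT x|lebesgue. indicator (cball (0::real^3) (R + 3)) x)"
  have W: "W \<ge> 0" by (simp add: W_def)
  define d where "d = e / (3 * (W + 1))"
  have d: "d > 0" "d * W < e / 3"
    using e W by (auto simp: d_def field_simps)
  obtain s where s: "s > 0" "\<And>x y. norm (y - x) < s \<Longrightarrow> norm (k y - k x) < d"
    using cs_uniformly_continuous[OF k(1,2) d(1)] by blast
  have "(\<lambda>n. 3 * inverse (real (Suc n))) \<longlonglongrightarrow> 3 * 0" by (intro tendsto_intros LIMSEQ_inverse_real_of_nat)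
  then have "eventually (\<lambda>n. 3 * inverse (real (Suc n)) < s) sequentially"
    by (intro order_tendstoD) (use s in auto)
  then obtain n0 where n0: "\<And>n. n \<ge> n0 \<Longrightarrow> 3 * inverse (real (Suc n)) < s" by (auto simp: eventually_sequentially)
  have "L2norm lebesgue (\<lambda>x. mollify (moll_kernel n) f x - f x) < e" if n: "n \<ge> n0" for n
  proof -
    let ?r = "moll_kernel n"
    note r = moll_kernel_props[of n]
    have fk: "integrable lebesgue (\<lambda>x. f x - k x)" "sq_integrable lebesgue (\<lambda>x. f x - k x)"
      using f ki by (auto intro: sq_integrable_diff)
    have mk: "sq_integrable lebesgue (mollify ?r k)" "sq_integrable lebesgue (mollify ?r f)"
      "sq_integrable lebesgue (mollify ?r (\<lambda>x. f x - k x))"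
      by (intro mollify_L2_bound(1) r f ki fk)+
    have b1: "L2norm lebesgue (\<lambda>x. mollify ?r f x - mollify ?r k x) < e / 3"
      using mollify_L2_bound(2)[OF r(1-3) fk] k(3)
      unfolding mollify_diff[OF r(1) f(1) ki(1), abs_def] by linarith
    have pt: "norm (mollify ?r k x - k x) \<le> norm (d * indicator (cball 0 (R + 3)) x :: real)" for x
    proof (cases "norm x \<le> R + 3")
      case True
      have i1: "integrable lebesgue (\<lambda>y. ?r (x - y))" by (rule test_integrable[OF test_flip[OF r(1)]])
      have int1: "(LINT y|lebesgue. ?r (x - y)) = 1"
        using preserving_integral[OF lebesgue_preserving_flip cont_measurable[OF test_continuous[OF r(1)]], of x] r(3) by simp
      have "mollify ?r k x - k x = (LINT y|lebesgue. ?r (x - y) *\<^sub>R k y) - (LINT y|lebesgue. ?r (x - y) *\<^sub>R k x)"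
        using i1 int1 by (simp add: mollify_def)
      also have "\<dots> = (LINT y|lebesgue. ?r (x - y) *\<^sub>R (k y - k x))"
        using mollify_integrable[OF r(1) ki(1), of x] i1 by (simp add: scaleR_diff_right)
      also have "norm \<dots> \<le> (LINT y|lebesgue. ?r (x - y) * d)"
      proof (rule Bochner_Integration.integral_norm_bound_integral)
        show "integrable lebesgue (\<lambda>y. ?r (x - y) *\<^sub>R (k y - k x))"
          using mollify_integrable[OF r(1) ki(1), of x] i1 by (simp add: scaleR_diff_right)
        show "integrable lebesgue (\<lambda>y. ?r (x - y) * d)" using i1 by simp
        fix y
        show "norm (?r (x - y) *\<^sub>R (k y - k x)) \<le> ?r (x - y) * d"
        proof (cases "norm (x - y) > 3 * inverse (real (Suc n))")
          case True then show ?thesis using r(4) by simp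
        next
          case False
          then have "norm (y - x) < s" using n0[OF n] by (simp add: norm_minus_commute)
          then have "norm (k y - k x) \<le> d" using s(2) by (simp add: less_imp_le)
          then show ?thesis using r(2) by (simp add: mult_left_mono)
        qed
      qed
      also have "\<dots> = d" using int1 by simp
      finally show ?thesis using True d(1) by simp
    next
      case False
      have "3 * inverse (real (Suc n)) \<le> 3" by (simp add: inverse_le_1_iff)
      then have "norm x > 3 * inverse (real (Suc n)) + R" using False by simp
      then have "mollify ?r k x = 0"
        by (intro mollify_support[where r="3 * inverse (real (Suc n))" and R=R]) (simp_all add: r(4) k(2) del: of_nat_Suc)
      moreover have "k x = 0" using False by (intro k(2)) simp
      ultimately show ?thesis using False by simp
    qed
    have fin: "integrable lebesgue (indicator (cball (0::real^3) (R + 3)) :: _ \<Rightarrow> real)"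
      using emeasure_bounded_finite[OF bounded_cball, of "0::real^3" "R+3"] by (intro integrable_real_indicator) auto
    have eqI: "(norm (d * indicator (cball 0 (R + 3)) x))\<^sup>2 = d\<^sup>2 * indicator (cball (0::real^3) (R + 3)) x" for x
      by (auto simp: indicator_def)
    have si: "sq_integrable lebesgue (\<lambda>x. d * indicator (cball (0::real^3) (R + 3)) x)"
      unfolding sq_integrable_def eqI using fin by auto
    have "L2norm lebesgue (\<lambda>x. mollify ?r k x - k x) \<le> L2norm lebesgue (\<lambda>x. d * indicator (cball (0::real^3) (R + 3)) x)"
      by (rule L2norm_mono[OF si sq_integrable_meas[OF sq_integrable_diff[OF mk(1) ki(2)]]]) (use pt in simp)
    also have "\<dots> = d * W"
      unfolding L2norm_def eqI W_def using d(1) by (simp add: real_sqrt_mult)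
    finally have b2: "L2norm lebesgue (\<lambda>x. mollify ?r k x - k x) < e / 3" using d(2) by simp
    have "L2norm lebesgue (\<lambda>x. mollify ?r f x - f x) \<le>
      L2norm lebesgue (\<lambda>x. mollify ?r f x - mollify ?r k x) + L2norm lebesgue (\<lambda>x. mollify ?r k x - f x)"
      by (rule L2norm_triangle3[OF mk(2,1) f(2)])
    also have "L2norm lebesgue (\<lambda>x. mollify ?r k x - f x) \<le> L2norm lebesgue (\<lambda>x. mollify ?r k x - k x) + L2norm lebesgue (\<lambda>x. k x - f x)"
      by (rule L2norm_triangle3[OF mk(1) ki(2) f(2)])
    finally show ?thesis using b1 b2 k(3) L2norm_commute[of lebesgue k f] by linarith
  qed
  then show "\<exists>no. \<forall>n\<ge>no. norm (L2norm lebesgue (\<lambda>x. mollify (moll_kernel n) f x - f x) - 0) < e"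
    by (intro exI[of _ n0]) simp
qed

section \<open>Limits of test fields\<close>

lemma borel_measurable_AE_on:
  fixes f g :: "'a::euclidean_space \<Rightarrow> 'b::euclidean_space"
  assumes A: "A \<in> sets lebesgue" and f: "f \<in> borel_measurable (lebesgue_on A)"
    and ae: "AE x in lebesgue_on A. f x = g x"
  shows "g \<in> borel_measurable (lebesgue_on A)"
proof (rule borel_measurable_if_D)
  show "(\<lambda>x. if x \<in> A then g x else 0) \<in> borel_measurable lebesgue"
  proof (rule borel_measurable_AE[OF borel_measurable_if_I[OF f A]])
    have "AE x in lebesgue. x \<in> A \<longrightarrow> f x = g x" using ae A by (simp add: AE_restrict_space_iff)
    then show "AE x in lebesgue. (if x \<in> A then f x else 0) = (if x \<in> A then g x else 0)"
      by eventually_elim simp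
  qed
qed

subsection \<open>The weighted norm controls the norm on bounded sets\<close>

lemma weight_boundary: "weight (boundary_point y) = weight y"
  by (simp add: weight_def boundary_point_def inner_vec_def sum_3 sum_2 vector_3)

lemma weight_reflect: "weight (reflect x) = weight x"
  by (simp add: weight_def dot_square_norm)

text \<open>Division by the positive continuous weight preserves measurability.\<close>
lemma unweighted_measurable:
  fixes f :: "'a::euclidean_space \<Rightarrow> 'b::euclidean_space"
  assumes "(\<lambda>x. weight x *\<^sub>R f x) \<in> borel_measurable (lebesgue_on A)"
  shows "f \<in> borel_measurable (lebesgue_on A)"
proof -
  have "continuous_on UNIV (\<lambda>x::'a. 1 / weight x)"
    by (intro continuous_intros weight_cont) (simp add: weight_pos(1)[THEN less_imp_neq, symmetric])
  then have "(\<lambda>x. (1 / weight x) *\<^sub>R (weight x *\<^sub>R f x)) \<in> borel_measurable (lebesgue_on A)"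
    by (intro borel_measurable_scaleR continuous_measurable_on assms)
  moreover have "(1 / weight x) *\<^sub>R (weight x *\<^sub>R f x) = f x" for x
    using weight_pos(1)[of x] by simp
  ultimately show ?thesis by simp
qed

lemma hardy_local:
  fixes f :: "'a::euclidean_space \<Rightarrow> 'b::euclidean_space"
  assumes A: "A \<in> sets lebesgue" and f: "sq_integrable (lebesgue_on A) (\<lambda>x. weight x *\<^sub>R f x)"
  shows "sq_integrable (lebesgue_on (A \<inter> ball 0 R)) f"
    "L2norm (lebesgue_on (A \<inter> ball 0 R)) f \<le> sqrt (1 + R\<^sup>2) * L2norm (lebesgue_on A) (\<lambda>x. weight x *\<^sub>R f x)"
proof -
  let ?B = "A \<inter> ball 0 R" and ?h = "\<lambda>x. weight x *\<^sub>R f x"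
  have B: "?B \<in> sets lebesgue" using A by auto
  have h: "sq_integrable (lebesgue_on ?B) ?h" "L2norm (lebesgue_on ?B) ?h \<le> L2norm (lebesgue_on A) ?h"
    using sq_integrable_sub[OF B A _ f] by auto
  have m: "f \<in> borel_measurable (lebesgue_on ?B)"
    by (rule unweighted_measurable[OF sq_integrable_meas[OF h(1)]])
  have le: "AE x in lebesgue_on ?B. norm (f x) \<le> norm (sqrt (1 + R\<^sup>2) *\<^sub>R ?h x)"
  proof (rule AE_I2)
    fix x assume "x \<in> space (lebesgue_on ?B)"
    then have "norm x \<le> R" by simp
    from weight_lower[OF this] have "1 \<le> sqrt (1 + R\<^sup>2) * weight x"
      by (simp add: field_simps add_pos_nonneg)
    from mult_right_mono[OF this, of "norm (f x)"]
    show "norm (f x) \<le> norm (sqrt (1 + R\<^sup>2) *\<^sub>R ?h x)"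
      using weight_pos(1)[of x] by (simp add: abs_of_nonneg)
  qed
  have s: "sq_integrable (lebesgue_on ?B) (\<lambda>x. sqrt (1 + R\<^sup>2) *\<^sub>R ?h x)" by (rule sq_integrable_scaleR[OF h(1)])
  show "sq_integrable (lebesgue_on ?B) f" using sq_integrable_bound[OF s m, of 1] le by simp
  have "L2norm (lebesgue_on ?B) f \<le> L2norm (lebesgue_on ?B) (\<lambda>x. sqrt (1 + R\<^sup>2) *\<^sub>R ?h x)"
    by (rule L2norm_mono[OF s m le])
  also have "\<dots> = sqrt (1 + R\<^sup>2) * L2norm (lebesgue_on ?B) ?h" by (subst L2norm_scaleR) simp
  also have "\<dots> \<le> sqrt (1 + R\<^sup>2) * L2norm (lebesgue_on A) ?h" by (intro mult_left_mono h) simp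
  finally show "L2norm (lebesgue_on ?B) f \<le> sqrt (1 + R\<^sup>2) * L2norm (lebesgue_on A) ?h" .
qed

lemma hardy_local_lim:
  assumes A: "A \<in> sets lebesgue"
    and f: "\<And>n. sq_integrable (lebesgue_on A) (\<lambda>x. weight x *\<^sub>R (f n x - g x))"
    and l: "(\<lambda>n. L2norm (lebesgue_on A) (\<lambda>x. weight x *\<^sub>R (f n x - g x))) \<longlonglongrightarrow> 0"
  shows "(\<lambda>n. L2norm (lebesgue_on (A \<inter> ball 0 R)) (\<lambda>x. f n x - g x)) \<longlonglongrightarrow> 0"
  by (rule Lim_null_comparison[OF _ tendsto_mult_right_zero[OF l, of "sqrt (1 + R\<^sup>2)"]])
     (use hardy_local(2)[OF A f] in auto)

text \<open>Gradient convergence of test fields together with convergence of the fields in the weighted norm.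
  The limit gradient \<open>G\<close> is a separate argument, because on the whole space it is not given as a weak
  gradient, and on the half-space it is only recognised as such afterwards.\<close>
definition approx_on :: "(real^3) set \<Rightarrow> (nat \<Rightarrow> real^3 \<Rightarrow> real^3) \<Rightarrow> (real^3 \<Rightarrow> real^3) \<Rightarrow> (real^3 \<Rightarrow> real^3^3) \<Rightarrow> bool" where
  "approx_on A \<phi> v G \<longleftrightarrow> (\<forall>n. \<phi> n \<in> test_fields) \<and> sq_integrable (lebesgue_on A) G \<and>
     sq_integrable (lebesgue_on A) (\<lambda>x. weight x *\<^sub>R v x) \<and>
     (\<lambda>n. L2norm (lebesgue_on A) (\<lambda>x. grad (\<phi> n) x - G x)) \<longlonglongrightarrow> 0 \<and>
     (\<lambda>n. L2norm (lebesgue_on A) (\<lambda>x. weight x *\<^sub>R (\<phi> n x - v x))) \<longlonglongrightarrow> 0"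

lemma approx_onD:
  assumes "approx_on A \<phi> v G"
  shows "\<phi> n \<in> test_fields" "sq_integrable (lebesgue_on A) G"
    "sq_integrable (lebesgue_on A) (\<lambda>x. weight x *\<^sub>R v x)"
    "(\<lambda>n. L2norm (lebesgue_on A) (\<lambda>x. grad (\<phi> n) x - G x)) \<longlonglongrightarrow> 0"
    "(\<lambda>n. L2norm (lebesgue_on A) (\<lambda>x. weight x *\<^sub>R (\<phi> n x - v x))) \<longlonglongrightarrow> 0"
  using assms unfolding approx_on_def by blast+

lemma approx_on_sq:
  assumes "approx_on A \<phi> v G" "A \<in> sets lebesgue"
  shows "sq_integrable (lebesgue_on A) (grad (\<phi> n))"
    "sq_integrable (lebesgue_on A) (\<lambda>x. weight x *\<^sub>R \<phi> n x)"
    "sq_integrable (lebesgue_on A) (\<lambda>x. weight x *\<^sub>R (\<phi> n x - v x))"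
    "sq_integrable (lebesgue_on A) (\<lambda>x. grad (\<phi> n) x - G x)"
proof -
  show 1: "sq_integrable (lebesgue_on A) (grad (\<phi> n))" by (rule grad_test_on[OF approx_onD(1)[OF assms(1)] assms(2)])
  show 2: "sq_integrable (lebesgue_on A) (\<lambda>x. weight x *\<^sub>R \<phi> n x)"
    by (rule weighted_test_sq_integrable[OF approx_onD(1)[OF assms(1)] assms(2)])
  show "sq_integrable (lebesgue_on A) (\<lambda>x. weight x *\<^sub>R (\<phi> n x - v x))"
    using sq_integrable_diff[OF 2 approx_onD(3)[OF assms(1)]] by (simp add: scaleR_diff_right)
  show "sq_integrable (lebesgue_on A) (\<lambda>x. grad (\<phi> n) x - G x)"
    by (rule sq_integrable_diff[OF 1 approx_onD(2)[OF assms(1)]])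
qed

lemma grad_add: "\<phi> \<in> test_fields \<Longrightarrow> \<psi> \<in> test_fields \<Longrightarrow> grad (\<lambda>x. \<phi> x + \<psi> x) x = grad \<phi> x + grad \<psi> x"
  by (simp add: grad_def vec_eq_iff partial_add smooth_differentiable test_smooth)

lemma grad_scale: "\<phi> \<in> test_fields \<Longrightarrow> grad (\<lambda>x. c *\<^sub>R \<phi> x) x = c *\<^sub>R grad \<phi> x"
  using partial_linear[OF smooth_differentiable[OF test_smooth] bounded_linear_scaleR_right[of c], of \<phi>]
  by (simp add: grad_def vec_eq_iff)

lemma grad_diff: "\<phi> \<in> test_fields \<Longrightarrow> \<psi> \<in> test_fields \<Longrightarrow> grad (\<lambda>x. \<phi> x - \<psi> x) x = grad \<phi> x - grad \<psi> x"
  using grad_add[OF _ test_scale[of \<psi> _ "-1"], of \<phi> x] grad_scale[of \<psi> "-1" x] by simp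

lemma grad_diff_fun: "\<phi> \<in> test_fields \<Longrightarrow> \<psi> \<in> test_fields \<Longrightarrow> grad (\<lambda>x. \<phi> x - \<psi> x) = (\<lambda>x. grad \<phi> x - grad \<psi> x)"
  by (rule ext) (rule grad_diff)

lemma L2norm_sum_lim:
  assumes "\<And>n. sq_integrable M (\<lambda>x. f n x - f' x)" "\<And>n. sq_integrable M (\<lambda>x. g n x - g' x)"
    "(\<lambda>n. L2norm M (\<lambda>x. f n x - f' x)) \<longlonglongrightarrow> 0" "(\<lambda>n. L2norm M (\<lambda>x. g n x - g' x)) \<longlonglongrightarrow> 0"
  shows "(\<lambda>n. L2norm M (\<lambda>x. (c *\<^sub>R f n x + d *\<^sub>R g n x) - (c *\<^sub>R f' x + d *\<^sub>R g' x))) \<longlonglongrightarrow> 0"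
proof (rule Lim_null_comparison)
  show "(\<lambda>n. \<bar>c\<bar> * L2norm M (\<lambda>x. f n x - f' x) + \<bar>d\<bar> * L2norm M (\<lambda>x. g n x - g' x)) \<longlonglongrightarrow> 0"
    using tendsto_add[OF tendsto_mult_right_zero[OF assms(3), of "\<bar>c\<bar>"] tendsto_mult_right_zero[OF assms(4), of "\<bar>d\<bar>"]] by simp
  have "L2norm M (\<lambda>x. (c *\<^sub>R f n x + d *\<^sub>R g n x) - (c *\<^sub>R f' x + d *\<^sub>R g' x)) \<le>
    \<bar>c\<bar> * L2norm M (\<lambda>x. f n x - f' x) + \<bar>d\<bar> * L2norm M (\<lambda>x. g n x - g' x)" for n
  proof -
    have "L2norm M (\<lambda>x. c *\<^sub>R (f n x - f' x) + d *\<^sub>R (g n x - g' x)) \<le>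
      L2norm M (\<lambda>x. c *\<^sub>R (f n x - f' x)) + L2norm M (\<lambda>x. d *\<^sub>R (g n x - g' x))"
      by (intro L2norm_triangle sq_integrable_scaleR assms)
    moreover have "c *\<^sub>R (f n x - f' x) + d *\<^sub>R (g n x - g' x) = (c *\<^sub>R f n x + d *\<^sub>R g n x) - (c *\<^sub>R f' x + d *\<^sub>R g' x)" for x
      by (simp add: algebra_simps)
    ultimately show ?thesis by (simp only: L2norm_scaleR)
  qed
  then show "eventually (\<lambda>n. norm (L2norm M (\<lambda>x. (c *\<^sub>R f n x + d *\<^sub>R g n x) - (c *\<^sub>R f' x + d *\<^sub>R g' x)))
    \<le> \<bar>c\<bar> * L2norm M (\<lambda>x. f n x - f' x) + \<bar>d\<bar> * L2norm M (\<lambda>x. g n x - g' x)) sequentially" by simp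
qed

text \<open>Stated for binary linear combinations, of which sums, differences and midpoints are instances.\<close>
lemma approx_on_combine:
  assumes "approx_on A \<phi> v G" "approx_on A \<psi> w H" and A: "A \<in> sets lebesgue"
  shows "approx_on A (\<lambda>n x. c *\<^sub>R \<phi> n x + d *\<^sub>R \<psi> n x) (\<lambda>x. c *\<^sub>R v x + d *\<^sub>R w x) (\<lambda>x. c *\<^sub>R G x + d *\<^sub>R H x)"
proof -
  note a = approx_onD[OF assms(1)] and b = approx_onD[OF assms(2)]
  note sa = approx_on_sq[OF assms(1) A] and sb = approx_on_sq[OF assms(2) A]
  have t: "(\<lambda>x. c *\<^sub>R \<phi> n x) \<in> test_fields" "(\<lambda>x. d *\<^sub>R \<psi> n x) \<in> test_fields" for n
    by (intro test_scale a b)+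
  have g: "grad (\<lambda>x. c *\<^sub>R \<phi> n x + d *\<^sub>R \<psi> n x) x = c *\<^sub>R grad (\<phi> n) x + d *\<^sub>R grad (\<psi> n) x" for n x
    using grad_add[OF t] grad_scale[OF a(1)] grad_scale[OF b(1)] by simp
  have 1: "sq_integrable (lebesgue_on A) (\<lambda>x. weight x *\<^sub>R (c *\<^sub>R v x + d *\<^sub>R w x))"
    using sq_integrable_add[OF sq_integrable_scaleR[OF a(3), of c] sq_integrable_scaleR[OF b(3), of d]]
    by (simp add: scaleR_add_right mult.commute)
  have 2: "(\<lambda>n. L2norm (lebesgue_on A) (\<lambda>x. weight x *\<^sub>R ((c *\<^sub>R \<phi> n x + d *\<^sub>R \<psi> n x) - (c *\<^sub>R v x + d *\<^sub>R w x)))) \<longlonglongrightarrow> 0"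
    using L2norm_sum_lim[of "lebesgue_on A" "\<lambda>n x. weight x *\<^sub>R \<phi> n x" "\<lambda>x. weight x *\<^sub>R v x"
      "\<lambda>n x. weight x *\<^sub>R \<psi> n x" "\<lambda>x. weight x *\<^sub>R w x" c d] sa(3) sb(3) a(5) b(5)
    by (simp add: scaleR_diff_right scaleR_add_right mult.commute)
  show ?thesis unfolding approx_on_def g
    using t 1 2 L2norm_sum_lim[OF sa(4) sb(4) a(4) b(4), of c d]
    by (intro conjI allI test_add sq_integrable_add sq_integrable_scaleR a b)
qed

subsection \<open>The limit is weakly differentiable\<close>

text \<open>A test function only sees a bounded part of the set, on which the weight is bounded below.\<close>
lemma test_mult_weighted:
  fixes f :: "'a::euclidean_space \<Rightarrow> 'b::euclidean_space" and \<psi> :: "'a \<Rightarrow> real"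
  assumes A: "A \<in> sets lebesgue" and f: "sq_integrable (lebesgue_on A) (\<lambda>x. weight x *\<^sub>R f x)"
    and c: "continuous_on UNIV \<psi>" and z: "\<And>x. norm x > R \<Longrightarrow> \<psi> x = 0"
  shows "integrable (lebesgue_on A) (\<lambda>x. \<psi> x *\<^sub>R f x)"
    "norm (LINT x|lebesgue_on A. \<psi> x *\<^sub>R f x) \<le> L2norm lebesgue (\<lambda>x. \<psi> x / weight x) * L2norm (lebesgue_on A) (\<lambda>x. weight x *\<^sub>R f x)"
proof -
  have nz: "weight x \<noteq> 0" for x :: 'a using weight_pos(1)[of x] by simp
  have s: "sq_integrable lebesgue (\<lambda>x. \<psi> x / weight x)"
    by (rule cs_sq_integrable[where R=R]) (auto simp: z nz intro!: continuous_intros c weight_cont)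
  have sA: "sq_integrable (lebesgue_on A) (\<lambda>x. \<psi> x / weight x)" "L2norm (lebesgue_on A) (\<lambda>x. \<psi> x / weight x) \<le> L2norm lebesgue (\<lambda>x. \<psi> x / weight x)"
    using sq_integrable_on_UNIV_sub[OF A s] by auto
  have eq: "(\<psi> x / weight x) *\<^sub>R (weight x *\<^sub>R f x) = \<psi> x *\<^sub>R f x" for x using nz by simp
  show "integrable (lebesgue_on A) (\<lambda>x. \<psi> x *\<^sub>R f x)"
    using sq_integrable_scaleR_prod[OF sA(1) f] by (simp only: eq)
  have "norm (LINT x|lebesgue_on A. \<psi> x *\<^sub>R f x) \<le> L2norm (lebesgue_on A) (\<lambda>x. \<psi> x / weight x) * L2norm (lebesgue_on A) (\<lambda>x. weight x *\<^sub>R f x)"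
    using L2norm_scaleR_prod_bound[OF sA(1) f] by (simp only: eq)
  also have "\<dots> \<le> L2norm lebesgue (\<lambda>x. \<psi> x / weight x) * L2norm (lebesgue_on A) (\<lambda>x. weight x *\<^sub>R f x)"
    by (intro mult_right_mono sA) simp
  finally show "norm (LINT x|lebesgue_on A. \<psi> x *\<^sub>R f x) \<le> L2norm lebesgue (\<lambda>x. \<psi> x / weight x) * L2norm (lebesgue_on A) (\<lambda>x. weight x *\<^sub>R f x)" .
qed

lemma test_integral_lim:
  fixes f :: "'a::euclidean_space \<Rightarrow> 'b::euclidean_space" and \<psi> :: "'a \<Rightarrow> real"
  assumes A: "A \<in> sets lebesgue" and f: "sq_integrable (lebesgue_on A) (\<lambda>x. weight x *\<^sub>R f x)"
    and fn: "\<And>n. sq_integrable (lebesgue_on A) (\<lambda>x. weight x *\<^sub>R fn n x)"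
    and l: "(\<lambda>n. L2norm (lebesgue_on A) (\<lambda>x. weight x *\<^sub>R (fn n x - f x))) \<longlonglongrightarrow> 0"
    and c: "continuous_on UNIV \<psi>" and z: "\<And>x. norm x > R \<Longrightarrow> \<psi> x = 0"
  shows "(\<lambda>n. LINT x|lebesgue_on A. \<psi> x *\<^sub>R fn n x) \<longlonglongrightarrow> (LINT x|lebesgue_on A. \<psi> x *\<^sub>R f x)"
proof -
  have d: "sq_integrable (lebesgue_on A) (\<lambda>x. weight x *\<^sub>R (fn n x - f x))" for n
    using sq_integrable_diff[OF fn f] by (simp add: scaleR_diff_right)
  have "norm ((LINT x|lebesgue_on A. \<psi> x *\<^sub>R fn n x) - (LINT x|lebesgue_on A. \<psi> x *\<^sub>R f x)) \<le>
     L2norm lebesgue (\<lambda>x. \<psi> x / weight x) * L2norm (lebesgue_on A) (\<lambda>x. weight x *\<^sub>R (fn n x - f x))" for n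
    using test_mult_weighted(2)[OF A d c z, of R n] test_mult_weighted(1)[OF A fn c z, of R n] test_mult_weighted(1)[OF A f c z, of R]
    by (simp add: scaleR_diff_right)
  then have "(\<lambda>n. (LINT x|lebesgue_on A. \<psi> x *\<^sub>R fn n x) - (LINT x|lebesgue_on A. \<psi> x *\<^sub>R f x)) \<longlonglongrightarrow> 0"
    by (intro Lim_null_comparison[OF _ tendsto_mult_right_zero[OF l, of "L2norm lebesgue (\<lambda>x. \<psi> x / weight x)"]] always_eventually allI)
  then show ?thesis by (simp add: LIM_zero_iff)
qed

lemma sq_integrable_weighted:
  fixes f :: "'a::euclidean_space \<Rightarrow> 'b::euclidean_space"
  assumes "sq_integrable (lebesgue_on A) f"
  shows "sq_integrable (lebesgue_on A) (\<lambda>x. weight x *\<^sub>R f x)"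
    "L2norm (lebesgue_on A) (\<lambda>x. weight x *\<^sub>R f x) \<le> L2norm (lebesgue_on A) f"
proof -
  have m: "(\<lambda>x. weight x *\<^sub>R f x) \<in> borel_measurable (lebesgue_on A)"
    by (intro borel_measurable_scaleR continuous_measurable_on weight_cont sq_integrable_meas assms)
  have le: "AE x in lebesgue_on A. norm (weight x *\<^sub>R f x) \<le> norm (f x)"
  proof (rule AE_I2)
    fix x
    have "norm (weight x *\<^sub>R f x) = weight x * norm (f x)"
      using weight_pos(1)[of x] by simp
    then show "norm (weight x *\<^sub>R f x) \<le> norm (f x)"
      using mult_left_le_one_le[of "norm (f x)" "weight x"] weight_pos[of x] by simp
  qed
  show "sq_integrable (lebesgue_on A) (\<lambda>x. weight x *\<^sub>R f x)"
    using sq_integrable_bound[OF assms m, of 1] le by simp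
  show "L2norm (lebesgue_on A) (\<lambda>x. weight x *\<^sub>R f x) \<le> L2norm (lebesgue_on A) f"
    by (rule L2norm_mono[OF assms m le])
qed

lemma loc_integrable_weighted:
  fixes f :: "real^3 \<Rightarrow> 'b::euclidean_space"
  assumes "sq_integrable half_measure (\<lambda>x. weight x *\<^sub>R f x)"
  shows "loc_integrable f"
  unfolding loc_integrable_def
proof (intro allI impI)
  fix K :: "(real^3) set" assume K: "compact K \<and> K \<subseteq> half_space"
  have "bounded K" using K by (simp add: compact_imp_bounded)
  then obtain R where R: "\<And>x. x \<in> K \<Longrightarrow> norm x \<le> R" by (auto simp: bounded_iff)
  have i: "integrable half_measure (\<lambda>x. cutoff R x *\<^sub>R f x)"
    by (rule test_mult_weighted(1)[OF half_space_sets(1) assms cutoff_props(5), where R="R+1"]) (rule cutoff_props(4))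
  have Ks: "K \<in> sets lebesgue" using K by (simp add: compact_sets_lebesgue)
  have "integrable lebesgue (\<lambda>x. indicator K x *\<^sub>R (indicator half_space x *\<^sub>R (cutoff R x *\<^sub>R f x)))"
  proof (rule integrable_mult_indicator[OF Ks])
    show "integrable lebesgue (\<lambda>x. indicator half_space x *\<^sub>R (cutoff R x *\<^sub>R f x))"
      using i by (subst (asm) integrable_restrict_space) simp_all
  qed
  moreover have "indicator K x *\<^sub>R (indicator half_space x *\<^sub>R (cutoff R x *\<^sub>R f x)) = indicator K x *\<^sub>R f x" for x
  proof (cases "x \<in> K")
    case True
    then have "cutoff R x = 1" "x \<in> half_space" using R[OF True] K cutoff_props(3)[of x R] by auto
    then show ?thesis by simp
  qed simp
  ultimately have "integrable lebesgue (\<lambda>x. indicator K x *\<^sub>R f x)" by (simp only:)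
  then show "integrable (lebesgue_on K) f" using Ks by (subst integrable_restrict_space) auto
qed

lemma integral_vec_nth:
  fixes f :: "'a \<Rightarrow> real^'n"
  shows "integrable M f \<Longrightarrow> (LINT x|M. f x) $ a = (LINT x|M. f x $ a)"
  by (rule integral_bounded_linear[OF bounded_linear_vec_nth, symmetric])

lemma bounded_linear_entry: "bounded_linear (\<lambda>A :: real^3^3. A $ a $ i)"
  using bounded_linear_compose[OF bounded_linear_vec_nth[of i] bounded_linear_vec_nth[of a]] by simp

definition column_of :: "3 \<Rightarrow> real^3^3 \<Rightarrow> real^3" where
  "column_of j A = (\<chi> i. A $ i $ j)"

lemma column_of_nth [simp]: "column_of j A $ i = A $ i $ j"
  by (simp add: column_of_def)

lemma bounded_linear_column: "bounded_linear (column_of j)"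
proof -
  have "bounded_linear (\<lambda>A. \<Sum>i\<in>UNIV. (A $ i $ j) *\<^sub>R (axis i 1 :: real^3))"
    by (intro bounded_linear_sum bounded_linear_compose[OF bounded_linear_scaleR_left bounded_linear_entry])
  moreover have "(\<lambda>A. \<Sum>i\<in>UNIV. (A $ i $ j) *\<^sub>R (axis i 1 :: real^3)) = column_of j"
    using vec3_decomp[of "column_of j _"] by (auto simp: fun_eq_iff)
  ultimately show ?thesis by simp
qed

lemma column_grad: "column_of j (grad \<phi> x) = partial j \<phi> x"
  by (simp add: vec_eq_iff grad_def)

lemma test_half_zero:
  assumes "\<psi> \<in> test_functions half_space" "x \<notin> half_space"
  shows "\<psi> x = 0"
  using assms zero_off_support[of x \<psi>] by (auto simp: test_functions_def)

text \<open>Integration by parts for test fields passes to the limit, since both integrals converge.\<close>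
lemma approx_weak_partial:
  assumes ap: "approx_on half_space \<phi> v G"
  shows "has_weak_partial j v (\<lambda>x. column_of j (G x))"
  unfolding has_weak_partial_def
proof (intro conjI allI impI)
  note a = approx_onD[OF ap] and sa = approx_on_sq[OF ap half_space_sets(1)]
  have cG: "sq_integrable half_measure (\<lambda>x. column_of j (G x))"
    by (rule sq_integrable_linear[OF a(2) bounded_linear_column])
  have cw: "sq_integrable half_measure (\<lambda>x. weight x *\<^sub>R column_of j (G x))"
    by (rule sq_integrable_weighted(1)[OF cG])
  show "loc_integrable v" by (rule loc_integrable_weighted[OF a(3)])
  show "loc_integrable (\<lambda>x. column_of j (G x))" by (rule loc_integrable_weighted[OF cw])
  fix \<psi> :: "real^3 \<Rightarrow> real" assume psi: "\<psi> \<in> test_functions half_space"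
  have pU: "\<psi> \<in> test_functions UNIV" by (rule test_UNIV[OF psi])
  obtain R where R: "\<And>x. norm x > R \<Longrightarrow> \<psi> x = 0" by (rule test_supp_bound[OF psi]) (rule that)
  have pR: "partial j \<psi> x = 0" if "norm x > R" for x by (rule partial_zero_far[OF R that])
  have pc: "continuous_on UNIV (partial j \<psi>)" by (rule test_continuous[OF test_partial[OF psi]])
  have 1: "(\<lambda>n. LINT x|half_measure. partial j \<psi> x *\<^sub>R \<phi> n x) \<longlonglongrightarrow> (LINT x|half_measure. partial j \<psi> x *\<^sub>R v x)"
    by (rule test_integral_lim[OF half_space_sets(1) a(3) sa(2) a(5) pc pR])
  have gl: "(\<lambda>n. L2norm half_measure (\<lambda>x. partial j (\<phi> n) x - column_of j (G x))) \<longlonglongrightarrow> 0"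
    using L2_lim_linear[OF sa(4) a(4) bounded_linear_column, of j] by (simp add: column_grad)
  have ps: "sq_integrable half_measure (partial j (\<phi> n))" for n
    by (rule test_sq_integrable_on[OF test_partial[OF a(1)]]) simp
  have gw: "(\<lambda>n. L2norm half_measure (\<lambda>x. weight x *\<^sub>R (partial j (\<phi> n) x - column_of j (G x)))) \<longlonglongrightarrow> 0"
    by (rule Lim_null_comparison[OF _ gl]) (use sq_integrable_weighted(2)[OF sq_integrable_diff[OF ps cG]] in auto)
  have 2: "(\<lambda>n. LINT x|half_measure. \<psi> x *\<^sub>R partial j (\<phi> n) x) \<longlonglongrightarrow> (LINT x|half_measure. \<psi> x *\<^sub>R column_of j (G x))"
    by (rule test_integral_lim[OF half_space_sets(1) cw sq_integrable_weighted(1)[OF ps] gw test_continuous[OF psi] R])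
  have 3: "(LINT x|half_measure. partial j \<psi> x *\<^sub>R \<phi> n x) = - (LINT x|half_measure. \<psi> x *\<^sub>R partial j (\<phi> n) x)" for n
  proof -
    have sn: "smooth (\<phi> n)" by (rule test_smooth[OF a(1)])
    have i: "integrable half_measure (\<lambda>x. partial j \<psi> x *\<^sub>R \<phi> n x)" "integrable half_measure (\<lambda>x. \<psi> x *\<^sub>R partial j (\<phi> n) x)"
      by (intro integral_test_on[of _ UNIV] test_scaleR_smooth test_partial pU sn smooth_partial half_space_sets)+
    have "(LINT x|half_measure. partial j \<psi> x * \<phi> n x $ b) = - (LINT x|half_measure. \<psi> x * partial j (\<phi> n) x $ b)" for b
    proof -
      have z: "\<psi> (boundary_point y) = 0" for y
        by (rule test_half_zero[OF psi]) (simp add: half_space_def boundary_point_def vector_3)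
      show ?thesis
        using integration_by_parts_half[OF pU smooth_component[OF sn, of b], of j]
        by (simp add: z partial_component smooth_differentiable[OF sn])
    qed
    then show ?thesis using i by (simp add: vec_eq_iff integral_vec_nth)
  qed
  show "(LINT x|half_measure. partial j \<psi> x *\<^sub>R v x) = - (LINT x|half_measure. \<psi> x *\<^sub>R column_of j (G x))"
    using LIMSEQ_unique[OF 1[unfolded 3] tendsto_minus[OF 2]] .
qed

lemma approx_weak_grad:
  assumes ap: "approx_on half_space \<phi> v G"
  shows "AE x in half_measure. weak_grad v x = G x" "weakly_differentiable j v"
    "weak_grad v \<in> borel_measurable half_measure" "sq_integrable half_measure (weak_grad v)"
proof -
  have "AE x in half_measure. \<forall>j. weak_partial j v x = column_of j (G x)"
    using weak_partial_eq_AE[OF approx_weak_partial[OF ap]] by (simp add: AE_all_countable)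
  then show ae: "AE x in half_measure. weak_grad v x = G x"
    by eventually_elim (simp add: weak_grad_def vec_eq_iff)
  show "weakly_differentiable j v" using approx_weak_partial[OF ap] unfolding weakly_differentiable_def by blast
  show m: "weak_grad v \<in> borel_measurable half_measure"
    by (rule borel_measurable_AE_on[OF half_space_sets(1) sq_integrable_meas[OF approx_onD(2)[OF ap]]]) (use ae in auto)
  show "sq_integrable half_measure (weak_grad v)"
    by (rule sq_integrable_cong_AE[OF approx_onD(2)[OF ap] m ae])
qed

subsection \<open>Limits of mirror-symmetric test fields\<close>

text \<open>The symmetry that encodes the boundary condition: the third component is odd in \<open>x\<^sub>3\<close> and the
  others are even.\<close>
definition mirror_symmetric :: "(real^3 \<Rightarrow> real^3) \<Rightarrow> bool" where
  "mirror_symmetric w \<longleftrightarrow> (\<forall>x. w (reflect x) = reflect (w x))"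

lemma reflect_boundary [simp]: "reflect (boundary_point y) = boundary_point y"
  by (simp add: vec_eq_iff boundary_point_def forall_3 vector_3)

lemma mirror_symmetric_boundary: "mirror_symmetric w \<Longrightarrow> w (boundary_point y) $ 3 = 0"
proof -
  assume "mirror_symmetric w"
  then have "w (reflect (boundary_point y)) = reflect (w (boundary_point y))" unfolding mirror_symmetric_def by blast
  then have "w (boundary_point y) $ 3 = reflect (w (boundary_point y)) $ 3" by simp
  then show ?thesis by simp
qed

lemma mirror_symmetric_combine:
  "mirror_symmetric v \<Longrightarrow> mirror_symmetric w \<Longrightarrow> mirror_symmetric (\<lambda>x. c *\<^sub>R v x + d *\<^sub>R w x)"
  by (simp add: mirror_symmetric_def reflect_add reflect_scaleR)

text \<open>By the weighted inequalities the boundary values of the test fields converge as well; their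
  third components vanish by symmetry.\<close>
lemma symmetric_trace:
  assumes t: "\<And>n. \<phi> n \<in> test_fields" and sym: "\<And>n. mirror_symmetric (\<phi> n)"
    and cau: "\<And>e. e > 0 \<Longrightarrow> \<exists>N. \<forall>m\<ge>N. \<forall>n\<ge>N. L2norm half_measure (\<lambda>x. grad (\<phi> m) x - grad (\<phi> n) x) < e"
  obtains g where "\<And>R. sq_integrable (lebesgue_on (ball 0 R)) g"
    "\<And>R. (\<lambda>n. L2norm (lebesgue_on (ball 0 R)) (\<lambda>y. \<phi> n (boundary_point y) - g y)) \<longlonglongrightarrow> 0"
    "AE y in lebesgue. g y $ 3 = 0"
proof -
  let ?h = "\<lambda>n y. weight y *\<^sub>R \<phi> n (boundary_point y)"
  have hs: "sq_integrable lebesgue (?h n)" for n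
    using boundary_test_sq_integrable(1)[OF t[of n]] by (simp add: weight_boundary)
  have hc: "\<exists>N. \<forall>m\<ge>N. \<forall>n\<ge>N. L2norm lebesgue (\<lambda>y. ?h m y - ?h n y) < e" if e: "e > 0" for e
  proof -
    obtain N where N: "\<And>m n. m \<ge> N \<Longrightarrow> n \<ge> N \<Longrightarrow> L2norm half_measure (\<lambda>x. grad (\<phi> m) x - grad (\<phi> n) x) < e / 3"
      using cau[of "e/3"] e by auto
    have "L2norm lebesgue (\<lambda>y. ?h m y - ?h n y) < e" if "m \<ge> N" "n \<ge> N" for m n
      using trace_half[OF test_diff[OF t[of m] t[of n]]] N[OF that]
      by (simp add: weight_boundary scaleR_diff_right grad_diff_fun[OF t t])
    then show ?thesis by blast
  qed
  obtain g0 where g0: "sq_integrable lebesgue g0" "(\<lambda>n. L2norm lebesgue (\<lambda>y. ?h n y - g0 y)) \<longlonglongrightarrow> 0"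
    using L2_complete[of lebesgue ?h, OF hs hc] by blast
  define g where "g y = (1 / weight y) *\<^sub>R g0 y" for y
  have hg: "weight y *\<^sub>R g y = g0 y" for y using weight_pos(1)[of y] by (simp add: g_def)
  have hgs: "sq_integrable (lebesgue_on UNIV) (\<lambda>y. weight y *\<^sub>R g y)"
    using g0(1) by (simp add: hg lebesgue_on_UNIV_eq)
  have 1: "sq_integrable (lebesgue_on (ball 0 R)) g" for R using hardy_local(1)[OF _ hgs, of R] by simp
  have 2: "(\<lambda>n. L2norm (lebesgue_on (ball 0 R)) (\<lambda>y. \<phi> n (boundary_point y) - g y)) \<longlonglongrightarrow> 0" for R
    using hardy_local_lim[of UNIV "\<lambda>n y. \<phi> n (boundary_point y)" g R] sq_integrable_diff[OF hs g0(1)] g0(2)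
    by (simp add: scaleR_diff_right hg lebesgue_on_UNIV_eq)
  obtain r where r: "strict_mono r" "AE y in lebesgue. (\<lambda>n. ?h (r n) y) \<longlonglongrightarrow> g0 y"
    using L2_lim_AE_subseq[of lebesgue ?h g0, OF sq_integrable_diff[OF hs g0(1)] g0(2)] by blast
  have "AE y in lebesgue. g y $ 3 = 0"
    using r(2)
  proof eventually_elim
    case (elim y)
    have "(\<lambda>n. ?h (r n) y $ 3) \<longlonglongrightarrow> g0 y $ 3" by (intro tendsto_intros elim)
    moreover have "(\<lambda>n. ?h (r n) y $ 3) = (\<lambda>n. 0)" using mirror_symmetric_boundary[OF sym] by simp
    ultimately have "g0 y $ 3 = 0" by (simp only: LIMSEQ_const_iff)
    then show ?case by (simp add: g_def)
  qed
  then show ?thesis using that 1 2 by blast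
qed

text \<open>By the inequality of Hardy type the weighted fields are a Cauchy sequence as well; dividing their
  limit by the weight gives the limit field.\<close>
lemma approx_limit_exists:
  assumes t: "\<And>n. \<phi> n \<in> test_fields"
    and cau: "\<And>e. e > 0 \<Longrightarrow> \<exists>N. \<forall>m\<ge>N. \<forall>n\<ge>N. L2norm half_measure (\<lambda>x. grad (\<phi> m) x - grad (\<phi> n) x) < e"
  obtains v G where "approx_on half_space \<phi> v G"
proof -
  let ?M = "half_measure"
  let ?h = "\<lambda>n x. weight x *\<^sub>R \<phi> n x"
  have gs: "sq_integrable ?M (grad (\<phi> n))" for n by (rule grad_test_on[OF t]) simp
  obtain G where G: "sq_integrable ?M G" "(\<lambda>n. L2norm ?M (\<lambda>x. grad (\<phi> n) x - G x)) \<longlonglongrightarrow> 0"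
    using L2_complete[of ?M "\<lambda>n. grad (\<phi> n)", OF gs cau] by blast
  have hs: "sq_integrable ?M (?h n)" for n by (rule weighted_test_sq_integrable[OF t]) simp
  have hc: "\<exists>N. \<forall>m\<ge>N. \<forall>n\<ge>N. L2norm ?M (\<lambda>y. ?h m y - ?h n y) < e" if e: "e > 0" for e
  proof -
    obtain N where N: "\<And>m n. m \<ge> N \<Longrightarrow> n \<ge> N \<Longrightarrow> L2norm ?M (\<lambda>x. grad (\<phi> m) x - grad (\<phi> n) x) < e / 2"
      using cau[of "e/2"] e by auto
    have "L2norm ?M (\<lambda>y. ?h m y - ?h n y) < e" if "m \<ge> N" "n \<ge> N" for m n
      using hardy_half[OF test_diff[OF t[of m] t[of n]]] N[OF that]
      by (simp add: scaleR_diff_right grad_diff_fun[OF t t])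
    then show ?thesis by blast
  qed
  obtain v0 where v0: "sq_integrable ?M v0" "(\<lambda>n. L2norm ?M (\<lambda>y. ?h n y - v0 y)) \<longlonglongrightarrow> 0"
    using L2_complete[of ?M ?h, OF hs hc] by blast
  have hv: "weight x *\<^sub>R ((1 / weight x) *\<^sub>R v0 x) = v0 x" for x
    using weight_pos(1)[of x] by simp
  have "approx_on half_space \<phi> (\<lambda>x. (1 / weight x) *\<^sub>R v0 x) G"
    unfolding approx_on_def scaleR_diff_right hv using t G v0 by blast
  then show ?thesis by (rule that)
qed

lemma lim_Cauchy:
  assumes "\<And>n. sq_integrable M (f n)" "sq_integrable M g" "(\<lambda>n. L2norm M (\<lambda>x. f n x - g x)) \<longlonglongrightarrow> 0" "e > 0"
  shows "\<exists>N. \<forall>m\<ge>N. \<forall>n\<ge>N. L2norm M (\<lambda>x. f m x - f n x) < e"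
proof -
  have "eventually (\<lambda>n. L2norm M (\<lambda>x. f n x - g x) < e / 2) sequentially"
    using assms(3) by (rule order_tendstoD) (use assms(4) in simp)
  then obtain N where N: "\<And>n. n \<ge> N \<Longrightarrow> L2norm M (\<lambda>x. f n x - g x) < e / 2" by (auto simp: eventually_sequentially)
  have "L2norm M (\<lambda>x. f m x - f n x) < e" if "m \<ge> N" "n \<ge> N" for m n
    using L2norm_triangle3[OF assms(1)[of m] assms(2) assms(1)[of n]] N[OF that(1)] N[OF that(2)]
      L2norm_commute[of M g "f n"] by linarith
  then show ?thesis by blast
qed

text \<open>The criterion by which all fields constructed later are recognised as admissible: the approximation
  and the trace in the definition of the space are supplied by symmetric test fields.\<close>
lemma V2_intro:
  assumes ap: "approx_on half_space \<phi> v G" and sym: "\<And>n. mirror_symmetric (\<phi> n)"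
    and div: "AE x in half_measure. trace (G x) = 0"
  shows "v \<in> V2"
proof -
  note a = approx_onD[OF ap] and sa = approx_on_sq[OF ap half_space_sets(1)] and w = approx_weak_grad[OF ap]
  have vl: "sq_integrable (lebesgue_on (half_space \<inter> ball 0 R)) v" for R
    by (rule hardy_local(1)[OF half_space_sets(1) a(3)])
  have "L2norm half_measure (\<lambda>x. grad (\<phi> n) x - weak_grad v x) = L2norm half_measure (\<lambda>x. grad (\<phi> n) x - G x)" for n
    by (rule L2norm_cong_AE[OF sq_integrable_meas[OF sq_integrable_diff[OF sa(1) w(4)]] sq_integrable_meas[OF sa(4)]])
       (use w(1) in eventually_elim, simp)
  then have gl: "(\<lambda>n. L2norm half_measure (\<lambda>x. grad (\<phi> n) x - weak_grad v x)) \<longlonglongrightarrow> 0"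
    using a(4) by simp
  have D: "D1_approx \<phi> v"
    unfolding D1_approx_def Lp_norm_2
    using a(1) gl hardy_local_lim[OF half_space_sets(1) sa(3) a(5)] by blast
  then have "v \<in> D1" unfolding D1_def Lp_2_iff using w vl by blast
  moreover have "AE x in half_measure. weak_div v x = 0"
    using w(1) div by eventually_elim (simp add: weak_div_def)
  moreover obtain g where "\<And>R. sq_integrable (lebesgue_on (ball 0 R)) g"
    "\<And>R. (\<lambda>n. L2norm (lebesgue_on (ball 0 R)) (\<lambda>y. \<phi> n (boundary_point y) - g y)) \<longlonglongrightarrow> 0"
    "AE y in lebesgue. g y $ 3 = 0"
    by (rule symmetric_trace[OF a(1) sym lim_Cauchy[OF sa(1) a(2) a(4)]]) (assumption, rule that)
  then have "\<exists>g. has_boundary_trace v g \<and> (AE y in lebesgue. g y $ 3 = 0)"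
    unfolding has_boundary_trace_def Lp_norm_2 Lp_2_iff using D by blast
  ultimately show ?thesis unfolding V2_def by blast
qed

section \<open>Reflection of admissible fields\<close>

lemma approx_on_cong:
  assumes ap: "approx_on A \<phi> v G" and A: "A \<in> sets lebesgue"
    and v: "AE x in lebesgue_on A. v x = v' x" and G: "AE x in lebesgue_on A. G x = G' x"
  shows "approx_on A \<phi> v' G'"
proof -
  note a = approx_onD[OF ap] and s = approx_on_sq[OF ap A]
  have m: "(\<lambda>x. weight x *\<^sub>R v' x) \<in> borel_measurable (lebesgue_on A)"
    by (rule borel_measurable_AE_on[OF A sq_integrable_meas[OF a(3)]]) (use v in eventually_elim, simp)
  have mG: "G' \<in> borel_measurable (lebesgue_on A)"
    by (rule borel_measurable_AE_on[OF A sq_integrable_meas[OF a(2)] G])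
  have 1: "sq_integrable (lebesgue_on A) G'"
    by (rule sq_integrable_cong_AE[OF a(2) mG]) (use G in eventually_elim, simp)
  have 2: "sq_integrable (lebesgue_on A) (\<lambda>x. weight x *\<^sub>R v' x)"
    by (rule sq_integrable_cong_AE[OF a(3) m]) (use v in eventually_elim, simp)
  have 3: "L2norm (lebesgue_on A) (\<lambda>x. grad (\<phi> n) x - G' x) = L2norm (lebesgue_on A) (\<lambda>x. grad (\<phi> n) x - G x)" for n
    by (rule L2norm_cong_AE[OF sq_integrable_meas[OF sq_integrable_diff[OF s(1) 1]] sq_integrable_meas[OF s(4)]])
       (use G in eventually_elim, simp)
  have 4: "L2norm (lebesgue_on A) (\<lambda>x. weight x *\<^sub>R (\<phi> n x - v' x)) = L2norm (lebesgue_on A) (\<lambda>x. weight x *\<^sub>R (\<phi> n x - v x))" for n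
  proof (rule L2norm_cong_AE[OF _ sq_integrable_meas[OF s(3)]])
    show "(\<lambda>x. weight x *\<^sub>R (\<phi> n x - v' x)) \<in> borel_measurable (lebesgue_on A)"
      using sq_integrable_meas[OF sq_integrable_diff[OF s(2)[of n] 2]] by (simp add: scaleR_diff_right)
    show "AE x in lebesgue_on A. weight x *\<^sub>R (\<phi> n x - v' x) = weight x *\<^sub>R (\<phi> n x - v x)"
      using v by eventually_elim simp
  qed
  show ?thesis unfolding approx_on_def 3 4 using a 1 2 by blast
qed

lemma approx_on_sub:
  assumes ap: "approx_on B \<phi> v G" and A: "A \<in> sets lebesgue" "B \<in> sets lebesgue" "A \<subseteq> B"
  shows "approx_on A \<phi> v G"
proof -
  note a = approx_onD[OF ap] and s = approx_on_sq[OF ap A(2)]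
  have l: "(\<lambda>n. L2norm (lebesgue_on A) (\<lambda>x. grad (\<phi> n) x - G x)) \<longlonglongrightarrow> 0"
    by (rule Lim_null_comparison[OF _ a(4)]) (use sq_integrable_sub(2)[OF A s(4)] in auto)
  have l2: "(\<lambda>n. L2norm (lebesgue_on A) (\<lambda>x. weight x *\<^sub>R (\<phi> n x - v x))) \<longlonglongrightarrow> 0"
    by (rule Lim_null_comparison[OF _ a(5)]) (use sq_integrable_sub(2)[OF A s(3)] in auto)
  show ?thesis unfolding approx_on_def
    using a(1) sq_integrable_sub(1)[OF A a(2)] sq_integrable_sub(1)[OF A a(3)] l l2 by blast
qed

text \<open>The approximating fields also have a limit in the weighted norm; on every ball it agrees with the
  given limit, so that local convergence improves to weighted convergence.\<close>
lemma D1_approx_weighted: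
  assumes v: "v \<in> D1" and D: "D1_approx \<phi> v"
  shows "approx_on half_space \<phi> v (weak_grad v)"
proof -
  let ?M = "half_measure"
  have t: "\<phi> n \<in> test_fields" for n using D by (simp add: D1_approx_def)
  have wg: "sq_integrable ?M (weak_grad v)" using v by (simp add: D1_def Lp_2_iff)
  have vl: "sq_integrable (lebesgue_on (half_space \<inter> ball 0 R)) v" for R using v by (simp add: D1_def Lp_2_iff)
  have gl: "(\<lambda>n. L2norm ?M (\<lambda>x. grad (\<phi> n) x - weak_grad v x)) \<longlonglongrightarrow> 0"
    and ll: "(\<lambda>n. L2norm (lebesgue_on (half_space \<inter> ball 0 R)) (\<lambda>x. \<phi> n x - v x)) \<longlonglongrightarrow> 0" for R
    using D by (simp_all add: D1_approx_def Lp_norm_2)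
  have gs: "sq_integrable ?M (grad (\<phi> n))" for n by (rule grad_test_on[OF t]) simp
  obtain v' G' where ap: "approx_on half_space \<phi> v' G'"
    by (rule approx_limit_exists[OF t lim_Cauchy[OF gs wg gl]]) (assumption, rule that)
  note a = approx_onD[OF ap] and s = approx_on_sq[OF ap half_space_sets(1)]
  have G: "AE x in ?M. G' x = weak_grad v x" by (rule L2_lim_unique[OF gs a(2) wg a(4) gl])
  have vn: "AE x in lebesgue_on (half_space \<inter> ball 0 (real n)). v' x = v x" for n
  proof (rule L2_lim_unique[of "lebesgue_on (half_space \<inter> ball 0 (real n))" \<phi>])
    show "sq_integrable (lebesgue_on (half_space \<inter> ball 0 (real n))) (\<phi> m)" for m
      by (rule test_sq_integrable_on[OF t]) auto
    show "sq_integrable (lebesgue_on (half_space \<inter> ball 0 (real n))) v'"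
      by (rule hardy_local(1)[OF half_space_sets(1) a(3)])
    show "(\<lambda>m. L2norm (lebesgue_on (half_space \<inter> ball 0 (real n))) (\<lambda>x. \<phi> m x - v' x)) \<longlonglongrightarrow> 0"
      by (rule hardy_local_lim[OF half_space_sets(1) s(3) a(5)])
  qed (rule vl, rule ll)
  have "AE x in lebesgue. \<forall>n. x \<in> half_space \<inter> ball 0 (real n) \<longrightarrow> v' x = v x"
    using vn by (subst AE_all_countable) (auto simp: AE_restrict_space_iff)
  then have "AE x in lebesgue. x \<in> half_space \<longrightarrow> v' x = v x"
  proof eventually_elim
    case (elim x)
    obtain n where "norm x < real n" using reals_Archimedean2 by blast
    then show ?case using elim by auto
  qed
  then have "AE x in ?M. v' x = v x" by (simp add: AE_half_iff)
  from approx_on_cong[OF ap half_space_sets(1) this G] show ?thesis .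
qed

definition flip_sign :: "3 \<Rightarrow> real" where
  "flip_sign i = (if i = 3 then -1 else 1)"

lemma flip_sign_square [simp]: "flip_sign i * flip_sign i = 1" "flip_sign i * (flip_sign i * c) = c" "\<bar>flip_sign i\<bar> = 1"
  by (simp_all add: flip_sign_def)

lemma reflect_flip: "reflect x $ i = flip_sign i * x $ i"
  by (simp add: flip_sign_def)

text \<open>Conjugation with the diagonal matrix \<open>diag (1, 1, -1)\<close>, which is how the gradient of a
  mirror-symmetric field transforms.\<close>
definition reflect_mat :: "real^3^3 \<Rightarrow> real^3^3" where
  "reflect_mat A = (\<chi> i j. flip_sign i * flip_sign j * A $ i $ j)"

lemma reflect_mat_nth [simp]: "reflect_mat A $ i $ j = flip_sign i * flip_sign j * A $ i $ j"
  by (simp add: reflect_mat_def)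

lemma reflect_mat_reflect_mat [simp]: "reflect_mat (reflect_mat A) = A"
  by (simp add: vec_eq_iff flip_sign_def)

lemma inner_reflect_mat: "reflect_mat A \<bullet> reflect_mat B = A \<bullet> B"
  by (auto simp: inner_vec_def flip_sign_def intro!: sum.cong)

lemma norm_reflect_mat [simp]: "norm (reflect_mat A) = norm A"
  by (simp add: norm_eq_sqrt_inner inner_reflect_mat)

lemma bounded_linear_reflect_mat: "bounded_linear reflect_mat"
  by (rule bounded_linear_intro[where K=1]) (auto simp: vec_eq_iff algebra_simps)

lemma partial_reflect:
  assumes "f differentiable (at (reflect x))"
  shows "partial i (\<lambda>x. f (reflect x)) x = flip_sign i *\<^sub>R partial i f (reflect x)"
proof -
  have "partial i (\<lambda>x. f (reflect x + 0)) x = (\<Sum>j\<in>UNIV. (reflect (axis i 1) $ j) *\<^sub>R partial j f (reflect x + 0))"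
    by (rule partial_affine_comp[OF bounded_linear_reflect]) (use assms in simp)
  then show ?thesis
    by (simp add: reflect_flip axis_def if_distrib[of "\<lambda>z. _ * z"] if_distrib[of "\<lambda>z. z *\<^sub>R _"] del: reflect_nth cong: if_cong)
qed

lemma test_reflect: "\<psi> \<in> test_functions UNIV \<Longrightarrow> (\<lambda>x. \<psi> (reflect x)) \<in> test_functions UNIV"
proof -
  assume a: "\<psi> \<in> test_functions UNIV"
  obtain R where R: "\<And>x. norm x > R \<Longrightarrow> \<psi> x = 0" by (rule test_supp_bound[OF a]) (rule that)
  have "smooth (\<lambda>x. \<psi> (reflect x))" using smooth_affine[OF test_smooth[OF a] bounded_linear_reflect, of 0] by simp
  then show ?thesis by (rule test_UNIV_I[where R=R]) (simp add: R)
qed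

lemma grad_mirror:
  assumes "smooth \<phi>" "mirror_symmetric \<phi>"
  shows "grad \<phi> (reflect x) = reflect_mat (grad \<phi> x)"
proof -
  have "partial j \<phi> (reflect x) $ i = flip_sign i * flip_sign j * partial j \<phi> x $ i" for i j
  proof -
    have "partial j (\<lambda>x. \<phi> (reflect x)) x = flip_sign j *\<^sub>R partial j \<phi> (reflect x)"
      by (rule partial_reflect[OF smooth_differentiable[OF assms(1)]])
    moreover have "(\<lambda>x. \<phi> (reflect x)) = (\<lambda>x. reflect (\<phi> x))" using assms(2) by (auto simp: mirror_symmetric_def)
    moreover have "partial j (\<lambda>x. reflect (\<phi> x)) x = reflect (partial j \<phi> x)"
      by (rule partial_linear[OF smooth_differentiable[OF assms(1)] bounded_linear_reflect])
    ultimately have "flip_sign j *\<^sub>R partial j \<phi> (reflect x) = reflect (partial j \<phi> x)" by simp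
    then have "flip_sign j *\<^sub>R (flip_sign j *\<^sub>R partial j \<phi> (reflect x)) = flip_sign j *\<^sub>R reflect (partial j \<phi> x)" by (rule arg_cong)
    then have "partial j \<phi> (reflect x) = flip_sign j *\<^sub>R reflect (partial j \<phi> x)" by simp
    then show ?thesis by (simp add: reflect_flip del: reflect_nth)
  qed
  then show ?thesis by (simp add: vec_eq_iff grad_def)
qed

lemma extend_scale: "c (reflect x) = c x \<Longrightarrow> bounded_linear S \<Longrightarrow> c x *\<^sub>R extend S h x = extend S (\<lambda>x. c x *\<^sub>R h x) x"
  by (simp add: extend_def linear_simps(5))

lemma extend_hardy_weight:
  "weight x *\<^sub>R extend reflect h x = extend reflect (\<lambda>x. weight x *\<^sub>R h x) x"
  by (rule extend_scale[where c=weight, OF weight_reflect bounded_linear_reflect])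

lemma L2norm_extend:
  assumes S: "bounded_linear S" "\<And>y. norm (S y) = norm y" and h: "sq_integrable half_measure h"
  shows "L2norm lebesgue (extend S h) = sqrt 2 * L2norm half_measure h"
proof -
  have "norm (extend S h (reflect x)) = norm (extend S h x)" for x
    by (simp add: extend_def S(2))
  then have "L2norm lebesgue (extend S h) = sqrt 2 * L2norm half_measure (extend S h)"
    by (rule L2norm_reflect_invariant[OF extend_sq_integrable[OF S h]])
  also have "L2norm half_measure (extend S h) = L2norm half_measure h"
    unfolding L2norm_def by (intro arg_cong[where f=sqrt] Bochner_Integration.integral_cong refl) simp
  finally show ?thesis .
qed

lemma mirror_extend_diff:
  assumes "\<And>x. f (reflect x) = S (f x)" "bounded_linear S" "x $ 3 \<noteq> 0"
  shows "f x - extend S h x = extend S (\<lambda>x. f x - h x) x"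
proof (cases "x $ 3 > 0")
  case False
  then have "x $ 3 < 0" using assms(3) by simp
  moreover have "f x = S (f (reflect x))" using assms(1)[of "reflect x"] by simp
  ultimately show ?thesis using False linear_simps(2)[OF assms(2)] by (simp add: extend_def)
qed (simp add: extend_def)

text \<open>Symmetric approximations on the half-space also approximate the extended field on the whole
  space.\<close>
lemma approx_extend:
  assumes ap: "approx_on half_space \<phi> v G" and sym: "\<And>n. mirror_symmetric (\<phi> n)"
  shows "approx_on UNIV \<phi> (extend reflect v) (extend reflect_mat G)"
proof -
  note a = approx_onD[OF ap] and s = approx_on_sq[OF ap half_space_sets(1)]
  note bl = bounded_linear_reflect bounded_linear_reflect_mat
  have W: "sq_integrable lebesgue (extend reflect_mat G)"
    by (rule extend_sq_integrable[OF bl(2) norm_reflect_mat a(2)])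
  note eq = extend_hardy_weight
  have w: "sq_integrable lebesgue (\<lambda>x. weight x *\<^sub>R extend reflect v x)"
    unfolding eq by (rule extend_sq_integrable[OF bl(1) norm_reflect a(3)])
  have gm: "grad (\<phi> n) (reflect x) = reflect_mat (grad (\<phi> n) x)" for n x
    by (rule grad_mirror[OF test_smooth[OF a(1)] sym])
  have gt: "sq_integrable lebesgue (grad (\<phi> n))" for n by (rule grad_test(2)[OF a(1)])
  have "L2norm lebesgue (\<lambda>x. grad (\<phi> n) x - extend reflect_mat G x) = sqrt 2 * L2norm half_measure (\<lambda>x. grad (\<phi> n) x - G x)" for n
  proof -
    have "L2norm lebesgue (\<lambda>x. grad (\<phi> n) x - extend reflect_mat G x) = L2norm lebesgue (extend reflect_mat (\<lambda>x. grad (\<phi> n) x - G x))"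
    proof (rule L2norm_cong_AE)
      show "AE x in lebesgue. grad (\<phi> n) x - extend reflect_mat G x = extend reflect_mat (\<lambda>x. grad (\<phi> n) x - G x) x"
        using AE_off_boundary by eventually_elim (rule mirror_extend_diff[where f="grad (\<phi> n)" and S=reflect_mat, OF gm bl(2)])
    qed (intro sq_integrable_meas sq_integrable_diff gt W extend_sq_integrable bl norm_reflect_mat s)+
    then show ?thesis using L2norm_extend[OF bl(2) norm_reflect_mat s(4)] by simp
  qed
  then have 1: "(\<lambda>n. L2norm lebesgue (\<lambda>x. grad (\<phi> n) x - extend reflect_mat G x)) \<longlonglongrightarrow> 0"
    using tendsto_mult_right_zero[OF a(4), of "sqrt 2"] by simp
  have pm: "\<phi> n (reflect x) = reflect (\<phi> n x)" for n x using sym by (simp add: mirror_symmetric_def)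
  have "L2norm lebesgue (\<lambda>x. weight x *\<^sub>R (\<phi> n x - extend reflect v x)) = sqrt 2 * L2norm half_measure (\<lambda>x. weight x *\<^sub>R (\<phi> n x - v x))" for n
  proof -
    have wt: "sq_integrable lebesgue (\<lambda>x. weight x *\<^sub>R \<phi> n x)"
      using weighted_test_sq_integrable[OF a(1), of UNIV n] by (simp add: lebesgue_on_UNIV_eq)
    have "L2norm lebesgue (\<lambda>x. weight x *\<^sub>R (\<phi> n x - extend reflect v x)) = L2norm lebesgue (extend reflect (\<lambda>x. weight x *\<^sub>R (\<phi> n x - v x)))"
    proof (rule L2norm_cong_AE)
      show "AE x in lebesgue. weight x *\<^sub>R (\<phi> n x - extend reflect v x) = extend reflect (\<lambda>x. weight x *\<^sub>R (\<phi> n x - v x)) x"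
        using AE_off_boundary
      proof eventually_elim
        case (elim x)
        show ?case unfolding mirror_extend_diff[of "\<phi> n" reflect, OF pm bl(1) elim] by (rule eq)
      qed
      show "(\<lambda>x. weight x *\<^sub>R (\<phi> n x - extend reflect v x)) \<in> borel_measurable lebesgue"
        using sq_integrable_meas[OF sq_integrable_diff[OF wt w]] by (simp add: scaleR_diff_right)
      show "extend reflect (\<lambda>x. weight x *\<^sub>R (\<phi> n x - v x)) \<in> borel_measurable lebesgue"
        by (intro sq_integrable_meas extend_sq_integrable bl norm_reflect s)
    qed
    then show ?thesis using L2norm_extend[OF bl(1) norm_reflect s(3)] by simp
  qed
  then have 2: "(\<lambda>n. L2norm lebesgue (\<lambda>x. weight x *\<^sub>R (\<phi> n x - extend reflect v x))) \<longlonglongrightarrow> 0"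
    using tendsto_mult_right_zero[OF a(5), of "sqrt 2"] by simp
  show ?thesis unfolding approx_on_def lebesgue_on_UNIV_eq using a(1) W w 1 2 by blast
qed

text \<open>Integration by parts in the half-space survives the limit when the boundary term does: either
  the derivative is tangential, or the test function vanishes on the boundary, or the third component
  is concerned, whose trace is zero.\<close>
lemma V2_integration_by_parts:
  fixes \<psi> :: "real^3 \<Rightarrow> real"
  assumes ap: "approx_on half_space \<phi> v G"
    and g: "\<And>R. sq_integrable (lebesgue_on (ball 0 R)) g"
      "\<And>R. (\<lambda>n. L2norm (lebesgue_on (ball 0 R)) (\<lambda>y. \<phi> n (boundary_point y) - g y)) \<longlonglongrightarrow> 0"
      "AE y in lebesgue. g y $ 3 = 0"
    and psi: "\<psi> \<in> test_functions UNIV"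
    and bc: "j = 3 \<Longrightarrow> b = 3 \<or> (\<forall>y. \<psi> (boundary_point y) = 0)"
  shows "(LINT x|half_measure. partial j \<psi> x * v x $ b) = - (LINT x|half_measure. \<psi> x * G x $ b $ j)"
proof -
  note a = approx_onD[OF ap] and sa = approx_on_sq[OF ap half_space_sets(1)]
  have entry: "bounded_linear (\<lambda>A::real^3^3. A $ b $ j)" by (rule bounded_linear_entry)
  have comp: "bounded_linear (\<lambda>w::real^3. w $ b)" by (rule bounded_linear_vec_nth)
  obtain R0 where R0: "\<And>x. norm x > R0 \<Longrightarrow> \<psi> x = 0" by (rule test_supp_bound[OF psi]) (rule that)
  define R where "R = R0 + 1"
  have R: "\<psi> x = 0" if "norm x > R" for x using that by (intro R0) (simp add: R_def)
  have pR: "partial j \<psi> x = 0" if "norm x > R" for x by (rule partial_zero_far[OF R that])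
  have pc: "continuous_on UNIV (partial j \<psi>)" by (rule test_continuous[OF test_partial[OF psi]])
  have vb: "sq_integrable half_measure (\<lambda>x. weight x *\<^sub>R v x $ b)"
    using sq_integrable_linear[OF a(3) comp] by simp
  have pb: "sq_integrable half_measure (\<lambda>x. weight x *\<^sub>R \<phi> n x $ b)" for n
    using sq_integrable_linear[OF sa(2) comp] by simp
  have pv: "(\<lambda>n. L2norm half_measure (\<lambda>x. weight x *\<^sub>R (\<phi> n x $ b - v x $ b))) \<longlonglongrightarrow> 0"
    using L2_lim_linear[of "half_measure" "\<lambda>n x. weight x *\<^sub>R \<phi> n x" "\<lambda>x. weight x *\<^sub>R v x", OF _ _ comp]
      sa(3) a(5) by (simp add: scaleR_diff_right right_diff_distrib)
  have 1: "(\<lambda>n. LINT x|half_measure. partial j \<psi> x *\<^sub>R \<phi> n x $ b) \<longlonglongrightarrow> (LINT x|half_measure. partial j \<psi> x *\<^sub>R v x $ b)"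
    by (rule test_integral_lim[OF half_space_sets(1) vb pb pv pc pR])
  have 2: "(\<lambda>n. LINT x|half_measure. \<psi> x *\<^sub>R grad (\<phi> n) x $ b $ j) \<longlonglongrightarrow> (LINT x|half_measure. \<psi> x *\<^sub>R G x $ b $ j)"
    using L2_lim_inner[OF sq_integrable_linear[OF sa(1) entry] sq_integrable_linear[OF a(2) entry]
        L2_lim_linear[OF sa(4) a(4) entry] test_sq_integrable_on[OF psi half_space_sets(1)]]
    by (simp add: mult.commute)
  have 3: "(if j = 3 then LINT y|lebesgue. \<psi> (boundary_point y) * \<phi> n (boundary_point y) $ b else 0)
     = (if j = 3 \<and> b = 3 then LINT y|lebesgue. \<psi> (boundary_point y) * \<phi> n (boundary_point y) $ 3 else 0)" for n
    using bc by auto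
  have 4: "(\<lambda>n. LINT y|lebesgue. \<psi> (boundary_point y) * \<phi> n (boundary_point y) $ 3) \<longlonglongrightarrow> 0"
  proof -
    let ?B = "ball (0::real^2) R" and ?p = "\<lambda>y. \<psi> (boundary_point y)"
    have far: "?p y = 0" if "y \<notin> ?B" for y
    proof (rule R0)
      have "norm y \<ge> R" using that by simp
      then show "R0 < norm (boundary_point y)"
        using norm_slab_point_ge(2)[of "(y, 0)"] by (simp add: slab_point_boundary R_def)
    qed
    have ps: "sq_integrable (lebesgue_on ?B) ?p"
      by (rule sq_integrable_on_UNIV_sub(1)[OF _ boundary_cs_sq_integrable[OF test_continuous[OF psi] R]]) simp
    have fs: "sq_integrable (lebesgue_on ?B) (\<lambda>y. \<phi> n (boundary_point y))" for n
      by (rule sq_integrable_on_UNIV_sub(1)[OF _ boundary_test_sq_integrable(2)[OF a(1)]]) simp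
    have c3: "bounded_linear (\<lambda>w::real^3. w $ 3)" by (rule bounded_linear_vec_nth)
    have eq: "(LINT y|lebesgue. ?p y * \<phi> n (boundary_point y) $ 3) = (LINT y|lebesgue_on ?B. (\<phi> n (boundary_point y) $ 3) \<bullet> ?p y)" for n
    proof -
      have "(LINT y|lebesgue. ?p y * \<phi> n (boundary_point y) $ 3) = (LINT y|lebesgue. (if y \<in> ?B then (\<phi> n (boundary_point y) $ 3) \<bullet> ?p y else 0))"
        by (intro Bochner_Integration.integral_cong refl) (use far in auto)
      then show ?thesis by (subst (asm) Lebesgue_Measure.integral_restrict_UNIV) auto
    qed
    have "(\<lambda>n. LINT y|lebesgue_on ?B. (\<phi> n (boundary_point y) $ 3) \<bullet> ?p y) \<longlonglongrightarrow> (LINT y|lebesgue_on ?B. (g y $ 3) \<bullet> ?p y)"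
      by (rule L2_lim_inner[OF sq_integrable_linear[OF fs c3] sq_integrable_linear[OF g(1) c3] _ ps])
         (rule L2_lim_linear[OF sq_integrable_diff[OF fs g(1)] g(2) c3])
    moreover have "(LINT y|lebesgue_on ?B. (g y $ 3) \<bullet> ?p y) = 0"
    proof (rule integral_eq_zero_AE)
      have "AE y in lebesgue. y \<in> ?B \<longrightarrow> (g y $ 3) \<bullet> ?p y = 0" using g(3) by eventually_elim simp
      then show "AE y in lebesgue_on ?B. (g y $ 3) \<bullet> ?p y = 0" by (subst AE_restrict_space_iff) auto
    qed
    ultimately show ?thesis by (simp only: eq)
  qed
  have "(LINT x|half_measure. partial j \<psi> x *\<^sub>R \<phi> n x $ b) = - (LINT x|half_measure. \<psi> x *\<^sub>R grad (\<phi> n) x $ b $ j)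
      - (if j = 3 \<and> b = 3 then LINT y|lebesgue. \<psi> (boundary_point y) * \<phi> n (boundary_point y) $ 3 else 0)" for n
    using integration_by_parts_half[OF psi smooth_component[OF test_smooth[OF a(1)[of n]], of b], of j]
    unfolding 3 by (simp add: grad_nth[OF test_smooth[OF a(1)]])
  note eq = this
  have "(\<lambda>n. if j = 3 \<and> b = 3 then LINT y|lebesgue. \<psi> (boundary_point y) * \<phi> n (boundary_point y) $ 3 else 0) \<longlonglongrightarrow> 0"
    using 4 by (cases "j = 3"; cases "b = 3") simp_all
  from tendsto_diff[OF tendsto_minus[OF 2] this]
  have "(\<lambda>n. LINT x|half_measure. partial j \<psi> x *\<^sub>R \<phi> n x $ b) \<longlonglongrightarrow> - (LINT x|half_measure. \<psi> x *\<^sub>R G x $ b $ j) - 0"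
    unfolding eq .
  from LIMSEQ_unique[OF 1 this] show ?thesis by simp
qed

text \<open>Odd reflection of the third component and even reflection of the others turn the boundary
  condition into weak differentiability across the boundary plane.\<close>
lemma extend_weak_derivative:
  fixes \<psi> :: "real^3 \<Rightarrow> real"
  assumes v: "v \<in> V2" and psi: "\<psi> \<in> test_functions UNIV"
  shows "(LINT x|lebesgue. partial j \<psi> x * extend reflect v x $ b) = - (LINT x|lebesgue. \<psi> x * extend reflect_mat (weak_grad v) x $ b $ j)"
proof -
  let ?M = "half_measure"
  obtain g \<phi> where tr: "D1_approx \<phi> v" "\<And>R. sq_integrable (lebesgue_on (ball 0 R)) g"
      "\<And>R. (\<lambda>n. L2norm (lebesgue_on (ball 0 R)) (\<lambda>y. \<phi> n (boundary_point y) - g y)) \<longlonglongrightarrow> 0"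
      "AE y in lebesgue. g y $ 3 = 0"
    using v unfolding V2_def has_boundary_trace_def Lp_2_iff Lp_norm_2 by blast
  have vD: "v \<in> D1" using v by (simp add: V2_def)
  note ap = D1_approx_weighted[OF vD tr(1)]
  note a = approx_onD[OF ap]
  define w where "w = extend reflect v"
  define W where "W = extend reflect_mat (weak_grad v)"
  have wr: "w (reflect x) = reflect (w x)" for x unfolding w_def by (rule extend_reflect[OF bounded_linear_reflect]) simp
  have Wr: "W (reflect x) = reflect_mat (W x)" for x unfolding W_def by (rule extend_reflect[OF bounded_linear_reflect_mat]) simp
  have hw: "sq_integrable lebesgue (\<lambda>x. weight x *\<^sub>R w x)"
    unfolding w_def extend_hardy_weight
    by (rule extend_sq_integrable[OF bounded_linear_reflect norm_reflect a(3)])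
  have Ws: "sq_integrable lebesgue W" unfolding W_def by (rule extend_sq_integrable[OF bounded_linear_reflect_mat norm_reflect_mat a(2)])
  have comp: "bounded_linear (\<lambda>w::real^3. w $ b)" by (rule bounded_linear_vec_nth)
  have entry: "bounded_linear (\<lambda>A::real^3^3. A $ b $ j)" by (rule bounded_linear_entry)
  have hwb: "sq_integrable (lebesgue_on UNIV) (\<lambda>x. weight x *\<^sub>R w x $ b)"
    using sq_integrable_linear[OF hw comp] by (simp add: lebesgue_on_UNIV_eq)
  have i1: "integrable lebesgue (\<lambda>x. partial j \<psi>' x * w x $ b)" if pt: "\<psi>' \<in> test_functions UNIV" for \<psi>'
  proof -
    obtain R where R: "\<And>x. norm x > R \<Longrightarrow> \<psi>' x = 0" by (rule test_supp_bound[OF pt]) (rule that)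
    have pf: "partial j \<psi>' x = 0" if "norm x > R" for x by (rule partial_zero_far[OF R that])
    have "integrable (lebesgue_on UNIV) (\<lambda>x. partial j \<psi>' x *\<^sub>R w x $ b)"
      by (rule test_mult_weighted(1)[OF _ hwb test_continuous[OF test_partial[OF pt]] pf]) simp
    then show ?thesis by (simp add: lebesgue_on_UNIV_eq)
  qed
  have i2: "integrable lebesgue (\<lambda>x. \<psi>' x * W x $ b $ j)" if "\<psi>' \<in> test_functions UNIV" for \<psi>'
    using sq_integrable_inner[OF test_sq_integrable[OF that] sq_integrable_linear[OF Ws entry]] by simp
  \<comment> \<open>Folding the integral onto the half-space symmetrises \<open>\<psi>\<close>. For the normal derivative of a tangential component the sign is negative, so that the folded function vanishes on the boundary plane, where the trace need not.\<close>
  let ?s = "flip_sign b * flip_sign j"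
  have pr: "(\<lambda>x. \<psi> (reflect x)) \<in> test_functions UNIV" by (rule test_reflect[OF psi])
  have prs: "(\<lambda>x. ?s *\<^sub>R \<psi> (reflect x)) \<in> test_functions UNIV" by (rule test_scale[OF pr])
  define \<Psi> where "\<Psi> x = \<psi> x + ?s *\<^sub>R \<psi> (reflect x)" for x
  have Pt: "\<Psi> \<in> test_functions UNIV" unfolding \<Psi>_def by (rule test_add[OF psi prs])
  have Pp: "partial j \<Psi> x = partial j \<psi> x + flip_sign b * partial j \<psi> (reflect x)" for x
  proof -
    have "partial j \<Psi> x = partial j \<psi> x + partial j (\<lambda>x. ?s *\<^sub>R \<psi> (reflect x)) x"
      unfolding \<Psi>_def by (intro partial_add smooth_differentiable test_smooth[OF psi] test_smooth[OF prs])
    also have "partial j (\<lambda>x. ?s *\<^sub>R \<psi> (reflect x)) x = ?s *\<^sub>R partial j (\<lambda>x. \<psi> (reflect x)) x"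
      by (rule partial_linear[OF smooth_differentiable[OF test_smooth[OF pr]] bounded_linear_scaleR_right])
    also have "partial j (\<lambda>x. \<psi> (reflect x)) x = flip_sign j *\<^sub>R partial j \<psi> (reflect x)"
      by (rule partial_reflect[OF smooth_differentiable[OF test_smooth[OF psi]]])
    finally show ?thesis by (simp add: mult.assoc)
  qed
  have Pb: "b = 3 \<or> (\<forall>y. \<Psi> (boundary_point y) = 0)" if "j = 3"
    using that by (auto simp: \<Psi>_def flip_sign_def)
  have half: "w x = v x" "W x = weak_grad v x" if "x \<in> half_space" for x using that by (simp_all add: w_def W_def)
  have cM: "(LINT x|?M. f x) = (LINT x|?M. h x)" if "\<And>x. x \<in> half_space \<Longrightarrow> f x = h x" for f h :: "real^3 \<Rightarrow> real"
    by (rule Bochner_Integration.integral_cong) (use that in auto)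
  have "(LINT x|lebesgue. partial j \<psi> x * w x $ b) = (LINT x|?M. partial j \<psi> x * w x $ b) + (LINT x|?M. partial j \<psi> (reflect x) * w (reflect x) $ b)"
    by (rule integral_split_reflect[OF i1[OF psi]])
  also have "\<dots> = (LINT x|?M. partial j \<psi> x * w x $ b + partial j \<psi> (reflect x) * w (reflect x) $ b)"
    by (rule Bochner_Integration.integral_add[symmetric])
       (intro integrable_restrictI i1[OF psi] half_space_sets preserving_integrable[OF lebesgue_preserving_reflect i1[OF psi]])+
  also have "\<dots> = (LINT x|?M. partial j \<Psi> x * v x $ b)"
    by (rule cM) (simp add: Pp wr reflect_flip half algebra_simps del: reflect_nth)
  also have "\<dots> = - (LINT x|?M. \<Psi> x * weak_grad v x $ b $ j)"
    by (rule V2_integration_by_parts[OF ap tr(2-4) Pt Pb])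
  also have "(LINT x|?M. \<Psi> x * weak_grad v x $ b $ j) = (LINT x|?M. \<psi> x * W x $ b $ j + \<psi> (reflect x) * W (reflect x) $ b $ j)"
    by (rule cM) (simp add: \<Psi>_def Wr half algebra_simps)
  also have "\<dots> = (LINT x|?M. \<psi> x * W x $ b $ j) + (LINT x|?M. \<psi> (reflect x) * W (reflect x) $ b $ j)"
    by (rule Bochner_Integration.integral_add)
       (intro integrable_restrictI i2[OF psi] half_space_sets preserving_integrable[OF lebesgue_preserving_reflect i2[OF psi]])+
  also have "\<dots> = (LINT x|lebesgue. \<psi> x * W x $ b $ j)"
    by (rule integral_split_reflect[OF i2[OF psi], symmetric])
  finally show ?thesis by (simp only: w_def W_def)
qed

subsection \<open>Smooth approximation of the extended field\<close>

lemma sq_integrable_norm: "sq_integrable M f \<Longrightarrow> sq_integrable M (\<lambda>x. norm (f x))"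
  unfolding sq_integrable_def by auto

lemma cutoff_bounded_integrable:
  fixes f :: "real^3 \<Rightarrow> 'b::euclidean_space"
  assumes "sq_integrable lebesgue f" "\<And>x. norm x > R \<Longrightarrow> f x = 0"
  shows "integrable lebesgue f"
proof -
  have c: "sq_integrable lebesgue (cutoff R :: real^3 \<Rightarrow> real)"
    by (rule cs_sq_integrable[OF cutoff_props(5), where R="R+1"]) (rule cutoff_props(4))
  have "cutoff R x *\<^sub>R f x = f x" for x
    using assms(2)[of x] cutoff_props(3)[of x R] by (cases "norm x > R") auto
  then show ?thesis using sq_integrable_scaleR_prod[OF c assms(1)] by simp
qed

text \<open>The term \<open>outer w (\<nabla> c)\<close> is the contribution of the cut-off \<open>c\<close> to the gradient of \<open>c w\<close>.\<close>
definition outer :: "real^3 \<Rightarrow> real^3 \<Rightarrow> real^3^3" where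
  "outer w c = (\<chi> i j. w $ i * c $ j)"

lemma norm_outer: "norm (outer w c) = norm w * norm c"
proof -
  have "(norm (outer w c))\<^sup>2 = (norm w * norm c)\<^sup>2"
    unfolding norm_matrix_square power_mult_distrib norm_vec_square
    by (simp add: outer_def sum_product power_mult_distrib)
  then show ?thesis by (simp add: power2_eq_iff_nonneg)
qed

lemma outer_measurable:
  assumes "w \<in> borel_measurable M" "c \<in> borel_measurable M"
  shows "(\<lambda>x. outer (w x) (c x)) \<in> borel_measurable M"
proof -
  have "continuous_on UNIV (\<lambda>z::(real^3)\<times>(real^3). outer (fst z) (snd z))"
    unfolding outer_def by (intro continuous_intros)
  from borel_measurable_continuous_on[OF this borel_measurable_Pair[OF assms]] show ?thesis by simp
qed

text \<open>A dilated kernel, normalised to the value one at the origin.\<close>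
definition smooth_cutoff :: "nat \<Rightarrow> real^3 \<Rightarrow> real" where
  "smooth_cutoff m x = moll_kernel 0 ((1 / real (Suc m)) *\<^sub>R x) / moll_kernel 0 0"

lemma moll_kernel_0_pos: "moll_kernel 0 0 > 0"
proof -
  have "box_bump 1 (- moll_corner 0) (moll_corner 0) 0 > 0"
    by (rule box_bump_pos) (auto simp: mem_box_cart moll_corner_def)
  moreover have "(LINT x|lebesgue. box_bump 1 (- moll_corner 0) (moll_corner 0) x) \<ge> 0"
    by (intro Bochner_Integration.integral_nonneg box_bump_bounds)
  moreover have "(LINT x|lebesgue. box_bump 1 (- moll_corner 0) (moll_corner 0) x) \<noteq> 0"
    using moll_kernel_props(3)[of 0] by (auto simp: moll_kernel_def)
  ultimately show ?thesis by (simp add: moll_kernel_def)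
qed

lemma smooth_cutoff_props:
  "smooth (smooth_cutoff m)" "norm x > 3 * real (Suc m) \<Longrightarrow> smooth_cutoff m x = 0"
  "smooth_cutoff m (reflect x) = smooth_cutoff m x" "(\<lambda>m. smooth_cutoff m x) \<longlonglongrightarrow> 1"
proof -
  let ?a = "1 / real (Suc m)"
  have s0: "smooth (moll_kernel 0)" by (rule test_smooth[OF moll_kernel_props(1)])
  have "smooth (\<lambda>x. moll_kernel 0 (?a *\<^sub>R x))"
    using smooth_affine[OF s0 bounded_linear_scaleR_right[of ?a], of 0] by simp
  then have "smooth (\<lambda>x. (1 / moll_kernel 0 0) *\<^sub>R moll_kernel 0 (?a *\<^sub>R x))"
    by (rule smooth_linear[OF _ bounded_linear_scaleR_right])
  then show "smooth (smooth_cutoff m)" by (simp add: smooth_cutoff_def[abs_def])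
  show "smooth_cutoff m x = 0" if "norm x > 3 * real (Suc m)"
  proof -
    have "norm (?a *\<^sub>R x) > 3 * inverse (real (Suc 0))"
      using that by (simp add: less_divide_eq mult.commute)
    then show ?thesis unfolding smooth_cutoff_def using moll_kernel_props(4)[where n=0] by simp
  qed
  show "smooth_cutoff m (reflect x) = smooth_cutoff m x"
    using moll_kernel_props(5)[of 0 "?a *\<^sub>R x"] by (simp add: smooth_cutoff_def reflect_scaleR)
  have "(\<lambda>m. (1 / real (Suc m)) *\<^sub>R x) \<longlonglongrightarrow> 0 *\<^sub>R x"
    using LIMSEQ_inverse_real_of_nat by (intro tendsto_intros) (simp add: divide_inverse)
  then have l: "(\<lambda>m. (1 / real (Suc m)) *\<^sub>R x) \<longlonglongrightarrow> 0" by simp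
  have "isCont (moll_kernel 0) 0"
    using smooth_continuous[OF s0] by (simp add: continuous_on_eq_continuous_at)
  from isCont_tendsto_compose[OF this l]
  have "(\<lambda>m. moll_kernel 0 ((1 / real (Suc m)) *\<^sub>R x) / moll_kernel 0 0) \<longlonglongrightarrow> moll_kernel 0 0 / moll_kernel 0 0"
    by (intro tendsto_divide tendsto_const) (use moll_kernel_0_pos in auto)
  then show "(\<lambda>m. smooth_cutoff m x) \<longlonglongrightarrow> 1" using moll_kernel_0_pos by (simp add: smooth_cutoff_def)
qed

text \<open>The gradient of the cut-off is of the order \<open>1 / m\<close>, and vanishes for \<open>\<bar>x\<bar> > 3 (m + 1)\<close>, so
  that it is dominated by the weight.\<close>
lemma smooth_cutoff_bounds:
  obtains C where "C > 0" "\<And>m x. \<bar>smooth_cutoff m x\<bar> \<le> C"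
    "\<And>m x. norm (\<chi> j. partial j (smooth_cutoff m) x) \<le> C / real (Suc m)"
    "\<And>m x. norm (\<chi> j. partial j (smooth_cutoff m) x) \<le> C * weight x"
proof -
  let ?k = "moll_kernel 0"
  note t = moll_kernel_props(1)[of 0]
  have s0: "smooth ?k" by (rule test_smooth[OF t])
  obtain B where B: "B > 0" "\<And>x. norm (?k x) \<le> B" by (rule test_bounded[OF t]) (rule that)
  have "\<exists>D. D > 0 \<and> (\<forall>x. norm (partial j ?k x) \<le> D)" for j
    using test_bounded[OF test_partial[OF t, of j]] by blast
  then obtain D where D: "\<And>j. D j > 0" "\<And>j x. norm (partial j ?k x) \<le> D j" by metis
  let ?S = "(\<Sum>j\<in>UNIV. D j)"
  have S: "?S > 0" using D(1) by (intro sum_pos) auto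
  have k0: "?k 0 > 0" by (rule moll_kernel_0_pos)
  define C where "C = (B + 4 * ?S) / ?k 0"
  have C: "C > 0" using B S k0 by (simp add: C_def add_pos_pos)
  have 1: "\<bar>smooth_cutoff m x\<bar> \<le> C" for m x
  proof -
    have "\<bar>smooth_cutoff m x\<bar> \<le> B / ?k 0"
      unfolding smooth_cutoff_def using B(2)[of "(1 / real (Suc m)) *\<^sub>R x"] k0 by (simp add: abs_divide divide_right_mono)
    also have "\<dots> \<le> C" unfolding C_def using S k0 by (intro divide_right_mono) auto
    finally show ?thesis .
  qed
  have p: "partial j (smooth_cutoff m) x = (1 / ?k 0) * ((1 / real (Suc m)) * partial j ?k ((1 / real (Suc m)) *\<^sub>R x))" for j m x
  proof -
    let ?a = "1 / real (Suc m)"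
    have "partial j (\<lambda>x. ?k (?a *\<^sub>R x + 0)) x = (\<Sum>i\<in>UNIV. ((?a *\<^sub>R axis j 1 :: real^3) $ i) *\<^sub>R partial i ?k (?a *\<^sub>R x + 0))"
      by (rule partial_affine_comp[OF bounded_linear_scaleR_right smooth_differentiable[OF s0]])
    then have q: "partial j (\<lambda>x. ?k (?a *\<^sub>R x)) x = ?a * partial j ?k (?a *\<^sub>R x)"
      by (simp add: axis_def if_distrib[of "\<lambda>z. _ * z"] if_distrib[of "\<lambda>z. z * _"] if_distrib[of "\<lambda>z. z / _"] cong: if_cong)
    have "smooth (\<lambda>x. ?k (?a *\<^sub>R x))"
      using smooth_affine[OF s0 bounded_linear_scaleR_right[of ?a], of 0] by simp
    from partial_linear[OF smooth_differentiable[OF this] bounded_linear_scaleR_right[of "1 / ?k 0"], of j x]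
    have "partial j (\<lambda>x. (1 / ?k 0) *\<^sub>R ?k (?a *\<^sub>R x)) x = (1 / ?k 0) *\<^sub>R partial j (\<lambda>x. ?k (?a *\<^sub>R x)) x" .
    moreover have "smooth_cutoff m = (\<lambda>x. (1 / ?k 0) *\<^sub>R ?k (?a *\<^sub>R x))" by (simp add: smooth_cutoff_def[abs_def])
    ultimately show ?thesis by (simp only: q real_scaleR_def)
  qed
  have 2: "norm (\<chi> j. partial j (smooth_cutoff m) x) \<le> (?S / ?k 0) / real (Suc m)" for m x
  proof -
    have "norm (\<chi> j. partial j (smooth_cutoff m) x) \<le> (\<Sum>j\<in>UNIV. \<bar>partial j (smooth_cutoff m) x\<bar>)"
      using norm_le_l1_cart[of "\<chi> j. partial j (smooth_cutoff m) x"] by simp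
    also have "\<dots> \<le> (\<Sum>j\<in>UNIV. (1 / ?k 0) * ((1 / real (Suc m)) * D j))"
    proof (rule sum_mono)
      fix j
      have "\<bar>partial j (smooth_cutoff m) x\<bar> = (1 / ?k 0) * ((1 / real (Suc m)) * \<bar>partial j ?k ((1 / real (Suc m)) *\<^sub>R x)\<bar>)"
        unfolding p using k0 by (simp add: abs_mult)
      also have "\<dots> \<le> (1 / ?k 0) * ((1 / real (Suc m)) * D j)"
        using D(2)[of j] k0 by (intro mult_left_mono) auto
      finally show "\<bar>partial j (smooth_cutoff m) x\<bar> \<le> (1 / ?k 0) * ((1 / real (Suc m)) * D j)" .
    qed
    also have "\<dots> = (?S / ?k 0) / real (Suc m)" by (simp add: sum_distrib_left[symmetric] sum_divide_distrib[symmetric] field_simps)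
    finally show ?thesis .
  qed
  have SC: "?S / ?k 0 \<le> C" "4 * (?S / ?k 0) \<le> C" using B S k0 by (simp_all add: C_def divide_right_mono)
  have 3: "norm (\<chi> j. partial j (smooth_cutoff m) x) \<le> C / real (Suc m)" for m x
    by (rule order_trans[OF 2 divide_right_mono[OF SC(1)]]) simp
  have 4: "norm (\<chi> j. partial j (smooth_cutoff m) x) \<le> C * weight x" for m x
  proof (cases "norm x > 3 * real (Suc m)")
    case True
    have "partial j (smooth_cutoff m) x = 0" for j
      by (rule partial_zero_far[OF smooth_cutoff_props(2) True])
    then have "norm (\<chi> j. partial j (smooth_cutoff m) x) = 0" by (simp add: vec_eq_iff)
    then show ?thesis using C weight_pos(1)[of x] by simp
  next
    case False
    define r where "r = real (Suc m)"
    have r: "r \<ge> 1" by (simp add: r_def)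
    have "1 + (3 * r)\<^sup>2 \<le> (4 * r)\<^sup>2" using r mult_mono[OF r r] by (simp add: power2_eq_square)
    then have "sqrt (1 + (3 * r)\<^sup>2) \<le> 4 * r" using r by (intro real_le_lsqrt) auto
    then have "1 / (4 * r) \<le> 1 / sqrt (1 + (3 * r)\<^sup>2)" using r by (intro divide_left_mono) (auto simp: add_pos_nonneg)
    also have "\<dots> \<le> weight x" by (rule weight_lower) (use False in \<open>simp add: r_def\<close>)
    finally have h: "1 / (4 * r) \<le> weight x" .
    have "(4 * (?S / ?k 0)) * (1 / (4 * r)) = (?S / ?k 0) / r" using r by (simp add: field_simps)
    then have "norm (\<chi> j. partial j (smooth_cutoff m) x) \<le> (4 * (?S / ?k 0)) * (1 / (4 * r))"
      using 2[of m x] by (simp only: r_def)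
    also have "\<dots> \<le> C * weight x"
      using SC(2) h C r by (intro mult_mono) auto
    finally show ?thesis .
  qed
  show ?thesis by (rule that[OF C 1 3 4])
qed

lemma mollify_mirror:
  assumes \<rho>: "\<rho> \<in> test_functions UNIV" "\<And>x. \<rho> (reflect x) = \<rho> x" and f: "integrable lebesgue f" "\<And>x. f (reflect x) = reflect (f x)"
  shows "mirror_symmetric (mollify \<rho> f)"
  unfolding mirror_symmetric_def
proof
  fix x
  have rd: "reflect (x - y) = reflect x - reflect y" for x y by (simp add: vec_eq_iff)
  have i: "integrable lebesgue (\<lambda>y. \<rho> (reflect x - y) *\<^sub>R f y)" by (rule mollify_integrable[OF \<rho>(1) f(1)])
  have i2: "integrable lebesgue (\<lambda>y. \<rho> (x - y) *\<^sub>R f y)" by (rule mollify_integrable[OF \<rho>(1) f(1)])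
  have "mollify \<rho> f (reflect x) = (LINT y|lebesgue. \<rho> (reflect x - reflect y) *\<^sub>R f (reflect y))"
    unfolding mollify_def
    by (rule preserving_integral[OF lebesgue_preserving_reflect borel_measurable_integrable[OF i], symmetric])
  also have "\<dots> = (LINT y|lebesgue. reflect (\<rho> (x - y) *\<^sub>R f y))"
    unfolding rd[symmetric] \<rho>(2) f(2) reflect_scaleR ..
  also have "\<dots> = reflect (mollify \<rho> f x)"
    unfolding mollify_def by (rule integral_bounded_linear[OF bounded_linear_reflect i2])
  finally show "mollify \<rho> f (reflect x) = reflect (mollify \<rho> f x)" .
qed

text \<open>The field is cut off, which changes the gradient by the product of the field and the gradient of
  the cut-off; by the previous bound this error is dominated by the weighted field and tends to zero.
  The truncated field is then mollified with a reflection invariant kernel. The hypothesis on \<open>w\<close> says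
  that \<open>W\<close> is its weak gradient, so mollification turns \<open>W\<close> into the classical gradient.\<close>
lemma symmetric_smooth_approximation:
  assumes hw: "sq_integrable lebesgue (\<lambda>x. weight x *\<^sub>R w x)" and W: "sq_integrable lebesgue W"
    and wd: "\<And>\<psi> j b. \<psi> \<in> test_functions UNIV \<Longrightarrow>
       (LINT x|lebesgue. partial j \<psi> x * w x $ b) = - (LINT x|lebesgue. \<psi> x * W x $ b $ j)"
    and sym: "\<And>x. w (reflect x) = reflect (w x)"
  obtains \<phi> where "approx_on UNIV \<phi> w W" "\<And>n. mirror_symmetric (\<phi> n)"
proof -
  obtain C where C: "C > 0" "\<And>m x. \<bar>smooth_cutoff m x\<bar> \<le> C"
    "\<And>m x. norm (\<chi> j. partial j (smooth_cutoff m) x) \<le> C / real (Suc m)"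
    "\<And>m x. norm (\<chi> j. partial j (smooth_cutoff m) x) \<le> C * weight x"
    by (rule smooth_cutoff_bounds) (rule that)
  let ?d = "\<lambda>m x. (\<chi> j. partial j (smooth_cutoff m) x) :: real^3"
  define f where "f m x = smooth_cutoff m x *\<^sub>R w x" for m x
  define F where "F m x = smooth_cutoff m x *\<^sub>R W x + outer (w x) (?d m x)" for m x
  have wm: "w \<in> borel_measurable lebesgue"
    using unweighted_measurable[of w UNIV] sq_integrable_meas[OF hw] by (simp add: lebesgue_on_UNIV_eq)
  have sc: "continuous_on UNIV (smooth_cutoff m)" for m by (rule smooth_continuous[OF smooth_cutoff_props(1)])
  have cm: "smooth_cutoff m \<in> borel_measurable lebesgue" for m by (rule cont_measurable[OF sc])
  have dm: "?d m \<in> borel_measurable lebesgue" for m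
    by (intro cont_measurable continuous_intros smooth_continuous smooth_partial smooth_cutoff_props(1))
  have fz: "f m x = 0" if "norm x > 3 * real (Suc m)" for m x
    using smooth_cutoff_props(2)[OF that] by (simp add: f_def)
  have Fz: "F m x = 0" if "norm x > 3 * real (Suc m)" for m x
    using smooth_cutoff_props(2)[OF that] partial_zero_far[OF smooth_cutoff_props(2) that]
    by (simp add: F_def outer_def vec_eq_iff)
  have hwL: "sq_integrable (lebesgue_on UNIV) (\<lambda>x. weight x *\<^sub>R w x)" using hw by (simp add: lebesgue_on_UNIV_eq)
  have outerb: "norm (outer (w x) (?d m x)) \<le> C * norm (weight x *\<^sub>R w x)" for m x
    using mult_left_mono[OF C(4)[of m x], of "norm (w x)"] weight_pos(1)[of x]
    by (simp add: norm_outer mult_ac)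
  have outers: "sq_integrable lebesgue (\<lambda>x. outer (w x) (?d m x))" for m
    by (rule sq_integrable_bound[OF hw outer_measurable[OF wm dm], where c=C]) (use outerb in simp)
  have cW: "sq_integrable lebesgue (\<lambda>x. smooth_cutoff m x *\<^sub>R W x)" for m
    by (rule sq_integrable_bound[OF W borel_measurable_scaleR[OF cm sq_integrable_meas[OF W]], where c=C])
       (use C(2)[of m] in \<open>simp add: mult_right_mono\<close>)
  have Fs: "sq_integrable lebesgue (F m)" for m unfolding F_def by (rule sq_integrable_add[OF cW outers])
  have Fi: "integrable lebesgue (F m)" for m by (rule cutoff_bounded_integrable[OF Fs Fz])
  have fs: "sq_integrable lebesgue (f m)" for m
  proof -
    have fm: "f m \<in> borel_measurable lebesgue" unfolding f_def by (intro borel_measurable_scaleR cm wm)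
    have "norm (f m x) \<le> (C * sqrt (1 + (3 * real (Suc m))\<^sup>2)) * norm (weight x *\<^sub>R w x)" for x
    proof (cases "norm x > 3 * real (Suc m)")
      case True then show ?thesis using fz C(1) by simp
    next
      case False
      then have "1 / sqrt (1 + (3 * real (Suc m))\<^sup>2) \<le> weight x" by (intro weight_lower) simp
      then have h: "1 \<le> sqrt (1 + (3 * real (Suc m))\<^sup>2) * weight x"
        by (simp add: divide_le_eq add_pos_nonneg mult.commute)
      have "norm (f m x) = \<bar>smooth_cutoff m x\<bar> * norm (w x)" by (simp add: f_def)
      also have "\<dots> \<le> C * (1 * norm (w x))" using C(2)[of m x] by (simp add: mult_right_mono)
      also have "\<dots> \<le> C * ((sqrt (1 + (3 * real (Suc m))\<^sup>2) * weight x) * norm (w x))"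
        by (intro mult_left_mono mult_right_mono h) (use C(1) in auto)
      finally show ?thesis using weight_pos(1)[of x] by (simp add: mult_ac)
    qed
    then show ?thesis
      by (intro sq_integrable_bound[OF hw fm, where c="C * sqrt (1 + (3 * real (Suc m))\<^sup>2)"] AE_I2)
  qed
  have fi: "integrable lebesgue (f m)" for m by (rule cutoff_bounded_integrable[OF fs fz])
  have fr: "f m (reflect x) = reflect (f m x)" for m x
    by (simp add: f_def sym smooth_cutoff_props(3) reflect_scaleR)
  have hwb: "sq_integrable (lebesgue_on UNIV) (\<lambda>x. weight x *\<^sub>R w x $ b)" for b
    using sq_integrable_linear[OF hw bounded_linear_vec_nth[of b]] by (simp add: lebesgue_on_UNIV_eq)
  have iw: "integrable lebesgue (\<lambda>x. \<psi> x * w x $ b)" if pt: "\<psi> \<in> test_functions UNIV" for \<psi> b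
  proof -
    obtain R where R: "\<And>x. norm x > R \<Longrightarrow> \<psi> x = 0" by (rule test_supp_bound[OF pt]) (rule that)
    have "integrable (lebesgue_on UNIV) (\<lambda>x. \<psi> x *\<^sub>R w x $ b)"
      by (rule test_mult_weighted(1)[OF _ hwb test_continuous[OF pt] R]) simp
    then show ?thesis by (simp add: lebesgue_on_UNIV_eq)
  qed
  have iW: "integrable lebesgue (\<lambda>x. \<psi> x * W x $ b $ j)" if "\<psi> \<in> test_functions UNIV" for \<psi> b j
    using sq_integrable_inner[OF test_sq_integrable[OF that] sq_integrable_linear[OF W bounded_linear_entry]] by simp
  have wdf: "(LINT x|lebesgue. partial j \<psi> x * f m x $ b) = - (LINT x|lebesgue. \<psi> x * F m x $ b $ j)"
    if psi: "\<psi> \<in> test_functions UNIV" for \<psi> j b m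
  proof -
    have st: "smooth (smooth_cutoff m)" by (rule smooth_cutoff_props(1))
    have t1: "(\<lambda>x. \<psi> x * smooth_cutoff m x) \<in> test_functions UNIV" by (rule test_mult_smooth[OF psi st])
    have t2: "(\<lambda>x. \<psi> x * partial j (smooth_cutoff m) x) \<in> test_functions UNIV" by (rule test_mult_smooth[OF psi smooth_partial[OF st]])
    have pp: "partial j (\<lambda>x. \<psi> x * smooth_cutoff m x) x = partial j \<psi> x * smooth_cutoff m x + \<psi> x * partial j (smooth_cutoff m) x" for x
      by (intro partial_mult smooth_differentiable test_smooth[OF psi] st)
    have "(LINT x|lebesgue. partial j \<psi> x * f m x $ b) =
       (LINT x|lebesgue. partial j (\<lambda>x. \<psi> x * smooth_cutoff m x) x * w x $ b - \<psi> x * partial j (smooth_cutoff m) x * w x $ b)"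
      unfolding pp by (intro Bochner_Integration.integral_cong refl) (simp add: f_def algebra_simps)
    also have "\<dots> = (LINT x|lebesgue. partial j (\<lambda>x. \<psi> x * smooth_cutoff m x) x * w x $ b) - (LINT x|lebesgue. \<psi> x * partial j (smooth_cutoff m) x * w x $ b)"
      by (rule Bochner_Integration.integral_diff[OF iw[OF test_partial[OF t1]] iw[OF t2]])
    also have "(LINT x|lebesgue. partial j (\<lambda>x. \<psi> x * smooth_cutoff m x) x * w x $ b) = - (LINT x|lebesgue. \<psi> x * smooth_cutoff m x * W x $ b $ j)"
      by (rule wd[OF t1])
    also have "- (LINT x|lebesgue. \<psi> x * smooth_cutoff m x * W x $ b $ j) - (LINT x|lebesgue. \<psi> x * partial j (smooth_cutoff m) x * w x $ b)
       = - (LINT x|lebesgue. \<psi> x * smooth_cutoff m x * W x $ b $ j + \<psi> x * partial j (smooth_cutoff m) x * w x $ b)"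
      using Bochner_Integration.integral_add[OF iW[OF t1] iw[OF t2]] by simp
    also have "\<dots> = - (LINT x|lebesgue. \<psi> x * F m x $ b $ j)"
      by (intro arg_cong[where f=uminus] Bochner_Integration.integral_cong refl) (simp add: F_def outer_def algebra_simps)
    finally show ?thesis .
  qed
  have gm: "grad (mollify \<rho> (f m)) x = mollify \<rho> (F m) x" if \<rho>: "\<rho> \<in> test_functions UNIV" for \<rho> m x
  proof -
    have "grad (mollify \<rho> (f m)) x $ b $ j = mollify \<rho> (F m) x $ b $ j" for b j
    proof -
      have "grad (mollify \<rho> (f m)) x $ b $ j = mollify (partial j \<rho>) (f m) x $ b"
        by (simp add: grad_def partial_mollify[OF \<rho> fi])
      also have "\<dots> = (LINT y|lebesgue. partial j \<rho> (x - y) * f m y $ b)"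
        unfolding mollify_def using mollify_integrable[OF test_partial[OF \<rho>] fi] by (simp add: integral_vec_nth)
      also have "\<dots> = - (LINT y|lebesgue. partial j (\<lambda>y. \<rho> (x - y)) y * f m y $ b)"
        by (simp add: partial_flip[OF \<rho>])
      also have "\<dots> = (LINT y|lebesgue. \<rho> (x - y) * F m y $ b $ j)"
        by (simp add: wdf[OF test_flip[OF \<rho>]])
      also have "\<dots> = mollify \<rho> (F m) x $ b $ j"
        using integral_bounded_linear[OF bounded_linear_entry[of b j] mollify_integrable[OF \<rho> Fi, of x m]]
        by (simp add: mollify_def)
      finally show ?thesis .
    qed
    then show ?thesis by (simp add: vec_eq_iff)
  qed
  define near where "near m k \<longleftrightarrow> L2norm lebesgue (\<lambda>x. mollify (moll_kernel k) (f m) x - f m x) < inverse (real (Suc m)) \<and>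
     L2norm lebesgue (\<lambda>x. mollify (moll_kernel k) (F m) x - F m x) < inverse (real (Suc m))" for m k
  have "\<exists>k. near m k" for m
  proof -
    have "eventually (\<lambda>k. L2norm lebesgue (\<lambda>x. mollify (moll_kernel k) (f m) x - f m x) < inverse (real (Suc m))) sequentially"
      by (rule order_tendstoD(2)[OF mollify_L2_lim[OF fi fs]]) simp
    moreover have "eventually (\<lambda>k. L2norm lebesgue (\<lambda>x. mollify (moll_kernel k) (F m) x - F m x) < inverse (real (Suc m))) sequentially"
      by (rule order_tendstoD(2)[OF mollify_L2_lim[OF Fi Fs]]) simp
    ultimately have "eventually (near m) sequentially"
      unfolding near_def[abs_def] by (rule eventually_conj)
    then show ?thesis by (auto simp: eventually_sequentially)
  qed
  then have "\<forall>m. \<exists>k. near m k" by (rule allI)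
  then have "\<exists>k. \<forall>m. near m (k m)" by (rule choice)
  then obtain k where kn: "\<forall>m. near m (k m)" by (rule exE)
  have k: "L2norm lebesgue (\<lambda>x. mollify (moll_kernel (k m)) (f m) x - f m x) < inverse (real (Suc m))"
     "L2norm lebesgue (\<lambda>x. mollify (moll_kernel (k m)) (F m) x - F m x) < inverse (real (Suc m))" for m
    using spec[OF kn, of m] unfolding near_def by (rule conjunct1, rule conjunct2)
  define \<phi> where "\<phi> m = mollify (moll_kernel (k m)) (f m)" for m
  have t: "\<phi> m \<in> test_fields" for m
    unfolding \<phi>_def by (rule test_mollify[OF moll_kernel_props(1) fi fz])
  have sy: "mirror_symmetric (\<phi> m)" for m
    unfolding \<phi>_def by (rule mollify_mirror[OF moll_kernel_props(1,5) fi fr])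
  have FW: "(\<lambda>m. L2norm lebesgue (\<lambda>x. F m x - W x)) \<longlonglongrightarrow> 0"
  proof (rule L2_dominated[OF sq_integrable_meas[OF Fs] sq_integrable_meas[OF W]])
    let ?g = "\<lambda>x. (C + 1) * norm (W x) + C * norm (weight x *\<^sub>R w x)"
    have "sq_integrable lebesgue (\<lambda>x. (C + 1) *\<^sub>R norm (W x) + C *\<^sub>R norm (weight x *\<^sub>R w x))"
      by (intro sq_integrable_add sq_integrable_scaleR sq_integrable_norm W hw)
    then show "integrable lebesgue (\<lambda>x. (?g x)\<^sup>2)" by (simp add: sq_integrable_def)
    show "AE x in lebesgue. norm (F m x - W x) \<le> ?g x" for m
    proof (rule AE_I2)
      fix x
      have "F m x - W x = (smooth_cutoff m x - 1) *\<^sub>R W x + outer (w x) (?d m x)" by (simp add: F_def algebra_simps)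
      then have "norm (F m x - W x) \<le> \<bar>smooth_cutoff m x - 1\<bar> * norm (W x) + norm (outer (w x) (?d m x))"
        using norm_triangle_ineq[of "(smooth_cutoff m x - 1) *\<^sub>R W x"] by simp
      also have "\<dots> \<le> ?g x"
        using C(2)[of m x] outerb[of x m] by (intro add_mono mult_right_mono) auto
      finally show "norm (F m x - W x) \<le> ?g x" .
    qed
    show "AE x in lebesgue. (\<lambda>m. F m x) \<longlonglongrightarrow> W x"
    proof (rule AE_I2)
      fix x
      have "(\<lambda>m. norm (w x) * (C * inverse (real (Suc m)))) \<longlonglongrightarrow> norm (w x) * (C * 0)"
        by (intro tendsto_intros LIMSEQ_inverse_real_of_nat)
      then have l0: "(\<lambda>m. norm (w x) * (C * inverse (real (Suc m)))) \<longlonglongrightarrow> 0" by simp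
      have "norm (outer (w x) (?d m x)) \<le> norm (w x) * (C * inverse (real (Suc m)))" for m
        unfolding norm_outer using C(3)[of m x] by (intro mult_left_mono) (auto simp: divide_inverse)
      then have "(\<lambda>m. outer (w x) (?d m x)) \<longlonglongrightarrow> 0"
        by (intro Lim_null_comparison[OF _ l0]) auto
      then have "(\<lambda>m. F m x) \<longlonglongrightarrow> 1 *\<^sub>R W x + 0"
        unfolding F_def by (intro tendsto_add tendsto_scaleR tendsto_const smooth_cutoff_props(4))
      then show "(\<lambda>m. F m x) \<longlonglongrightarrow> W x" by simp
    qed
  qed
  have fw: "(\<lambda>m. L2norm lebesgue (\<lambda>x. weight x *\<^sub>R f m x - weight x *\<^sub>R w x)) \<longlonglongrightarrow> 0"
  proof (rule L2_dominated[OF _ sq_integrable_meas[OF hw]])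
    show "(\<lambda>x. weight x *\<^sub>R f m x) \<in> borel_measurable lebesgue" for m
      by (intro borel_measurable_scaleR cont_measurable weight_cont sq_integrable_meas[OF fs])
    have "sq_integrable lebesgue (\<lambda>x. (C + 1) *\<^sub>R norm (weight x *\<^sub>R w x))"
      by (intro sq_integrable_scaleR sq_integrable_norm hw)
    then show "integrable lebesgue (\<lambda>x. ((C + 1) * norm (weight x *\<^sub>R w x))\<^sup>2)" by (simp add: sq_integrable_def)
    show "AE x in lebesgue. norm (weight x *\<^sub>R f m x - weight x *\<^sub>R w x) \<le> (C + 1) * norm (weight x *\<^sub>R w x)" for m
    proof (rule AE_I2)
      fix x
      have "weight x *\<^sub>R f m x - weight x *\<^sub>R w x = (smooth_cutoff m x - 1) *\<^sub>R (weight x *\<^sub>R w x)"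
        by (simp add: f_def algebra_simps)
      then have "norm (weight x *\<^sub>R f m x - weight x *\<^sub>R w x) = \<bar>smooth_cutoff m x - 1\<bar> * norm (weight x *\<^sub>R w x)" by (simp only: norm_scaleR)
      also have "\<dots> \<le> (C + 1) * norm (weight x *\<^sub>R w x)"
        using C(2)[of m x] by (intro mult_right_mono) auto
      finally show "norm (weight x *\<^sub>R f m x - weight x *\<^sub>R w x) \<le> (C + 1) * norm (weight x *\<^sub>R w x)" .
    qed
    show "AE x in lebesgue. (\<lambda>m. weight x *\<^sub>R f m x) \<longlonglongrightarrow> weight x *\<^sub>R w x"
    proof (rule AE_I2)
      fix x
      have "(\<lambda>m. weight x *\<^sub>R f m x) \<longlonglongrightarrow> weight x *\<^sub>R (1 *\<^sub>R w x)"
        unfolding f_def by (intro tendsto_scaleR tendsto_const smooth_cutoff_props(4))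
      then show "(\<lambda>m. weight x *\<^sub>R f m x) \<longlonglongrightarrow> weight x *\<^sub>R w x" by simp
    qed
  qed
  have ms: "sq_integrable lebesgue (mollify (moll_kernel n) (f m))" "sq_integrable lebesgue (mollify (moll_kernel n) (F m))" for n m
    by (intro mollify_L2_bound(1) moll_kernel_props fi fs Fi Fs)+
  have gg: "grad (\<phi> m) x = mollify (moll_kernel (k m)) (F m) x" for m x
    unfolding \<phi>_def by (rule gm[OF moll_kernel_props(1)])
  have g: "(\<lambda>m. L2norm lebesgue (\<lambda>x. grad (\<phi> m) x - W x)) \<longlonglongrightarrow> 0"
  proof (rule Lim_null_comparison)
    show "(\<lambda>m. inverse (real (Suc m)) + L2norm lebesgue (\<lambda>x. F m x - W x)) \<longlonglongrightarrow> 0"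
      using tendsto_add[OF LIMSEQ_inverse_real_of_nat FW] by simp
    show "eventually (\<lambda>m. norm (L2norm lebesgue (\<lambda>x. grad (\<phi> m) x - W x)) \<le> inverse (real (Suc m)) + L2norm lebesgue (\<lambda>x. F m x - W x)) sequentially"
    proof (intro always_eventually allI)
      fix m
      show "norm (L2norm lebesgue (\<lambda>x. grad (\<phi> m) x - W x)) \<le> inverse (real (Suc m)) + L2norm lebesgue (\<lambda>x. F m x - W x)"
        using L2norm_triangle3[OF ms(2)[of "k m" m] Fs[of m] W] k(2)[of m] by (simp add: gg del: of_nat_Suc)
    qed
  qed
  have h: "(\<lambda>m. L2norm lebesgue (\<lambda>x. weight x *\<^sub>R (\<phi> m x - w x))) \<longlonglongrightarrow> 0"
  proof (rule Lim_null_comparison)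
    show "(\<lambda>m. inverse (real (Suc m)) + L2norm lebesgue (\<lambda>x. weight x *\<^sub>R f m x - weight x *\<^sub>R w x)) \<longlonglongrightarrow> 0"
      using tendsto_add[OF LIMSEQ_inverse_real_of_nat fw] by simp
    show "eventually (\<lambda>m. norm (L2norm lebesgue (\<lambda>x. weight x *\<^sub>R (\<phi> m x - w x))) \<le> inverse (real (Suc m)) + L2norm lebesgue (\<lambda>x. weight x *\<^sub>R f m x - weight x *\<^sub>R w x)) sequentially"
    proof (intro always_eventually allI)
      fix m
      have hs: "sq_integrable lebesgue (\<lambda>x. weight x *\<^sub>R \<phi> m x)" "sq_integrable lebesgue (\<lambda>x. weight x *\<^sub>R f m x)"
        using sq_integrable_weighted(1)[of UNIV] ms(1) fs by (auto simp: \<phi>_def lebesgue_on_UNIV_eq)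
      have "L2norm lebesgue (\<lambda>x. weight x *\<^sub>R \<phi> m x - weight x *\<^sub>R f m x) \<le> L2norm lebesgue (\<lambda>x. \<phi> m x - f m x)"
        using sq_integrable_weighted(2)[of UNIV "\<lambda>x. \<phi> m x - f m x"] sq_integrable_diff[OF ms(1) fs]
        by (simp add: \<phi>_def lebesgue_on_UNIV_eq scaleR_diff_right)
      then show "norm (L2norm lebesgue (\<lambda>x. weight x *\<^sub>R (\<phi> m x - w x))) \<le> inverse (real (Suc m)) + L2norm lebesgue (\<lambda>x. weight x *\<^sub>R f m x - weight x *\<^sub>R w x)"
        using L2norm_triangle3[OF hs hw] k(1)[of m] by (simp add: scaleR_diff_right \<phi>_def del: of_nat_Suc)
    qed
  qed
  have "approx_on UNIV \<phi> w W"
    unfolding approx_on_def lebesgue_on_UNIV_eq using t W hw g h by blast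
  then show ?thesis using that sy by blast
qed

text \<open>The converse of \<open>V2_intro\<close>: the reflected field is weakly differentiable on the whole space, and
  its symmetric smooth approximations are restricted to the half-space.\<close>
lemma V2_symmetric_approximation:
  assumes v: "v \<in> V2"
  obtains \<phi> where "approx_on half_space \<phi> v (weak_grad v)" "\<And>n. mirror_symmetric (\<phi> n)"
proof -
  obtain \<psi> where D: "D1_approx \<psi> v" and vD: "v \<in> D1" using v unfolding V2_def has_boundary_trace_def by blast
  note a = approx_onD[OF D1_approx_weighted[OF vD D]]
  have hw: "sq_integrable lebesgue (\<lambda>x. weight x *\<^sub>R extend reflect v x)"
    unfolding extend_hardy_weight by (rule extend_sq_integrable[OF bounded_linear_reflect norm_reflect a(3)])
  have W: "sq_integrable lebesgue (extend reflect_mat (weak_grad v))"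
    by (rule extend_sq_integrable[OF bounded_linear_reflect_mat norm_reflect_mat a(2)])
  obtain \<phi> where p: "approx_on UNIV \<phi> (extend reflect v) (extend reflect_mat (weak_grad v))" "\<And>n. mirror_symmetric (\<phi> n)"
    by (rule symmetric_smooth_approximation[OF hw W extend_weak_derivative[OF v] extend_reflect[OF bounded_linear_reflect reflect_reflect]])
       (assumption, rule that)
  have "approx_on half_space \<phi> v (weak_grad v)"
    by (rule approx_on_cong[OF approx_on_sub[OF p(1) half_space_sets(1)] half_space_sets(1)]) (auto intro!: AE_I2)
  then show ?thesis using that p(2) by blast
qed

section \<open>Korn's inequality\<close>

definition sym_part :: "real^3^3 \<Rightarrow> real^3^3" where
  "sym_part A = (1/2) *\<^sub>R (A + transpose A)"

lemma sym_grad_eq: "sym_grad v x = sym_part (weak_grad v x)"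
  by (simp add: sym_grad_def sym_part_def)

lemma sym_part_nth: "sym_part A $ i $ j = (A $ i $ j + A $ j $ i) / 2"
  by (simp add: sym_part_def transpose_def)

lemma bounded_linear_sym_part: "bounded_linear sym_part"
proof -
  have l: "linear sym_part"
    by (rule linearI) (simp_all add: vec_eq_iff sym_part_nth algebra_simps add_divide_distrib)
  then show ?thesis by (simp add: linear_conv_bounded_linear)
qed

lemma bounded_linear_trace: "bounded_linear (trace :: real^3^3 \<Rightarrow> real)"
proof -
  have "linear (trace :: real^3^3 \<Rightarrow> real)" by (rule linearI) (simp_all add: trace_def sum.distrib sum_distrib_left)
  then show ?thesis by (simp add: linear_conv_bounded_linear)
qed

lemma norm_sym_part: "2 * (norm (sym_part A))\<^sup>2 = (norm A)\<^sup>2 + (\<Sum>i\<in>UNIV. \<Sum>j\<in>UNIV. A $ i $ j * A $ j $ i)"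
proof -
  have "2 * (norm (sym_part A))\<^sup>2 = (\<Sum>i\<in>UNIV. \<Sum>j\<in>UNIV. (A $ i $ j + A $ j $ i)\<^sup>2 / 2)"
    by (simp add: norm_matrix_square sym_part_nth power_divide sum_distrib_left)
  also have "\<dots> = (norm A)\<^sup>2 + (\<Sum>i\<in>UNIV. \<Sum>j\<in>UNIV. A $ i $ j * A $ j $ i)"
    by (simp add: norm_matrix_square sum_3 power2_sum) (simp add: field_simps power2_eq_square)
  finally show ?thesis .
qed

text \<open>Two integrations by parts identify the integral of the product of transposed gradient entries
  with that of the squared divergence.\<close>
lemma korn_test:
  assumes t: "\<phi> \<in> test_fields"
  shows "2 * (L2norm lebesgue (\<lambda>x. sym_part (grad \<phi> x)))\<^sup>2 = (L2norm lebesgue (grad \<phi>))\<^sup>2 + (L2norm lebesgue (\<lambda>x. trace (grad \<phi> x)))\<^sup>2"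
proof -
  let ?p = "\<lambda>i j x. partial j (\<lambda>x. \<phi> x $ i) x"
  have g: "grad \<phi> x $ i $ j = ?p i j x" for x i j by (rule grad_nth[OF test_smooth[OF t]])
  have i: "integrable lebesgue (\<lambda>x. ?p a b x * ?p c d x)" for a b c d
    by (intro test_integrable[of _ UNIV] test_mult_smooth test_partial test_component t smooth_partial smooth_component test_smooth[OF t])
  have gi: "integrable lebesgue (\<lambda>x. (norm (grad \<phi> x))\<^sup>2)" using grad_test(2)[OF t] by (simp add: sq_integrable_def)
  have "2 * (L2norm lebesgue (\<lambda>x. sym_part (grad \<phi> x)))\<^sup>2 = (LINT x|lebesgue. 2 * (norm (sym_part (grad \<phi> x)))\<^sup>2)"
    by (simp add: L2norm_square)
  also have "\<dots> = (LINT x|lebesgue. (norm (grad \<phi> x))\<^sup>2 + (\<Sum>i\<in>UNIV. \<Sum>j\<in>UNIV. ?p i j x * ?p j i x))"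
    unfolding norm_sym_part g ..
  also have "\<dots> = (LINT x|lebesgue. (norm (grad \<phi> x))\<^sup>2) + (\<Sum>i\<in>UNIV. \<Sum>j\<in>UNIV. LINT x|lebesgue. ?p i j x * ?p j i x)"
    using gi i by simp
  also have "(LINT x|lebesgue. (norm (grad \<phi> x))\<^sup>2) = (L2norm lebesgue (grad \<phi>))\<^sup>2" by (simp add: L2norm_square)
  also have "(\<Sum>i\<in>UNIV. \<Sum>j\<in>UNIV. LINT x|lebesgue. ?p i j x * ?p j i x) = (\<Sum>i\<in>UNIV. \<Sum>j\<in>UNIV. LINT x|lebesgue. ?p i i x * ?p j j x)"
    by (intro sum.cong refl integral_partial_swap test_component t)
  also have "\<dots> = (LINT x|lebesgue. (trace (grad \<phi> x))\<^sup>2)"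
  proof -
    have "(trace (grad \<phi> x))\<^sup>2 = (\<Sum>i\<in>UNIV. \<Sum>j\<in>UNIV. ?p i i x * ?p j j x)" for x
      by (simp add: trace_def g power2_eq_square sum_product)
    then show ?thesis using i by simp
  qed
  also have "\<dots> = (L2norm lebesgue (\<lambda>x. trace (grad \<phi> x)))\<^sup>2" by (simp add: L2norm_square)
  finally show ?thesis .
qed

text \<open>The identity for test fields passes to the limit, in which the divergence disappears.\<close>
lemma korn_full:
  assumes ap: "approx_on UNIV \<phi> w W" and div: "AE x in lebesgue. trace (W x) = 0"
  shows "L2norm lebesgue W = sqrt 2 * L2norm lebesgue (\<lambda>x. sym_part (W x))"
proof -
  note a = approx_onD[OF ap, unfolded lebesgue_on_UNIV_eq] and s = approx_on_sq[OF ap, unfolded lebesgue_on_UNIV_eq, simplified]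
  have 1: "(\<lambda>n. L2norm lebesgue (grad (\<phi> n))) \<longlonglongrightarrow> L2norm lebesgue W" by (rule L2norm_tendsto[OF s(1) a(2) a(4)])
  have 2: "(\<lambda>n. L2norm lebesgue (\<lambda>x. sym_part (grad (\<phi> n) x))) \<longlonglongrightarrow> L2norm lebesgue (\<lambda>x. sym_part (W x))"
    by (rule L2norm_tendsto[OF sq_integrable_linear[OF s(1) bounded_linear_sym_part] sq_integrable_linear[OF a(2) bounded_linear_sym_part]
        L2_lim_linear[OF s(4) a(4) bounded_linear_sym_part]])
  have 3: "(\<lambda>n. L2norm lebesgue (\<lambda>x. trace (grad (\<phi> n) x))) \<longlonglongrightarrow> L2norm lebesgue (\<lambda>x. trace (W x))"
    by (rule L2norm_tendsto[OF sq_integrable_linear[OF s(1) bounded_linear_trace] sq_integrable_linear[OF a(2) bounded_linear_trace]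
        L2_lim_linear[OF s(4) a(4) bounded_linear_trace]])
  have z: "L2norm lebesgue (\<lambda>x. trace (W x)) = 0"
  proof -
    have "(LINT x|lebesgue. (norm (trace (W x)))\<^sup>2) = 0"
      by (rule integral_eq_zero_AE) (use div in eventually_elim, simp)
    then show ?thesis by (simp add: L2norm_def)
  qed
  have "(\<lambda>n. 2 * (L2norm lebesgue (\<lambda>x. sym_part (grad (\<phi> n) x)))\<^sup>2) \<longlonglongrightarrow> 2 * (L2norm lebesgue (\<lambda>x. sym_part (W x)))\<^sup>2"
    by (intro tendsto_intros 2)
  moreover have "(\<lambda>n. (L2norm lebesgue (grad (\<phi> n)))\<^sup>2 + (L2norm lebesgue (\<lambda>x. trace (grad (\<phi> n) x)))\<^sup>2) \<longlonglongrightarrow> (L2norm lebesgue W)\<^sup>2 + (L2norm lebesgue (\<lambda>x. trace (W x)))\<^sup>2"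
    by (intro tendsto_intros 1 3)
  ultimately have "2 * (L2norm lebesgue (\<lambda>x. sym_part (W x)))\<^sup>2 = (L2norm lebesgue W)\<^sup>2"
    unfolding korn_test[OF a(1)] using z by (simp add: LIMSEQ_unique)
  then have "(L2norm lebesgue W)\<^sup>2 = (sqrt 2 * L2norm lebesgue (\<lambda>x. sym_part (W x)))\<^sup>2" by (simp add: power_mult_distrib)
  then show ?thesis by (simp add: power2_eq_iff_nonneg)
qed

lemma trace_reflect_mat: "trace (reflect_mat A) = trace A"
  by (simp add: trace_def)

lemma sym_part_reflect_mat: "sym_part (reflect_mat A) = reflect_mat (sym_part A)"
  by (simp add: vec_eq_iff sym_part_nth algebra_simps add_divide_distrib)

lemma extend_commute: "bounded_linear L \<Longrightarrow> (\<And>y. L (S y) = S (L y)) \<Longrightarrow> L (extend S h x) = extend S (\<lambda>x. L (h x)) x"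
  by (simp add: extend_def linear_simps(3))

lemma extend_trace_zero:
  assumes "AE x in half_measure. trace (G x) = 0"
  shows "AE x in lebesgue. trace (extend reflect_mat G x) = 0"
proof -
  have h: "AE x in lebesgue. x \<in> half_space \<longrightarrow> trace (G x) = 0" using assms by (simp add: AE_half_iff)
  have "AE x in lebesgue. reflect x \<in> half_space \<longrightarrow> trace (G (reflect x)) = 0"
    by (rule preserving_AE[OF lebesgue_preserving_reflect h])
  then show ?thesis using h
    by eventually_elim (auto simp: extend_def half_space_def trace_reflect_mat linear_simps(3)[OF bounded_linear_trace])
qed

lemma V2_div: "v \<in> V2 \<Longrightarrow> AE x in half_measure. trace (weak_grad v x) = 0"
  by (simp add: V2_def weak_div_def)

lemma V2_weak_grad: "v \<in> V2 \<Longrightarrow> sq_integrable half_measure (weak_grad v)"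
  by (simp add: V2_def D1_def Lp_2_iff)

lemma V2_sym_grad: "v \<in> V2 \<Longrightarrow> sq_integrable half_measure (sym_grad v)"
  using sq_integrable_linear[OF V2_weak_grad bounded_linear_sym_part] by (simp add: sym_grad_eq[abs_def])

text \<open>Reflection doubles the squares of both norms, so the identity on the whole space descends.\<close>
lemma korn_half:
  assumes v: "v \<in> V2"
  shows "L2norm half_measure (weak_grad v) = sqrt 2 * L2norm half_measure (sym_grad v)"
proof -
  obtain \<phi> where p: "approx_on half_space \<phi> v (weak_grad v)" "\<And>n. mirror_symmetric (\<phi> n)"
    by (rule V2_symmetric_approximation[OF v]) (rule that)
  note bl = bounded_linear_reflect_mat norm_reflect_mat
  have "L2norm lebesgue (extend reflect_mat (weak_grad v)) = sqrt 2 * L2norm lebesgue (\<lambda>x. sym_part (extend reflect_mat (weak_grad v) x))"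
    by (rule korn_full[OF approx_extend[OF p] extend_trace_zero[OF V2_div[OF v]]])
  also have "(\<lambda>x. sym_part (extend reflect_mat (weak_grad v) x)) = extend reflect_mat (sym_grad v)"
    unfolding sym_grad_eq[abs_def] by (rule ext) (rule extend_commute[where L=sym_part and S=reflect_mat, OF bounded_linear_sym_part sym_part_reflect_mat])
  finally show ?thesis
    using L2norm_extend[OF bl V2_weak_grad[OF v]] L2norm_extend[OF bl V2_sym_grad[OF v]] by simp
qed

section \<open>The space of admissible fields\<close>

lemma V2_combine:
  assumes "v \<in> V2" "w \<in> V2"
  shows "(\<lambda>x. c *\<^sub>R v x + d *\<^sub>R w x) \<in> V2"
    "AE x in half_measure. weak_grad (\<lambda>x. c *\<^sub>R v x + d *\<^sub>R w x) x = c *\<^sub>R weak_grad v x + d *\<^sub>R weak_grad w x"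
proof -
  obtain \<phi> where p: "approx_on half_space \<phi> v (weak_grad v)" "\<And>n. mirror_symmetric (\<phi> n)"
    by (rule V2_symmetric_approximation[OF assms(1)]) (rule that)
  obtain \<psi> where q: "approx_on half_space \<psi> w (weak_grad w)" "\<And>n. mirror_symmetric (\<psi> n)"
    by (rule V2_symmetric_approximation[OF assms(2)]) (rule that)
  note ap = approx_on_combine[OF p(1) q(1) half_space_sets(1), of c d]
  have tr: "AE x in half_measure. trace (c *\<^sub>R weak_grad v x + d *\<^sub>R weak_grad w x) = 0"
    using V2_div[OF assms(1)] V2_div[OF assms(2)]
    by eventually_elim (simp add: linear_simps(1,5)[OF bounded_linear_trace])
  show "(\<lambda>x. c *\<^sub>R v x + d *\<^sub>R w x) \<in> V2"
    by (rule V2_intro[OF ap mirror_symmetric_combine[OF p(2) q(2)] tr])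
  show "AE x in half_measure. weak_grad (\<lambda>x. c *\<^sub>R v x + d *\<^sub>R w x) x = c *\<^sub>R weak_grad v x + d *\<^sub>R weak_grad w x"
    by (rule approx_weak_grad(1)[OF ap])
qed

lemma V2_sym_grad_combine:
  assumes "v \<in> V2" "w \<in> V2"
  shows "AE x in half_measure. sym_grad (\<lambda>x. c *\<^sub>R v x + d *\<^sub>R w x) x = c *\<^sub>R sym_grad v x + d *\<^sub>R sym_grad w x"
  using V2_combine(2)[OF assms, of c d]
  by eventually_elim (simp add: sym_grad_eq linear_simps(1,5)[OF bounded_linear_sym_part])

text \<open>Through this bound a field with vanishing gradient vanishes, which is why the gradient norm
  determines a field uniquely.\<close>
lemma hardy_approx:
  assumes ap: "approx_on half_space \<phi> v G"
  shows "L2norm half_measure (\<lambda>x. weight x *\<^sub>R v x) \<le> 2 * L2norm half_measure G"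
proof -
  note a = approx_onD[OF ap] and s = approx_on_sq[OF ap half_space_sets(1)]
  have 1: "(\<lambda>n. L2norm half_measure (\<lambda>x. weight x *\<^sub>R \<phi> n x)) \<longlonglongrightarrow> L2norm half_measure (\<lambda>x. weight x *\<^sub>R v x)"
    by (rule L2norm_tendsto[OF s(2) a(3)]) (use a(5) in \<open>simp add: scaleR_diff_right\<close>)
  have 2: "(\<lambda>n. 2 * L2norm half_measure (grad (\<phi> n))) \<longlonglongrightarrow> 2 * L2norm half_measure G"
    by (intro tendsto_intros L2norm_tendsto[OF s(1) a(2) a(4)])
  show ?thesis by (rule LIMSEQ_le[OF 1 2]) (use hardy_half[OF a(1)] in blast)
qed

lemma V2_zero_gradient:
  assumes v: "v \<in> V2" and z: "L2norm half_measure (weak_grad v) = 0"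
  shows "AE x in half_measure. v x = 0"
proof -
  obtain \<phi> where p: "approx_on half_space \<phi> v (weak_grad v)" "\<And>n. mirror_symmetric (\<phi> n)"
    by (rule V2_symmetric_approximation[OF v]) (rule that)
  have "L2norm half_measure (\<lambda>x. weight x *\<^sub>R v x) = 0"
    using hardy_approx[OF p(1)] z by (simp add: antisym)
  then have "AE x in half_measure. weight x *\<^sub>R v x = 0"
    by (rule L2norm_zero_AE[OF approx_onD(3)[OF p(1)]])
  then show ?thesis
  proof eventually_elim
    case (elim x)
    then show ?case using weight_pos(1)[of x] by simp
  qed
qed

text \<open>Completeness: each member of a Cauchy sequence is replaced by a symmetric test field with
  almost the same gradient.\<close>
lemma V2_complete:
  assumes u: "\<And>n. u n \<in> V2"
    and cau: "\<And>e. e > 0 \<Longrightarrow> \<exists>N. \<forall>m\<ge>N. \<forall>n\<ge>N. L2norm half_measure (\<lambda>x. weak_grad (u m) x - weak_grad (u n) x) < e"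
  obtains v where "v \<in> V2" "(\<lambda>n. L2norm half_measure (\<lambda>x. weak_grad (u n) x - weak_grad v x)) \<longlonglongrightarrow> 0"
proof -
  let ?M = "half_measure"
  define near where "near n \<psi> \<longleftrightarrow> \<psi> \<in> test_fields \<and> mirror_symmetric \<psi> \<and> L2norm ?M (\<lambda>x. grad \<psi> x - weak_grad (u n) x) < inverse (real (Suc n))" for n \<psi>
  have "\<exists>\<psi>. near n \<psi>" for n
  proof -
    obtain \<phi> where p: "approx_on half_space \<phi> (u n) (weak_grad (u n))" "\<And>m. mirror_symmetric (\<phi> m)"
      by (rule V2_symmetric_approximation[OF u]) (rule that)
    have "eventually (\<lambda>m. L2norm ?M (\<lambda>x. grad (\<phi> m) x - weak_grad (u n) x) < inverse (real (Suc n))) sequentially"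
      by (rule order_tendstoD(2)[OF approx_onD(4)[OF p(1)]]) simp
    then obtain m where "L2norm ?M (\<lambda>x. grad (\<phi> m) x - weak_grad (u n) x) < inverse (real (Suc n))"
      by (auto simp: eventually_sequentially)
    then have "near n (\<phi> m)" unfolding near_def using approx_onD(1)[OF p(1)] p(2) by blast
    then show ?thesis by blast
  qed
  then have "\<forall>n. \<exists>\<psi>. near n \<psi>" by (rule allI)
  then have "\<exists>\<phi>. \<forall>n. near n (\<phi> n)" by (rule choice)
  then obtain \<phi> where ph: "\<forall>n. near n (\<phi> n)" by (rule exE)
  have t: "\<phi> n \<in> test_fields" and sy: "mirror_symmetric (\<phi> n)"
    and d: "L2norm ?M (\<lambda>x. grad (\<phi> n) x - weak_grad (u n) x) < inverse (real (Suc n))" for n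
    using spec[OF ph, of n] unfolding near_def by blast+
  have gs: "sq_integrable ?M (grad (\<phi> n))" for n by (rule grad_test_on[OF t]) simp
  have ws: "sq_integrable ?M (weak_grad (u n))" for n by (rule V2_weak_grad[OF u])
  have cau2: "\<exists>N. \<forall>m\<ge>N. \<forall>n\<ge>N. L2norm ?M (\<lambda>x. grad (\<phi> m) x - grad (\<phi> n) x) < e" if e: "e > 0" for e
  proof -
    obtain N1 where N1: "\<And>m n. m \<ge> N1 \<Longrightarrow> n \<ge> N1 \<Longrightarrow> L2norm ?M (\<lambda>x. weak_grad (u m) x - weak_grad (u n) x) < e / 3"
      using cau[of "e/3"] e by auto
    obtain N2 where N2: "inverse (real (Suc N2)) < e / 3" using reals_Archimedean[of "e/3"] e by auto
    have "L2norm ?M (\<lambda>x. grad (\<phi> m) x - grad (\<phi> n) x) < e" if mn: "m \<ge> max N1 N2" "n \<ge> max N1 N2" for m n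
    proof -
      have "inverse (real (Suc m)) \<le> inverse (real (Suc N2))" "inverse (real (Suc n)) \<le> inverse (real (Suc N2))"
        using mn by (auto intro!: le_imp_inverse_le)
      then have i: "L2norm ?M (\<lambda>x. grad (\<phi> m) x - weak_grad (u m) x) < e / 3" "L2norm ?M (\<lambda>x. grad (\<phi> n) x - weak_grad (u n) x) < e / 3"
        using d[of m] d[of n] N2 by linarith+
      have "L2norm ?M (\<lambda>x. grad (\<phi> m) x - grad (\<phi> n) x) \<le> L2norm ?M (\<lambda>x. grad (\<phi> m) x - weak_grad (u m) x) + L2norm ?M (\<lambda>x. weak_grad (u m) x - grad (\<phi> n) x)"
        by (rule L2norm_triangle3[OF gs ws gs])
      moreover have "L2norm ?M (\<lambda>x. weak_grad (u m) x - grad (\<phi> n) x) \<le> L2norm ?M (\<lambda>x. weak_grad (u m) x - weak_grad (u n) x) + L2norm ?M (\<lambda>x. weak_grad (u n) x - grad (\<phi> n) x)"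
        by (rule L2norm_triangle3[OF ws ws gs])
      moreover have "L2norm ?M (\<lambda>x. weak_grad (u m) x - weak_grad (u n) x) < e / 3" using mn by (intro N1) auto
      ultimately show ?thesis using i L2norm_commute[of ?M "weak_grad (u n)" "grad (\<phi> n)"] by linarith
    qed
    then show ?thesis by blast
  qed
  obtain v G where ap: "approx_on half_space \<phi> v G"
    by (rule approx_limit_exists[OF t cau2]) (assumption, rule that)
  note a = approx_onD[OF ap]
  have lim: "(\<lambda>n. L2norm ?M (\<lambda>x. weak_grad (u n) x - G x)) \<longlonglongrightarrow> 0"
  proof (rule Lim_null_comparison)
    show "(\<lambda>n. inverse (real (Suc n)) + L2norm ?M (\<lambda>x. grad (\<phi> n) x - G x)) \<longlonglongrightarrow> 0"
      using tendsto_add[OF LIMSEQ_inverse_real_of_nat a(4)] by simp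
    show "eventually (\<lambda>n. norm (L2norm ?M (\<lambda>x. weak_grad (u n) x - G x)) \<le> inverse (real (Suc n)) + L2norm ?M (\<lambda>x. grad (\<phi> n) x - G x)) sequentially"
    proof (intro always_eventually allI)
      fix n
      have "L2norm ?M (\<lambda>x. weak_grad (u n) x - G x) \<le> L2norm ?M (\<lambda>x. weak_grad (u n) x - grad (\<phi> n) x) + L2norm ?M (\<lambda>x. grad (\<phi> n) x - G x)"
        by (rule L2norm_triangle3[OF ws gs a(2)])
      then show "norm (L2norm ?M (\<lambda>x. weak_grad (u n) x - G x)) \<le> inverse (real (Suc n)) + L2norm ?M (\<lambda>x. grad (\<phi> n) x - G x)"
        using d[of n] L2norm_commute[of ?M "weak_grad (u n)" "grad (\<phi> n)"] L2norm_nonneg[of ?M "\<lambda>x. weak_grad (u n) x - G x"]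
        unfolding real_norm_def by linarith
    qed
  qed
  have tz: "L2norm ?M (\<lambda>x. trace (weak_grad (u n) x) - trace (G x)) = L2norm ?M (\<lambda>x. trace (G x))" for n
  proof -
    have tG: "sq_integrable ?M (\<lambda>x. trace (G x))" "sq_integrable ?M (\<lambda>x. trace (weak_grad (u n) x))"
      by (intro sq_integrable_linear[OF _ bounded_linear_trace] ws a(2))+
    have "L2norm ?M (\<lambda>x. trace (weak_grad (u n) x) - trace (G x)) = L2norm ?M (\<lambda>x. - trace (G x))"
    proof (rule L2norm_cong_AE)
      show "AE x in ?M. trace (weak_grad (u n) x) - trace (G x) = - trace (G x)"
        using V2_div[OF u[of n]] by eventually_elim simp
    qed (intro sq_integrable_meas sq_integrable_diff sq_integrable_minus tG)+
    then show ?thesis by (simp add: L2norm_minus)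
  qed
  have "(\<lambda>n::nat. L2norm ?M (\<lambda>x. trace (G x))) \<longlonglongrightarrow> 0"
    using L2_lim_linear[OF sq_integrable_diff[OF ws a(2)] lim bounded_linear_trace] unfolding tz .
  then have "L2norm ?M (\<lambda>x. trace (G x)) = 0" by (simp add: LIMSEQ_const_iff)
  then have tr: "AE x in ?M. trace (G x) = 0"
    by (rule L2norm_zero_AE[OF sq_integrable_linear[OF a(2) bounded_linear_trace]])
  have v: "v \<in> V2" by (rule V2_intro[OF ap sy tr])
  have "L2norm ?M (\<lambda>x. weak_grad (u n) x - weak_grad v x) = L2norm ?M (\<lambda>x. weak_grad (u n) x - G x)" for n
    by (rule L2norm_cong_AE[OF sq_integrable_meas[OF sq_integrable_diff[OF ws V2_weak_grad[OF v]]] sq_integrable_meas[OF sq_integrable_diff[OF ws a(2)]]])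
       (use approx_weak_grad(1)[OF ap] in eventually_elim, simp)
  then show ?thesis using that[OF v] lim by simp
qed

lemma V2_zero: "(\<lambda>x. 0) \<in> V2"
proof (rule V2_intro)
  have g0: "grad (\<lambda>x. 0) x = 0" for x by (simp add: grad_def vec_eq_iff)
  show "approx_on half_space (\<lambda>n x. 0) (\<lambda>x. 0) (\<lambda>x. 0)"
    unfolding approx_on_def by (simp add: test_zero g0 L2norm_def)
  show "mirror_symmetric (\<lambda>x. 0)" for n :: nat by (simp add: mirror_symmetric_def vec_eq_iff)
qed (simp add: trace_def)

section \<open>The flux and its potential\<close>

definition potential :: "real \<Rightarrow> real \<Rightarrow> real \<Rightarrow> 'b::euclidean_space \<Rightarrow> real" where
  "potential p \<nu>0 \<nu>1 a = \<nu>0 / 2 * (norm a)\<^sup>2 + \<nu>1 / p * norm a powr p"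

definition flux :: "real \<Rightarrow> real \<Rightarrow> real \<Rightarrow> 'b::euclidean_space \<Rightarrow> 'b" where
  "flux p \<nu>0 \<nu>1 a = (\<nu>0 + \<nu>1 * norm a powr (p - 2)) *\<^sub>R a"

lemma powr_split2: "p > 2 \<Longrightarrow> x \<ge> 0 \<Longrightarrow> x powr (p - 2) * (x * x) = x powr p"
  for x :: real
  by (cases "x = 0") (simp_all add: powr_diff powr_numeral power2_eq_square)

lemma powr_split1: "p > 2 \<Longrightarrow> x \<ge> 0 \<Longrightarrow> x powr (p - 2) * x = x powr (p - 1)"
  for x :: real
  by (cases "x = 0") (simp_all add: powr_diff powr_numeral power2_eq_square)

lemma young_powr:
  assumes "p > 2" "x \<ge> 0" "y \<ge> (0::real)"
  shows "x * y powr (p - 1) \<le> x powr p / p + (1 - 1 / p) * y powr p"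
proof -
  define q where "q = p / (p - 1)"
  have q: "q > 1" "1 / p + 1 / q = 1" using assms(1) by (auto simp: q_def field_simps)
  have "x * y powr (p - 1) \<le> x powr p / p + (y powr (p - 1)) powr q / q"
    by (rule Youngs_inequality[OF _ q]) (use assms in auto)
  also have "(y powr (p - 1)) powr q = y powr p"
    using assms(1) by (simp add: powr_powr q_def)
  also have "y powr p / q = (1 - 1 / p) * y powr p"
  proof -
    have "1 - 1 / p = 1 / q" using q(2) by linarith
    then show ?thesis by (simp only:) simp
  qed
  finally show ?thesis .
qed

text \<open>Convexity of \<open>norm a powr p / p\<close>: the Cauchy--Schwarz inequality reduces the claim to Young's
  inequality for the norms.\<close>
lemma p_subgradient:
  fixes a c :: "'b::euclidean_space"
  assumes "p > 2"
  shows "norm c powr p / p - norm a powr p / p \<le> norm c powr (p - 2) * (c \<bullet> (c - a))"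
proof -
  have "norm c powr (p - 2) * (c \<bullet> a) \<le> norm c powr (p - 2) * (norm c * norm a)"
    by (intro mult_left_mono norm_cauchy_schwarz) simp
  also have "\<dots> = norm a * norm c powr (p - 1)"
    using powr_split1[OF assms, of "norm c"] by (simp add: mult_ac)
  also have "\<dots> \<le> norm a powr p / p + (1 - 1 / p) * norm c powr p" by (rule young_powr[OF assms]) auto
  finally have "norm c powr (p - 2) * (c \<bullet> a) \<le> norm a powr p / p + (norm c powr p - norm c powr p / p)"
    by (simp add: algebra_simps)
  moreover have "norm c powr (p - 2) * (c \<bullet> c) = norm c powr p"
    using powr_split2[OF assms, of "norm c"] by (simp add: dot_square_norm power2_eq_square)
  ultimately show ?thesis by (simp add: inner_diff_right right_diff_distrib)
qed

context
  fixes p \<nu>0 \<nu>1 :: real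
  assumes p: "p > 2" and nu: "\<nu>0 > 0" "\<nu>1 > 0"
begin

text \<open>The potential is convex with gradient equal to the flux.\<close>
lemma potential_subgradient:
  fixes a c :: "'b::euclidean_space"
  shows "potential p \<nu>0 \<nu>1 c - potential p \<nu>0 \<nu>1 a + \<nu>0 / 2 * (norm (c - a))\<^sup>2 \<le> flux p \<nu>0 \<nu>1 c \<bullet> (c - a)"
proof -
  have 1: "(norm c)\<^sup>2 - (norm a)\<^sup>2 + (norm (c - a))\<^sup>2 = 2 * (c \<bullet> (c - a))"
    unfolding power2_norm_eq_inner by (simp add: inner_diff_left inner_diff_right inner_commute)
  have 2: "\<nu>1 * (norm c powr p / p - norm a powr p / p) \<le> \<nu>1 * (norm c powr (p - 2) * (c \<bullet> (c - a)))"
    using nu by (intro mult_left_mono p_subgradient[OF p]) simp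
  have "potential p \<nu>0 \<nu>1 c - potential p \<nu>0 \<nu>1 a + \<nu>0 / 2 * (norm (c - a))\<^sup>2 =
    \<nu>0 / 2 * ((norm c)\<^sup>2 - (norm a)\<^sup>2 + (norm (c - a))\<^sup>2) + \<nu>1 * (norm c powr p / p - norm a powr p / p)"
    by (simp add: potential_def algebra_simps)
  also have "\<dots> \<le> \<nu>0 * (c \<bullet> (c - a)) + \<nu>1 * (norm c powr (p - 2) * (c \<bullet> (c - a)))"
    unfolding 1 using 2 by simp
  also have "\<dots> = flux p \<nu>0 \<nu>1 c \<bullet> (c - a)" by (simp add: flux_def algebra_simps)
  finally show ?thesis .
qed

lemma flux_monotone:
  fixes a c :: "'b::euclidean_space"
  shows "\<nu>0 * (norm (a - c))\<^sup>2 \<le> (flux p \<nu>0 \<nu>1 a - flux p \<nu>0 \<nu>1 c) \<bullet> (a - c)"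
  using potential_subgradient[of a c] potential_subgradient[of c a]
  by (simp add: inner_diff_left inner_diff_right norm_minus_commute)

text \<open>The subgradient inequality at the midpoint, averaged over both endpoints: the linear terms cancel
  and the quadratic surplus remains.\<close>
lemma potential_midpoint:
  fixes a c :: "'b::euclidean_space"
  shows "potential p \<nu>0 \<nu>1 ((1/2) *\<^sub>R a + (1/2) *\<^sub>R c) + \<nu>0 / 8 * (norm (a - c))\<^sup>2 \<le> (potential p \<nu>0 \<nu>1 a + potential p \<nu>0 \<nu>1 c) / 2"
proof -
  define b where "b = (1/2) *\<^sub>R a + (1/2) *\<^sub>R c"
  have ba: "b - a = (1/2) *\<^sub>R (c - a)" and bc: "b - c = - ((1/2) *\<^sub>R (c - a))"
    by (simp_all add: b_def algebra_simps scaleR_add_left[symmetric])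
  have n: "(norm (b - a))\<^sup>2 = (norm (a - c))\<^sup>2 / 4" "(norm (b - c))\<^sup>2 = (norm (a - c))\<^sup>2 / 4"
    unfolding ba bc by (simp_all add: power_divide power_mult_distrib norm_minus_commute)
  have "flux p \<nu>0 \<nu>1 b \<bullet> (b - a) + flux p \<nu>0 \<nu>1 b \<bullet> (b - c) = 0" unfolding ba bc by simp
  then show ?thesis
    using potential_subgradient[of b a] potential_subgradient[of b c] unfolding n b_def[symmetric] by simp
qed

lemma potential_bounds:
  shows "0 \<le> potential p \<nu>0 \<nu>1 a" "\<nu>0 / 2 * (norm a)\<^sup>2 \<le> potential p \<nu>0 \<nu>1 a" "\<nu>1 / p * norm a powr p \<le> potential p \<nu>0 \<nu>1 a"
  using p nu by (auto simp: potential_def)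

lemma norm_flux_le: "norm (flux p \<nu>0 \<nu>1 a) \<le> \<nu>0 * norm a + \<nu>1 * norm a powr (p - 1)"
proof -
  have "norm (flux p \<nu>0 \<nu>1 a) = (\<nu>0 + \<nu>1 * norm a powr (p - 2)) * norm a"
    using nu by (simp add: flux_def abs_of_nonneg)
  also have "\<dots> = \<nu>0 * norm a + \<nu>1 * norm a powr (p - 1)"
    using powr_split1[OF p, of "norm a"] by (simp add: algebra_simps)
  finally show ?thesis by simp
qed

end

lemma flux_tendsto:
  fixes a :: "'b::euclidean_space"
  assumes "p > 2" "f \<longlonglongrightarrow> a"
  shows "(\<lambda>n. flux p \<nu>0 \<nu>1 (f n)) \<longlonglongrightarrow> flux p \<nu>0 \<nu>1 a"
  unfolding flux_def
  by (intro tendsto_intros tendsto_powr' assms) (use assms(1) in auto)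

lemma potential_tendsto:
  fixes a :: "'b::euclidean_space"
  assumes "p > 2" "f \<longlonglongrightarrow> a"
  shows "(\<lambda>n. potential p \<nu>0 \<nu>1 (f n)) \<longlonglongrightarrow> potential p \<nu>0 \<nu>1 a"
  unfolding potential_def
  by (intro tendsto_intros tendsto_powr' assms) (use assms(1) in auto)

lemma flux_measurable: "f \<in> borel_measurable M \<Longrightarrow> (\<lambda>x. flux p \<nu>0 \<nu>1 (f x)) \<in> borel_measurable M"
  for f :: "'a \<Rightarrow> 'b::euclidean_space"
  unfolding flux_def by measurable

lemma potential_measurable: "f \<in> borel_measurable M \<Longrightarrow> (\<lambda>x. potential p \<nu>0 \<nu>1 (f x)) \<in> borel_measurable M"
  for f :: "'a \<Rightarrow> 'b::euclidean_space"
proof -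
  assume f[measurable]: "f \<in> borel_measurable M"
  have 1: "(\<lambda>x. norm (f x) powr p) \<in> borel_measurable M" by measurable
  have 2: "(\<lambda>x. (norm (f x))\<^sup>2) \<in> borel_measurable M" by measurable
  show ?thesis unfolding potential_def
    by (rule borel_measurable_add[OF borel_measurable_times[OF borel_measurable_const 2] borel_measurable_times[OF borel_measurable_const 1]])
qed

subsection \<open>Functions with finite energy\<close>

definition energy_integrable :: "real \<Rightarrow> 'a measure \<Rightarrow> ('a \<Rightarrow> 'b::euclidean_space) \<Rightarrow> bool" where
  "energy_integrable p M f \<longleftrightarrow> sq_integrable M f \<and> integrable M (\<lambda>x. norm (f x) powr p)"

lemma powr_add_le:
  assumes "p > (0::real)" "a \<ge> 0" "b \<ge> 0"
  shows "(a + b) powr p \<le> 2 powr p * (a powr p + b powr p)"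
proof -
  have "(a + b) powr p \<le> (2 * max a b) powr p" using assms by (intro powr_mono2) auto
  also have "\<dots> = 2 powr p * max a b powr p" using assms by (simp add: powr_mult)
  also have "\<dots> \<le> 2 powr p * (a powr p + b powr p)" by (intro mult_left_mono) (auto simp: max_def)
  finally show ?thesis .
qed

lemma energy_integrable_meas: "energy_integrable p M f \<Longrightarrow> f \<in> borel_measurable M"
  by (simp add: energy_integrable_def sq_integrable_def)

lemma energy_integrable_bound:
  assumes p: "p > 0" and g: "energy_integrable p M g" and f: "f \<in> borel_measurable M" and le: "AE x in M. norm (f x) \<le> norm (g x)"
  shows "energy_integrable p M f"
proof -
  have "integrable M (\<lambda>x. norm (f x) powr p)"
  proof (rule Bochner_Integration.integrable_bound)
    show "integrable M (\<lambda>x. norm (g x) powr p)" using g by (simp add: energy_integrable_def)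
    show "AE x in M. norm (norm (f x) powr p) \<le> norm (norm (g x) powr p)"
      using le by eventually_elim (use p in \<open>simp add: powr_mono2\<close>)
  qed (use f in measurable)
  moreover have "sq_integrable M f"
    by (rule sq_integrable_bound[OF _ f, where c=1]) (use g le in \<open>auto simp: energy_integrable_def\<close>)
  ultimately show ?thesis by (simp add: energy_integrable_def)
qed

lemma energy_integrable_scaleR: "energy_integrable p M f \<Longrightarrow> energy_integrable p M (\<lambda>x. c *\<^sub>R f x)"
  unfolding energy_integrable_def by (auto simp: powr_mult intro: sq_integrable_scaleR)

lemma energy_integrable_norm: "energy_integrable p M f \<Longrightarrow> energy_integrable p M (\<lambda>x. norm (f x))"
  unfolding energy_integrable_def by (auto intro: sq_integrable_norm)

lemma energy_integrable_add:
  assumes p: "p > 0" and f: "energy_integrable p M f" and g: "energy_integrable p M g"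
  shows "energy_integrable p M (\<lambda>x. f x + g x)"
proof -
  have m: "f \<in> borel_measurable M" "g \<in> borel_measurable M" using f g by (auto intro: energy_integrable_meas)
  have i: "integrable M (\<lambda>x. 2 powr p * (norm (f x) powr p + norm (g x) powr p))"
    using f g by (simp add: energy_integrable_def)
  have "integrable M (\<lambda>x. norm (f x + g x) powr p)"
  proof (rule Bochner_Integration.integrable_bound[OF i])
    show "AE x in M. norm (norm (f x + g x) powr p) \<le> norm (2 powr p * (norm (f x) powr p + norm (g x) powr p))"
    proof (rule AE_I2)
      fix x
      have "norm (f x + g x) powr p \<le> (norm (f x) + norm (g x)) powr p"
        using p by (intro powr_mono2 norm_triangle_ineq) auto
      also have "\<dots> \<le> 2 powr p * (norm (f x) powr p + norm (g x) powr p)" by (rule powr_add_le[OF p]) auto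
      finally show "norm (norm (f x + g x) powr p) \<le> norm (2 powr p * (norm (f x) powr p + norm (g x) powr p))" by simp
    qed
  qed (use m in measurable)
  then show ?thesis using f g sq_integrable_add by (auto simp: energy_integrable_def)
qed

lemma energy_integrable_combine:
  "p > 0 \<Longrightarrow> energy_integrable p M f \<Longrightarrow> energy_integrable p M g \<Longrightarrow> energy_integrable p M (\<lambda>x. c *\<^sub>R f x + d *\<^sub>R g x)"
  by (intro energy_integrable_add energy_integrable_scaleR)

lemma potential_integrable: "energy_integrable p M f \<Longrightarrow> integrable M (\<lambda>x. potential p \<nu>0 \<nu>1 (f x))"
  unfolding potential_def energy_integrable_def sq_integrable_def by simp

lemma flux_inner_bound:
  fixes a b :: "'b::euclidean_space"
  assumes "p > 2" "\<nu>0 > 0" "\<nu>1 > 0" "norm a \<le> r" "norm b \<le> r"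
  shows "\<bar>flux p \<nu>0 \<nu>1 a \<bullet> b\<bar> \<le> \<nu>0 * r\<^sup>2 + \<nu>1 * r powr p"
proof -
  have r: "r \<ge> 0" using assms(4) norm_ge_zero order_trans by blast
  have "\<bar>flux p \<nu>0 \<nu>1 a \<bullet> b\<bar> \<le> norm (flux p \<nu>0 \<nu>1 a) * norm b" by (rule Cauchy_Schwarz_ineq2)
  also have "\<dots> \<le> (\<nu>0 * r + \<nu>1 * r powr (p - 1)) * r"
  proof (intro mult_mono assms)
    have "norm (flux p \<nu>0 \<nu>1 a) \<le> \<nu>0 * norm a + \<nu>1 * norm a powr (p - 1)" by (rule norm_flux_le[OF assms(1-3)])
    also have "\<dots> \<le> \<nu>0 * r + \<nu>1 * r powr (p - 1)"
      using assms by (intro add_mono mult_left_mono powr_mono2) auto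
    finally show "norm (flux p \<nu>0 \<nu>1 a) \<le> \<nu>0 * r + \<nu>1 * r powr (p - 1)" .
  qed (use assms r in auto)
  also have "\<dots> = \<nu>0 * r\<^sup>2 + \<nu>1 * r powr p"
  proof -
    have "r powr (p - 1) * r = r powr p"
      using r assms(1) by (cases "r = 0") (simp_all add: powr_diff)
    then show ?thesis by (simp add: algebra_simps power2_eq_square)
  qed
  finally show ?thesis .
qed

lemma flux_inner_integrable:
  assumes "p > 2" "\<nu>0 > 0" "\<nu>1 > 0" and a: "energy_integrable p M a" and b: "energy_integrable p M b"
  shows "integrable M (\<lambda>x. flux p \<nu>0 \<nu>1 (a x) \<bullet> b x)"
proof -
  have m: "a \<in> borel_measurable M" "b \<in> borel_measurable M" using a b by (auto intro: energy_integrable_meas)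
  have r: "energy_integrable p M (\<lambda>x. norm (a x) + norm (b x))"
    using assms by (intro energy_integrable_add energy_integrable_norm) auto
  have "integrable M (\<lambda>x. \<nu>0 * (norm (a x) + norm (b x))\<^sup>2 + \<nu>1 * (norm (a x) + norm (b x)) powr p)"
    using r by (simp add: energy_integrable_def sq_integrable_def)
  then show ?thesis
  proof (rule Bochner_Integration.integrable_bound)
    show "AE x in M. norm (flux p \<nu>0 \<nu>1 (a x) \<bullet> b x) \<le> norm (\<nu>0 * (norm (a x) + norm (b x))\<^sup>2 + \<nu>1 * (norm (a x) + norm (b x)) powr p)"
    proof (rule AE_I2)
      fix x
      have "\<bar>flux p \<nu>0 \<nu>1 (a x) \<bullet> b x\<bar> \<le> \<nu>0 * (norm (a x) + norm (b x))\<^sup>2 + \<nu>1 * (norm (a x) + norm (b x)) powr p"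
        by (rule flux_inner_bound[OF assms(1-3)]) auto
      then show "norm (flux p \<nu>0 \<nu>1 (a x) \<bullet> b x) \<le> norm (\<nu>0 * (norm (a x) + norm (b x))\<^sup>2 + \<nu>1 * (norm (a x) + norm (b x)) powr p)"
        by simp
    qed
  qed (use flux_measurable[OF m(1)] m(2) in measurable)
qed

text \<open>Dominated convergence: the norms of all arguments are bounded by \<open>norm a + norm b\<close>, which has
  finite energy.\<close>
lemma flux_inner_lim:
  assumes p: "p > 2" "\<nu>0 > 0" "\<nu>1 > 0" and a: "energy_integrable p M a" and b: "energy_integrable p M b"
  shows "(\<lambda>n. LINT x|M. flux p \<nu>0 \<nu>1 (a x + inverse (real (Suc n)) *\<^sub>R b x) \<bullet> b x) \<longlonglongrightarrow> (LINT x|M. flux p \<nu>0 \<nu>1 (a x) \<bullet> b x)"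
proof (rule integral_dominated_convergence)
  have m: "a \<in> borel_measurable M" "b \<in> borel_measurable M" using a b by (auto intro: energy_integrable_meas)
  have r: "energy_integrable p M (\<lambda>x. norm (a x) + norm (b x))"
    using assms by (intro energy_integrable_add energy_integrable_norm) auto
  then show "integrable M (\<lambda>x. \<nu>0 * (norm (a x) + norm (b x))\<^sup>2 + \<nu>1 * (norm (a x) + norm (b x)) powr p)"
    by (simp add: energy_integrable_def sq_integrable_def)
  show "(\<lambda>x. flux p \<nu>0 \<nu>1 (a x) \<bullet> b x) \<in> borel_measurable M"
    using flux_measurable[OF m(1)] m(2) by measurable
  show "(\<lambda>x. flux p \<nu>0 \<nu>1 (a x + inverse (real (Suc n)) *\<^sub>R b x) \<bullet> b x) \<in> borel_measurable M" for n
  proof -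
    have "(\<lambda>x. a x + inverse (real (Suc n)) *\<^sub>R b x) \<in> borel_measurable M" using m by measurable
    from flux_measurable[OF this] m(2) show ?thesis by measurable
  qed
  show "AE x in M. norm (flux p \<nu>0 \<nu>1 (a x + inverse (real (Suc n)) *\<^sub>R b x) \<bullet> b x) \<le> \<nu>0 * (norm (a x) + norm (b x))\<^sup>2 + \<nu>1 * (norm (a x) + norm (b x)) powr p" for n
  proof (rule AE_I2)
    fix x
    have "inverse (real (Suc n)) * norm (b x) \<le> norm (b x)"
      by (rule mult_left_le_one_le) (simp_all add: inverse_le_1_iff)
    then have "norm (a x + inverse (real (Suc n)) *\<^sub>R b x) \<le> norm (a x) + norm (b x)"
      using norm_triangle_ineq[of "a x" "inverse (real (Suc n)) *\<^sub>R b x"] by simp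
    then have "\<bar>flux p \<nu>0 \<nu>1 (a x + inverse (real (Suc n)) *\<^sub>R b x) \<bullet> b x\<bar> \<le> \<nu>0 * (norm (a x) + norm (b x))\<^sup>2 + \<nu>1 * (norm (a x) + norm (b x)) powr p"
      by (intro flux_inner_bound[OF p]) auto
    then show "norm (flux p \<nu>0 \<nu>1 (a x + inverse (real (Suc n)) *\<^sub>R b x) \<bullet> b x) \<le> \<nu>0 * (norm (a x) + norm (b x))\<^sup>2 + \<nu>1 * (norm (a x) + norm (b x)) powr p"
      by simp
  qed
  show "AE x in M. (\<lambda>n. flux p \<nu>0 \<nu>1 (a x + inverse (real (Suc n)) *\<^sub>R b x) \<bullet> b x) \<longlonglongrightarrow> flux p \<nu>0 \<nu>1 (a x) \<bullet> b x"
  proof (rule AE_I2)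
    fix x
    have "(\<lambda>n. a x + inverse (real (Suc n)) *\<^sub>R b x) \<longlonglongrightarrow> a x + 0 *\<^sub>R b x"
      by (intro tendsto_intros LIMSEQ_inverse_real_of_nat)
    then have "(\<lambda>n. a x + inverse (real (Suc n)) *\<^sub>R b x) \<longlonglongrightarrow> a x" by simp
    from tendsto_inner[OF flux_tendsto[OF p(1) this] tendsto_const]
    show "(\<lambda>n. flux p \<nu>0 \<nu>1 (a x + inverse (real (Suc n)) *\<^sub>R b x) \<bullet> b x) \<longlonglongrightarrow> flux p \<nu>0 \<nu>1 (a x) \<bullet> b x" .
  qed
qed

section \<open>Existence and uniqueness\<close>

lemma V_iff: "v \<in> V p \<longleftrightarrow> v \<in> V2 \<and> energy_integrable p half_measure (sym_grad v)"
  using V2_sym_grad[of v] by (auto simp: V_def Lp_def energy_integrable_def sq_integrable_def)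

lemma V_combine:
  assumes p: "p > 0" and v: "v \<in> V p" and w: "w \<in> V p"
  shows "(\<lambda>x. c *\<^sub>R v x + d *\<^sub>R w x) \<in> V p"
proof -
  have V2: "v \<in> V2" "w \<in> V2" using v w by (auto simp: V_iff)
  have e: "energy_integrable p half_measure (\<lambda>x. c *\<^sub>R sym_grad v x + d *\<^sub>R sym_grad w x)"
    using v w by (intro energy_integrable_combine p) (auto simp: V_iff)
  have "energy_integrable p half_measure (sym_grad (\<lambda>x. c *\<^sub>R v x + d *\<^sub>R w x))"
    by (rule energy_integrable_bound[OF p e sq_integrable_meas[OF V2_sym_grad[OF V2_combine(1)[OF V2]]]])
       (use V2_sym_grad_combine[OF V2, of c d] in eventually_elim, simp)
  then show ?thesis using V2_combine(1)[OF V2] by (simp add: V_iff)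
qed

lemma V_zero: "p > 0 \<Longrightarrow> (\<lambda>x. 0) \<in> V p"
proof -
  assume p: "p > 0"
  have "AE x in half_measure. sym_grad (\<lambda>x. 0) x = 0"
    using V2_sym_grad_combine[OF V2_zero V2_zero, of 0 0] by simp
  moreover have "energy_integrable p half_measure (\<lambda>x. 0 :: real^3^3)" by (simp add: energy_integrable_def)
  ultimately have "energy_integrable p half_measure (sym_grad (\<lambda>x. 0))"
    using energy_integrable_bound[OF p _ sq_integrable_meas[OF V2_sym_grad[OF V2_zero]], of "\<lambda>x. 0 :: real^3^3"] by auto
  then show ?thesis using V2_zero by (simp add: V_iff)
qed

lemma functional_combine:
  assumes F: "bounded_functional_V2 F" and v: "v \<in> V2" "w \<in> V2"
  shows "F (\<lambda>x. c *\<^sub>R v x + d *\<^sub>R w x) = c * F v + d * F w"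
proof -
  have s: "(\<lambda>x. a *\<^sub>R z x) \<in> V2" if "z \<in> V2" for a z
    using V2_combine(1)[OF that that, of a 0] by simp
  have "F (\<lambda>x. c *\<^sub>R v x + d *\<^sub>R w x) = F (\<lambda>x. c *\<^sub>R v x) + F (\<lambda>x. d *\<^sub>R w x)"
  proof -
    have "\<And>v w. v \<in> V2 \<Longrightarrow> w \<in> V2 \<Longrightarrow> F (\<lambda>x. v x + w x) = F v + F w"
      using F unfolding bounded_functional_V2_def by blast
    from this[OF s[OF v(1), of c] s[OF v(2), of d]] show ?thesis .
  qed
  also have "\<dots> = c * F v + d * F w" using F v unfolding bounded_functional_V2_def by simp
  finally show ?thesis .
qed

text \<open>By Korn's inequality the functional is also controlled by the symmetric gradient, which is the only
  part of the gradient that the energy sees.\<close>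
lemma functional_bound:
  assumes F: "bounded_functional_V2 F"
  obtains K where "K \<ge> 0" "\<And>v. v \<in> V2 \<Longrightarrow> \<bar>F v\<bar> \<le> K * L2norm half_measure (sym_grad v)"
    "\<And>v. v \<in> V2 \<Longrightarrow> \<bar>F v\<bar> \<le> K * L2norm half_measure (weak_grad v)"
proof -
  obtain C where C: "\<And>v. v \<in> V2 \<Longrightarrow> \<bar>F v\<bar> \<le> C * L2norm half_measure (weak_grad v)"
    using F unfolding bounded_functional_V2_def Lp_norm_2 by blast
  have 1: "\<bar>F v\<bar> \<le> (\<bar>C\<bar> * sqrt 2) * L2norm half_measure (sym_grad v)" if v: "v \<in> V2" for v
  proof -
    have "\<bar>F v\<bar> \<le> \<bar>C\<bar> * L2norm half_measure (weak_grad v)"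
      by (rule order_trans[OF C[OF v] mult_right_mono]) auto
    then show ?thesis by (simp add: korn_half[OF v] mult.assoc)
  qed
  have 2: "\<bar>F v\<bar> \<le> (\<bar>C\<bar> * sqrt 2) * L2norm half_measure (weak_grad v)" if v: "v \<in> V2" for v
  proof -
    have "1 \<le> sqrt 2" by simp
    then have "\<bar>C\<bar> * 1 \<le> \<bar>C\<bar> * sqrt 2" by (rule mult_left_mono) simp
    then have "C \<le> \<bar>C\<bar> * sqrt 2" by linarith
    then show ?thesis by (rule order_trans[OF C[OF v] mult_right_mono]) simp
  qed
  show ?thesis by (rule that[of "\<bar>C\<bar> * sqrt 2"]) (use 1 2 in auto)
qed

lemma sym_grad_difference:
  assumes "v \<in> V2" "w \<in> V2"
  shows "L2norm half_measure (\<lambda>x. weak_grad v x - weak_grad w x) = sqrt 2 * L2norm half_measure (\<lambda>x. sym_grad v x - sym_grad w x)"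
proof -
  let ?z = "\<lambda>x. 1 *\<^sub>R v x + (-1) *\<^sub>R w x"
  have z: "?z \<in> V2" by (rule V2_combine(1)[OF assms])
  have "L2norm half_measure (\<lambda>x. weak_grad v x - weak_grad w x) = L2norm half_measure (weak_grad ?z)"
    by (rule L2norm_cong_AE[OF sq_integrable_meas[OF sq_integrable_diff] sq_integrable_meas])
       (use V2_weak_grad assms z V2_combine(2)[OF assms, of 1 "-1"] in auto)
  also have "\<dots> = sqrt 2 * L2norm half_measure (sym_grad ?z)" by (rule korn_half[OF z])
  also have "L2norm half_measure (sym_grad ?z) = L2norm half_measure (\<lambda>x. sym_grad v x - sym_grad w x)"
    by (rule L2norm_cong_AE[OF sq_integrable_meas sq_integrable_meas[OF sq_integrable_diff]])
       (use V2_sym_grad assms z V2_sym_grad_combine[OF assms, of 1 "-1"] in auto)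
  finally show ?thesis .
qed

context
  fixes p \<nu>0 \<nu>1 :: real and F :: "(real^3 \<Rightarrow> real^3) \<Rightarrow> real"
  assumes p: "p > 2" and nu: "\<nu>0 > 0" "\<nu>1 > 0" and F: "bounded_functional_V2 F"
begin

definition energy :: "(real^3 \<Rightarrow> real^3) \<Rightarrow> real" where
  "energy v = (LINT x|half_measure. potential p \<nu>0 \<nu>1 (sym_grad v x)) - F v"

lemma energy_midpoint:
  assumes v: "v \<in> V p" and w: "w \<in> V p"
  shows "energy (\<lambda>x. (1/2) *\<^sub>R v x + (1/2) *\<^sub>R w x) + \<nu>0 / 8 * (L2norm half_measure (\<lambda>x. sym_grad v x - sym_grad w x))\<^sup>2
    \<le> (energy v + energy w) / 2"
proof -
  let ?z = "\<lambda>x. (1/2) *\<^sub>R v x + (1/2) *\<^sub>R w x"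
  have p0: "p > 0" using p by simp
  have e: "energy_integrable p half_measure (sym_grad v)" "energy_integrable p half_measure (sym_grad w)" and V2: "v \<in> V2" "w \<in> V2"
    using v w by (auto simp: V_iff)
  have c: "energy_integrable p half_measure (\<lambda>x. (1/2) *\<^sub>R sym_grad v x + (1/2) *\<^sub>R sym_grad w x)"
    by (rule energy_integrable_combine[OF p0 e])
  have z: "energy_integrable p half_measure (sym_grad ?z)" using V_combine[OF p0 v w] unfolding V_iff by blast
  have d: "sq_integrable half_measure (\<lambda>x. sym_grad v x - sym_grad w x)"
    using e by (auto simp: energy_integrable_def intro: sq_integrable_diff)
  have "(LINT x|half_measure. potential p \<nu>0 \<nu>1 (sym_grad ?z x)) = (LINT x|half_measure. potential p \<nu>0 \<nu>1 ((1/2) *\<^sub>R sym_grad v x + (1/2) *\<^sub>R sym_grad w x))"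
    by (rule integral_cong_AE[OF potential_measurable[OF energy_integrable_meas[OF z]] potential_measurable[OF energy_integrable_meas[OF c]]])
       (use V2_sym_grad_combine[OF V2, of "1/2" "1/2"] in eventually_elim, simp)
  then have "(LINT x|half_measure. potential p \<nu>0 \<nu>1 (sym_grad ?z x)) + \<nu>0 / 8 * (L2norm half_measure (\<lambda>x. sym_grad v x - sym_grad w x))\<^sup>2
     = (LINT x|half_measure. potential p \<nu>0 \<nu>1 ((1/2) *\<^sub>R sym_grad v x + (1/2) *\<^sub>R sym_grad w x) + \<nu>0 / 8 * (norm (sym_grad v x - sym_grad w x))\<^sup>2)"
    using potential_integrable[OF c] d by (simp add: L2norm_square sq_integrable_def)
  also have "\<dots> \<le> (LINT x|half_measure. (potential p \<nu>0 \<nu>1 (sym_grad v x) + potential p \<nu>0 \<nu>1 (sym_grad w x)) / 2)"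
  proof (rule integral_mono)
    show "integrable half_measure (\<lambda>x. potential p \<nu>0 \<nu>1 ((1/2) *\<^sub>R sym_grad v x + (1/2) *\<^sub>R sym_grad w x) + \<nu>0 / 8 * (norm (sym_grad v x - sym_grad w x))\<^sup>2)"
      using potential_integrable[OF c] d by (simp add: sq_integrable_def)
    show "integrable half_measure (\<lambda>x. (potential p \<nu>0 \<nu>1 (sym_grad v x) + potential p \<nu>0 \<nu>1 (sym_grad w x)) / 2)"
      using potential_integrable[OF e(1)] potential_integrable[OF e(2)] by simp
  qed (rule potential_midpoint[OF p nu])
  also have "\<dots> = ((LINT x|half_measure. potential p \<nu>0 \<nu>1 (sym_grad v x)) + (LINT x|half_measure. potential p \<nu>0 \<nu>1 (sym_grad w x))) / 2"
    using potential_integrable[OF e(1)] potential_integrable[OF e(2)] by simp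
  finally show ?thesis
    using functional_combine[OF F V2, of "1/2" "1/2"] unfolding energy_def by (simp add: field_simps)
qed

text \<open>The quadratic part absorbs the linear functional.\<close>
lemma energy_bounded_below:
  obtains m where "\<And>v. v \<in> V p \<Longrightarrow> m \<le> energy v"
proof -
  obtain K where K: "K \<ge> 0" "\<And>v. v \<in> V2 \<Longrightarrow> \<bar>F v\<bar> \<le> K * L2norm half_measure (sym_grad v)"
    by (rule functional_bound[OF F]) (rule that)
  have "- (K\<^sup>2 / (2 * \<nu>0)) \<le> energy v" if v: "v \<in> V p" for v
  proof -
    let ?d = "L2norm half_measure (sym_grad v)"
    have e: "energy_integrable p half_measure (sym_grad v)" and V2: "v \<in> V2" using v by (auto simp: V_iff)
    have "\<nu>0 / 2 * ?d\<^sup>2 = (LINT x|half_measure. \<nu>0 / 2 * (norm (sym_grad v x))\<^sup>2)"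
      by (simp add: L2norm_square)
    also have "\<dots> \<le> (LINT x|half_measure. potential p \<nu>0 \<nu>1 (sym_grad v x))"
      using e by (intro integral_mono potential_integrable potential_bounds(2)[OF p nu]) (auto simp: energy_integrable_def sq_integrable_def)
    finally have 1: "\<nu>0 / 2 * ?d\<^sup>2 \<le> (LINT x|half_measure. potential p \<nu>0 \<nu>1 (sym_grad v x))" .
    have "0 \<le> (\<nu>0 * ?d - K)\<^sup>2 / (2 * \<nu>0)" using nu by simp
    also have "\<dots> = \<nu>0 / 2 * ?d\<^sup>2 - K * ?d + K\<^sup>2 / (2 * \<nu>0)"
      using nu by (simp add: power2_diff power2_eq_square field_simps)
    finally show ?thesis using 1 K(2)[OF V2] unfolding energy_def by linarith
  qed
  then show ?thesis by (rule that)
qed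

text \<open>A minimising sequence is a Cauchy sequence by the midpoint estimate and Korn's inequality; Fatou's
  lemma along a subsequence with pointwise convergent gradients shows that the limit has finite energy
  and attains the infimum.\<close>
lemma energy_minimiser:
  obtains u where "u \<in> V p" "\<And>v. v \<in> V p \<Longrightarrow> energy u \<le> energy v"
proof -
  have p0: "p > 0" using p by simp
  obtain b where b: "\<And>v. v \<in> V p \<Longrightarrow> b \<le> energy v" by (rule energy_bounded_below) (rule that)
  define m where "m = Inf (energy ` V p)"
  have bb: "bdd_below (energy ` V p)" using b by (intro bdd_belowI[of _ b]) auto
  have ne: "energy ` V p \<noteq> {}" using V_zero[OF p0] by blast
  have mle: "m \<le> energy v" if "v \<in> V p" for v unfolding m_def using that by (intro cInf_lower bb) auto
  have "\<exists>v\<in>V p. energy v < m + inverse (real (Suc n))" for n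
    using cInf_lessD[OF ne, of "m + inverse (real (Suc n))"] unfolding m_def[symmetric] by (simp add: image_iff)
  then have "\<forall>n. \<exists>v. v \<in> V p \<and> energy v < m + inverse (real (Suc n))" by blast
  then have "\<exists>u. \<forall>n. u n \<in> V p \<and> energy (u n) < m + inverse (real (Suc n))" by (rule choice)
  then obtain u where un: "\<forall>n. u n \<in> V p \<and> energy (u n) < m + inverse (real (Suc n))" by (rule exE)
  have uV: "u n \<in> V p" and uE: "energy (u n) < m + inverse (real (Suc n))" for n using spec[OF un, of n] by blast+
  have uV2: "u n \<in> V2" and ue: "energy_integrable p half_measure (sym_grad (u n))" for n using uV[of n] by (auto simp: V_iff)
  have dist: "\<nu>0 / 8 * (L2norm half_measure (\<lambda>x. sym_grad (u i) x - sym_grad (u j) x))\<^sup>2 \<le> (inverse (real (Suc i)) + inverse (real (Suc j))) / 2" for i j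
  proof -
    have 1: "m \<le> energy (\<lambda>x. (1/2) *\<^sub>R u i x + (1/2) *\<^sub>R u j x)" by (rule mle[OF V_combine[OF p0 uV uV]])
    show ?thesis using energy_midpoint[OF uV[of i] uV[of j]] 1 uE[of i] uE[of j] unfolding add_divide_distrib by linarith
  qed
  have cau: "\<exists>N. \<forall>i\<ge>N. \<forall>j\<ge>N. L2norm half_measure (\<lambda>x. weak_grad (u i) x - weak_grad (u j) x) < e" if e: "e > 0" for e
  proof -
    have pos: "\<nu>0 / 16 * e\<^sup>2 > 0" using e nu by simp
    obtain N where N: "inverse (real (Suc N)) < \<nu>0 / 16 * e\<^sup>2" using reals_Archimedean[OF pos] by blast
    have "L2norm half_measure (\<lambda>x. weak_grad (u i) x - weak_grad (u j) x) < e" if ij: "i \<ge> N" "j \<ge> N" for i j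
    proof -
      let ?d = "L2norm half_measure (\<lambda>x. sym_grad (u i) x - sym_grad (u j) x)"
      have "inverse (real (Suc i)) \<le> inverse (real (Suc N))" "inverse (real (Suc j)) \<le> inverse (real (Suc N))"
        using ij by (auto intro!: le_imp_inverse_le)
      then have "(inverse (real (Suc i)) + inverse (real (Suc j))) / 2 \<le> inverse (real (Suc N))" by argo
      from order_le_less_trans[OF order_trans[OF dist this] N]
      have "\<nu>0 / 8 * ?d\<^sup>2 < \<nu>0 / 16 * e\<^sup>2" .
      then have "2 * ?d\<^sup>2 < e\<^sup>2" using nu by (simp add: field_simps)
      then have "(sqrt 2 * ?d)\<^sup>2 < e\<^sup>2" by (simp add: power_mult_distrib)
      then have "sqrt 2 * ?d < e" by (rule power2_less_imp_less) (use e in simp)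
      then show ?thesis by (simp add: sym_grad_difference[OF uV2 uV2])
    qed
    then show ?thesis by blast
  qed
  obtain v where v: "v \<in> V2" "(\<lambda>n. L2norm half_measure (\<lambda>x. weak_grad (u n) x - weak_grad v x)) \<longlonglongrightarrow> 0"
    by (rule V2_complete[OF uV2 cau]) (assumption, rule that)
  have sd: "sq_integrable half_measure (\<lambda>x. weak_grad (u n) x - weak_grad v x)" for n
    by (rule sq_integrable_diff[OF V2_weak_grad[OF uV2] V2_weak_grad[OF v(1)]])
  have sl: "(\<lambda>n. L2norm half_measure (\<lambda>x. sym_grad (u n) x - sym_grad v x)) \<longlonglongrightarrow> 0"
    unfolding sym_grad_eq by (rule L2_lim_linear[OF sd v(2) bounded_linear_sym_part])
  obtain r where r: "strict_mono r" "AE x in half_measure. (\<lambda>n. sym_grad (u (r n)) x) \<longlonglongrightarrow> sym_grad v x"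
    by (rule L2_lim_AE_subseq[OF sq_integrable_diff[OF V2_sym_grad[OF uV2] V2_sym_grad[OF v(1)]] sl]) (rule that)
  have Fl: "(\<lambda>n. F (u n)) \<longlonglongrightarrow> F v"
  proof -
    obtain K where K: "K \<ge> 0" "\<And>v. v \<in> V2 \<Longrightarrow> \<bar>F v\<bar> \<le> K * L2norm half_measure (weak_grad v)"
      by (rule functional_bound[OF F]) (rule that)
    have "\<bar>F (u n) - F v\<bar> \<le> K * L2norm half_measure (\<lambda>x. weak_grad (u n) x - weak_grad v x)" for n
    proof -
      let ?z = "\<lambda>x. 1 *\<^sub>R u n x + (-1) *\<^sub>R v x"
      have z: "?z \<in> V2" by (rule V2_combine(1)[OF uV2 v(1)])
      have "F (u n) - F v = F ?z" using functional_combine[OF F uV2[of n] v(1), of 1 "-1"] by simp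
      also have "\<bar>F ?z\<bar> \<le> K * L2norm half_measure (weak_grad ?z)" by (rule K(2)[OF z])
      also have "L2norm half_measure (weak_grad ?z) = L2norm half_measure (\<lambda>x. weak_grad (u n) x - weak_grad v x)"
        by (rule L2norm_cong_AE[OF sq_integrable_meas[OF V2_weak_grad[OF z]] sq_integrable_meas[OF sd]])
           (use V2_combine(2)[OF uV2[of n] v(1), of 1 "-1"] in eventually_elim, simp)
      finally show ?thesis .
    qed
    then have "(\<lambda>n. F (u n) - F v) \<longlonglongrightarrow> 0"
      by (intro Lim_null_comparison[OF _ tendsto_mult_right_zero[OF v(2), of K]]) auto
    then show ?thesis by (simp add: LIM_zero_iff)
  qed
  have pl: "AE x in half_measure. (\<lambda>n. potential p \<nu>0 \<nu>1 (sym_grad (u (r n)) x)) \<longlonglongrightarrow> potential p \<nu>0 \<nu>1 (sym_grad v x)"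
    using r(2) by eventually_elim (rule potential_tendsto[OF p])
  have cl: "(\<lambda>n. m + inverse (real (Suc (r n))) + F (u (r n))) \<longlonglongrightarrow> m + 0 + F v"
    using LIMSEQ_subseq_LIMSEQ[OF LIMSEQ_inverse_real_of_nat r(1)] LIMSEQ_subseq_LIMSEQ[OF Fl r(1)]
    by (intro tendsto_add tendsto_const) (simp_all add: o_def)
  have pb: "(LINT x|half_measure. potential p \<nu>0 \<nu>1 (sym_grad (u (r n)) x)) \<le> m + inverse (real (Suc (r n))) + F (u (r n))" for n
    using uE[of "r n"] unfolding energy_def by linarith
  have vm: "sym_grad v \<in> borel_measurable half_measure" by (rule sq_integrable_meas[OF V2_sym_grad[OF v(1)]])
  note fat = Fatou_integrable[OF potential_integrable[OF ue] potential_bounds(1)[OF p nu] pl potential_measurable[OF vm] pb cl]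
  have "integrable half_measure (\<lambda>x. norm (sym_grad v x) powr p)"
  proof (rule Bochner_Integration.integrable_bound)
    show "integrable half_measure (\<lambda>x. (p / \<nu>1) * potential p \<nu>0 \<nu>1 (sym_grad v x))" using fat(1) by simp
    show "AE x in half_measure. norm (norm (sym_grad v x) powr p) \<le> norm ((p / \<nu>1) * potential p \<nu>0 \<nu>1 (sym_grad v x))"
    proof (rule AE_I2)
      fix x
      have "(p / \<nu>1) * (\<nu>1 / p * norm (sym_grad v x) powr p) \<le> (p / \<nu>1) * potential p \<nu>0 \<nu>1 (sym_grad v x)"
        by (intro mult_left_mono potential_bounds(3)[OF p nu]) (use p nu in simp)
      then show "norm (norm (sym_grad v x) powr p) \<le> norm ((p / \<nu>1) * potential p \<nu>0 \<nu>1 (sym_grad v x))"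
        using p nu potential_bounds(1)[OF p nu, of "sym_grad v x"] by simp
    qed
  qed (use vm in measurable)
  then have vV: "v \<in> V p" using v(1) V2_sym_grad[OF v(1)] by (simp add: V_iff energy_integrable_def)
  moreover have "energy v \<le> energy w" if "w \<in> V p" for w
    using fat(2) mle[OF that] unfolding energy_def by linarith
  ultimately show ?thesis using that by blast
qed

text \<open>The Euler--Lagrange equation. By convexity, the difference quotients of the energy at the
  minimiser are bounded by the flux at the perturbed point, which converges.\<close>
lemma minimiser_weak_solution:
  assumes u: "u \<in> V p" and min: "\<And>v. v \<in> V p \<Longrightarrow> energy u \<le> energy v"
  shows "weak_solution p \<nu>0 \<nu>1 F u"
proof -
  have p0: "p > 0" using p by simp
  have ue: "energy_integrable p half_measure (sym_grad u)" and uV2: "u \<in> V2" using u by (auto simp: V_iff)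
  have le: "F v \<le> (LINT x|half_measure. flux p \<nu>0 \<nu>1 (sym_grad u x) \<bullet> sym_grad v x)" if v: "v \<in> V p" for v
  proof -
    have ve: "energy_integrable p half_measure (sym_grad v)" and vV2: "v \<in> V2" using v by (auto simp: V_iff)
    have "F v \<le> (LINT x|half_measure. flux p \<nu>0 \<nu>1 (sym_grad u x + inverse (real (Suc n)) *\<^sub>R sym_grad v x) \<bullet> sym_grad v x)" for n
    proof -
      let ?t = "inverse (real (Suc n))"
      let ?c = "\<lambda>x. sym_grad u x + ?t *\<^sub>R sym_grad v x"
      let ?z = "\<lambda>x. 1 *\<^sub>R u x + ?t *\<^sub>R v x"
      have t: "?t > 0" by simp
      have zV: "?z \<in> V p" by (rule V_combine[OF p0 u v])
      have ze: "energy_integrable p half_measure (sym_grad ?z)" using zV unfolding V_iff by blast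
      have ce: "energy_integrable p half_measure ?c"
        using energy_integrable_combine[OF p0 ue ve, of 1 ?t] by simp
      have "(LINT x|half_measure. potential p \<nu>0 \<nu>1 (sym_grad ?z x)) = (LINT x|half_measure. potential p \<nu>0 \<nu>1 (?c x))"
        by (rule integral_cong_AE[OF potential_measurable[OF energy_integrable_meas[OF ze]] potential_measurable[OF energy_integrable_meas[OF ce]]])
           (use V2_sym_grad_combine[OF uV2 vV2, of 1 ?t] in eventually_elim, simp)
      moreover have "F ?z = F u + ?t * F v" using functional_combine[OF F uV2 vV2, of 1 ?t] by simp
      moreover have "energy u \<le> energy ?z" by (rule min[OF zV])
      ultimately have "?t * F v \<le> (LINT x|half_measure. potential p \<nu>0 \<nu>1 (?c x)) - (LINT x|half_measure. potential p \<nu>0 \<nu>1 (sym_grad u x))"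
        unfolding energy_def by linarith
      also have "\<dots> = (LINT x|half_measure. potential p \<nu>0 \<nu>1 (?c x) - potential p \<nu>0 \<nu>1 (sym_grad u x))"
        using potential_integrable[OF ce] potential_integrable[OF ue] by simp
      also have "\<dots> \<le> (LINT x|half_measure. ?t * (flux p \<nu>0 \<nu>1 (?c x) \<bullet> sym_grad v x))"
      proof (rule integral_mono)
        fix x
        have "0 \<le> \<nu>0 / 2 * (norm (?c x - sym_grad u x))\<^sup>2" using nu by simp
        then have "potential p \<nu>0 \<nu>1 (?c x) - potential p \<nu>0 \<nu>1 (sym_grad u x) \<le> flux p \<nu>0 \<nu>1 (?c x) \<bullet> (?c x - sym_grad u x)"
          using potential_subgradient[OF p nu, of "?c x" "sym_grad u x"] by linarith
        then show "potential p \<nu>0 \<nu>1 (?c x) - potential p \<nu>0 \<nu>1 (sym_grad u x) \<le> ?t * (flux p \<nu>0 \<nu>1 (?c x) \<bullet> sym_grad v x)" by simp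
      qed (use potential_integrable[OF ce] potential_integrable[OF ue] flux_inner_integrable[OF p nu ce ve] in auto)
      also have "\<dots> = ?t * (LINT x|half_measure. flux p \<nu>0 \<nu>1 (?c x) \<bullet> sym_grad v x)" by simp
      finally show ?thesis using t by (simp only: mult_le_cancel_left_pos)
    qed
    then show ?thesis
      by (intro LIMSEQ_le_const[OF flux_inner_lim[OF p nu ue ve]]) blast
  qed
  have "(LINT x|half_measure. flux p \<nu>0 \<nu>1 (sym_grad u x) \<bullet> sym_grad v x) = F v" if v: "v \<in> V p" for v
  proof -
    have ve: "energy_integrable p half_measure (sym_grad v)" and vV2: "v \<in> V2" using v by (auto simp: V_iff)
    let ?z = "\<lambda>x. (-1) *\<^sub>R v x + 0 *\<^sub>R v x"
    have zV: "?z \<in> V p" by (rule V_combine[OF p0 v v])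
    have ze: "energy_integrable p half_measure (sym_grad ?z)" using zV unfolding V_iff by blast
    have "F ?z \<le> (LINT x|half_measure. flux p \<nu>0 \<nu>1 (sym_grad u x) \<bullet> sym_grad ?z x)" by (rule le[OF zV])
    also have "\<dots> = (LINT x|half_measure. - (flux p \<nu>0 \<nu>1 (sym_grad u x) \<bullet> sym_grad v x))"
    proof (rule integral_cong_AE)
      show "AE x in half_measure. flux p \<nu>0 \<nu>1 (sym_grad u x) \<bullet> sym_grad ?z x = - (flux p \<nu>0 \<nu>1 (sym_grad u x) \<bullet> sym_grad v x)"
        using V2_sym_grad_combine[OF vV2 vV2, of "-1" 0] by eventually_elim simp
    qed (use flux_inner_integrable[OF p nu ue ze] flux_inner_integrable[OF p nu ue ve] in auto)
    also have "\<dots> = - (LINT x|half_measure. flux p \<nu>0 \<nu>1 (sym_grad u x) \<bullet> sym_grad v x)" by simp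
    finally have "(LINT x|half_measure. flux p \<nu>0 \<nu>1 (sym_grad u x) \<bullet> sym_grad v x) \<le> F v"
      using functional_combine[OF F vV2 vV2, of "-1" 0] by simp
    then show ?thesis using le[OF v] by simp
  qed
  then show ?thesis unfolding weak_solution_def flux_def using u by blast
qed

lemma weak_solution_exists: obtains u where "weak_solution p \<nu>0 \<nu>1 F u"
  using energy_minimiser minimiser_weak_solution by blast

lemma weak_solution_flux:
  "weak_solution p \<nu>0 \<nu>1 F u \<Longrightarrow> v \<in> V p \<Longrightarrow> (LINT x|half_measure. flux p \<nu>0 \<nu>1 (sym_grad u x) \<bullet> sym_grad v x) = F v"
  unfolding weak_solution_def flux_def by blast

text \<open>Testing both equations with the difference of the solutions, monotonicity annihilates its
  symmetric gradient, Korn's inequality its gradient, and the inequality of Hardy type the field.\<close>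
lemma weak_solution_unique:
  assumes u: "weak_solution p \<nu>0 \<nu>1 F u" and w: "weak_solution p \<nu>0 \<nu>1 F w"
  shows "AE x in half_measure. w x = u x"
proof -
  have p0: "p > 0" using p by simp
  have V: "u \<in> V p" "w \<in> V p" using u w by (auto simp: weak_solution_def)
  then have V2: "u \<in> V2" "w \<in> V2" and e: "energy_integrable p half_measure (sym_grad u)" "energy_integrable p half_measure (sym_grad w)"
    by (auto simp: V_iff)
  let ?z = "\<lambda>x. 1 *\<^sub>R w x + (-1) *\<^sub>R u x"
  have zV: "?z \<in> V p" by (rule V_combine[OF p0 V(2,1)])
  then have ze: "energy_integrable p half_measure (sym_grad ?z)" and zV2: "?z \<in> V2" unfolding V_iff by blast+
  have zd: "AE x in half_measure. sym_grad ?z x = sym_grad w x - sym_grad u x"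
    using V2_sym_grad_combine[OF V2(2,1), of 1 "-1"] by eventually_elim simp
  let ?f = "\<lambda>x. flux p \<nu>0 \<nu>1 (sym_grad w x) \<bullet> sym_grad ?z x - flux p \<nu>0 \<nu>1 (sym_grad u x) \<bullet> sym_grad ?z x"
  have fi: "integrable half_measure ?f"
    by (intro Bochner_Integration.integrable_diff flux_inner_integrable[OF p nu] e ze)
  have "\<nu>0 * (L2norm half_measure (sym_grad ?z))\<^sup>2 = (LINT x|half_measure. \<nu>0 * (norm (sym_grad ?z x))\<^sup>2)" by (simp add: L2norm_square)
  also have "\<dots> \<le> (LINT x|half_measure. ?f x)"
  proof (rule integral_mono_AE[OF _ fi])
    show "integrable half_measure (\<lambda>x. \<nu>0 * (norm (sym_grad ?z x))\<^sup>2)" using ze by (simp add: energy_integrable_def sq_integrable_def)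
    show "AE x in half_measure. \<nu>0 * (norm (sym_grad ?z x))\<^sup>2 \<le> ?f x"
      using zd
    proof eventually_elim
      case (elim x)
      show ?case unfolding elim using flux_monotone[OF p nu, of "sym_grad w x" "sym_grad u x"] by (simp add: inner_diff_left)
    qed
  qed
  also have "\<dots> = F ?z - F ?z"
    using flux_inner_integrable[OF p nu e(1) ze] flux_inner_integrable[OF p nu e(2) ze]
      weak_solution_flux[OF u zV] weak_solution_flux[OF w zV] by simp
  finally have "\<nu>0 * (L2norm half_measure (sym_grad ?z))\<^sup>2 \<le> 0" by simp
  then have "L2norm half_measure (sym_grad ?z) = 0" using nu by (simp add: mult_le_0_iff)
  then have "L2norm half_measure (weak_grad ?z) = 0"
    unfolding korn_half[OF zV2] by (simp only: mult_zero_right)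
  from V2_zero_gradient[OF zV2 this] show ?thesis by eventually_elim simp
qed

end

section \<open>Translations of extended fields\<close>

lemma weight_translate:
  fixes x b :: "'a::real_inner"
  shows "weight x \<le> sqrt (2 + 2 * (norm b)\<^sup>2) * weight (x + b)"
proof -
  have b2: "b \<bullet> b = (norm b)\<^sup>2" by (simp add: dot_square_norm)
  have "0 \<le> (x - b) \<bullet> (x - b)" by (rule inner_ge_zero)
  then have "(x + b) \<bullet> (x + b) \<le> 2 * (x \<bullet> x) + 2 * (b \<bullet> b)"
    by (simp add: inner_add_left inner_add_right inner_diff_left inner_diff_right inner_commute)
  have "0 \<le> (x \<bullet> x) * (b \<bullet> b)" by simp
  then have "1 + (x + b) \<bullet> (x + b) \<le> (2 + 2 * (norm b)\<^sup>2) * (1 + x \<bullet> x)"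
  proof -
    have "(2 + 2 * (b \<bullet> b)) * (1 + x \<bullet> x) = 2 + 2 * (x \<bullet> x) + 2 * (b \<bullet> b) + 2 * ((x \<bullet> x) * (b \<bullet> b))"
      by (simp only: distrib_left distrib_right mult_1 mult_1_right mult.assoc) (simp add: mult.commute)
    with \<open>(x + b) \<bullet> (x + b) \<le> 2 * (x \<bullet> x) + 2 * (b \<bullet> b)\<close> \<open>0 \<le> (x \<bullet> x) * (b \<bullet> b)\<close>
    show ?thesis unfolding b2[symmetric] by linarith
  qed
  then have "sqrt (1 + (x + b) \<bullet> (x + b)) \<le> sqrt (2 + 2 * (norm b)\<^sup>2) * sqrt (1 + x \<bullet> x)"
    by (simp add: real_sqrt_mult[symmetric])
  moreover have "sqrt (1 + x \<bullet> x) > 0" "sqrt (1 + (x + b) \<bullet> (x + b)) > 0"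
    using inner_ge_zero[of x] inner_ge_zero[of "x + b"] by (simp_all add: add_pos_nonneg)
  ultimately show ?thesis unfolding weight_def by (simp add: field_simps)
qed

text \<open>Translating the weight changes it by a bounded factor only, so weighted square integrability is
  invariant under translations.\<close>
lemma weighted_translate:
  fixes f :: "'a::euclidean_space \<Rightarrow> 'b::euclidean_space"
  assumes f: "sq_integrable lebesgue (\<lambda>x. weight x *\<^sub>R f x)"
  shows "sq_integrable lebesgue (\<lambda>x. weight x *\<^sub>R f (x + b))"
    "L2norm lebesgue (\<lambda>x. weight x *\<^sub>R f (x + b)) \<le> sqrt (2 + 2 * (norm b)\<^sup>2) * L2norm lebesgue (\<lambda>x. weight x *\<^sub>R f x)"
proof -
  let ?c = "sqrt (2 + 2 * (norm b)\<^sup>2)"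
  note pr = lebesgue_preserving_translation[of b]
  have s: "sq_integrable lebesgue (\<lambda>x. ?c *\<^sub>R (weight (x + b) *\<^sub>R f (x + b)))"
    by (rule sq_integrable_scaleR[OF preserving_sq_integrable[OF pr f]])
  have fm: "f \<in> borel_measurable lebesgue"
    using unweighted_measurable[of f UNIV] sq_integrable_meas[OF f] by (simp add: lebesgue_on_UNIV_eq)
  have m: "(\<lambda>x. weight x *\<^sub>R f (x + b)) \<in> borel_measurable lebesgue"
    by (intro borel_measurable_scaleR cont_measurable weight_cont preserving_measurable[OF pr fm])
  have le: "norm (weight x *\<^sub>R f (x + b)) \<le> norm (?c *\<^sub>R (weight (x + b) *\<^sub>R f (x + b)))" for x
  proof -
    have "norm (weight x *\<^sub>R f (x + b)) = weight x * norm (f (x + b))"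
      using weight_pos(1)[of x] by simp
    also have "\<dots> \<le> (?c * weight (x + b)) * norm (f (x + b))"
      by (intro mult_right_mono weight_translate) simp
    also have "\<dots> = norm (?c *\<^sub>R (weight (x + b) *\<^sub>R f (x + b)))"
      using weight_pos(1)[of "x + b"] by simp
    finally show ?thesis .
  qed
  show "sq_integrable lebesgue (\<lambda>x. weight x *\<^sub>R f (x + b))"
    by (rule sq_integrable_bound[OF s m, where c=1]) (use le in simp)
  have "L2norm lebesgue (\<lambda>x. weight x *\<^sub>R f (x + b)) \<le> L2norm lebesgue (\<lambda>x. ?c *\<^sub>R (weight (x + b) *\<^sub>R f (x + b)))"
    by (rule L2norm_mono[OF s m]) (use le in blast)
  also have "\<dots> = ?c * L2norm lebesgue (\<lambda>x. weight (x + b) *\<^sub>R f (x + b))"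
    by (subst L2norm_scaleR) simp
  also have "L2norm lebesgue (\<lambda>x. weight (x + b) *\<^sub>R f (x + b)) = L2norm lebesgue (\<lambda>x. weight x *\<^sub>R f x)"
    by (rule preserving_L2norm[OF pr sq_integrable_meas[OF f]])
  finally show "L2norm lebesgue (\<lambda>x. weight x *\<^sub>R f (x + b)) \<le> ?c * L2norm lebesgue (\<lambda>x. weight x *\<^sub>R f x)" .
qed

lemma approx_translate:
  assumes ap: "approx_on UNIV \<phi> w W"
  shows "approx_on UNIV (\<lambda>n x. \<phi> n (x + b)) (\<lambda>x. w (x + b)) (\<lambda>x. W (x + b))"
proof -
  note a = approx_onD[OF ap, unfolded lebesgue_on_UNIV_eq] and s = approx_on_sq[OF ap, unfolded lebesgue_on_UNIV_eq, simplified]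
  note pr = lebesgue_preserving_translation[of b]
  have t: "(\<lambda>x. \<phi> n (x + b)) \<in> test_fields" for n by (rule test_translate[OF a(1)])
  have g: "grad (\<lambda>x. \<phi> n (x + b)) x = grad (\<phi> n) (x + b)" for n x
    using partial_translate[OF smooth_differentiable[OF test_smooth[OF a(1)]]] by (simp add: grad_def)
  have 1: "(\<lambda>n. L2norm lebesgue (\<lambda>x. grad (\<phi> n) (x + b) - W (x + b))) \<longlonglongrightarrow> 0"
    using a(4) preserving_L2norm[OF pr sq_integrable_meas[OF s(4)]] by simp
  have 2: "(\<lambda>n. L2norm lebesgue (\<lambda>x. weight x *\<^sub>R (\<phi> n (x + b) - w (x + b)))) \<longlonglongrightarrow> 0"
    by (rule Lim_null_comparison[OF _ tendsto_mult_right_zero[OF a(5), of "sqrt (2 + 2 * (norm b)\<^sup>2)"]])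
       (use weighted_translate(2)[OF s(3)] in simp)
  show ?thesis unfolding approx_on_def lebesgue_on_UNIV_eq g
    using t preserving_sq_integrable[OF pr a(2)] weighted_translate(1)[OF a(3)] 1 2 by blast
qed

lemma norm_column_le: "norm (column_of k A) \<le> norm A"
proof (rule power2_le_imp_le)
  have "(A $ a $ k)\<^sup>2 \<le> (\<Sum>i\<in>UNIV. (A $ a $ i)\<^sup>2)" for a
    using member_le_sum[of k UNIV "\<lambda>i. (A $ a $ i)\<^sup>2"] by simp
  then show "(norm (column_of k A))\<^sup>2 \<le> (norm A)\<^sup>2"
    unfolding norm_matrix_square norm_vec_square by (simp add: sum_mono)
qed simp

text \<open>The difference of a field is square integrable even when the field itself is not: the bound for
  test fields passes to a pointwise limit along a subsequence by Fatou's lemma.\<close>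
lemma approx_shift_bound:
  assumes ap: "approx_on UNIV \<phi> z Z"
  shows "sq_integrable lebesgue (\<lambda>x. z (x + t *\<^sub>R axis k 1) - z x)"
    "L2norm lebesgue (\<lambda>x. z (x + t *\<^sub>R axis k 1) - z x) \<le> \<bar>t\<bar> * L2norm lebesgue Z"
proof -
  note a = approx_onD[OF ap, unfolded lebesgue_on_UNIV_eq] and s = approx_on_sq[OF ap, unfolded lebesgue_on_UNIV_eq, simplified]
  let ?e = "t *\<^sub>R axis k 1 :: real^3"
  note pr = lebesgue_preserving_translation[of ?e]
  have l: "(\<lambda>n. L2norm lebesgue (\<lambda>x. weight x *\<^sub>R \<phi> n x - weight x *\<^sub>R z x)) \<longlonglongrightarrow> 0"
    using a(5) by (simp add: scaleR_diff_right)
  have sq: "sq_integrable lebesgue (\<lambda>x. weight x *\<^sub>R \<phi> n x - weight x *\<^sub>R z x)" for n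
    using s(3)[of n] by (simp add: scaleR_diff_right)
  obtain r where r: "strict_mono r" "AE x in lebesgue. (\<lambda>n. weight x *\<^sub>R \<phi> (r n) x) \<longlonglongrightarrow> weight x *\<^sub>R z x"
    by (rule L2_lim_AE_subseq[OF sq l]) (rule that)
  have ae: "AE x in lebesgue. (\<lambda>n. \<phi> (r n) x) \<longlonglongrightarrow> z x"
    using r(2)
  proof eventually_elim
    case (elim x)
    have "(\<lambda>n. (1 / weight x) *\<^sub>R (weight x *\<^sub>R \<phi> (r n) x)) \<longlonglongrightarrow> (1 / weight x) *\<^sub>R (weight x *\<^sub>R z x)"
      by (intro tendsto_scaleR tendsto_const elim)
    then show ?case using weight_pos(1)[of x] by simp
  qed
  have ae2: "AE x in lebesgue. (\<lambda>n. \<phi> (r n) (x + ?e) - \<phi> (r n) x) \<longlonglongrightarrow> z (x + ?e) - z x"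
    using ae preserving_AE[OF pr ae] by eventually_elim (rule tendsto_diff)
  have zm: "z \<in> borel_measurable lebesgue"
    using unweighted_measurable[of z UNIV] sq_integrable_meas[OF a(3)] by (simp add: lebesgue_on_UNIV_eq)
  have m: "(\<lambda>x. z (x + ?e) - z x) \<in> borel_measurable lebesgue"
    by (intro borel_measurable_diff zm preserving_measurable[OF pr zm])
  have ts: "sq_integrable lebesgue (\<lambda>x. \<phi> (r n) (x + ?e) - \<phi> (r n) x)" for n
    by (intro test_sq_integrable[of _ UNIV] test_diff test_translate a)
  have b: "L2norm lebesgue (\<lambda>x. \<phi> (r n) (x + ?e) - \<phi> (r n) x) \<le> \<bar>t\<bar> * L2norm lebesgue (grad (\<phi> (r n)))" for n
  proof -
    have "L2norm lebesgue (partial k (\<phi> (r n))) \<le> L2norm lebesgue (grad (\<phi> (r n)))"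
    proof (rule L2norm_mono[OF s(1)])
      show "partial k (\<phi> (r n)) \<in> borel_measurable lebesgue" by (rule cont_measurable[OF test_continuous[OF test_partial[OF a(1)]]])
      show "AE x in lebesgue. norm (partial k (\<phi> (r n)) x) \<le> norm (grad (\<phi> (r n)) x)"
        unfolding column_grad[symmetric] using norm_column_le by (intro AE_I2) blast
    qed
    then have "\<bar>t\<bar> * L2norm lebesgue (partial k (\<phi> (r n))) \<le> \<bar>t\<bar> * L2norm lebesgue (grad (\<phi> (r n)))" by (rule mult_left_mono) simp
    then show ?thesis using translation_bound_test[OF a(1)[of "r n"], of t k] by linarith
  qed
  have c: "(\<lambda>n. \<bar>t\<bar> * L2norm lebesgue (grad (\<phi> (r n)))) \<longlonglongrightarrow> \<bar>t\<bar> * L2norm lebesgue Z"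
    using LIMSEQ_subseq_LIMSEQ[OF L2norm_tendsto[OF s(1) a(2) a(4)] r(1)] by (intro tendsto_mult_left) (simp add: o_def)
  show "sq_integrable lebesgue (\<lambda>x. z (x + ?e) - z x)" "L2norm lebesgue (\<lambda>x. z (x + ?e) - z x) \<le> \<bar>t\<bar> * L2norm lebesgue Z"
    by (rule L2_Fatou[OF ts m ae2 b c])+
qed

section \<open>Weak derivatives from difference quotients\<close>

text \<open>The first-order condition at a minimum, for the quadratic functional of the next lemma along a
  line.\<close>
lemma parabola_slope_zero:
  fixes d N :: real
  assumes N: "N \<ge> 0" and all: "\<And>s. 0 \<le> s * d + s\<^sup>2 / 2 * N"
  shows "d = 0"
proof (rule ccontr)
  assume "d \<noteq> 0"
  define r where "r = 1 / (N + 1)"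
  have r: "r > 0" "r * N \<le> 1" using N by (auto simp: r_def)
  have "0 \<le> (- (d * r)) * d + (- (d * r))\<^sup>2 / 2 * N" by (rule all)
  also have "\<dots> = d\<^sup>2 * r * (r * N / 2 - 1)" by (simp add: power2_eq_square algebra_simps)
  finally have "0 \<le> d\<^sup>2 * r * (r * N / 2 - 1)" .
  moreover have "d\<^sup>2 * r > 0" using r \<open>d \<noteq> 0\<close> by simp
  ultimately have "0 \<le> r * N / 2 - 1" by (simp add: zero_le_mult_iff)
  then show False using r by simp
qed

text \<open>The functional \<open>\<psi> \<mapsto> - \<integral> \<partial>\<psi> g\<close> is bounded in the square norm, hence represented by a square
  integrable function. The representative is obtained as the limit of a minimising sequence of test
  functions for the associated quadratic functional.\<close>
lemma weak_derivative_of_difference_bound: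
  fixes g :: "real^3 \<Rightarrow> real"
  assumes g: "sq_integrable lebesgue g"
    and b: "\<And>t. t > 0 \<Longrightarrow> L2norm lebesgue (\<lambda>x. g (x + t *\<^sub>R axis j 1) - g x) \<le> C * t"
  obtains q where "sq_integrable lebesgue q"
    "\<And>\<psi>. \<psi> \<in> test_functions UNIV \<Longrightarrow> (LINT x|lebesgue. partial j \<psi> x * g x) = - (LINT x|lebesgue. \<psi> x * q x)"
proof -
  define L where "L \<psi> = - (LINT x|lebesgue. partial j \<psi> x * g x)" for \<psi>
  let ?T = "test_functions UNIV :: (real^3 \<Rightarrow> real) set"
  have ts: "sq_integrable lebesgue \<psi>" if "\<psi> \<in> ?T" for \<psi> by (rule test_sq_integrable[OF that])
  have ti: "integrable lebesgue (\<lambda>x. \<psi> x * g x)" if "\<psi> \<in> ?T" for \<psi>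
    using sq_integrable_scaleR_prod[OF ts[OF that] g] by simp
  have Lb: "\<bar>L \<psi>\<bar> \<le> C * L2norm lebesgue \<psi>" if psi: "\<psi> \<in> ?T" for \<psi>
  proof -
    let ?t = "\<lambda>n. inverse (real (Suc n))"
    have gi: "integrable lebesgue (\<lambda>x. indicator (cball 0 r) x *\<^sub>R g x)" for r
    proof (rule cutoff_bounded_integrable[where R=r])
      show "sq_integrable lebesgue (\<lambda>x. indicator (cball 0 r) x *\<^sub>R g x)"
      proof (rule sq_integrable_bound[OF g, where c=1])
        show "(\<lambda>x. indicator (cball 0 r) x *\<^sub>R g x) \<in> borel_measurable lebesgue"
          by (rule borel_measurable_scaleR[OF borel_measurable_indicator sq_integrable_meas[OF g]]) simp
      qed (auto simp: indicator_def)
    qed auto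
    have lim: "(\<lambda>n. LINT x|lebesgue. diff_quot j (- ?t n) \<psi> x *\<^sub>R g x) \<longlonglongrightarrow> (LINT x|lebesgue. partial j \<psi> x *\<^sub>R g x)"
      using tendsto_minus[OF steps(3)] steps(1,2)
      by (intro diff_quot_integral_lim(1)[OF C1c_test[OF psi] gi sq_integrable_meas[OF g]]) auto
    have eq: "\<bar>LINT x|lebesgue. diff_quot j (- ?t n) \<psi> x *\<^sub>R g x\<bar> \<le> C * L2norm lebesgue \<psi>" for n
    proof -
      let ?e = "?t n *\<^sub>R axis j 1 :: real^3"
      note pr = lebesgue_preserving_translation[of ?e]
      have tp: "?t n > 0" by simp
      have pe: "(\<lambda>x. \<psi> (x - ?e)) \<in> ?T" using test_translate[OF psi, of "- ?e"] by simp
      have ge: "sq_integrable lebesgue (\<lambda>x. g (x + ?e))" by (rule preserving_sq_integrable[OF pr g])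
      have i3: "integrable lebesgue (\<lambda>x. \<psi> x * g (x + ?e))" using sq_integrable_scaleR_prod[OF ts[OF psi] ge] by simp
      have "(LINT x|lebesgue. diff_quot j (- ?t n) \<psi> x *\<^sub>R g x) = (LINT x|lebesgue. (1 / ?t n) * (\<psi> x * g x - \<psi> (x - ?e) * g x))"
        by (simp add: diff_quot_def algebra_simps)
      also have "\<dots> = (1 / ?t n) * ((LINT x|lebesgue. \<psi> x * g x) - (LINT x|lebesgue. \<psi> (x - ?e) * g x))"
        using ti[OF psi] ti[OF pe] by simp
      also have "(LINT x|lebesgue. \<psi> (x - ?e) * g x) = (LINT x|lebesgue. \<psi> x * g (x + ?e))"
        using preserving_integral[OF pr borel_measurable_integrable[OF ti[OF pe]]] by simp
      also have "(LINT x|lebesgue. \<psi> x * g x) - (LINT x|lebesgue. \<psi> x * g (x + ?e)) = - (LINT x|lebesgue. \<psi> x \<bullet> (g (x + ?e) - g x))"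
        using ti[OF psi] i3 by (simp add: right_diff_distrib)
      finally have "\<bar>LINT x|lebesgue. diff_quot j (- ?t n) \<psi> x *\<^sub>R g x\<bar> = (1 / ?t n) * \<bar>LINT x|lebesgue. \<psi> x \<bullet> (g (x + ?e) - g x)\<bar>"
        using tp by (simp add: abs_mult del: of_nat_Suc)
      also have "\<dots> \<le> (1 / ?t n) * (L2norm lebesgue \<psi> * (C * ?t n))"
      proof (rule mult_left_mono)
        have "\<bar>LINT x|lebesgue. \<psi> x \<bullet> (g (x + ?e) - g x)\<bar> \<le> L2norm lebesgue \<psi> * L2norm lebesgue (\<lambda>x. g (x + ?e) - g x)"
          by (rule L2norm_inner_bound[OF ts[OF psi] sq_integrable_diff[OF ge g]])
        also have "\<dots> \<le> L2norm lebesgue \<psi> * (C * ?t n)" by (intro mult_left_mono b tp) simp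
        finally show "\<bar>LINT x|lebesgue. \<psi> x \<bullet> (g (x + ?e) - g x)\<bar> \<le> L2norm lebesgue \<psi> * (C * ?t n)" .
      qed (use tp in simp)
      also have "\<dots> = C * L2norm lebesgue \<psi>" using tp by (simp del: of_nat_Suc)
      finally show ?thesis .
    qed
    have "\<bar>LINT x|lebesgue. partial j \<psi> x *\<^sub>R g x\<bar> \<le> C * L2norm lebesgue \<psi>"
      by (rule LIMSEQ_le_const2[OF tendsto_rabs[OF lim]]) (use eq in blast)
    then show ?thesis by (simp add: L_def)
  qed
  have Lc: "L (\<lambda>x. a *\<^sub>R \<psi> x + c *\<^sub>R \<eta> x) = a * L \<psi> + c * L \<eta>" if "\<psi> \<in> ?T" "\<eta> \<in> ?T" for \<psi> \<eta> a c
  proof -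
    have d: "\<psi> differentiable (at x)" "\<eta> differentiable (at x)" for x using that by (auto intro: smooth_differentiable test_smooth)
    have "partial j (\<lambda>x. a *\<^sub>R \<psi> x + c *\<^sub>R \<eta> x) x = a * partial j \<psi> x + c * partial j \<eta> x" for x
      using partial_add[OF differentiable_linear_comp[OF d(1) bounded_linear_scaleR_right] differentiable_linear_comp[OF d(2) bounded_linear_scaleR_right], of j a c]
        partial_linear[OF d(1) bounded_linear_scaleR_right, of j a] partial_linear[OF d(2) bounded_linear_scaleR_right, of j c] by simp
    then show ?thesis unfolding L_def
      using ti[OF test_partial[OF that(1)], of j] ti[OF test_partial[OF that(2)], of j] by (simp add: distrib_right mult.assoc)
  qed
  \<comment> \<open>The functional whose minimiser represents \<open>L\<close>.\<close>
  define Q where "Q \<psi> = (L2norm lebesgue \<psi>)\<^sup>2 / 2 - L \<psi>" for \<psi>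
  have Qb: "- (C\<^sup>2 / 2) \<le> Q \<psi>" if "\<psi> \<in> ?T" for \<psi>
  proof -
    have "0 \<le> (L2norm lebesgue \<psi> - C)\<^sup>2" by simp
    then show ?thesis using Lb[OF that] unfolding Q_def power2_diff by (simp add: mult.commute)
  qed
  have sqi: "integrable lebesgue (\<lambda>x. (\<psi> x)\<^sup>2)" if "sq_integrable lebesgue \<psi>" for \<psi> :: "real^3 \<Rightarrow> real"
    using that by (simp add: sq_integrable_def)
  have L2s: "(L2norm lebesgue (\<lambda>x. a *\<^sub>R \<psi> x + c *\<^sub>R \<eta> x))\<^sup>2 = a\<^sup>2 * (L2norm lebesgue \<psi>)\<^sup>2 + 2 * a * c * (LINT x|lebesgue. \<psi> x * \<eta> x) + c\<^sup>2 * (L2norm lebesgue \<eta>)\<^sup>2"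
    if s: "sq_integrable lebesgue \<psi>" "sq_integrable lebesgue \<eta>" for \<psi> \<eta> :: "real^3 \<Rightarrow> real" and a c
  proof -
    have ic: "integrable lebesgue (\<lambda>x. \<psi> x * \<eta> x)" using sq_integrable_scaleR_prod[OF s] by simp
    have "(L2norm lebesgue (\<lambda>x. a *\<^sub>R \<psi> x + c *\<^sub>R \<eta> x))\<^sup>2 = (LINT x|lebesgue. a\<^sup>2 * (\<psi> x)\<^sup>2 + 2 * a * c * (\<psi> x * \<eta> x) + c\<^sup>2 * (\<eta> x)\<^sup>2)"
      unfolding L2norm_square by (intro Bochner_Integration.integral_cong refl) (simp add: power2_eq_square algebra_simps)
    also have "\<dots> = a\<^sup>2 * (LINT x|lebesgue. (\<psi> x)\<^sup>2) + 2 * a * c * (LINT x|lebesgue. \<psi> x * \<eta> x) + c\<^sup>2 * (LINT x|lebesgue. (\<eta> x)\<^sup>2)"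
      using sqi[OF s(1)] sqi[OF s(2)] ic by simp
    finally show ?thesis by (simp add: L2norm_square)
  qed
  have comb: "(\<lambda>x. a *\<^sub>R \<psi> x + c *\<^sub>R \<eta> x) \<in> ?T" if "\<psi> \<in> ?T" "\<eta> \<in> ?T" for \<psi> \<eta> a c
    using that by (intro test_add test_scale)
  define m where "m = Inf (Q ` ?T)"
  have bb: "bdd_below (Q ` ?T)" using Qb by (intro bdd_belowI[of _ "- (C\<^sup>2 / 2)"]) auto
  have ne: "Q ` ?T \<noteq> {}" using test_zero by blast
  have mle: "m \<le> Q \<psi>" if "\<psi> \<in> ?T" for \<psi> unfolding m_def using that by (intro cInf_lower bb) auto
  have "\<exists>\<psi>\<in>?T. Q \<psi> < m + inverse (real (Suc n))" for n
    using cInf_lessD[OF ne, of "m + inverse (real (Suc n))"] unfolding m_def[symmetric] by (simp add: image_iff)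
  then have "\<forall>n. \<exists>\<psi>. \<psi> \<in> ?T \<and> Q \<psi> < m + inverse (real (Suc n))" by blast
  then have "\<exists>\<psi>. \<forall>n. \<psi> n \<in> ?T \<and> Q (\<psi> n) < m + inverse (real (Suc n))" by (rule choice)
  then obtain \<psi> where pn: "\<forall>n. \<psi> n \<in> ?T \<and> Q (\<psi> n) < m + inverse (real (Suc n))" by (rule exE)
  have pT: "\<psi> n \<in> ?T" and pQ: "Q (\<psi> n) < m + inverse (real (Suc n))" for n using spec[OF pn, of n] by blast+
  have dist: "(L2norm lebesgue (\<lambda>x. \<psi> i x - \<psi> k x))\<^sup>2 / 8 \<le> (inverse (real (Suc i)) + inverse (real (Suc k))) / 2" for i k
  proof -
    let ?z = "\<lambda>x. (1/2) *\<^sub>R \<psi> i x + (1/2) *\<^sub>R \<psi> k x"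
    have "m \<le> Q ?z" by (rule mle[OF comb[OF pT pT]])
    moreover have "Q ?z + (L2norm lebesgue (\<lambda>x. \<psi> i x - \<psi> k x))\<^sup>2 / 8 = (Q (\<psi> i) + Q (\<psi> k)) / 2"
      using L2s[OF ts[OF pT[of i]] ts[OF pT[of k]], of "1/2" "1/2"] L2s[OF ts[OF pT[of i]] ts[OF pT[of k]], of 1 "-1"]
        Lc[OF pT[of i] pT[of k], of "1/2" "1/2"]
      unfolding Q_def by (simp add: power2_eq_square field_simps)
    ultimately show ?thesis using pQ[of i] pQ[of k] unfolding add_divide_distrib by linarith
  qed
  have cau: "\<exists>N. \<forall>i\<ge>N. \<forall>k\<ge>N. L2norm lebesgue (\<lambda>x. \<psi> i x - \<psi> k x) < e" if e: "e > 0" for e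
  proof -
    have pos: "e\<^sup>2 / 8 > 0" using e by simp
    obtain N where N: "inverse (real (Suc N)) < e\<^sup>2 / 8" using reals_Archimedean[OF pos] by blast
    have "L2norm lebesgue (\<lambda>x. \<psi> i x - \<psi> k x) < e" if ij: "i \<ge> N" "k \<ge> N" for i k
    proof -
      have "inverse (real (Suc i)) \<le> inverse (real (Suc N))" "inverse (real (Suc k)) \<le> inverse (real (Suc N))"
        using ij by (auto intro!: le_imp_inverse_le)
      then have "(inverse (real (Suc i)) + inverse (real (Suc k))) / 2 \<le> inverse (real (Suc N))" by argo
      from order_le_less_trans[OF order_trans[OF dist this] N]
      have "(L2norm lebesgue (\<lambda>x. \<psi> i x - \<psi> k x))\<^sup>2 < e\<^sup>2" by simp
      then show ?thesis by (rule power2_less_imp_less) (use e in simp)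
    qed
    then show ?thesis by blast
  qed
  obtain q where q: "sq_integrable lebesgue q" "(\<lambda>n. L2norm lebesgue (\<lambda>x. \<psi> n x - q x)) \<longlonglongrightarrow> 0"
    by (rule L2_complete[OF ts[OF pT] cau]) (assumption, rule that)
  have "(LINT x|lebesgue. q x * \<eta> x) = L \<eta>" if chi: "\<eta> \<in> ?T" for \<eta>
  proof -
    let ?N = "(L2norm lebesgue \<eta>)\<^sup>2" and ?I = "LINT x|lebesgue. q x * \<eta> x"
    have N0: "?N \<ge> 0" by simp
    have lim: "(\<lambda>n. LINT x|lebesgue. \<psi> n x * \<eta> x) \<longlonglongrightarrow> ?I"
      using L2_lim_inner[OF ts[OF pT] q(1) q(2) ts[OF chi]] by simp
    have all: "0 \<le> s * (?I - L \<eta>) + s\<^sup>2 / 2 * ?N" for s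
    proof -
      have pos: "0 \<le> inverse (real (Suc n)) + (s * ((LINT x|lebesgue. \<psi> n x * \<eta> x) - L \<eta>) + s\<^sup>2 / 2 * ?N)" for n
      proof -
        have "m \<le> Q (\<lambda>x. 1 *\<^sub>R \<psi> n x + s *\<^sub>R \<eta> x)" by (rule mle[OF comb[OF pT chi]])
        also have "\<dots> = Q (\<psi> n) + (s * ((LINT x|lebesgue. \<psi> n x * \<eta> x) - L \<eta>) + s\<^sup>2 / 2 * ?N)"
          unfolding Q_def L2s[OF ts[OF pT[of n]] ts[OF chi]] Lc[OF pT[of n] chi] by (simp add: field_simps)
        finally show ?thesis using pQ[of n] by linarith
      qed
      have l: "(\<lambda>n. inverse (real (Suc n)) + (s * ((LINT x|lebesgue. \<psi> n x * \<eta> x) - L \<eta>) + s\<^sup>2 / 2 * ?N)) \<longlonglongrightarrow> 0 + (s * (?I - L \<eta>) + s\<^sup>2 / 2 * ?N)"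
        by (intro tendsto_intros LIMSEQ_inverse_real_of_nat lim)
      have "0 \<le> 0 + (s * (?I - L \<eta>) + s\<^sup>2 / 2 * ?N)" by (rule LIMSEQ_le_const[OF l]) (use pos in blast)
      then show ?thesis by simp
    qed
    have "?I - L \<eta> = 0" by (rule parabola_slope_zero[OF N0 all])
    then show ?thesis by simp
  qed
  then have "(LINT x|lebesgue. partial j \<eta> x * g x) = - (LINT x|lebesgue. \<eta> x * q x)" if "\<eta> \<in> ?T" for \<eta>
    using that unfolding L_def by (simp add: mult.commute[of "q _"])
  then show ?thesis using that q(1) by blast
qed

section \<open>Second derivatives\<close>

lemma flux_reflect_mat: "flux p \<nu>0 \<nu>1 (reflect_mat a) = reflect_mat (flux p \<nu>0 \<nu>1 a)"
  by (simp add: flux_def linear_simps(5)[OF bounded_linear_reflect_mat])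

lemma preserving_energy_integrable:
  assumes "lebesgue_preserving T" "energy_integrable p lebesgue f"
  shows "energy_integrable p lebesgue (\<lambda>x. f (T x))"
  using assms preserving_sq_integrable[OF assms(1), of f] preserving_integrable[OF assms(1), of "\<lambda>x. norm (f x) powr p"]
  by (simp add: energy_integrable_def)

lemma extend_energy_integrable:
  assumes "energy_integrable p half_measure f"
  shows "energy_integrable p lebesgue (extend reflect_mat f)"
proof -
  have "integrable lebesgue (extend (\<lambda>y. y) (\<lambda>x. norm (f x) powr p))"
    by (rule extend_integrable[OF bounded_linear_ident]) (use assms in \<open>simp add: energy_integrable_def\<close>)
  moreover have "extend (\<lambda>y. y) (\<lambda>x. norm (f x) powr p) = (\<lambda>x. norm (extend reflect_mat f x) powr p)"
    by (auto simp: extend_def fun_eq_iff)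
  ultimately have "integrable lebesgue (\<lambda>x. norm (extend reflect_mat f x) powr p)" by simp
  moreover have "sq_integrable lebesgue (extend reflect_mat f)"
    by (rule extend_sq_integrable[OF bounded_linear_reflect_mat norm_reflect_mat]) (use assms in \<open>simp add: energy_integrable_def\<close>)
  ultimately show ?thesis by (simp add: energy_integrable_def)
qed

lemma energy_integrable_half:
  assumes "energy_integrable p lebesgue f"
  shows "energy_integrable p half_measure f"
  using assms sq_integrable_on_UNIV_sub(1)[OF half_space_sets(1), of f]
    integrable_restrictI[OF half_space_sets(1), of "\<lambda>x. norm (f x) powr p"]
  by (simp add: energy_integrable_def)

text \<open>Written as a nested binary linear combination, to which the closure properties of approximations
  and of finite energy apply literally.\<close>
definition second_difference :: "real^3 \<Rightarrow> (real^3 \<Rightarrow> 'b::real_vector) \<Rightarrow> real^3 \<Rightarrow> 'b" where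
  "second_difference h f x = 1 *\<^sub>R (1 *\<^sub>R f (x + h) + 1 *\<^sub>R f (x + - h)) + (-2) *\<^sub>R f x"

text \<open>The second difference along a coordinate direction commutes with the reflection, also for the
  direction orthogonal to the boundary, in which it merely exchanges the two translations.\<close>
lemma second_difference_reflect:
  assumes "\<And>x. f (reflect x) = S (f x)" "bounded_linear S"
  shows "second_difference (t *\<^sub>R axis k 1) f (reflect x) = S (second_difference (t *\<^sub>R axis k 1) f x)"
proof (cases "k = 3")
  case True
  have e: "reflect x + t *\<^sub>R axis k 1 = reflect (x + - (t *\<^sub>R axis k 1))" "reflect x + - (t *\<^sub>R axis k 1) = reflect (x + t *\<^sub>R axis k 1)"
    using True by (simp_all add: vec_eq_iff axis_def)
  show ?thesis unfolding second_difference_def e assms(1)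
    by (simp add: linear_simps(1,2,5)[OF assms(2)] add.commute)
next
  case False
  have e: "reflect x + t *\<^sub>R axis k 1 = reflect (x + t *\<^sub>R axis k 1)" "reflect x + - (t *\<^sub>R axis k 1) = reflect (x + - (t *\<^sub>R axis k 1))"
    using False by (simp_all add: vec_eq_iff axis_def)
  show ?thesis unfolding second_difference_def e assms(1)
    by (simp add: linear_simps(1,2,5)[OF assms(2)])
qed

lemma second_difference_eq: "second_difference h f x = (f (x + h) - f x) - (f (x + - h + h) - f (x + - h))"
  for f :: "real^3 \<Rightarrow> 'b::real_vector"
  by (simp add: second_difference_def scaleR_2)

context
  fixes p \<nu>0 \<nu>1 :: real and f :: "real^3 \<Rightarrow> real^3" and F :: "(real^3 \<Rightarrow> real^3) \<Rightarrow> real" and u :: "real^3 \<Rightarrow> real^3"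
  assumes p: "p > 2" and nu: "\<nu>0 > 0" "\<nu>1 > 0"
    and f: "sq_integrable half_measure f" and dp: "duality_pairing f F"
    and u: "weak_solution p \<nu>0 \<nu>1 F u"
begin

text \<open>The solution, reflected to the whole space, is tested with the half-space restriction of its own
  second difference. The right-hand side is of first order in the step, because the second difference
  is a difference of the first one; monotonicity of the flux bounds the left-hand side from below by
  the square of the difference of the gradient.\<close>
lemma gradient_difference_bound:
  assumes t: "t > 0"
  shows "L2norm lebesgue (\<lambda>x. extend reflect_mat (weak_grad u) (x + t *\<^sub>R axis k 1) - extend reflect_mat (weak_grad u) x)
    \<le> (4 * L2norm half_measure f / \<nu>0) * t"
proof -
  let ?h = "t *\<^sub>R axis k 1 :: real^3"
  have p0: "p > 0" using p by simp
  have uV: "u \<in> V p" using u by (simp add: weak_solution_def)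
  then have uV2: "u \<in> V2" and ue: "energy_integrable p half_measure (sym_grad u)" by (auto simp: V_iff)
  obtain \<phi> where ph: "approx_on half_space \<phi> u (weak_grad u)" "\<And>n. mirror_symmetric (\<phi> n)"
    by (rule V2_symmetric_approximation[OF uV2]) (rule that)
  define w where "w = extend reflect u"
  define W where "W = extend reflect_mat (weak_grad u)"
  define U where "U x = sym_part (W x)" for x
  have ap: "approx_on UNIV \<phi> w W" unfolding w_def W_def by (rule approx_extend[OF ph])
  have Wtr: "AE x in lebesgue. trace (W x) = 0" unfolding W_def by (rule extend_trace_zero[OF V2_div[OF uV2]])
  have Ueq: "U = extend reflect_mat (sym_grad u)"
    unfolding U_def W_def sym_grad_eq[abs_def]
    by (rule ext) (rule extend_commute[where L=sym_part and S=reflect_mat, OF bounded_linear_sym_part sym_part_reflect_mat])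
  have Ue: "energy_integrable p lebesgue U" unfolding Ueq by (rule extend_energy_integrable[OF ue])
  have Ur: "U (reflect x) = reflect_mat (U x)" for x unfolding Ueq by (rule extend_reflect[OF bounded_linear_reflect_mat reflect_mat_reflect_mat])
  have Uhalf: "U x = sym_grad u x" if "x \<in> half_space" for x using that by (simp add: Ueq)
  have pr: "lebesgue_preserving (\<lambda>x::real^3. x + b)" for b by (rule lebesgue_preserving_translation)
  have Wtr2: "AE x in lebesgue. trace (W (x + b)) = 0" for b by (rule preserving_AE[OF pr Wtr])
  have Ue2: "energy_integrable p lebesgue (\<lambda>x. U (x + b))" for b by (rule preserving_energy_integrable[OF pr Ue])
  define z where "z x = 1 *\<^sub>R w (x + ?h) + (-1) *\<^sub>R w x" for x
  define Z where "Z x = 1 *\<^sub>R W (x + ?h) + (-1) *\<^sub>R W x" for x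
  have apz: "approx_on UNIV (\<lambda>n x. 1 *\<^sub>R \<phi> n (x + ?h) + (-1) *\<^sub>R \<phi> n x) z Z"
    unfolding z_def Z_def by (rule approx_on_combine[OF approx_translate[OF ap] ap]) simp
  have Ztr: "AE x in lebesgue. trace (Z x) = 0"
    using Wtr Wtr2[of ?h] by eventually_elim (simp add: Z_def linear_simps(2)[OF bounded_linear_trace])
  have Zsym: "sym_part (Z x) = U (x + ?h) - U x" for x
    by (simp add: Z_def U_def linear_simps(2)[OF bounded_linear_sym_part])
  \<comment> \<open>The difference inherits a vanishing divergence, so Korn turns control of its symmetric part into control of all of it.\<close>
  have Zkorn: "L2norm lebesgue Z = sqrt 2 * L2norm lebesgue (\<lambda>x. U (x + ?h) - U x)"
    using korn_full[OF apz Ztr] by (simp add: Zsym)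
  \<comment> \<open>The second difference is an admissible test field.\<close>
  define v where "v = second_difference ?h w"
  define G where "G = second_difference ?h W"
  have apv: "approx_on UNIV (\<lambda>n. second_difference ?h (\<phi> n)) v G"
    unfolding v_def G_def second_difference_def[abs_def]
    by (rule approx_on_combine[OF approx_on_combine[OF approx_translate[OF ap] approx_translate[OF ap]] ap]) simp_all
  have aph: "approx_on half_space (\<lambda>n. second_difference ?h (\<phi> n)) v G"
    by (rule approx_on_sub[OF apv]) auto
  have sy: "mirror_symmetric (second_difference ?h (\<phi> n))" for n
    unfolding mirror_symmetric_def
    using second_difference_reflect[of "\<phi> n" reflect, OF _ bounded_linear_reflect] ph(2)[of n] by (simp add: mirror_symmetric_def)
  have "AE x in lebesgue. trace (G x) = 0"
    using Wtr Wtr2[of ?h] Wtr2[of "- ?h"]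
    by eventually_elim (simp add: G_def second_difference_def linear_simps(1,2,5)[OF bounded_linear_trace])
  then have Gtr: "AE x in half_measure. trace (G x) = 0" unfolding AE_half_iff by eventually_elim simp
  have vV2: "v \<in> V2" by (rule V2_intro[OF aph sy Gtr])
  define S where "S = second_difference ?h U"
  have GS: "sym_part (G x) = S x" for x
    by (simp add: G_def S_def U_def second_difference_def linear_simps(1,2,5)[OF bounded_linear_sym_part])
  have Se: "energy_integrable p lebesgue S"
    unfolding S_def second_difference_def by (intro energy_integrable_combine p0 Ue Ue2)
  have vs: "AE x in half_measure. sym_grad v x = S x"
    using approx_weak_grad(1)[OF aph] by eventually_elim (simp add: sym_grad_eq GS)
  have ve: "energy_integrable p half_measure (sym_grad v)"
    by (rule energy_integrable_bound[OF p0 energy_integrable_half[OF Se] sq_integrable_meas[OF V2_sym_grad[OF vV2]]])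
       (use vs in eventually_elim, simp)
  have vV: "v \<in> V p" using vV2 ve by (simp add: V_iff)
  \<comment> \<open>As a difference of first differences it is square integrable, even if the solution is not, and of first order in the step.\<close>
  have v_eq: "v x = - (z (x + (- t) *\<^sub>R axis k 1) - z x)" for x
    unfolding v_def second_difference_eq by (simp add: z_def)
  have vL2: "sq_integrable lebesgue v" "L2norm lebesgue v \<le> t * L2norm lebesgue Z"
    using sq_integrable_minus[OF approx_shift_bound(1)[OF apz, of "- t" k]] approx_shift_bound(2)[OF apz, of "- t" k] t
    by (simp_all add: v_eq[abs_def] L2norm_minus[of lebesgue "\<lambda>x. z (x - t *\<^sub>R axis k 1) - z x"] L2norm_commute[of lebesgue z])
  have vhalf: "sq_integrable half_measure v" "L2norm half_measure v \<le> L2norm lebesgue v"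
    using sq_integrable_on_UNIV_sub[OF half_space_sets(1) vL2(1)] by auto
  have Fv: "F v = (LINT x|half_measure. f x \<bullet> v x)"
  proof -
    have "v \<in> V2 \<inter> Lp 2 half_space" using vV2 vhalf(1) by (simp add: Lp_2_iff)
    then show ?thesis using dp[unfolded duality_pairing_def] by (simp del: IntE IntI Int_iff)
  qed
  have "\<bar>F v\<bar> \<le> L2norm half_measure f * L2norm half_measure v" unfolding Fv by (rule L2norm_inner_bound[OF f vhalf(1)])
  also have "\<dots> \<le> L2norm half_measure f * (t * L2norm lebesgue Z)"
    using vhalf(2) vL2(2) by (intro mult_left_mono) auto
  finally have Fb: "\<bar>F v\<bar> \<le> L2norm half_measure f * (t * L2norm lebesgue Z)" .
  \<comment> \<open>By symmetry the weak formulation extends to the whole space.\<close>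
  have FI: "bounded_functional_V2 F" using dp by (simp add: duality_pairing_def)
  let ?A = "\<lambda>x. flux p \<nu>0 \<nu>1 (U x)"
  have ii: "integrable lebesgue (\<lambda>x. flux p \<nu>0 \<nu>1 (U (x + a)) \<bullet> U (x + b))" for a b
    by (rule flux_inner_integrable[OF p nu Ue2 Ue2])
  have iS: "integrable lebesgue (\<lambda>x. ?A x \<bullet> S x)" by (rule flux_inner_integrable[OF p nu Ue Se])
  have "(LINT x|half_measure. ?A x \<bullet> S x) = (LINT x|half_measure. flux p \<nu>0 \<nu>1 (sym_grad u x) \<bullet> sym_grad v x)"
  proof (rule integral_cong_AE)
    show "AE x in half_measure. ?A x \<bullet> S x = flux p \<nu>0 \<nu>1 (sym_grad u x) \<bullet> sym_grad v x"
      using vs AE_space by eventually_elim (simp add: Uhalf)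
    show "(\<lambda>x. ?A x \<bullet> S x) \<in> borel_measurable half_measure"
      using integrable_restrictI[OF half_space_sets(1) iS] by simp
    show "(\<lambda>x. flux p \<nu>0 \<nu>1 (sym_grad u x) \<bullet> sym_grad v x) \<in> borel_measurable half_measure"
      using flux_inner_integrable[OF p nu ue ve] by simp
  qed
  then have half: "(LINT x|half_measure. ?A x \<bullet> S x) = F v"
    using weak_solution_flux[OF p nu FI u vV] by simp
  have "(LINT x|lebesgue. ?A x \<bullet> S x) = 2 * (LINT x|half_measure. ?A x \<bullet> S x)"
  proof (rule integral_reflect_invariant[OF iS])
    fix x
    have "S (reflect x) = reflect_mat (S x)"
      unfolding S_def by (rule second_difference_reflect[where f=U and S=reflect_mat, OF Ur bounded_linear_reflect_mat])
    then show "?A (reflect x) \<bullet> S (reflect x) = ?A x \<bullet> S x"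
      by (simp add: Ur flux_reflect_mat inner_reflect_mat)
  qed
  then have full: "(LINT x|lebesgue. ?A x \<bullet> S x) = 2 * F v" using half by simp
  \<comment> \<open>Summation by parts.\<close>
  let ?I = "\<lambda>a b. LINT x|lebesgue. flux p \<nu>0 \<nu>1 (U (x + a)) \<bullet> U (x + b)"
  have shift: "?I (a + c) (b + c) = ?I a b" for a b c
    using preserving_integral[OF pr borel_measurable_integrable[OF ii[of a b]], of c] by (simp add: add_ac)
  have "(LINT x|lebesgue. ?A x \<bullet> S x) = (LINT x|lebesgue. flux p \<nu>0 \<nu>1 (U (x + 0)) \<bullet> U (x + ?h) + flux p \<nu>0 \<nu>1 (U (x + 0)) \<bullet> U (x + - ?h) - 2 * (flux p \<nu>0 \<nu>1 (U (x + 0)) \<bullet> U (x + 0)))"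
    by (intro Bochner_Integration.integral_cong refl) (simp add: S_def second_difference_def inner_add_right inner_diff_right)
  also have "\<dots> = ?I 0 ?h + ?I 0 (- ?h) - 2 * ?I 0 0"
    using ii[of 0 ?h] ii[of 0 "- ?h"] ii[of 0 0] by simp
  also have "?I 0 (- ?h) = ?I ?h 0" using shift[of 0 ?h "- ?h"] by simp
  also have "?I 0 ?h + ?I ?h 0 - 2 * ?I 0 0 = - (?I ?h ?h - ?I ?h 0 - ?I 0 ?h + ?I 0 0)"
    using shift[of 0 ?h 0] by simp
  also have "\<dots> = - (LINT x|lebesgue. flux p \<nu>0 \<nu>1 (U (x + ?h)) \<bullet> U (x + ?h) - flux p \<nu>0 \<nu>1 (U (x + ?h)) \<bullet> U (x + 0) - flux p \<nu>0 \<nu>1 (U (x + 0)) \<bullet> U (x + ?h) + flux p \<nu>0 \<nu>1 (U (x + 0)) \<bullet> U (x + 0))"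
    using ii[of ?h ?h] ii[of ?h 0] ii[of 0 ?h] ii[of 0 0] by simp
  also have "\<dots> = - (LINT x|lebesgue. (flux p \<nu>0 \<nu>1 (U (x + ?h)) - ?A x) \<bullet> (U (x + ?h) - U x))"
    by (intro arg_cong[where f=uminus] Bochner_Integration.integral_cong refl) (simp add: inner_diff_left inner_diff_right)
  finally have parts: "(LINT x|lebesgue. (flux p \<nu>0 \<nu>1 (U (x + ?h)) - ?A x) \<bullet> (U (x + ?h) - U x)) = - (2 * F v)"
    using full by simp
  let ?d = "L2norm lebesgue (\<lambda>x. U (x + ?h) - U x)"
  have Us: "sq_integrable lebesgue (\<lambda>x. U (x + ?h) - U x)"
    using Ue Ue2[of ?h] by (intro sq_integrable_diff) (auto simp: energy_integrable_def)
  have "\<nu>0 * ?d\<^sup>2 = (LINT x|lebesgue. \<nu>0 * (norm (U (x + ?h) - U x))\<^sup>2)" by (simp add: L2norm_square)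
  also have "\<dots> \<le> (LINT x|lebesgue. (flux p \<nu>0 \<nu>1 (U (x + ?h)) - ?A x) \<bullet> (U (x + ?h) - U x))"
  proof (rule integral_mono)
    show "integrable lebesgue (\<lambda>x. \<nu>0 * (norm (U (x + ?h) - U x))\<^sup>2)" using Us by (simp add: sq_integrable_def)
    have "integrable lebesgue (\<lambda>x. flux p \<nu>0 \<nu>1 (U (x + ?h)) \<bullet> U (x + ?h) - flux p \<nu>0 \<nu>1 (U (x + ?h)) \<bullet> U (x + 0) - flux p \<nu>0 \<nu>1 (U (x + 0)) \<bullet> U (x + ?h) + flux p \<nu>0 \<nu>1 (U (x + 0)) \<bullet> U (x + 0))"
      by (intro Bochner_Integration.integrable_add Bochner_Integration.integrable_diff ii)
    then show "integrable lebesgue (\<lambda>x. (flux p \<nu>0 \<nu>1 (U (x + ?h)) - ?A x) \<bullet> (U (x + ?h) - U x))"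
      by (simp add: inner_diff_left inner_diff_right algebra_simps)
  qed (rule flux_monotone[OF p nu])
  also have "\<dots> \<le> 2 * \<bar>F v\<bar>" unfolding parts by linarith
  also have "\<dots> \<le> 2 * (L2norm half_measure f * (t * L2norm lebesgue Z))" using Fb by simp
  finally have "\<nu>0 * ?d\<^sup>2 \<le> 2 * (L2norm half_measure f * (t * L2norm lebesgue Z))" .
  then have "2 * (\<nu>0 * ?d\<^sup>2) \<le> 2 * (2 * (L2norm half_measure f * (t * L2norm lebesgue Z)))" by linarith
  moreover have "L2norm lebesgue Z * L2norm lebesgue Z = 2 * ?d\<^sup>2"
    unfolding power2_eq_square[of "L2norm lebesgue Z", symmetric] unfolding Zkorn by (simp add: power_mult_distrib)
  then have "(\<nu>0 * L2norm lebesgue Z) * L2norm lebesgue Z = 2 * (\<nu>0 * ?d\<^sup>2)" by (simp only: mult.assoc mult.left_commute)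
  ultimately have "(\<nu>0 * L2norm lebesgue Z) * L2norm lebesgue Z \<le> 2 * (2 * (L2norm half_measure f * (t * L2norm lebesgue Z)))"
    by (simp only:)
  also have "\<dots> = (4 * L2norm half_measure f * t) * L2norm lebesgue Z" by simp
  finally have ineq: "(\<nu>0 * L2norm lebesgue Z) * L2norm lebesgue Z \<le> (4 * L2norm half_measure f * t) * L2norm lebesgue Z" .
  have "\<nu>0 * L2norm lebesgue Z \<le> 4 * L2norm half_measure f * t"
  proof (cases "L2norm lebesgue Z = 0")
    case True
    have "0 \<le> 4 * L2norm half_measure f * t" using t by simp
    then show ?thesis using True by simp
  next
    case False
    then have "L2norm lebesgue Z > 0" by (simp add: less_le)
    then show ?thesis using ineq by (simp add: mult_le_cancel_right)
  qed
  then have "L2norm lebesgue Z \<le> (4 * L2norm half_measure f / \<nu>0) * t"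
    using nu by (simp add: field_simps)
  then show ?thesis unfolding Z_def W_def by simp
qed

text \<open>The entries of the reflected gradient have square integrable weak derivatives on the whole space;
  test functions of the half-space see only the restriction.\<close>
lemma second_derivatives:
  "weakly_differentiable j (weak_partial i u) \<and> weak_partial j (weak_partial i u) \<in> Lp 2 half_space"
proof -
  have uV2: "u \<in> V2" using u by (simp add: weak_solution_def V_iff)
  define W where "W = extend reflect_mat (weak_grad u)"
  have Ws: "sq_integrable lebesgue W"
    unfolding W_def by (rule extend_sq_integrable[OF bounded_linear_reflect_mat norm_reflect_mat V2_weak_grad[OF uV2]])
  have "\<exists>q. sq_integrable lebesgue q \<and> (\<forall>\<psi>\<in>test_functions UNIV. (LINT x|lebesgue. partial j \<psi> x * W x $ a $ i) = - (LINT x|lebesgue. \<psi> x * q x))" for a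
  proof -
    have g: "sq_integrable lebesgue (\<lambda>x. W x $ a $ i)" by (rule sq_integrable_linear[OF Ws bounded_linear_entry])
    have b: "L2norm lebesgue (\<lambda>x. W (x + t *\<^sub>R axis j 1) $ a $ i - W x $ a $ i) \<le> (4 * L2norm half_measure f / \<nu>0) * t" if t: "t > 0" for t
    proof -
      have s: "sq_integrable lebesgue (\<lambda>x. W (x + t *\<^sub>R axis j 1) - W x)"
        by (rule sq_integrable_diff[OF preserving_sq_integrable[OF lebesgue_preserving_translation Ws] Ws])
      have m: "(\<lambda>x. W (x + t *\<^sub>R axis j 1) $ a $ i - W x $ a $ i) \<in> borel_measurable lebesgue"
        using sq_integrable_meas[OF sq_integrable_linear[OF s bounded_linear_entry]] by simp
      have "L2norm lebesgue (\<lambda>x. W (x + t *\<^sub>R axis j 1) $ a $ i - W x $ a $ i) \<le> L2norm lebesgue (\<lambda>x. W (x + t *\<^sub>R axis j 1) - W x)"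
      proof (rule L2norm_mono[OF s m], rule AE_I2)
        fix x
        let ?B = "W (x + t *\<^sub>R axis j 1) - W x"
        have "\<bar>?B $ a $ i\<bar> \<le> norm (?B $ a)" by (rule component_le_norm_cart)
        also have "\<dots> \<le> norm ?B" by (rule Finite_Cartesian_Product.norm_nth_le)
        finally show "norm (W (x + t *\<^sub>R axis j 1) $ a $ i - W x $ a $ i) \<le> norm ?B" by simp
      qed
      also have "\<dots> \<le> (4 * L2norm half_measure f / \<nu>0) * t" unfolding W_def by (rule gradient_difference_bound[OF t])
      finally show ?thesis .
    qed
    obtain q where "sq_integrable lebesgue q"
      "\<And>\<psi>. \<psi> \<in> test_functions UNIV \<Longrightarrow> (LINT x|lebesgue. partial j \<psi> x * W x $ a $ i) = - (LINT x|lebesgue. \<psi> x * q x)"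
      by (rule weak_derivative_of_difference_bound[OF g b]) (assumption, rule that)
    then show ?thesis by blast
  qed
  then have "\<forall>a. \<exists>q. sq_integrable lebesgue q \<and> (\<forall>\<psi>\<in>test_functions UNIV. (LINT x|lebesgue. partial j \<psi> x * W x $ a $ i) = - (LINT x|lebesgue. \<psi> x * q x))"
    by (rule allI)
  then have "\<exists>q. \<forall>a. sq_integrable lebesgue (q a) \<and> (\<forall>\<psi>\<in>test_functions UNIV. (LINT x|lebesgue. partial j \<psi> x * W x $ a $ i) = - (LINT x|lebesgue. \<psi> x * q a x))"
    by (rule choice)
  then obtain q where qq: "\<forall>a. sq_integrable lebesgue (q a) \<and> (\<forall>\<psi>\<in>test_functions UNIV. (LINT x|lebesgue. partial j \<psi> x * W x $ a $ i) = - (LINT x|lebesgue. \<psi> x * q a x))"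
    by (rule exE)
  have q: "sq_integrable lebesgue (q a)"
    "\<psi> \<in> test_functions UNIV \<Longrightarrow> (LINT x|lebesgue. partial j \<psi> x * W x $ a $ i) = - (LINT x|lebesgue. \<psi> x * q a x)" for a \<psi>
    using spec[OF qq, of a] by blast+
  define r where "r x = (\<Sum>a\<in>UNIV. q a x *\<^sub>R axis a (1::real))" for x
  have rn: "r x $ a = q a x" for x a
    by (simp add: r_def axis_def if_distrib[of "\<lambda>z. _ * z"] cong: if_cong)
  have rs: "sq_integrable lebesgue r"
  proof -
    have "sq_integrable lebesgue (\<lambda>x. q a x *\<^sub>R (axis a (1::real) :: real^3))" for a
      by (rule sq_integrable_linear[OF q(1) bounded_linear_scaleR_left])
    then show ?thesis unfolding r_def sum_3 by (intro sq_integrable_add)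
  qed
  have rh: "sq_integrable half_measure r" by (rule sq_integrable_on_UNIV_sub(1)[OF half_space_sets(1) rs])
  have wd: "weakly_differentiable i u" using uV2 by (simp add: V2_def D1_def)
  have hw: "has_weak_partial i u (weak_partial i u)" by (rule weak_partial_works[OF wd])
  have li: "loc_integrable (weak_partial i u)" using hw by (simp add: has_weak_partial_def)
  have "has_weak_partial j (weak_partial i u) r"
    unfolding has_weak_partial_def
  proof (intro conjI allI impI)
    show "loc_integrable (weak_partial i u)" by (rule li)
    show "loc_integrable r" by (rule loc_integrable_weighted[OF sq_integrable_weighted(1)[OF rh]])
    fix \<psi> :: "real^3 \<Rightarrow> real" assume psi: "\<psi> \<in> test_functions half_space"
    have pU: "\<psi> \<in> test_functions UNIV" by (rule test_UNIV[OF psi])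
    have pp: "partial j \<psi> \<in> test_functions half_space" by (rule test_partial[OF psi])
    have off: "\<psi> x = 0" "partial j \<psi> x = 0" if "x \<notin> half_space" for x
      by (rule test_half_zero[OF psi that], rule test_half_zero[OF pp that])
    have i1: "integrable half_measure (\<lambda>x. partial j \<psi> x *\<^sub>R weak_partial i u x)" by (rule loc_integrable_measurable_mult[OF li pp])
    have i2: "integrable half_measure (\<lambda>x. \<psi> x *\<^sub>R r x)"
      by (rule sq_integrable_scaleR_prod[OF test_sq_integrable_on[OF psi half_space_sets(1)] rh])
    have restr: "(LINT x|half_measure. \<eta> x * h x) = (LINT x|lebesgue. \<eta> x * h x)" if "\<And>x. x \<notin> half_space \<Longrightarrow> \<eta> x = 0" for \<eta> h :: "real^3 \<Rightarrow> real"
    proof -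
      have "(LINT x|lebesgue. \<eta> x * h x) = (LINT x|lebesgue. (if x \<in> half_space then \<eta> x * h x else 0))"
        by (intro Bochner_Integration.integral_cong refl) (simp add: that)
      then show ?thesis by (simp add: Lebesgue_Measure.integral_restrict_UNIV)
    qed
    have "(LINT x|half_measure. partial j \<psi> x * weak_partial i u x $ a) = - (LINT x|half_measure. \<psi> x * r x $ a)" for a
    proof -
      have "(LINT x|half_measure. partial j \<psi> x * weak_partial i u x $ a) = (LINT x|half_measure. partial j \<psi> x * W x $ a $ i)"
        by (intro Bochner_Integration.integral_cong refl) (simp add: W_def weak_grad_def)
      also have "\<dots> = (LINT x|lebesgue. partial j \<psi> x * W x $ a $ i)" by (rule restr) (rule off(2))
      also have "\<dots> = - (LINT x|lebesgue. \<psi> x * q a x)" by (rule q(2)[OF pU])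
      also have "(LINT x|lebesgue. \<psi> x * q a x) = (LINT x|half_measure. \<psi> x * r x $ a)"
        unfolding rn by (rule restr[symmetric]) (rule off(1))
      finally show ?thesis .
    qed
    then show "(LINT x|half_measure. partial j \<psi> x *\<^sub>R weak_partial i u x) = - (LINT x|half_measure. \<psi> x *\<^sub>R r x)"
      using i1 i2 by (simp add: vec_eq_iff integral_vec_nth)
  qed
  then have "weakly_differentiable j (weak_partial i u)" and ae: "AE x in half_measure. weak_partial j (weak_partial i u) x = r x"
    using weak_partial_eq_AE by (auto simp: weakly_differentiable_def)
  moreover have "sq_integrable half_measure (weak_partial j (weak_partial i u))"
  proof (rule sq_integrable_cong_AE[OF rh _ ae])
    show "weak_partial j (weak_partial i u) \<in> borel_measurable half_measure"
      by (rule borel_measurable_AE_on[OF half_space_sets(1) sq_integrable_meas[OF rh]]) (use ae in eventually_elim, simp)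
  qed
  ultimately show ?thesis by (simp add: Lp_2_iff)
qed

end

theorem theorem9p1:
  fixes p \<nu>0 \<nu>1 :: real
    and f :: "real^3 \<Rightarrow> real^3"
    and F :: "(real^3 \<Rightarrow> real^3) \<Rightarrow> real"
  assumes "p > 2" and "\<nu>0 > 0" and "\<nu>1 > 0"
    and "f \<in> Lp 2 half_space" and "duality_pairing f F"
  shows "\<exists>u. weak_solution p \<nu>0 \<nu>1 F u \<and>
      (\<forall>w. weak_solution p \<nu>0 \<nu>1 F w \<longrightarrow> (AE x in lebesgue_on half_space. w x = u x)) \<and>
      (\<forall>i j. weakly_differentiable j (weak_partial i u) \<and>
             weak_partial j (weak_partial i u) \<in> Lp 2 half_space)"
proof -
  have F: "bounded_functional_V2 F" using assms(5) by (simp add: duality_pairing_def)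
  have f: "sq_integrable half_measure f" using assms(4) by (simp add: Lp_2_iff)
  obtain u where u: "weak_solution p \<nu>0 \<nu>1 F u" by (rule weak_solution_exists[OF assms(1-3) F]) (rule that)
  show ?thesis
  proof (intro exI[of _ u] conjI allI impI)
    show "AE x in half_measure. w x = u x" if "weak_solution p \<nu>0 \<nu>1 F w" for w
      by (rule weak_solution_unique[OF assms(1-3) F u that])
    show "weakly_differentiable j (weak_partial i u)" "weak_partial j (weak_partial i u) \<in> Lp 2 half_space" for i j
      using second_derivatives[OF assms(1-3) f assms(5) u] by blast+
  qed (rule u)
qed

end
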